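(* Let $k$ be a field, let $q\in k$, and let $\Lambda=\Lambda_q=k\langle x,y\rangle/(x^2,\,xy+qyx,\,y^2)$. Let $\mathrm{HH}^*(\Lambda)=\bigoplus_{i\ge 0}\mathrm{HH}^i(\Lambda)$ be the Hochschild cohomology ring of $\Lambda$ over $k$. (a) If $q$ is non-zero and not a root of unity, then $\mathrm{HH}^*(\Lambda)$ is a $5$-dimensional algebra over $k$ with $$\sum_{i\ge 0}\dim_k \mathrm{HH}^i(\Lambda)\,t^i = 2+2t+t^2.$$ Moreover, $\mathrm{HH}^*(\Lambda)$ is isomorphic as a ring to the fibre product $$k[z]/(z^2)\times_k \wedge^*(u_1,u_2),$$ where $z$ is in degree $0$, the elements $u_1$ and $u_2$ are in degree $1$, and $\wedge^*(u_1,u_2)$ is the exterior algebra over $k$ on the generators $u_1,u_2$. (b) If $q$ is a root of unity, then $\mathrm{HH}^*(\Lambda)$ is an infinite dimensional algebra over $k$, and it is finitely generated as a module over a polynomial subring generated by two elements. (c) If $q=0$, then $\mathrm{HH}^*(\Lambda)$ is an infinitely generated algebra over $k$ (that is, it is not finitely generated as a $k$-algebra) with $$\sum_{i\ge 0}\dim_k \mathrm{HH}^i(\Lambda)\,t^i = 1+\frac{1+t^3}{(1-t)^2}.$$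
   Context: $k\langle x,y\rangle$ is the free associative (non-commutative) $k$-algebra on $x,y$, and $(\dots)$ denotes the two-sided ideal generated by the listed elements; $\Lambda_q$ is a $4$-dimensional $k$-algebra with basis $1,x,y,yx$. The enveloping algebra is $\Lambda^e=\Lambda^{\mathrm{op}}\otimes_k\Lambda$, and $\mathrm{HH}^i(\Lambda)=\mathrm{Ext}^i_{\Lambda^e}(\Lambda,\Lambda)$; the ring structure on $\mathrm{HH}^*(\Lambda)$ is the Yoneda product (equivalently the cup product). For ring homomorphisms $R\to A$ and $S\to A$, $R\times_A S$ denotes the fibre product (pullback) of rings. In (a), the two maps to $k$ are the augmentations $k[z]/(z^2)\to k$, $z\mapsto 0$, and $\wedge^*(u_1,u_2)\to k$, $u_1,u_2\mapsto 0$. The exterior algebra satisfies $u_1^2=u_2^2=0$ and $u_1u_2=-u_2u_1$. *)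

theory Defs
  imports
    "HOL-Library.Poly_Mapping"
    "HOL-Computational_Algebra.Formal_Power_Series"
    "HOL-Algebra.Algebraic_Closure_Type"
    "HOL-Algebra.Algebra"
begin

section \<open>Free algebras\<close>

text \<open>
  Words form the free monoid, so the convolution product of \<^theory>\<open>HOL-Library.Poly_Mapping\<close>
  on finitely supported functions from words to \<open>k\<close> is the free associative algebra. The wrapper
  type avoids a global \<^class>\<open>monoid_add\<close> instance for lists.
\<close>

datatype 'g word = Word (letters: "'g list")

instantiation word :: (type) monoid_add
begin
definition zero_word :: "'a word" where "zero_word = Word []"
definition plus_word :: "'a word \<Rightarrow> 'a word \<Rightarrow> 'a word"
  where "plus_word u v = Word (letters u @ letters v)"
instance
  by standard (simp_all add: zero_word_def plus_word_def)
end

type_synonym ('g, 'k) free_algebra = "'g word \<Rightarrow>\<^sub>0 'k"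

definition gen :: "'g \<Rightarrow> ('g, 'k::field) free_algebra"
  where "gen g = Poly_Mapping.single (Word [g]) 1"

definition const :: "'k \<Rightarrow> ('g, 'k::field) free_algebra"
  where "const c = Poly_Mapping.single 0 c"

abbreviation free_algebra :: "('g, 'k::field) free_algebra ring"
  where "free_algebra \<equiv> ring_of_type_algebra"

definition homogeneous :: "nat \<Rightarrow> ('g, 'k::field) free_algebra \<Rightarrow> bool"
  where "homogeneous n f \<longleftrightarrow> (\<forall>w\<in>Poly_Mapping.keys f. length (letters w) = n)"

datatype letter = Letter1 | Letter2


section \<open>The algebra \<open>\<Lambda>\<^sub>q = k\<langle>x,y\<rangle>/(x\<^sup>2, xy + qyx, y\<^sup>2)\<close>\<close>

definition Lambda_ideal :: "'k::field \<Rightarrow> (letter, 'k) free_algebra set"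
  where "Lambda_ideal q =
    (let x = gen Letter1; y = gen Letter2
     in Idl\<^bsub>free_algebra\<^esub> {x * x, x * y + const q * y * x, y * y})"

definition Lambda :: "'k::field \<Rightarrow> (letter, 'k) free_algebra set ring"
  where "Lambda q = free_algebra Quot Lambda_ideal q"

text \<open>
  A \<open>k\<close>-algebra is handled as a ring together with its structure map from \<open>k\<close> (a type).
\<close>

definition Lambda_unit :: "'k::field \<Rightarrow> 'k \<Rightarrow> (letter, 'k) free_algebra set"
  where "Lambda_unit q c = Lambda_ideal q +>\<^bsub>free_algebra\<^esub> const c"


section \<open>Tensor products of algebras and the enveloping algebra\<close>

text \<open>
  The algebra \<open>A \<otimes>\<^sub>k B\<close> is the free \<open>k\<close>-module on \<open>A \<times> B\<close>, with product
  \<open>(a,b)(a',b') = (aa',bb')\<close>, modulo the bilinearity relations. The subspace spanned by these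
  relations is already a two-sided ideal, so the ideal generated by them is that subspace.
\<close>

definition pair_algebra ::
  "('a, 'x) ring_scheme \<Rightarrow> ('b, 'y) ring_scheme \<Rightarrow> (('a \<times> 'b) \<Rightarrow>\<^sub>0 'k::field) ring"
  where "pair_algebra A B =
    \<lparr>carrier = {f. Poly_Mapping.keys f \<subseteq> carrier A \<times> carrier B},
     monoid.mult = (\<lambda>f g. \<Sum>(a, b)\<in>Poly_Mapping.keys f. \<Sum>(a', b')\<in>Poly_Mapping.keys g.
        Poly_Mapping.single (a \<otimes>\<^bsub>A\<^esub> a', b \<otimes>\<^bsub>B\<^esub> b')
          (Poly_Mapping.lookup f (a, b) * Poly_Mapping.lookup g (a', b'))),
     one = Poly_Mapping.single (\<one>\<^bsub>A\<^esub>, \<one>\<^bsub>B\<^esub>) 1,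
     ring.zero = 0,
     add = (+)\<rparr>"

definition tensor_relations ::
  "('a, 'x) ring_scheme \<Rightarrow> ('k \<Rightarrow> 'a) \<Rightarrow> ('b, 'y) ring_scheme \<Rightarrow> ('k \<Rightarrow> 'b)
    \<Rightarrow> (('a \<times> 'b) \<Rightarrow>\<^sub>0 'k::field) set"
  where "tensor_relations A \<eta> B \<theta> =
    (let t = (\<lambda>a b c. Poly_Mapping.single (a, b) c) in
      {t (a \<oplus>\<^bsub>A\<^esub> a') b 1 - t a b 1 - t a' b 1 |
          a a' b. a \<in> carrier A \<and> a' \<in> carrier A \<and> b \<in> carrier B}
    \<union> {t a (b \<oplus>\<^bsub>B\<^esub> b') 1 - t a b 1 - t a b' 1 |
          a b b'. a \<in> carrier A \<and> b \<in> carrier B \<and> b' \<in> carrier B}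
    \<union> {t (\<eta> c \<otimes>\<^bsub>A\<^esub> a) b 1 - t a b c | c a b. a \<in> carrier A \<and> b \<in> carrier B}
    \<union> {t a (\<theta> c \<otimes>\<^bsub>B\<^esub> b) 1 - t a b c | c a b. a \<in> carrier A \<and> b \<in> carrier B})"

definition tensor_ideal ::
  "('a, 'x) ring_scheme \<Rightarrow> ('k \<Rightarrow> 'a) \<Rightarrow> ('b, 'y) ring_scheme \<Rightarrow> ('k \<Rightarrow> 'b)
    \<Rightarrow> (('a \<times> 'b) \<Rightarrow>\<^sub>0 'k::field) set"
  where "tensor_ideal A \<eta> B \<theta> = Idl\<^bsub>pair_algebra A B\<^esub> (tensor_relations A \<eta> B \<theta>)"

definition tensor_algebra ::
  "('a, 'x) ring_scheme \<Rightarrow> ('k \<Rightarrow> 'a) \<Rightarrow> ('b, 'y) ring_scheme \<Rightarrow> ('k \<Rightarrow> 'b)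
    \<Rightarrow> (('a \<times> 'b) \<Rightarrow>\<^sub>0 'k::field) set ring"
  where "tensor_algebra A \<eta> B \<theta> = pair_algebra A B Quot tensor_ideal A \<eta> B \<theta>"

definition tensor_unit ::
  "('a, 'x) ring_scheme \<Rightarrow> ('k \<Rightarrow> 'a) \<Rightarrow> ('b, 'y) ring_scheme \<Rightarrow> ('k \<Rightarrow> 'b)
    \<Rightarrow> 'k \<Rightarrow> (('a \<times> 'b) \<Rightarrow>\<^sub>0 'k::field) set"
  where "tensor_unit A \<eta> B \<theta> c =
    tensor_ideal A \<eta> B \<theta> +>\<^bsub>pair_algebra A B\<^esub> Poly_Mapping.single (\<one>\<^bsub>A\<^esub>, \<one>\<^bsub>B\<^esub>) c"

definition opposite_ring :: "('a, 'x) ring_scheme \<Rightarrow> ('a, 'x) ring_scheme"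
  where "opposite_ring A = A\<lparr>monoid.mult := \<lambda>a b. b \<otimes>\<^bsub>A\<^esub> a\<rparr>"

definition enveloping_algebra ::
  "('a, 'x) ring_scheme \<Rightarrow> ('k \<Rightarrow> 'a) \<Rightarrow> (('a \<times> 'a) \<Rightarrow>\<^sub>0 'k::field) set ring"
  where "enveloping_algebra A \<eta> = tensor_algebra (opposite_ring A) \<eta> A \<eta>"

definition enveloping_unit ::
  "('a, 'x) ring_scheme \<Rightarrow> ('k \<Rightarrow> 'a) \<Rightarrow> 'k \<Rightarrow> (('a \<times> 'a) \<Rightarrow>\<^sub>0 'k::field) set"
  where "enveloping_unit A \<eta> = tensor_unit (opposite_ring A) \<eta> A \<eta>"

text \<open>
  The algebra \<open>A\<close> as a left module over \<open>A\<^sup>o\<^sup>p \<otimes>\<^sub>k A\<close>, with \<open>(a \<otimes> b)m = bma\<close>. The right-hand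
  side does not depend on the representative of the element of the tensor product.
\<close>

definition regular_bimodule ::
  "('a, 'x) ring_scheme \<Rightarrow> ('k \<Rightarrow> 'a) \<Rightarrow> ((('a \<times> 'a) \<Rightarrow>\<^sub>0 'k::field) set, 'a) module"
  where "regular_bimodule A \<eta> =
    \<lparr>carrier = carrier A, monoid.mult = monoid.mult A, one = \<one>\<^bsub>A\<^esub>, ring.zero = \<zero>\<^bsub>A\<^esub>, add = add A,
     module.smult = (\<lambda>t m. the_elem
       ((\<lambda>f. \<Oplus>\<^bsub>A\<^esub>p\<in>Poly_Mapping.keys f.
           \<eta> (Poly_Mapping.lookup f p) \<otimes>\<^bsub>A\<^esub> (snd p \<otimes>\<^bsub>A\<^esub> m \<otimes>\<^bsub>A\<^esub> fst p)) ` t))\<rparr>"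


section \<open>Projective resolutions\<close>

text \<open>
  The library locale \<^locale>\<open>module\<close> is restricted to commutative rings. The fields \<open>mult\<close> and
  \<open>one\<close> of the record type of modules are never used.
\<close>

locale left_module = R?: ring R + M?: abelian_group M
  for R :: "('r, 'x) ring_scheme" (structure) and M :: "('r, 'm, 'y) module_scheme" (structure) +
  assumes smult_closed:
      "\<lbrakk>a \<in> carrier R; x \<in> carrier M\<rbrakk> \<Longrightarrow> a \<odot>\<^bsub>M\<^esub> x \<in> carrier M"
    and smult_l_distr:
      "\<lbrakk>a \<in> carrier R; b \<in> carrier R; x \<in> carrier M\<rbrakk> \<Longrightarrow>
        (a \<oplus>\<^bsub>R\<^esub> b) \<odot>\<^bsub>M\<^esub> x = a \<odot>\<^bsub>M\<^esub> x \<oplus>\<^bsub>M\<^esub> b \<odot>\<^bsub>M\<^esub> x"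
    and smult_r_distr:
      "\<lbrakk>a \<in> carrier R; x \<in> carrier M; y \<in> carrier M\<rbrakk> \<Longrightarrow>
        a \<odot>\<^bsub>M\<^esub> (x \<oplus>\<^bsub>M\<^esub> y) = a \<odot>\<^bsub>M\<^esub> x \<oplus>\<^bsub>M\<^esub> a \<odot>\<^bsub>M\<^esub> y"
    and smult_assoc:
      "\<lbrakk>a \<in> carrier R; b \<in> carrier R; x \<in> carrier M\<rbrakk> \<Longrightarrow>
        (a \<otimes>\<^bsub>R\<^esub> b) \<odot>\<^bsub>M\<^esub> x = a \<odot>\<^bsub>M\<^esub> (b \<odot>\<^bsub>M\<^esub> x)"
    and smult_one:
      "x \<in> carrier M \<Longrightarrow> \<one>\<^bsub>R\<^esub> \<odot>\<^bsub>M\<^esub> x = x"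

definition linear_maps ::
  "('r, 'x) ring_scheme \<Rightarrow> ('r, 'm, 'y) module_scheme \<Rightarrow> ('r, 'n, 'z) module_scheme \<Rightarrow> ('m \<Rightarrow> 'n) set"
  where "linear_maps R M N =
    {f \<in> carrier M \<rightarrow>\<^sub>E carrier N.
       (\<forall>x\<in>carrier M. \<forall>y\<in>carrier M. f (x \<oplus>\<^bsub>M\<^esub> y) = f x \<oplus>\<^bsub>N\<^esub> f y) \<and>
       (\<forall>a\<in>carrier R. \<forall>x\<in>carrier M. f (a \<odot>\<^bsub>M\<^esub> x) = a \<odot>\<^bsub>N\<^esub> f x)}"

definition free_module :: "('r, 'x) ring_scheme \<Rightarrow> 'i set \<Rightarrow> ('r, 'i \<Rightarrow> 'r) module"
  where "free_module R I =
    \<lparr>carrier = {v. (\<forall>i\<in>I. v i \<in> carrier R) \<and> (\<forall>i. i \<notin> I \<longrightarrow> v i = \<zero>\<^bsub>R\<^esub>) \<and>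
                   finite {i. v i \<noteq> \<zero>\<^bsub>R\<^esub>}},
     monoid.mult = (\<lambda>_ _. undefined), one = undefined,
     ring.zero = (\<lambda>_. \<zero>\<^bsub>R\<^esub>),
     add = (\<lambda>v w i. v i \<oplus>\<^bsub>R\<^esub> w i),
     module.smult = (\<lambda>a v i. a \<otimes>\<^bsub>R\<^esub> v i)\<rparr>"

text \<open>
  Projective means direct summand of a free module. A module \<open>P\<close> which is a direct summand of some
  free module is one of the free module with basis the set \<open>carrier P\<close>, so it is no restriction
  to take index sets in the element type of \<open>P\<close>.
\<close>

definition projective_module ::
  "('r, 'x) ring_scheme \<Rightarrow> ('r, 'p, 'y) module_scheme \<Rightarrow> bool"
  where "projective_module R P \<longleftrightarrow> left_module R P \<and>
    (\<exists>I :: 'p set. \<exists>s\<in>linear_maps R P (free_module R I). \<exists>r\<in>linear_maps R (free_module R I) P.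
       \<forall>x\<in>carrier P. r (s x) = x)"

definition projective_resolution ::
  "('r, 'x) ring_scheme \<Rightarrow> (nat \<Rightarrow> ('r, 'p) module) \<Rightarrow> (nat \<Rightarrow> 'p \<Rightarrow> 'p) \<Rightarrow> ('p \<Rightarrow> 'm)
    \<Rightarrow> ('r, 'm, 'y) module_scheme \<Rightarrow> bool"
  where "projective_resolution R P d \<epsilon> M \<longleftrightarrow>
    (\<forall>n. projective_module R (P n)) \<and>
    (\<forall>n. d n \<in> linear_maps R (P (Suc n)) (P n)) \<and>
    \<epsilon> \<in> linear_maps R (P 0) M \<and>
    \<epsilon> ` carrier (P 0) = carrier M \<and>
    d 0 ` carrier (P 1) = {x \<in> carrier (P 0). \<epsilon> x = \<zero>\<^bsub>M\<^esub>} \<and>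
    (\<forall>n. d (Suc n) ` carrier (P (Suc (Suc n))) = {x \<in> carrier (P (Suc n)). d n x = \<zero>\<^bsub>P n\<^esub>})"


subsection \<open>Existence of projective resolutions\<close>

text \<open>
  Every module has a projective resolution with all its terms in a single type: the free module on
  the elements of the module, followed by the free modules on the elements of the successive kernels.
\<close>

lemma left_module_free_module:
  assumes "ring R"
  shows "left_module R (free_module R I)"
proof -
  interpret R: ring R by fact
  let ?F = "free_module R I"
  have cl: "v i \<in> carrier R" if "v \<in> carrier ?F" for v i
    using that by (cases "i \<in> I") (auto simp: free_module_def)
  have "abelian_group ?F"
  proof (rule abelian_groupI)
    fix v w assume v: "v \<in> carrier ?F" and w: "w \<in> carrier ?F"
    have "finite ({i. v i \<noteq> \<zero>\<^bsub>R\<^esub>} \<union> {i. w i \<noteq> \<zero>\<^bsub>R\<^esub>})"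
      using v w by (auto simp: free_module_def)
    then have "finite {i. v i \<oplus>\<^bsub>R\<^esub> w i \<noteq> \<zero>\<^bsub>R\<^esub>}"
      by (rule rev_finite_subset) auto
    with v w show "v \<oplus>\<^bsub>?F\<^esub> w \<in> carrier ?F"
      by (auto simp: free_module_def)
  next
    fix v assume v: "v \<in> carrier ?F"
    have "{i. \<ominus>\<^bsub>R\<^esub> v i \<noteq> \<zero>\<^bsub>R\<^esub>} \<subseteq> {i. v i \<noteq> \<zero>\<^bsub>R\<^esub>}"
      by auto
    then have "finite {i. \<ominus>\<^bsub>R\<^esub> v i \<noteq> \<zero>\<^bsub>R\<^esub>}"
      by (rule finite_subset) (use v in \<open>auto simp: free_module_def\<close>)
    then have "(\<lambda>i. \<ominus>\<^bsub>R\<^esub> v i) \<in> carrier ?F"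
      using v by (auto simp: free_module_def)
    moreover have "(\<lambda>i. \<ominus>\<^bsub>R\<^esub> v i) \<oplus>\<^bsub>?F\<^esub> v = \<zero>\<^bsub>?F\<^esub>"
      using cl[OF v] by (simp add: free_module_def fun_eq_iff R.l_neg)
    ultimately show "\<exists>w\<in>carrier ?F. w \<oplus>\<^bsub>?F\<^esub> v = \<zero>\<^bsub>?F\<^esub>"
      by blast
  next
    fix u v w assume "u \<in> carrier ?F" "v \<in> carrier ?F" "w \<in> carrier ?F"
    then have "\<And>i. u i \<in> carrier R" "\<And>i. v i \<in> carrier R" "\<And>i. w i \<in> carrier R"
      by (simp_all add: cl)
    then show "u \<oplus>\<^bsub>?F\<^esub> v \<oplus>\<^bsub>?F\<^esub> w = u \<oplus>\<^bsub>?F\<^esub> (v \<oplus>\<^bsub>?F\<^esub> w)"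
      by (simp add: free_module_def R.a_assoc)
  next
    fix v w assume "v \<in> carrier ?F" "w \<in> carrier ?F"
    then have "\<And>i. v i \<in> carrier R" "\<And>i. w i \<in> carrier R"
      by (simp_all add: cl)
    then show "v \<oplus>\<^bsub>?F\<^esub> w = w \<oplus>\<^bsub>?F\<^esub> v"
      by (simp add: free_module_def R.a_comm)
  next
    fix v assume "v \<in> carrier ?F"
    then have "\<And>i. v i \<in> carrier R"
      by (simp_all add: cl)
    then show "\<zero>\<^bsub>?F\<^esub> \<oplus>\<^bsub>?F\<^esub> v = v"
      by (simp add: free_module_def)
  qed (simp add: free_module_def)
  then interpret F: abelian_group ?F .
  show ?thesis
  proof
    fix a v assume a: "a \<in> carrier R" and v: "v \<in> carrier ?F"
    have "{i. a \<otimes>\<^bsub>R\<^esub> v i \<noteq> \<zero>\<^bsub>R\<^esub>} \<subseteq> {i. v i \<noteq> \<zero>\<^bsub>R\<^esub>}"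
      using a by auto
    then have "finite {i. a \<otimes>\<^bsub>R\<^esub> v i \<noteq> \<zero>\<^bsub>R\<^esub>}"
      by (rule finite_subset) (use v in \<open>auto simp: free_module_def\<close>)
    then show "a \<odot>\<^bsub>?F\<^esub> v \<in> carrier ?F"
      using a v by (auto simp: free_module_def)
  next
    fix a b v assume "a \<in> carrier R" "b \<in> carrier R" "v \<in> carrier ?F"
    with cl[of v] show "(a \<oplus>\<^bsub>R\<^esub> b) \<odot>\<^bsub>?F\<^esub> v = a \<odot>\<^bsub>?F\<^esub> v \<oplus>\<^bsub>?F\<^esub> b \<odot>\<^bsub>?F\<^esub> v"
      by (simp add: free_module_def R.l_distr)
  next
    fix a v w assume "a \<in> carrier R" "v \<in> carrier ?F" "w \<in> carrier ?F"
    with cl[of v] cl[of w]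
    show "a \<odot>\<^bsub>?F\<^esub> (v \<oplus>\<^bsub>?F\<^esub> w) = a \<odot>\<^bsub>?F\<^esub> v \<oplus>\<^bsub>?F\<^esub> a \<odot>\<^bsub>?F\<^esub> w"
      by (simp add: free_module_def R.r_distr)
  next
    fix a b v assume "a \<in> carrier R" "b \<in> carrier R" "v \<in> carrier ?F"
    with cl[of v] show "(a \<otimes>\<^bsub>R\<^esub> b) \<odot>\<^bsub>?F\<^esub> v = a \<odot>\<^bsub>?F\<^esub> (b \<odot>\<^bsub>?F\<^esub> v)"
      by (simp add: free_module_def R.m_assoc)
  next
    fix v assume "v \<in> carrier ?F"
    with cl[of v] show "\<one>\<^bsub>R\<^esub> \<odot>\<^bsub>?F\<^esub> v = v"
      by (simp add: free_module_def)
  qed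
qed

definition basis_vector :: "('r, 'x) ring_scheme \<Rightarrow> 'i \<Rightarrow> 'i \<Rightarrow> 'r"
  where "basis_vector R i = (\<lambda>j. if j = i then \<one>\<^bsub>R\<^esub> else \<zero>\<^bsub>R\<^esub>)"

lemma basis_vector_in_carrier:
  assumes "ring R" "i \<in> I"
  shows "basis_vector R i \<in> carrier (free_module R I)"
proof -
  interpret R: ring R by fact
  have "finite {j. basis_vector R i j \<noteq> \<zero>\<^bsub>R\<^esub>}"
    by (rule finite_subset[of _ "{i}"]) (auto simp: basis_vector_def)
  with assms(2) show ?thesis
    by (auto simp: basis_vector_def free_module_def)
qed

definition linear_extension ::
  "('r, 'x) ring_scheme \<Rightarrow> 'i set \<Rightarrow> ('r, 'm, 'y) module_scheme \<Rightarrow> ('i \<Rightarrow> 'm) \<Rightarrow> ('i \<Rightarrow> 'r) \<Rightarrow> 'm"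
  where "linear_extension R I M \<phi> =
    (\<lambda>v\<in>carrier (free_module R I). \<Oplus>\<^bsub>M\<^esub>i\<in>{i. v i \<noteq> \<zero>\<^bsub>R\<^esub>}. v i \<odot>\<^bsub>M\<^esub> \<phi> i)"

context left_module
begin

lemma smult_l_zero:
  assumes x: "x \<in> carrier M"
  shows "\<zero>\<^bsub>R\<^esub> \<odot>\<^bsub>M\<^esub> x = \<zero>\<^bsub>M\<^esub>"
proof -
  have c: "\<zero>\<^bsub>R\<^esub> \<odot>\<^bsub>M\<^esub> x \<in> carrier M"
    using x by (simp add: smult_closed)
  have "\<zero>\<^bsub>R\<^esub> \<odot>\<^bsub>M\<^esub> x \<oplus>\<^bsub>M\<^esub> \<zero>\<^bsub>R\<^esub> \<odot>\<^bsub>M\<^esub> x = \<zero>\<^bsub>R\<^esub> \<odot>\<^bsub>M\<^esub> x"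
    using smult_l_distr[of "\<zero>\<^bsub>R\<^esub>" "\<zero>\<^bsub>R\<^esub>" x] x by simp
  then show ?thesis
    using c by (simp add: M.add.r_cancel_one')
qed

lemma smult_r_zero:
  assumes a: "a \<in> carrier R"
  shows "a \<odot>\<^bsub>M\<^esub> \<zero>\<^bsub>M\<^esub> = \<zero>\<^bsub>M\<^esub>"
proof -
  have c: "a \<odot>\<^bsub>M\<^esub> \<zero>\<^bsub>M\<^esub> \<in> carrier M"
    using a by (simp add: smult_closed)
  have "a \<odot>\<^bsub>M\<^esub> \<zero>\<^bsub>M\<^esub> \<oplus>\<^bsub>M\<^esub> a \<odot>\<^bsub>M\<^esub> \<zero>\<^bsub>M\<^esub> = a \<odot>\<^bsub>M\<^esub> \<zero>\<^bsub>M\<^esub>"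
    using smult_r_distr[of a "\<zero>\<^bsub>M\<^esub>" "\<zero>\<^bsub>M\<^esub>"] a by simp
  then show ?thesis
    using c by (simp add: M.add.r_cancel_one')
qed

lemma linear_extension_eq:
  assumes v: "v \<in> carrier (free_module R I)" and \<phi>: "\<phi> \<in> I \<rightarrow> carrier M"
    and A: "finite A" "{i. v i \<noteq> \<zero>\<^bsub>R\<^esub>} \<subseteq> A" "A \<subseteq> I"
  shows "linear_extension R I M \<phi> v = (\<Oplus>\<^bsub>M\<^esub>i\<in>A. v i \<odot>\<^bsub>M\<^esub> \<phi> i)"
proof -
  have v': "v i \<in> carrier R" if "i \<in> A" for i
    using v A that by (auto simp: free_module_def)
  have "(\<Oplus>\<^bsub>M\<^esub>i\<in>{i. v i \<noteq> \<zero>\<^bsub>R\<^esub>}. v i \<odot>\<^bsub>M\<^esub> \<phi> i) = (\<Oplus>\<^bsub>M\<^esub>i\<in>A. v i \<odot>\<^bsub>M\<^esub> \<phi> i)"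
  proof (rule M.add.finprod_mono_neutral_cong_left)
    show "\<And>i. i \<in> A - {i. v i \<noteq> \<zero>\<^bsub>R\<^esub>} \<Longrightarrow> v i \<odot>\<^bsub>M\<^esub> \<phi> i = \<zero>\<^bsub>M\<^esub>"
      using A \<phi> by (auto intro!: smult_l_zero)
    show "(\<lambda>i. v i \<odot>\<^bsub>M\<^esub> \<phi> i) \<in> A \<rightarrow> carrier M"
      using A \<phi> v' by (auto intro!: smult_closed)
  qed (use A in auto)
  with v show ?thesis
    by (simp add: linear_extension_def)
qed

lemma smult_finsum:
  assumes "finite A" "a \<in> carrier R" "f \<in> A \<rightarrow> carrier M"
  shows "a \<odot>\<^bsub>M\<^esub> (\<Oplus>\<^bsub>M\<^esub>i\<in>A. f i) = (\<Oplus>\<^bsub>M\<^esub>i\<in>A. a \<odot>\<^bsub>M\<^esub> f i)"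
  using assms
proof (induction A)
  case (insert i A)
  have 1: "f \<in> A \<rightarrow> carrier M" "f i \<in> carrier M"
    using insert.prems by auto
  have 2: "(\<lambda>i. a \<odot>\<^bsub>M\<^esub> f i) \<in> A \<rightarrow> carrier M" "a \<odot>\<^bsub>M\<^esub> f i \<in> carrier M"
    using 1 insert.prems by (auto intro: smult_closed)
  have "(\<Oplus>\<^bsub>M\<^esub>j\<in>insert i A. f j) = f i \<oplus>\<^bsub>M\<^esub> (\<Oplus>\<^bsub>M\<^esub>j\<in>A. f j)"
    using insert.hyps 1 by (intro M.finsum_insert)
  moreover have "(\<Oplus>\<^bsub>M\<^esub>j\<in>insert i A. a \<odot>\<^bsub>M\<^esub> f j) = a \<odot>\<^bsub>M\<^esub> f i \<oplus>\<^bsub>M\<^esub> (\<Oplus>\<^bsub>M\<^esub>j\<in>A. a \<odot>\<^bsub>M\<^esub> f j)"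
    using insert.hyps 2 by (intro M.finsum_insert)
  ultimately show ?case
    using 1 insert by (simp add: smult_r_distr)
qed (simp add: smult_r_zero)

lemma linear_extension_linear:
  fixes I :: "'i set"
  assumes \<phi>: "\<phi> \<in> I \<rightarrow> carrier M"
  shows "linear_extension R I M \<phi> \<in> linear_maps R (free_module R I) M"
proof -
  let ?F = "free_module R I" and ?f = "linear_extension R I M \<phi>"
  interpret F: left_module R ?F
    by (rule left_module_free_module) (rule R.ring_axioms)
  define S where "S v = {i. v i \<noteq> \<zero>\<^bsub>R\<^esub>}" for v :: "'i \<Rightarrow> 'r"
  have S: "finite (S v)" "S v \<subseteq> I" if "v \<in> carrier ?F" for v
    using that by (auto simp: S_def free_module_def)
  have cl: "v i \<in> carrier R" if "v \<in> carrier ?F" for v i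
    using that by (cases "i \<in> I") (auto simp: free_module_def)
  have term_cl: "(\<lambda>i. v i \<odot>\<^bsub>M\<^esub> \<phi> i) \<in> A \<rightarrow> carrier M" if "v \<in> carrier ?F" "A \<subseteq> I" for v A
    using that \<phi> cl by (auto intro!: smult_closed)
  have "?f \<in> carrier ?F \<rightarrow>\<^sub>E carrier M"
  proof
    fix v assume v: "v \<in> carrier ?F"
    have "?f v = (\<Oplus>\<^bsub>M\<^esub>i\<in>S v. v i \<odot>\<^bsub>M\<^esub> \<phi> i)"
      using v \<phi> S[OF v] by (intro linear_extension_eq) (auto simp: S_def)
    also have "\<dots> \<in> carrier M"
      using v S[OF v] by (intro M.finsum_closed term_cl)
    finally show "?f v \<in> carrier M" .
  qed (simp add: linear_extension_def)
  moreover have "?f (v \<oplus>\<^bsub>?F\<^esub> w) = ?f v \<oplus>\<^bsub>M\<^esub> ?f w" if v: "v \<in> carrier ?F" and w: "w \<in> carrier ?F" for v w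
  proof -
    define A where "A = S v \<union> S w"
    have A: "finite A" "A \<subseteq> I"
      using S[OF v] S[OF w] by (auto simp: A_def)
    have vw: "v \<oplus>\<^bsub>?F\<^esub> w \<in> carrier ?F"
      using v w by simp
    have ev: "(v \<oplus>\<^bsub>?F\<^esub> w) i = v i \<oplus>\<^bsub>R\<^esub> w i" for i
      by (simp add: free_module_def)
    have "?f (v \<oplus>\<^bsub>?F\<^esub> w) = (\<Oplus>\<^bsub>M\<^esub>i\<in>A. (v \<oplus>\<^bsub>?F\<^esub> w) i \<odot>\<^bsub>M\<^esub> \<phi> i)"
      using vw \<phi> A by (intro linear_extension_eq) (auto simp: A_def S_def ev)
    also have "\<dots> = (\<Oplus>\<^bsub>M\<^esub>i\<in>A. v i \<odot>\<^bsub>M\<^esub> \<phi> i \<oplus>\<^bsub>M\<^esub> w i \<odot>\<^bsub>M\<^esub> \<phi> i)"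
      using A \<phi> cl[OF v] cl[OF w]
      by (intro M.finsum_cong') (auto simp: ev Pi_iff smult_closed intro!: smult_l_distr M.a_closed)
    also have "\<dots> = (\<Oplus>\<^bsub>M\<^esub>i\<in>A. v i \<odot>\<^bsub>M\<^esub> \<phi> i) \<oplus>\<^bsub>M\<^esub> (\<Oplus>\<^bsub>M\<^esub>i\<in>A. w i \<odot>\<^bsub>M\<^esub> \<phi> i)"
      using A v w by (intro M.finsum_addf term_cl)
    also have "(\<Oplus>\<^bsub>M\<^esub>i\<in>A. v i \<odot>\<^bsub>M\<^esub> \<phi> i) = ?f v"
      using v \<phi> A by (intro linear_extension_eq[symmetric]) (auto simp: A_def S_def)
    also have "(\<Oplus>\<^bsub>M\<^esub>i\<in>A. w i \<odot>\<^bsub>M\<^esub> \<phi> i) = ?f w"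
      using w \<phi> A by (intro linear_extension_eq[symmetric]) (auto simp: A_def S_def)
    finally show ?thesis .
  qed
  moreover have "?f (a \<odot>\<^bsub>?F\<^esub> v) = a \<odot>\<^bsub>M\<^esub> ?f v" if a: "a \<in> carrier R" and v: "v \<in> carrier ?F" for a v
  proof -
    note A = S[OF v]
    have av: "a \<odot>\<^bsub>?F\<^esub> v \<in> carrier ?F"
      using a v by (rule F.smult_closed)
    have ev: "(a \<odot>\<^bsub>?F\<^esub> v) i = a \<otimes>\<^bsub>R\<^esub> v i" for i
      by (simp add: free_module_def)
    have "?f (a \<odot>\<^bsub>?F\<^esub> v) = (\<Oplus>\<^bsub>M\<^esub>i\<in>S v. (a \<odot>\<^bsub>?F\<^esub> v) i \<odot>\<^bsub>M\<^esub> \<phi> i)"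
      using av \<phi> A a by (intro linear_extension_eq) (auto simp: S_def ev)
    also have "\<dots> = (\<Oplus>\<^bsub>M\<^esub>i\<in>S v. a \<odot>\<^bsub>M\<^esub> (v i \<odot>\<^bsub>M\<^esub> \<phi> i))"
      using A \<phi> a cl[OF v]
      by (intro M.finsum_cong') (auto simp: ev intro!: smult_assoc smult_closed)
    also have "\<dots> = a \<odot>\<^bsub>M\<^esub> (\<Oplus>\<^bsub>M\<^esub>i\<in>S v. v i \<odot>\<^bsub>M\<^esub> \<phi> i)"
      using A a v by (intro smult_finsum[symmetric] term_cl)
    also have "(\<Oplus>\<^bsub>M\<^esub>i\<in>S v. v i \<odot>\<^bsub>M\<^esub> \<phi> i) = ?f v"
      using v \<phi> A by (intro linear_extension_eq[symmetric]) (auto simp: S_def)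
    finally show ?thesis .
  qed
  ultimately show ?thesis
    by (simp add: linear_maps_def)
qed

lemma linear_extension_basis_vector:
  assumes \<phi>: "\<phi> \<in> I \<rightarrow> carrier M" and i: "i \<in> I"
  shows "linear_extension R I M \<phi> (basis_vector R i) = \<phi> i"
proof -
  have "linear_extension R I M \<phi> (basis_vector R i) =
      (\<Oplus>\<^bsub>M\<^esub>j\<in>{i}. basis_vector R i j \<odot>\<^bsub>M\<^esub> \<phi> j)"
    using \<phi> i
    by (intro linear_extension_eq basis_vector_in_carrier R.ring_axioms)
       (auto simp: basis_vector_def)
  also have "\<dots> = \<phi> i"
    using \<phi> i by (subst M.finsum_insert) (auto simp: basis_vector_def smult_one smult_closed Pi_iff)
  finally show ?thesis .
qed

end

lemma linear_maps_eq_on_basis: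
  assumes R: "ring R" and N: "left_module R N"
    and f: "f \<in> linear_maps R (free_module R I) N" and g: "g \<in> linear_maps R (free_module R I) N"
    and eq: "\<And>i. i \<in> I \<Longrightarrow> f (basis_vector R i) = g (basis_vector R i)"
    and v: "v \<in> carrier (free_module R I)"
  shows "f v = g v"
proof -
  let ?F = "free_module R I"
  interpret R: ring R by fact
  interpret N: left_module R N by fact
  interpret F: left_module R ?F
    by (rule left_module_free_module) fact
  have zero: "h \<zero>\<^bsub>?F\<^esub> = \<zero>\<^bsub>N\<^esub>" if h: "h \<in> linear_maps R ?F N" for h
  proof -
    have "h (\<zero>\<^bsub>R\<^esub> \<odot>\<^bsub>?F\<^esub> \<zero>\<^bsub>?F\<^esub>) = \<zero>\<^bsub>R\<^esub> \<odot>\<^bsub>N\<^esub> h \<zero>\<^bsub>?F\<^esub>" "h \<zero>\<^bsub>?F\<^esub> \<in> carrier N"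
      using h by (auto simp: linear_maps_def)
    then show ?thesis
      by (simp add: F.smult_l_zero N.smult_l_zero)
  qed
  have "f v = g v" if "finite A" "{i. v i \<noteq> \<zero>\<^bsub>R\<^esub>} \<subseteq> A" "v \<in> carrier ?F" for A v
    using that
  proof (induction A arbitrary: v)
    case empty
    then have "v = \<zero>\<^bsub>?F\<^esub>"
      by (auto simp: free_module_def)
    then show ?case
      by (simp add: zero f g)
  next
    case (insert i A)
    show ?case
    proof (cases "i \<in> I")
      case True
      define w where "w = v(i := \<zero>\<^bsub>R\<^esub>)"
      define u where "u = v i \<odot>\<^bsub>?F\<^esub> basis_vector R i"
      have vi: "v i \<in> carrier R"
        using True insert.prems(2) by (auto simp: free_module_def)
      have b: "basis_vector R i \<in> carrier ?F"
        using R True by (rule basis_vector_in_carrier)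
      have u: "u \<in> carrier ?F"
        unfolding u_def using vi b by (rule F.smult_closed)
      have "finite {j. v j \<noteq> \<zero>\<^bsub>R\<^esub>}"
        using insert.prems(2) by (auto simp: free_module_def)
      then have "finite {j. w j \<noteq> \<zero>\<^bsub>R\<^esub>}"
        by (rule rev_finite_subset) (auto simp: w_def)
      then have w: "w \<in> carrier ?F"
        using insert.prems(2) by (auto simp: free_module_def w_def)
      have v_eq: "v = w \<oplus>\<^bsub>?F\<^esub> u"
      proof
        fix j
        have "v j \<in> carrier R"
          using insert.prems(2) by (cases "j \<in> I") (auto simp: free_module_def)
        with vi show "v j = (w \<oplus>\<^bsub>?F\<^esub> u) j"
          by (simp add: free_module_def w_def u_def basis_vector_def)
      qed
      have fw: "f w = g w"
        using insert.prems(1) by (intro insert.IH w) (auto simp: w_def)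
      have h: "h v = h w \<oplus>\<^bsub>N\<^esub> v i \<odot>\<^bsub>N\<^esub> h (basis_vector R i)" if "h \<in> linear_maps R ?F N" for h
      proof -
        have "h (w \<oplus>\<^bsub>?F\<^esub> u) = h w \<oplus>\<^bsub>N\<^esub> h u" "h u = v i \<odot>\<^bsub>N\<^esub> h (basis_vector R i)"
          using that w u vi b by (simp_all add: linear_maps_def u_def)
        then show ?thesis
          using v_eq by simp
      qed
      show ?thesis
        by (simp only: h[OF f] h[OF g] fw eq[OF True])
    next
      case False
      then have "v i = \<zero>\<^bsub>R\<^esub>"
        using insert.prems(2) by (auto simp: free_module_def)
      then show ?thesis
        using insert.prems by (intro insert.IH) auto
    qed
  qed
  from this[of "{i. v i \<noteq> \<zero>\<^bsub>R\<^esub>}"] v show ?thesis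
    by (auto simp: free_module_def)
qed

lemma projective_free_module:
  assumes R: "ring R"
  shows "projective_module R (free_module R I)"
proof -
  let ?F = "free_module R I"
  let ?E = "free_module R (carrier ?F)"
  interpret F: left_module R ?F by (rule left_module_free_module) fact
  interpret E: left_module R ?E by (rule left_module_free_module) fact
  define s where "s = linear_extension R I ?E (\<lambda>i. basis_vector R (basis_vector R i))"
  define r where "r = linear_extension R (carrier ?F) ?F (\<lambda>x. x)"
  have b: "(\<lambda>i. basis_vector R (basis_vector R i)) \<in> I \<rightarrow> carrier ?E"
    using R by (auto intro!: basis_vector_in_carrier)
  have s: "s \<in> linear_maps R ?F ?E"
    unfolding s_def using b by (rule E.linear_extension_linear)
  have r: "r \<in> linear_maps R ?E ?F"
    unfolding r_def by (rule F.linear_extension_linear) simp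
  have id: "(\<lambda>x\<in>carrier ?F. x) \<in> linear_maps R ?F ?F"
    by (auto simp: linear_maps_def F.smult_closed)
  have rs: "compose (carrier ?F) r s \<in> linear_maps R ?F ?F"
    using r s by (auto simp: linear_maps_def compose_def PiE_iff F.smult_closed Pi_iff)
  have id_rs: "r (s x) = x" if x: "x \<in> carrier ?F" for x
  proof -
    have "compose (carrier ?F) r s x = (\<lambda>x\<in>carrier ?F. x) x"
    proof (rule linear_maps_eq_on_basis[OF R F.left_module_axioms rs id _ x])
      fix i assume i: "i \<in> I"
      have bi: "basis_vector R i \<in> carrier ?F"
        using R i by (rule basis_vector_in_carrier)
      have "s (basis_vector R i) = basis_vector R (basis_vector R i)"
        unfolding s_def using b i by (rule E.linear_extension_basis_vector)
      moreover have "r (basis_vector R (basis_vector R i)) = basis_vector R i"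
        unfolding r_def using bi by (intro F.linear_extension_basis_vector) auto
      ultimately show "compose (carrier ?F) r s (basis_vector R i) = (\<lambda>x\<in>carrier ?F. x) (basis_vector R i)"
        using bi by (simp add: compose_def)
    qed
    with x show ?thesis
      by (simp add: compose_def)
  qed
  show ?thesis
    unfolding projective_module_def
    by (intro conjI F.left_module_axioms exI[of _ "carrier ?F"] bexI[OF _ s] bexI[OF _ r] ballI id_rs)
qed

datatype ('m, 'r) syzygy = Element 'm | Syzygy "(('m, 'r) syzygy \<times> 'r) list"

lemma projective_resolution_exists:
  fixes R :: "('r, 'x) ring_scheme" and M :: "('r, 'm, 'y) module_scheme"
  assumes M: "left_module R M"
  shows "\<exists>(P :: nat \<Rightarrow> ('r, ('m, 'r) syzygy \<Rightarrow> 'r) module) d \<epsilon>. projective_resolution R P d \<epsilon> M"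
proof -
  interpret M: left_module R M by fact
  have R: "ring R" by (rule M.R.ring_axioms)
  let ?F = "\<lambda>I :: ('m, 'r) syzygy set. free_module R I"
  define dec where "dec l = (\<lambda>i. case map_of l i of None \<Rightarrow> \<zero>\<^bsub>R\<^esub> | Some a \<Rightarrow> a)"
    for l :: "(('m, 'r) syzygy \<times> 'r) list"
  have dec_surj: "\<exists>l. dec l = v" if "v \<in> carrier (?F I)" for v I
  proof -
    have "finite {i. v i \<noteq> \<zero>\<^bsub>R\<^esub>}"
      using that by (simp add: free_module_def)
    then obtain xs where xs: "set xs = {i. v i \<noteq> \<zero>\<^bsub>R\<^esub>}"
      using finite_list by auto
    have "dec (map (\<lambda>i. (i, v i)) xs) = v"
      unfolding dec_def fun_eq_iff map_of_map_restrict restrict_map_def xs by simp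
    then show ?thesis ..
  qed
  define \<psi> where "\<psi> i = (case i of Element m \<Rightarrow> (\<lambda>_. \<zero>\<^bsub>R\<^esub>) | Syzygy l \<Rightarrow> dec l)"
    for i :: "('m, 'r) syzygy"
  define \<phi> where "\<phi> i = (case i of Element m \<Rightarrow> m | Syzygy l \<Rightarrow> \<zero>\<^bsub>M\<^esub>)" for i :: "('m, 'r) syzygy"
  define I0 where "I0 = (Element ` carrier M :: ('m, 'r) syzygy set)"
  define \<epsilon> where "\<epsilon> = linear_extension R I0 M \<phi>"
  define nxt where "nxt Z = Syzygy ` {l. dec l \<in> Z}" for Z
  define st where "st = rec_nat (I0, {v \<in> carrier (?F I0). \<epsilon> v = \<zero>\<^bsub>M\<^esub>})
    (\<lambda>_ (I, Z). (nxt Z, {v \<in> carrier (?F (nxt Z)).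
        linear_extension R (nxt Z) (?F I) \<psi> v = \<zero>\<^bsub>?F I\<^esub>}))"
  define I where "I n = fst (st n)" for n
  define Z where "Z n = snd (st n)" for n
  define d where "d n = linear_extension R (I (Suc n)) (?F (I n)) \<psi>" for n
  have I_0: "I 0 = I0" and Z_0: "Z 0 = {v \<in> carrier (?F I0). \<epsilon> v = \<zero>\<^bsub>M\<^esub>}"
    by (simp_all add: I_def Z_def st_def)
  have I_Suc: "I (Suc n) = nxt (Z n)" for n
    by (simp add: I_def Z_def st_def split_beta)
  have Z_Suc: "Z (Suc n) = {v \<in> carrier (?F (I (Suc n))). d n v = \<zero>\<^bsub>?F (I n)\<^esub>}" for n
    by (simp add: d_def I_Suc) (simp add: I_def Z_def st_def split_beta)
  have Z_sub: "Z n \<subseteq> carrier (?F (I n))" for n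
    by (cases n) (auto simp: Z_0 I_0 Z_Suc)
  have F: "left_module R (?F J)" for J
    using R by (rule left_module_free_module)
  have \<phi>: "\<phi> \<in> I0 \<rightarrow> carrier M"
    by (auto simp: \<phi>_def I0_def)
  have \<psi>Z: "\<psi> \<in> I (Suc n) \<rightarrow> Z n" for n
    by (auto simp: \<psi>_def I_Suc nxt_def)
  then have \<psi>: "\<psi> \<in> I (Suc n) \<rightarrow> carrier (?F (I n))" for n
    using Z_sub by blast
  have \<epsilon>: "\<epsilon> \<in> linear_maps R (?F (I 0)) M"
    unfolding \<epsilon>_def I_0 using \<phi> by (rule M.linear_extension_linear)
  have d: "d n \<in> linear_maps R (?F (I (Suc n))) (?F (I n))" for n
    unfolding d_def using F \<psi> by (rule left_module.linear_extension_linear)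
  have d_basis: "d n (basis_vector R i) = \<psi> i" if "i \<in> I (Suc n)" for n i
    unfolding d_def using F \<psi> that by (rule left_module.linear_extension_basis_vector)
  have image_\<epsilon>: "\<epsilon> ` carrier (?F (I 0)) = carrier M"
  proof
    show "\<epsilon> ` carrier (?F (I 0)) \<subseteq> carrier M"
      using \<epsilon> by (auto simp: linear_maps_def)
    show "carrier M \<subseteq> \<epsilon> ` carrier (?F (I 0))"
    proof
      fix m assume "m \<in> carrier M"
      then have i: "Element m \<in> I0"
        by (simp add: I0_def)
      have "\<epsilon> (basis_vector R (Element m)) = m"
        unfolding \<epsilon>_def using M.linear_extension_basis_vector[OF \<phi> i] by (simp add: \<phi>_def)
      with basis_vector_in_carrier[OF R i] show "m \<in> \<epsilon> ` carrier (?F (I 0))"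
        unfolding I_0 by (metis image_eqI)
    qed
  qed
  have image_d: "d n ` carrier (?F (I (Suc n))) = Z n" for n
  proof
    show "Z n \<subseteq> d n ` carrier (?F (I (Suc n)))"
    proof
      fix z assume z: "z \<in> Z n"
      then obtain l where l: "dec l = z"
        using dec_surj Z_sub by blast
      then have i: "Syzygy l \<in> I (Suc n)"
        using z by (auto simp: I_Suc nxt_def)
      have "d n (basis_vector R (Syzygy l)) = z"
        using d_basis[OF i] l by (simp add: \<psi>_def)
      with basis_vector_in_carrier[OF R i] show "z \<in> d n ` carrier (?F (I (Suc n)))"
        by (metis image_eqI)
    qed
    have kill: "h (d n v) = \<zero>\<^bsub>N\<^esub>"
      if N: "left_module R N" and h: "h \<in> linear_maps R (?F (I n)) N"
        and hZ: "\<And>z. z \<in> Z n \<Longrightarrow> h z = \<zero>\<^bsub>N\<^esub>" and v: "v \<in> carrier (?F (I (Suc n)))"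
      for h v and N :: "('r, 'q, 'w) module_scheme"
    proof -
      interpret N: left_module R N by fact
      let ?G = "?F (I (Suc n))"
      interpret G: left_module R ?G by (rule F)
      have 1: "compose (carrier ?G) h (d n) \<in> linear_maps R ?G N"
        using h d[of n] by (auto simp: linear_maps_def compose_def PiE_iff G.smult_closed Pi_iff)
      have 2: "(\<lambda>x\<in>carrier ?G. \<zero>\<^bsub>N\<^esub>) \<in> linear_maps R ?G N"
        by (auto simp: linear_maps_def G.smult_closed N.smult_r_zero)
      have "compose (carrier ?G) h (d n) v = (\<lambda>x\<in>carrier ?G. \<zero>\<^bsub>N\<^esub>) v"
      proof (rule linear_maps_eq_on_basis[OF R N 1 2 _ v])
        fix i assume i: "i \<in> I (Suc n)"
        have "h (\<psi> i) = \<zero>\<^bsub>N\<^esub>"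
          using \<psi>Z i by (intro hZ) auto
        with basis_vector_in_carrier[OF R i] d_basis[OF i]
        show "compose (carrier ?G) h (d n) (basis_vector R i) = (\<lambda>x\<in>carrier ?G. \<zero>\<^bsub>N\<^esub>) (basis_vector R i)"
          by (simp add: compose_def)
      qed
      with v show ?thesis
        by (simp add: compose_def)
    qed
    have dv: "d n v \<in> carrier (?F (I n))" if "v \<in> carrier (?F (I (Suc n)))" for v
      using d[of n] that by (auto simp: linear_maps_def)
    show "d n ` carrier (?F (I (Suc n))) \<subseteq> Z n"
    proof (cases n)
      case 0
      have "\<epsilon> (d n v) = \<zero>\<^bsub>M\<^esub>" if "v \<in> carrier (?F (I (Suc n)))" for v
        by (rule kill[OF M _ _ that]) (use \<epsilon> Z_0 0 in auto)
      with dv show ?thesis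
        by (auto simp: 0 Z_0 I_0)
    next
      case (Suc m)
      have "d m (d n v) = \<zero>\<^bsub>?F (I m)\<^esub>" if "v \<in> carrier (?F (I (Suc n)))" for v
        by (rule kill[OF F _ _ that]) (use d[of m] Z_Suc[of m] Suc in auto)
      with dv show ?thesis
        by (auto simp: Suc Z_Suc)
    qed
  qed
  have "d 0 ` carrier (?F (I 1)) = {x \<in> carrier (?F (I 0)). \<epsilon> x = \<zero>\<^bsub>M\<^esub>}"
    using image_d[of 0] unfolding Z_0 I_0 One_nat_def .
  moreover have "d (Suc n) ` carrier (?F (I (Suc (Suc n)))) =
      {x \<in> carrier (?F (I (Suc n))). d n x = \<zero>\<^bsub>?F (I n)\<^esub>}" for n
    using image_d[of "Suc n"] unfolding Z_Suc .
  ultimately have "projective_resolution R (\<lambda>n. ?F (I n)) d \<epsilon> M"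
    unfolding projective_resolution_def
    by (intro conjI allI projective_free_module R d \<epsilon> image_\<epsilon>)
  then show ?thesis
    by (intro exI)
qed


section \<open>Ext groups and the Yoneda product\<close>

text \<open>
  \<open>Ext\<^sup>n\<^sub>R(M,N)\<close> is the \<open>n\<close>-th cohomology of \<open>Hom\<^sub>R(P\<^sub>\<bullet>,N)\<close> for a projective resolution \<open>P\<^sub>\<bullet>\<close> of \<open>M\<close>.
  The groups of homomorphisms and the Ext groups are written as (multiplicative) groups in the sense
  of HOL-Algebra, so that its quotient groups and direct sums can be used.
\<close>

definition hom_group ::
  "('r, 'x) ring_scheme \<Rightarrow> ('r, 'm, 'y) module_scheme \<Rightarrow> ('r, 'n, 'z) module_scheme \<Rightarrow> ('m \<Rightarrow> 'n) monoid"
  where "hom_group R M N =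
    \<lparr>carrier = linear_maps R M N,
     monoid.mult = (\<lambda>f g. \<lambda>x\<in>carrier M. f x \<oplus>\<^bsub>N\<^esub> g x),
     one = (\<lambda>x\<in>carrier M. \<zero>\<^bsub>N\<^esub>)\<rparr>"

definition cocycles ::
  "('r, 'x) ring_scheme \<Rightarrow> (nat \<Rightarrow> ('r, 'p) module) \<Rightarrow> (nat \<Rightarrow> 'p \<Rightarrow> 'p)
    \<Rightarrow> ('r, 'n, 'y) module_scheme \<Rightarrow> nat \<Rightarrow> ('p \<Rightarrow> 'n) set"
  where "cocycles R P d N n =
    {f \<in> linear_maps R (P n) N. \<forall>x\<in>carrier (P (Suc n)). f (d n x) = \<zero>\<^bsub>N\<^esub>}"

definition coboundaries ::
  "('r, 'x) ring_scheme \<Rightarrow> (nat \<Rightarrow> ('r, 'p) module) \<Rightarrow> (nat \<Rightarrow> 'p \<Rightarrow> 'p)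
    \<Rightarrow> ('r, 'n, 'y) module_scheme \<Rightarrow> nat \<Rightarrow> ('p \<Rightarrow> 'n) set"
  where "coboundaries R P d N n =
    (case n of
       0 \<Rightarrow> {\<one>\<^bsub>hom_group R (P 0) N\<^esub>}
     | Suc m \<Rightarrow> (\<lambda>g. compose (carrier (P n)) g (d m)) ` linear_maps R (P m) N)"

definition ext_class ::
  "('r, 'x) ring_scheme \<Rightarrow> (nat \<Rightarrow> ('r, 'p) module) \<Rightarrow> (nat \<Rightarrow> 'p \<Rightarrow> 'p)
    \<Rightarrow> ('r, 'n, 'y) module_scheme \<Rightarrow> nat \<Rightarrow> ('p \<Rightarrow> 'n) \<Rightarrow> ('p \<Rightarrow> 'n) set"
  where "ext_class R P d N n f = coboundaries R P d N n #>\<^bsub>hom_group R (P n) N\<^esub> f"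

definition Ext ::
  "('r, 'x) ring_scheme \<Rightarrow> (nat \<Rightarrow> ('r, 'p) module) \<Rightarrow> (nat \<Rightarrow> 'p \<Rightarrow> 'p)
    \<Rightarrow> ('r, 'n, 'y) module_scheme \<Rightarrow> nat \<Rightarrow> ('p \<Rightarrow> 'n) set monoid"
  where "Ext R P d N n =
    (hom_group R (P n) N)\<lparr>carrier := cocycles R P d N n\<rparr> Mod coboundaries R P d N n"

text \<open>
  A cocycle \<open>g : P\<^sub>n \<rightarrow> M\<close> lifts to a chain map \<open>G\<^sub>i : P\<^sub>n\<^sub>+\<^sub>i \<rightarrow> P\<^sub>i\<close>, and the Yoneda product of the
  classes of \<open>f : P\<^sub>m \<rightarrow> M\<close> and \<open>g\<close> is the class of \<open>f \<circ> G\<^sub>m\<close>. Putting signs on the differential of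
  the shifted complex changes the product by \<open>(-1)\<^sup>m\<^sup>n\<close>, which gives an isomorphic graded ring.
\<close>

definition chain_lift ::
  "('r, 'x) ring_scheme \<Rightarrow> (nat \<Rightarrow> ('r, 'p) module) \<Rightarrow> (nat \<Rightarrow> 'p \<Rightarrow> 'p) \<Rightarrow> ('p \<Rightarrow> 'm)
    \<Rightarrow> nat \<Rightarrow> ('p \<Rightarrow> 'm) \<Rightarrow> (nat \<Rightarrow> 'p \<Rightarrow> 'p) \<Rightarrow> bool"
  where "chain_lift R P d \<epsilon> n g G \<longleftrightarrow>
    (\<forall>i. G i \<in> linear_maps R (P (n + i)) (P i)) \<and>
    (\<forall>x\<in>carrier (P n). \<epsilon> (G 0 x) = g x) \<and>
    (\<forall>i. \<forall>x\<in>carrier (P (Suc (n + i))). d i (G (Suc i) x) = G i (d (n + i) x))"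

definition yoneda_product ::
  "('r, 'x) ring_scheme \<Rightarrow> (nat \<Rightarrow> ('r, 'p) module) \<Rightarrow> (nat \<Rightarrow> 'p \<Rightarrow> 'p) \<Rightarrow> ('p \<Rightarrow> 'm)
    \<Rightarrow> ('r, 'm, 'y) module_scheme \<Rightarrow> nat \<Rightarrow> nat \<Rightarrow> ('p \<Rightarrow> 'm) set \<Rightarrow> ('p \<Rightarrow> 'm) set \<Rightarrow> ('p \<Rightarrow> 'm) set"
  where "yoneda_product R P d \<epsilon> M m n U V =
    the_elem {ext_class R P d M (n + m) (compose (carrier (P (n + m))) f (G m)) |
                f g G. f \<in> U \<and> g \<in> V \<and> chain_lift R P d \<epsilon> n g G}"

definition Ext_ring ::
  "('r, 'x) ring_scheme \<Rightarrow> (nat \<Rightarrow> ('r, 'p) module) \<Rightarrow> (nat \<Rightarrow> 'p \<Rightarrow> 'p) \<Rightarrow> ('p \<Rightarrow> 'm)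
    \<Rightarrow> ('r, 'm, 'y) module_scheme \<Rightarrow> (nat \<Rightarrow> ('p \<Rightarrow> 'm) set) ring"
  where "Ext_ring R P d \<epsilon> M =
    (let S = sum_group UNIV (Ext R P d M) in
    \<lparr>carrier = carrier S,
     monoid.mult = (\<lambda>a b n. \<Otimes>\<^bsub>Ext R P d M n\<^esub>i\<in>{..n}. yoneda_product R P d \<epsilon> M i (n - i) (a i) (b (n - i))),
     one = (\<lambda>n. if n = 0 then ext_class R P d M 0 \<epsilon> else \<one>\<^bsub>Ext R P d M n\<^esub>),
     ring.zero = \<one>\<^bsub>S\<^esub>,
     add = monoid.mult S\<rparr>)"

definition Ext_component ::
  "('r, 'x) ring_scheme \<Rightarrow> (nat \<Rightarrow> ('r, 'p) module) \<Rightarrow> (nat \<Rightarrow> 'p \<Rightarrow> 'p)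
    \<Rightarrow> ('r, 'm, 'y) module_scheme \<Rightarrow> nat \<Rightarrow> (nat \<Rightarrow> ('p \<Rightarrow> 'm) set) set"
  where "Ext_component R P d M n =
    {a \<in> carrier (sum_group UNIV (Ext R P d M)). \<forall>m. m \<noteq> n \<longrightarrow> a m = \<one>\<^bsub>Ext R P d M m\<^esub>}"


section \<open>Hochschild cohomology\<close>

text \<open>
  In this section \<open>P\<close>, \<open>d\<close>, \<open>\<epsilon>\<close> stand for a projective resolution of \<open>A\<close> over its enveloping
  algebra. The structure map of the \<open>k\<close>-algebra \<open>HH\<^sup>*(A)\<close> sends \<open>c\<close> to the class of \<open>c\<epsilon>\<close>.
\<close>

definition HH ::
  "('a, 'x) ring_scheme \<Rightarrow> ('k::field \<Rightarrow> 'a)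
    \<Rightarrow> (nat \<Rightarrow> ((('a \<times> 'a) \<Rightarrow>\<^sub>0 'k) set, 'p) module) \<Rightarrow> (nat \<Rightarrow> 'p \<Rightarrow> 'p) \<Rightarrow> ('p \<Rightarrow> 'a)
    \<Rightarrow> (nat \<Rightarrow> ('p \<Rightarrow> 'a) set) ring"
  where "HH A \<eta> P d \<epsilon> = Ext_ring (enveloping_algebra A \<eta>) P d \<epsilon> (regular_bimodule A \<eta>)"

definition HH_component ::
  "('a, 'x) ring_scheme \<Rightarrow> ('k::field \<Rightarrow> 'a)
    \<Rightarrow> (nat \<Rightarrow> ((('a \<times> 'a) \<Rightarrow>\<^sub>0 'k) set, 'p) module) \<Rightarrow> (nat \<Rightarrow> 'p \<Rightarrow> 'p) \<Rightarrow> nat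
    \<Rightarrow> (nat \<Rightarrow> ('p \<Rightarrow> 'a) set) set"
  where "HH_component A \<eta> P d = Ext_component (enveloping_algebra A \<eta>) P d (regular_bimodule A \<eta>)"

definition HH_unit ::
  "('a, 'x) ring_scheme \<Rightarrow> ('k::field \<Rightarrow> 'a)
    \<Rightarrow> (nat \<Rightarrow> ((('a \<times> 'a) \<Rightarrow>\<^sub>0 'k) set, 'p) module) \<Rightarrow> (nat \<Rightarrow> 'p \<Rightarrow> 'p) \<Rightarrow> ('p \<Rightarrow> 'a)
    \<Rightarrow> 'k \<Rightarrow> nat \<Rightarrow> ('p \<Rightarrow> 'a) set"
  where "HH_unit A \<eta> P d \<epsilon> c =
    (let R = enveloping_algebra A \<eta>; M = regular_bimodule A \<eta> in
     (\<lambda>n. if n = 0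
          then ext_class R P d M 0 (\<lambda>x\<in>carrier (P 0). enveloping_unit A \<eta> c \<odot>\<^bsub>M\<^esub> \<epsilon> x)
          else \<one>\<^bsub>Ext R P d M n\<^esub>))"


section \<open>The rings and finiteness conditions of the theorem\<close>

text \<open>
  Dimensions over \<open>k\<close> are those of \<^theory>\<open>HOL-Algebra.Embedded_Algebras\<close> with respect to the
  image \<open>K\<close> of \<open>k\<close> in the ring. The library's \<open>dim\<close> only makes sense in the finite-dimensional case.
\<close>

definition has_hilbert_series ::
  "('a, 'x) ring_scheme \<Rightarrow> 'a set \<Rightarrow> (nat \<Rightarrow> 'a set) \<Rightarrow> rat fps \<Rightarrow> bool"
  where "has_hilbert_series H K C s \<longleftrightarrow>
    (\<forall>i. ring.finite_dimension H K (C i)) \<and> Abs_fps (\<lambda>i. of_nat (ring.dim H K (C i))) = s"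

definition fin_gen_algebra :: "('a, 'x) ring_scheme \<Rightarrow> 'a set \<Rightarrow> bool"
  where "fin_gen_algebra H K \<longleftrightarrow>
    (\<exists>F. finite F \<and> F \<subseteq> carrier H \<and> generate_ring H (K \<union> F) = carrier H)"

definition fin_gen_module_over_subring :: "('a, 'x) ring_scheme \<Rightarrow> 'a set \<Rightarrow> bool"
  where "fin_gen_module_over_subring H S \<longleftrightarrow>
    (\<exists>F. finite F \<and> F \<subseteq> carrier H \<and>
      (\<forall>h\<in>carrier H. \<exists>c\<in>F \<rightarrow> S. h = (\<Oplus>\<^bsub>H\<^esub>v\<in>F. c v \<otimes>\<^bsub>H\<^esub> v)))"

definition polynomial_subring_in_two ::
  "('a, 'x) ring_scheme \<Rightarrow> ('k::field \<Rightarrow> 'a) \<Rightarrow> 'a set \<Rightarrow> bool"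
  where "polynomial_subring_in_two H \<eta> S \<longleftrightarrow>
    (\<exists>\<phi>\<in>ring_hom (ring_of_type_algebra :: 'k poly poly ring) H.
       inj \<phi> \<and> range \<phi> = S \<and> (\<forall>c. \<phi> [:[:c:]:] = \<eta> c))"

definition fibre_product ::
  "('a, 'x) ring_scheme \<Rightarrow> ('b, 'y) ring_scheme \<Rightarrow> ('a \<Rightarrow> 'c) \<Rightarrow> ('b \<Rightarrow> 'c) \<Rightarrow> ('a \<times> 'b) ring"
  where "fibre_product R S f g =
    (RDirProd R S)\<lparr>carrier := {(r, s). r \<in> carrier R \<and> s \<in> carrier S \<and> f r = g s}\<rparr>"

definition dual_numbers :: "'k::field poly set ring"
  where "dual_numbers =
    (ring_of_type_algebra :: 'k poly ring) Quot (Idl\<^bsub>ring_of_type_algebra\<^esub> {[:0, 1:] ^ 2})"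

definition dual_numbers_augmentation :: "'k::field poly set \<Rightarrow> 'k"
  where "dual_numbers_augmentation r = the_elem ((\<lambda>p. poly p 0) ` r)"

definition exterior_ideal :: "(letter, 'k::field) free_algebra set"
  where "exterior_ideal =
    (let u1 = gen Letter1; u2 = gen Letter2
     in Idl\<^bsub>free_algebra\<^esub> {u1 * u1, u2 * u2, u1 * u2 + u2 * u1})"

definition exterior_algebra :: "(letter, 'k::field) free_algebra set ring"
  where "exterior_algebra = free_algebra Quot exterior_ideal"

definition exterior_augmentation :: "(letter, 'k::field) free_algebra set \<Rightarrow> 'k"
  where "exterior_augmentation s = the_elem ((\<lambda>f. Poly_Mapping.lookup f 0) ` s)"

definition exterior_component :: "nat \<Rightarrow> (letter, 'k::field) free_algebra set set"
  where "exterior_component n =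
    {exterior_ideal +>\<^bsub>free_algebra\<^esub> f | f. homogeneous n f}"

definition fibre_ring :: "('k::field poly set \<times> (letter, 'k) free_algebra set) ring"
  where "fibre_ring =
    fibre_product dual_numbers exterior_algebra dual_numbers_augmentation exterior_augmentation"

text \<open>The first factor is concentrated in degree \<open>0\<close>.\<close>

definition fibre_component :: "nat \<Rightarrow> ('k::field poly set \<times> (letter, 'k) free_algebra set) set"
  where "fibre_component n =
    {(r, s) \<in> carrier fibre_ring. (n = 0 \<or> r = \<zero>\<^bsub>dual_numbers\<^esub>) \<and> s \<in> exterior_component n}"

definition root_of_unity :: "'k::field \<Rightarrow> bool"
  where "root_of_unity q \<longleftrightarrow> (\<exists>n>0. q ^ n = 1)"

end

theory Submission
  imports Defs
begin

text \<open>
  \<open>\<Lambda>\<close> is a Koszul algebra, so its Koszul bimodule resolution identifies \<open>HH\<^sup>*(\<Lambda>)\<close>, computed from any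
  projective resolution, with the cohomology ring of \<open>\<Lambda> \<otimes> \<Lambda>\<^sup>!\<close> under the graded commutator with
  \<open>xX + yY\<close>, where \<open>YX = qXY\<close> in \<open>\<Lambda>\<^sup>!\<close>. This complex is graded by total multidegree, and each of its
  multihomogeneous parts, spanned by \<open>X\<^sup>iY\<^sup>j\<close>, \<open>xX\<^bsup>i+1\<^esup>Y\<^sup>j\<close>, \<open>yX\<^sup>iY\<^bsup>j+1\<^esup>\<close>, \<open>yxX\<^bsup>i+1\<^esup>Y\<^bsup>j+1\<^esup>\<close>, is governed by the
  two numbers \<open>1 - (-1)\<^bsup>i+j\<^esup>q\<^sup>j\<close> and \<open>q\<^sup>i - (-1)\<^bsup>i+j\<^esup>\<close>: it is exact unless both vanish or \<open>q = 0\<close>. For generic \<open>q\<close>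
  only small degrees survive; if \<open>q\<^sup>N = 1\<close> with \<open>N\<close> even, the two numbers depend on \<open>i\<close> and \<open>j\<close> modulo \<open>N\<close> only,
  which makes the cohomology finite over \<open>k[X\<^sup>N, Y\<^sup>N]\<close>.
\<close>

section \<open>Coordinates on \<open>\<Lambda>\<^sub>q\<close>\<close>

text \<open>The hypothesis supplies an arbitrary projective resolution over a ring whose elements
  are classes of classes, so two translations precede any computation: iterated quotients become
  coordinate records, and classes on the given resolution are compared with classes on the Koszul
  resolution by chain maps that are unique up to homotopy. What remains is the interface
  \<open>HH_model\<close>, in which no resolution occurs. Write p and r for the two numbers of a
  multihomogeneous part. Its maps are (p, r) and q(r, -p). For q nonzero this is a Koszul complex on
  p, r, exact as soon as one of them is nonzero. For q = 0 the second map vanishes, so yx survives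
  in every part with i, j at least 0, and the cohomology spreads over all degrees. At the edges i =
  -1 or j = -1 only one middle term is left, and its coefficient is 1 \<plusminus> q or, up to sign,
  q \<plusminus> 1. If p = r = 0, then q^(2i) = q^(2j) = 1; this isolates i = j = 0 for generic q.
  The resolution and its contraction never divide by q, so all three cases share them.\<close>

text \<open>\<open>Lam a b c e\<close> stands for \<open>a + b x + c y + e yx\<close>.\<close>

datatype 'k lam = Lam (c1: 'k) (cx: 'k) (cy: 'k) (cw: 'k)

instantiation lam :: (ab_group_add) ab_group_add
begin
definition "0 = Lam 0 0 0 0"
definition "u + v = Lam (c1 u + c1 v) (cx u + cx v) (cy u + cy v) (cw u + cw v)"
definition "u - v = Lam (c1 u - c1 v) (cx u - cx v) (cy u - cy v) (cw u - cw v)"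
definition "- u = Lam (- c1 u) (- cx u) (- cy u) (- cw u)"
instance
  by standard (simp_all add: zero_lam_def plus_lam_def minus_lam_def uminus_lam_def lam.expand algebra_simps)
end

lemma lam_simps [simp]:
  "c1 (0 :: 'k::ab_group_add lam) = 0" "cx (0 :: 'k lam) = 0" "cy (0 :: 'k lam) = 0" "cw (0 :: 'k lam) = 0"
  "c1 (u + v) = c1 u + c1 v" "cx (u + v) = cx u + cx v" "cy (u + v) = cy u + cy v" "cw (u + v) = cw u + cw v"
  "c1 (u - v) = c1 u - c1 v" "cx (u - v) = cx u - cx v" "cy (u - v) = cy u - cy v" "cw (u - v) = cw u - cw v"
  "c1 (- u) = - c1 u" "cx (- u) = - cx u" "cy (- u) = - cy u" "cw (- u) = - cw u"
  for u v :: "'k::ab_group_add lam"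
  by (simp_all add: zero_lam_def plus_lam_def minus_lam_def uminus_lam_def)

lemma lam_sum:
  fixes f :: "'i \<Rightarrow> 'k::ab_group_add lam"
  shows "c1 (sum f A) = (\<Sum>i\<in>A. c1 (f i))" "cx (sum f A) = (\<Sum>i\<in>A. cx (f i))"
    "cy (sum f A) = (\<Sum>i\<in>A. cy (f i))" "cw (sum f A) = (\<Sum>i\<in>A. cw (f i))"
  by (induction A rule: infinite_finite_induct) simp_all

lemma lam_eq_iff: "u = v \<longleftrightarrow> c1 u = c1 v \<and> cx u = cx v \<and> cy u = cy v \<and> cw u = cw v"
  by (auto simp: lam.expand)


definition lscale :: "'k::field \<Rightarrow> 'k lam \<Rightarrow> 'k lam"
  where "lscale c u = Lam (c * c1 u) (c * cx u) (c * cy u) (c * cw u)"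

text \<open>The last entry collects y x = yx and x y = -q yx; the squares of x and y and all
  products of degree three or more vanish.\<close>

definition lmul :: "'k::field \<Rightarrow> 'k lam \<Rightarrow> 'k lam \<Rightarrow> 'k lam"
  where "lmul q u v =
    Lam (c1 u * c1 v) (c1 u * cx v + cx u * c1 v) (c1 u * cy v + cy u * c1 v)
      (c1 u * cw v + cw u * c1 v + cy u * cx v - q * cx u * cy v)"

lemma lscale_sel [simp]:
  "c1 (lscale c u) = c * c1 u" "cx (lscale c u) = c * cx u"
  "cy (lscale c u) = c * cy u" "cw (lscale c u) = c * cw u"
  by (simp_all add: lscale_def)

lemma lmul_sel [simp]:
  "c1 (lmul q u v) = c1 u * c1 v" "cx (lmul q u v) = c1 u * cx v + cx u * c1 v"
  "cy (lmul q u v) = c1 u * cy v + cy u * c1 v"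
  "cw (lmul q u v) = c1 u * cw v + cw u * c1 v + cy u * cx v - q * cx u * cy v"
  by (simp_all add: lmul_def)

definition lone :: "'k::field lam" where "lone = Lam 1 0 0 0"
definition lX :: "'k::field lam" where "lX = Lam 0 1 0 0"
definition lY :: "'k::field lam" where "lY = Lam 0 0 1 0"
definition lW :: "'k::field lam" where "lW = Lam 0 0 0 1"

lemma lbasis_sel [simp]:
  "c1 lone = 1" "cx lone = 0" "cy lone = 0" "cw lone = 0"
  "c1 lX = 0" "cx lX = 1" "cy lX = 0" "cw lX = 0"
  "c1 lY = 0" "cx lY = 0" "cy lY = 1" "cw lY = 0"
  "c1 lW = 0" "cx lW = 0" "cy lW = 0" "cw lW = 1"
  by (simp_all add: lone_def lX_def lY_def lW_def)


lemma lmul_assoc: "lmul q (lmul q u v) w = lmul q u (lmul q v w)"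
  by (simp add: lam_eq_iff algebra_simps)

lemma lmul_distrib:
  "lmul q (u + u') v = lmul q u v + lmul q u' v" "lmul q u (v + v') = lmul q u v + lmul q u v'"
  "lmul q (u - u') v = lmul q u v - lmul q u' v" "lmul q u (v - v') = lmul q u v - lmul q u v'"
  "lmul q (- u) v = - lmul q u v" "lmul q u (- v) = - lmul q u v"
  by (simp_all add: lam_eq_iff algebra_simps)

lemma lmul_zero [simp]: "lmul q 0 v = 0" "lmul q u 0 = 0"
  by (simp_all add: lam_eq_iff)

lemma lmul_lone [simp]: "lmul q lone v = v" "lmul q u lone = u"
  by (simp_all add: lam_eq_iff)

lemma lmul_lscale [simp]:
  "lmul q (lscale c u) v = lscale c (lmul q u v)" "lmul q u (lscale c v) = lscale c (lmul q u v)"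
  by (simp_all add: lam_eq_iff algebra_simps)

lemma lmul_sum:
  "lmul q (sum f A) v = (\<Sum>i\<in>A. lmul q (f i) v)" "lmul q u (sum f A) = (\<Sum>i\<in>A. lmul q u (f i))"
  by (induction A rule: infinite_finite_induct) (simp_all add: lmul_distrib)

lemma lam_decomp:
  "u = lscale (c1 u) lone + lscale (cx u) lX + lscale (cy u) lY + lscale (cw u) lW"
  by (simp add: lam_eq_iff)


section \<open>Linear extension to finitely supported functions\<close>

text \<open>The induction removes one support point at a time and stays inside \<open>A\<close>.
  This matters for the pair algebra, where the ring laws are available only for elements of the
  carriers.\<close>

lemma poly_mapping_induct_on [consumes 1, case_names zero single_add]:
  fixes f :: "'a \<Rightarrow>\<^sub>0 'b::ab_group_add"
  assumes "Poly_Mapping.keys f \<subseteq> A" and "P 0"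
    and step: "\<And>f a c. \<lbrakk>Poly_Mapping.keys f \<subseteq> A; a \<in> A; P f\<rbrakk> \<Longrightarrow> P (Poly_Mapping.single a c + f)"
  shows "P f"
  using assms(1)
proof (induction "card (Poly_Mapping.keys f)" arbitrary: f)
  case 0
  then have "f = 0" by simp
  with assms(2) show ?case by simp
next
  case (Suc n)
  then obtain a where a: "a \<in> Poly_Mapping.keys f"
    by (metis card.empty ex_in_conv nat.distinct(1))
  define g where "g = f - Poly_Mapping.single a (Poly_Mapping.lookup f a)"
  have "Poly_Mapping.keys g = Poly_Mapping.keys f - {a}"
    by (auto simp: g_def in_keys_iff lookup_minus lookup_single when_def split: if_splits)
  moreover from this have "n = card (Poly_Mapping.keys g)"
    using Suc.hyps(2) a by simp
  ultimately have "P g" "Poly_Mapping.keys g \<subseteq> A"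
    using Suc.hyps(1)[of g] Suc.prems by blast+
  moreover have "f = Poly_Mapping.single a (Poly_Mapping.lookup f a) + g"
    by (simp add: g_def)
  ultimately show ?case
    using step a Suc.prems by (metis subsetD)
qed

lemma poly_mapping_induct [case_names zero single_add]:
  fixes f :: "'a \<Rightarrow>\<^sub>0 'b::ab_group_add"
  assumes "P 0" and "\<And>f a c. P f \<Longrightarrow> P (Poly_Mapping.single a c + f)"
  shows "P f"
  by (rule poly_mapping_induct_on [of f UNIV]) (use assms in auto)

text \<open>Kept over an abstract scalar multiplication because it is interpreted twice: with
  \<open>lscale\<close> for evaluating words in \<Lambda>, and with \<open>llscale\<close> for
  evaluating formal sums of pairs in \<Lambda> \<otimes> \<Lambda>.\<close>

locale linear_ext = vector_space scale
  for scale :: "'a::field \<Rightarrow> 'b::ab_group_add \<Rightarrow> 'b" (infixr \<open>*s\<close> 75)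
begin

definition lext :: "('i \<Rightarrow> 'b) \<Rightarrow> ('i \<Rightarrow>\<^sub>0 'a) \<Rightarrow> 'b"
  where "lext \<phi> f = (\<Sum>p\<in>Poly_Mapping.keys f. Poly_Mapping.lookup f p *s \<phi> p)"

lemma lext_eq:
  fixes f :: "'i \<Rightarrow>\<^sub>0 'a"
  assumes "finite A" "Poly_Mapping.keys f \<subseteq> A"
  shows "lext \<phi> f = (\<Sum>p\<in>A. Poly_Mapping.lookup f p *s \<phi> p)"
  unfolding lext_def using assms
  by (intro sum.mono_neutral_left) (auto simp: in_keys_iff)

lemma lext_add: "lext \<phi> (f + g) = lext \<phi> f + lext \<phi> g"
proof -
  let ?A = "Poly_Mapping.keys f \<union> Poly_Mapping.keys g"
  have "lext \<phi> (f + g) = (\<Sum>p\<in>?A. Poly_Mapping.lookup (f + g) p *s \<phi> p)"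
    using Poly_Mapping.keys_add[of f g] by (intro lext_eq) auto
  also have "\<dots> = (\<Sum>p\<in>?A. Poly_Mapping.lookup f p *s \<phi> p) + (\<Sum>p\<in>?A. Poly_Mapping.lookup g p *s \<phi> p)"
    by (simp add: lookup_add scale_left_distrib sum.distrib)
  finally show ?thesis
    by (simp add: lext_eq[of ?A f] lext_eq[of ?A g])
qed

lemma lext_zero [simp]: "lext \<phi> 0 = 0"
  by (simp add: lext_def)

lemma lext_single [simp]: "lext \<phi> (Poly_Mapping.single a c) = c *s \<phi> a"
  by (simp add: lext_def)

lemma lext_uminus: "lext \<phi> (- f) = - lext \<phi> f"
  using lext_add[of \<phi> f "- f"] by (simp add: eq_neg_iff_add_eq_0 add.commute)

lemma lext_diff: "lext \<phi> (f - g) = lext \<phi> f - lext \<phi> g"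
  using lext_add[of \<phi> f "- g"] by (simp add: lext_uminus)

end


interpretation lam: linear_ext lscale
  by standard (simp_all add: lam_eq_iff algebra_simps)


section \<open>The quotient of the free algebra\<close>

definition letter_lam :: "letter \<Rightarrow> 'k::field lam"
  where "letter_lam g = (case g of Letter1 \<Rightarrow> lX | Letter2 \<Rightarrow> lY)"

fun list_lam :: "'k::field \<Rightarrow> letter list \<Rightarrow> 'k lam"
  where
    "list_lam q [] = lone"
  | "list_lam q (g # w) = lmul q (letter_lam g) (list_lam q w)"

lemma list_lam_append: "list_lam q (u @ v) = lmul q (list_lam q u) (list_lam q v)"
  by (induction u) (simp_all add: lmul_assoc)

definition ev :: "'k::field \<Rightarrow> (letter, 'k) free_algebra \<Rightarrow> 'k lam"
  where "ev q = lam.lext (\<lambda>w. list_lam q (letters w))"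

lemma ev_add: "ev q (f + g) = ev q f + ev q g"
  and ev_diff: "ev q (f - g) = ev q f - ev q g"
  and ev_uminus: "ev q (- f) = - ev q f"
  and ev_zero [simp]: "ev q 0 = 0"
  and ev_single: "ev q (Poly_Mapping.single w c) = lscale c (list_lam q (letters w))"
  by (simp_all add: ev_def lam.lext_add lam.lext_diff lam.lext_uminus)

lemma ev_mult: "ev q (f * g) = lmul q (ev q f) (ev q g)"
proof (induction f rule: poly_mapping_induct)
  case (single_add f a c)
  have "ev q (Poly_Mapping.single a c * g) = lmul q (ev q (Poly_Mapping.single a c)) (ev q g)"
  proof (induction g rule: poly_mapping_induct)
    case (single_add g b e)
    then show ?case
      by (simp add: distrib_left ev_add mult_single ev_single plus_word_def list_lam_append lmul_distrib)
  qed simp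
  with single_add show ?case
    by (simp add: distrib_right ev_add lmul_distrib)
qed simp

lemma ev_const [simp]: "ev q (const c) = lscale c lone"
  by (simp add: const_def ev_single zero_word_def)

lemma ev_gen [simp]: "ev q (gen Letter1) = lX" "ev q (gen Letter2) = lY"
  by (simp_all add: gen_def ev_single letter_lam_def)

lemma ev_one [simp]: "ev q 1 = lone"
  using ev_const[of q 1] by (simp add: const_def del: ev_const)

lemma const_add: "const (a + b) = const a + const b"
  and const_mult: "const (a * b) = const a * const b"
  and const_uminus: "const (- a) = - const a"
  and const_zero [simp]: "const 0 = 0" and const_one [simp]: "const 1 = 1"
  by (simp_all add: const_def single_add single_diff single_uminus mult_single)

lemma const_commute: "const c * f = f * const c"
proof (induction f rule: poly_mapping_induct)
  case (single_add f a e)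
  have "const c * Poly_Mapping.single a e = Poly_Mapping.single a e * const c"
    by (simp add: const_def mult_single mult.commute)
  with single_add show ?case
    by (simp add: distrib_left distrib_right)
qed simp

text \<open>A linear section of \<open>ev q\<close> with values in the span of the words 1, x, y,
  yx. It does not depend on q; the parameter enters only through products.\<close>

definition nf :: "'k::field lam \<Rightarrow> (letter, 'k) free_algebra"
  where "nf u = const (c1 u) + const (cx u) * gen Letter1 + const (cy u) * gen Letter2
    + const (cw u) * (gen Letter2 * gen Letter1)"

lemma ev_nf [simp]: "ev q (nf u) = u"
  by (simp add: nf_def ev_add ev_mult lam_eq_iff)

lemma nf_add: "nf (u + v) = nf u + nf v"
  by (simp add: nf_def const_add algebra_simps)

lemma nf_lscale: "nf (lscale c u) = const c * nf u"
  by (simp add: nf_def const_mult algebra_simps)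

lemma ring_free_algebra: "ring (free_algebra :: ('g, 'k::field) free_algebra ring)"
proof -
  have "\<exists>y. x + y = 0" for x :: "('g, 'k::field) free_algebra"
    using add.right_inverse by blast
  then show ?thesis
    unfolding ring_of_type_algebra_def
    by unfold_locales (auto simp: algebra_simps Units_def intro: exI[of _ "- x" for x])
qed

lemma free_algebra_sel [simp]:
  "carrier (free_algebra :: ('g, 'k::field) free_algebra ring) = UNIV"
  "f \<otimes>\<^bsub>free_algebra\<^esub> g = f * g" "f \<oplus>\<^bsub>free_algebra\<^esub> g = f + g"
  "\<zero>\<^bsub>free_algebra :: ('g, 'k::field) free_algebra ring\<^esub> = 0"
  "\<one>\<^bsub>free_algebra :: ('g, 'k::field) free_algebra ring\<^esub> = 1"
  for f g :: "('g, 'k::field) free_algebra"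
  by (simp_all add: ring_of_type_algebra_def)

lemma free_algebra_a_inv [simp]: "\<ominus>\<^bsub>free_algebra\<^esub> f = - f"
  for f :: "('g, 'k::field) free_algebra"
proof -
  interpret ring "free_algebra :: ('g, 'k) free_algebra ring" by (rule ring_free_algebra)
  show ?thesis
    by (rule minus_equality) simp_all
qed

lemma Lambda_ideal_ideal: "ideal (Lambda_ideal q) free_algebra"
  unfolding Lambda_ideal_def Let_def
  by (intro ring.genideal_ideal ring_free_algebra) simp

lemma ideal_ev_kernel: "ideal {f. ev q f = 0} free_algebra"
proof (rule idealI)
  show "subgroup {f. ev q f = 0} (add_monoid free_algebra)"
  proof
    fix f assume "f \<in> {f. ev q f = 0}"
    then have "\<ominus>\<^bsub>free_algebra\<^esub> f \<in> {f. ev q f = 0}"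
      by (simp add: ev_uminus)
    then show "inv\<^bsub>add_monoid free_algebra\<^esub> f \<in> {f. ev q f = 0}"
      by (simp add: a_inv_def)
  qed (simp_all add: ev_add)
qed (simp_all add: ring_free_algebra ev_mult)

lemma Lambda_ideal_closed:
  "0 \<in> Lambda_ideal q"
  "f \<in> Lambda_ideal q \<Longrightarrow> g \<in> Lambda_ideal q \<Longrightarrow> f + g \<in> Lambda_ideal q"
  "f \<in> Lambda_ideal q \<Longrightarrow> - f \<in> Lambda_ideal q"
  "f \<in> Lambda_ideal q \<Longrightarrow> h * f \<in> Lambda_ideal q"
  "f \<in> Lambda_ideal q \<Longrightarrow> f * h \<in> Lambda_ideal q"
proof -
  interpret ideal "Lambda_ideal q" free_algebra by (rule Lambda_ideal_ideal)
  show "0 \<in> Lambda_ideal q" using additive_subgroup.zero_closed[OF is_additive_subgroup] by simp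
  show "f \<in> Lambda_ideal q \<Longrightarrow> g \<in> Lambda_ideal q \<Longrightarrow> f + g \<in> Lambda_ideal q"
    using additive_subgroup.a_closed[OF is_additive_subgroup, of f g] by simp
  show "f \<in> Lambda_ideal q \<Longrightarrow> - f \<in> Lambda_ideal q"
    using additive_subgroup.a_inv_closed[OF is_additive_subgroup, of f] by simp
  show "f \<in> Lambda_ideal q \<Longrightarrow> h * f \<in> Lambda_ideal q"
    using I_l_closed[of f h] by simp
  show "f \<in> Lambda_ideal q \<Longrightarrow> f * h \<in> Lambda_ideal q"
    using I_r_closed[of f h] by simp
qed

lemma Lambda_ideal_gens:
  "gen Letter1 * gen Letter1 \<in> Lambda_ideal q"
  "gen Letter1 * gen Letter2 + const q * gen Letter2 * gen Letter1 \<in> Lambda_ideal q"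
  "gen Letter2 * gen Letter2 \<in> Lambda_ideal q"
  using ring.genideal_self[OF ring_free_algebra,
      of "{gen Letter1 * gen Letter1, gen Letter1 * gen Letter2 + const q * gen Letter2 * gen Letter1,
           gen Letter2 * gen Letter2}"]
  unfolding Lambda_ideal_def Let_def by auto

text \<open>The rewriting step behind the normal form: a letter in front of a normal form produces
  x^2, y^2 or xy, and each of these is reduced by one of the three relations. Left multiplication
  suffices, since words are read from the left in \<open>list_lam\<close>.\<close>

lemma gen_mult_nf:
  fixes q :: "'k::field"
  shows "gen g * nf u - nf (lmul q (letter_lam g) u) \<in> Lambda_ideal q"
proof (cases g)
  case Letter1
  define x where "x = (gen Letter1 :: (letter, 'k) free_algebra)"
  define y where "y = (gen Letter2 :: (letter, 'k) free_algebra)"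
  define r where "r = x * y + const q * y * x"
  \<comment> \<open>The last two terms come from x(yx) = rx - q y x^2, where r = xy + qyx is the
    mixed relation.\<close>
  have "gen g * nf u - nf (lmul q (letter_lam g) u) =
      const (cx u) * (x * x) + const (cy u) * r + const (cw u) * (r * x)
        + - (const (cw u) * const q * y * (x * x))"
    by (simp add: nf_def Letter1 x_def[symmetric] y_def[symmetric] r_def letter_lam_def
        const_mult const_uminus algebra_simps const_commute[of _ x, symmetric])
       (simp add: mult.assoc[symmetric] const_commute[of _ x, symmetric]
         const_commute[of q "const (cy u)"])
  moreover have "x * x \<in> Lambda_ideal q" "r \<in> Lambda_ideal q"
    using Lambda_ideal_gens by (simp_all add: x_def y_def r_def)
  ultimately show ?thesis
    by (simp only: Lambda_ideal_closed)
next
  case Letter2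
  define x where "x = (gen Letter1 :: (letter, 'k) free_algebra)"
  define y where "y = (gen Letter2 :: (letter, 'k) free_algebra)"
  have "gen g * nf u - nf (lmul q (letter_lam g) u) =
      const (cy u) * (y * y) + const (cw u) * (y * y * x)"
    by (simp add: nf_def Letter2 x_def[symmetric] y_def[symmetric] letter_lam_def
        const_mult const_uminus algebra_simps)
       (simp add: mult.assoc[symmetric] const_commute[of _ y, symmetric])
  moreover have "y * y \<in> Lambda_ideal q"
    using Lambda_ideal_gens by (simp add: y_def)
  ultimately show ?thesis
    by (simp add: Lambda_ideal_closed)
qed

lemma word_nf: "Poly_Mapping.single (Word w) 1 - nf (list_lam q w) \<in> Lambda_ideal q"
proof (induction w)
  case Nil
  show ?case
    by (simp add: nf_def Lambda_ideal_closed flip: zero_word_def)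
next
  case (Cons g w)
  have "Poly_Mapping.single (Word (g # w)) 1 - nf (list_lam q (g # w)) =
      gen g * (Poly_Mapping.single (Word w) 1 - nf (list_lam q w)) +
      (gen g * nf (list_lam q w) - nf (lmul q (letter_lam g) (list_lam q w)))"
    by (simp add: gen_def mult_single plus_word_def algebra_simps)
  then show ?case
    by (simp only: Lambda_ideal_closed Cons gen_mult_nf)
qed

lemma diff_nf_ev: "f - nf (ev q f) \<in> Lambda_ideal q"
proof (induction f rule: poly_mapping_induct)
  case zero
  have "nf (0 :: 'a lam) = 0" by (simp add: nf_def)
  then show ?case by (simp add: Lambda_ideal_closed)
next
  case (single_add f a c)
  obtain w where a: "a = Word w" by (cases a)
  have "Poly_Mapping.single a c + f - nf (ev q (Poly_Mapping.single a c + f)) =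
      const c * (Poly_Mapping.single (Word w) 1 - nf (list_lam q w)) + (f - nf (ev q f))"
    by (simp add: a ev_add nf_add nf_lscale ev_single const_def mult_single algebra_simps)
  then show ?case
    by (simp only: Lambda_ideal_closed word_nf single_add)
qed

text \<open>One inclusion is minimality of the generated ideal. For the other, f is congruent to
  \<open>nf (ev q f)\<close>, which is 0 when f evaluates to 0. Together with surjectivity of
  \<open>ev q\<close> this says that 1, x, y, yx form a basis of the quotient, for every q.\<close>

lemma Lambda_ideal_eq: "Lambda_ideal q = {f. ev q f = 0}"
proof
  have "{gen Letter1 * gen Letter1, gen Letter1 * gen Letter2 + const q * gen Letter2 * gen Letter1,
        gen Letter2 * gen Letter2} \<subseteq> {f. ev q f = 0}"
    by (simp add: ev_add ev_mult lam_eq_iff)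
  then show "Lambda_ideal q \<subseteq> {f. ev q f = 0}"
    unfolding Lambda_ideal_def Let_def
    by (rule ring.genideal_minimal[OF ring_free_algebra ideal_ev_kernel])
  show "{f. ev q f = 0} \<subseteq> Lambda_ideal q"
  proof
    fix f assume "f \<in> {f. ev q f = 0}"
    then show "f \<in> Lambda_ideal q"
      using diff_nf_ev[of f q] by (simp add: nf_def)
  qed
qed

section \<open>Residue classes of the free algebra and their coordinates\<close>

definition cls :: "'k::field \<Rightarrow> (letter, 'k) free_algebra \<Rightarrow> (letter, 'k) free_algebra set"
  where "cls q f = Lambda_ideal q +>\<^bsub>free_algebra\<^esub> f"

lemma cls_eq: "cls q f = {g. ev q g = ev q f}"
proof -
  have "g \<in> cls q f \<longleftrightarrow> (\<exists>h. ev q h = 0 \<and> g = h + f)" for g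
    unfolding cls_def a_r_coset_def r_coset_def Lambda_ideal_eq by auto
  then have "g \<in> cls q f \<longleftrightarrow> ev q g = ev q f" for g
    by (metis (no_types, lifting) add_0 diff_add_cancel ev_add ev_diff eq_iff_diff_eq_0)
  then show ?thesis by blast
qed

lemma cls_eq_iff [simp]: "cls q f = cls q g \<longleftrightarrow> ev q f = ev q g"
  by (auto simp: cls_eq)

definition lam_of :: "'k::field \<Rightarrow> (letter, 'k) free_algebra set \<Rightarrow> 'k lam"
  where "lam_of q S = the_elem (ev q ` S)"

definition of_lam :: "'k::field \<Rightarrow> 'k lam \<Rightarrow> (letter, 'k) free_algebra set"
  where "of_lam q u = cls q (nf u)"

lemma lam_of_cls [simp]: "lam_of q (cls q f) = ev q f"
proof -
  have "ev q ` cls q f = {ev q f}"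
    by (auto simp: cls_eq)
  then show ?thesis by (simp add: lam_of_def)
qed

lemma carrier_Lambda: "carrier (Lambda q) = range (cls q)"
  unfolding Lambda_def FactRing_def A_RCOSETS_def RCOSETS_def cls_def a_r_coset_def by auto

lemma ring_Lambda: "ring (Lambda q)"
  unfolding Lambda_def by (rule ideal.quotient_is_ring[OF Lambda_ideal_ideal])

lemma cls_hom:
  "cls q f \<otimes>\<^bsub>Lambda q\<^esub> cls q g = cls q (f * g)"
  "cls q f \<oplus>\<^bsub>Lambda q\<^esub> cls q g = cls q (f + g)"
  "\<one>\<^bsub>Lambda q\<^esub> = cls q 1" "\<zero>\<^bsub>Lambda q\<^esub> = cls q 0"
  using ring_hom_memE(2-4)[OF ideal.rcos_ring_hom[OF Lambda_ideal_ideal[of q]]]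
    ring_hom_zero[OF ideal.rcos_ring_hom[OF Lambda_ideal_ideal[of q]] ring_free_algebra
      ideal.quotient_is_ring[OF Lambda_ideal_ideal[of q]]]
  unfolding Lambda_def cls_def by simp_all

lemma lam_of_of_lam [simp]: "lam_of q (of_lam q u) = u"
  by (simp add: of_lam_def)

lemma of_lam_carrier [simp]: "of_lam q u \<in> carrier (Lambda q)"
  unfolding of_lam_def carrier_Lambda by (rule rangeI)

lemma of_lam_lam_of [simp]: "a \<in> carrier (Lambda q) \<Longrightarrow> of_lam q (lam_of q a) = a"
  by (clarsimp simp: carrier_Lambda of_lam_def)

lemma lam_of_inj: "a \<in> carrier (Lambda q) \<Longrightarrow> b \<in> carrier (Lambda q) \<Longrightarrow> lam_of q a = lam_of q b \<Longrightarrow> a = b"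
  by (metis of_lam_lam_of)

lemma lam_of_hom:
  "a \<in> carrier (Lambda q) \<Longrightarrow> b \<in> carrier (Lambda q) \<Longrightarrow> lam_of q (a \<otimes>\<^bsub>Lambda q\<^esub> b) = lmul q (lam_of q a) (lam_of q b)"
  "a \<in> carrier (Lambda q) \<Longrightarrow> b \<in> carrier (Lambda q) \<Longrightarrow> lam_of q (a \<oplus>\<^bsub>Lambda q\<^esub> b) = lam_of q a + lam_of q b"
  "lam_of q \<one>\<^bsub>Lambda q\<^esub> = lone" "lam_of q \<zero>\<^bsub>Lambda q\<^esub> = 0"
  by (auto simp: carrier_Lambda cls_hom ev_mult ev_add)

lemma of_lam_hom:
  "of_lam q u \<otimes>\<^bsub>Lambda q\<^esub> of_lam q v = of_lam q (lmul q u v)"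
  "of_lam q u \<oplus>\<^bsub>Lambda q\<^esub> of_lam q v = of_lam q (u + v)"
  "\<one>\<^bsub>Lambda q\<^esub> = of_lam q lone" "\<zero>\<^bsub>Lambda q\<^esub> = of_lam q 0"
  by (simp_all add: of_lam_def cls_hom ev_mult ev_add)

lemma Lambda_unit_eq: "Lambda_unit q c = of_lam q (lscale c lone)"
  unfolding Lambda_unit_def cls_def[symmetric] of_lam_def by simp

lemma lam_of_finsum:
  assumes "finite A" "f \<in> A \<rightarrow> carrier (Lambda q)"
  shows "lam_of q (\<Oplus>\<^bsub>Lambda q\<^esub>i\<in>A. f i) = (\<Sum>i\<in>A. lam_of q (f i))"
  using assms
proof (induction A)
  case empty
  interpret ring "Lambda q" by (rule ring_Lambda)
  show ?case by (simp add: lam_of_hom)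
next
  case (insert i A)
  interpret ring "Lambda q" by (rule ring_Lambda)
  from insert show ?case by (simp add: lam_of_hom Pi_iff)
qed


section \<open>The ring structure on the pair algebra\<close>

definition pair_mult :: "('a, 'x) ring_scheme \<Rightarrow> ('b, 'y) ring_scheme \<Rightarrow> (('a \<times> 'b) \<Rightarrow>\<^sub>0 'k::field)
    \<Rightarrow> (('a \<times> 'b) \<Rightarrow>\<^sub>0 'k) \<Rightarrow> (('a \<times> 'b) \<Rightarrow>\<^sub>0 'k)"
  where "pair_mult A B f g = (\<Sum>p\<in>Poly_Mapping.keys f. \<Sum>p'\<in>Poly_Mapping.keys g.
    Poly_Mapping.single (fst p \<otimes>\<^bsub>A\<^esub> fst p', snd p \<otimes>\<^bsub>B\<^esub> snd p')
      (Poly_Mapping.lookup f p * Poly_Mapping.lookup g p'))"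

lemma pair_algebra_sel [simp]:
  "carrier (pair_algebra A B) = {f. Poly_Mapping.keys f \<subseteq> carrier A \<times> carrier B}"
  "f \<otimes>\<^bsub>pair_algebra A B\<^esub> g = pair_mult A B f g"
  "f \<oplus>\<^bsub>pair_algebra A B\<^esub> g = f + g"
  "\<zero>\<^bsub>pair_algebra A B\<^esub> = 0"
  "\<one>\<^bsub>pair_algebra A B\<^esub> = Poly_Mapping.single (\<one>\<^bsub>A\<^esub>, \<one>\<^bsub>B\<^esub>) 1"
  by (simp_all add: pair_algebra_def pair_mult_def split_def)

lemma pair_mult_eq:
  assumes "finite S" "Poly_Mapping.keys f \<subseteq> S" "finite T" "Poly_Mapping.keys g \<subseteq> T"
  shows "pair_mult A B f g = (\<Sum>p\<in>S. \<Sum>p'\<in>T.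
    Poly_Mapping.single (fst p \<otimes>\<^bsub>A\<^esub> fst p', snd p \<otimes>\<^bsub>B\<^esub> snd p')
      (Poly_Mapping.lookup f p * Poly_Mapping.lookup g p'))"
proof -
  let ?h = "\<lambda>p p'. Poly_Mapping.single (fst p \<otimes>\<^bsub>A\<^esub> fst p', snd p \<otimes>\<^bsub>B\<^esub> snd p')
      (Poly_Mapping.lookup f p * Poly_Mapping.lookup g p')"
  have "pair_mult A B f g = (\<Sum>p\<in>Poly_Mapping.keys f. \<Sum>p'\<in>T. ?h p p')"
    unfolding pair_mult_def using assms
    by (intro sum.cong refl sum.mono_neutral_left) (auto simp: in_keys_iff)
  also have "\<dots> = (\<Sum>p\<in>S. \<Sum>p'\<in>T. ?h p p')"
    using assms by (intro sum.mono_neutral_left) (auto simp: in_keys_iff)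
  finally show ?thesis .
qed

lemma pair_mult_zero [simp]: "pair_mult A B 0 g = 0" "pair_mult A B f 0 = 0"
  by (simp_all add: pair_mult_def)

lemma pair_mult_add:
  "pair_mult A B (f + f') g = pair_mult A B f g + pair_mult A B f' g"
  "pair_mult A B f (g + g') = pair_mult A B f g + pair_mult A B f g'"
proof -
  let ?F = "Poly_Mapping.keys f \<union> Poly_Mapping.keys f'"
  let ?G = "Poly_Mapping.keys g \<union> Poly_Mapping.keys g'"
  have F: "Poly_Mapping.keys (f + f') \<subseteq> ?F" and G: "Poly_Mapping.keys (g + g') \<subseteq> ?G"
    by (rule Poly_Mapping.keys_add)+
  show "pair_mult A B (f + f') g = pair_mult A B f g + pair_mult A B f' g"
    using F pair_mult_eq[of ?F _ ?G g A B]
    by (simp add: lookup_add distrib_right single_add sum.distrib)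
  show "pair_mult A B f (g + g') = pair_mult A B f g + pair_mult A B f g'"
    using G pair_mult_eq[of ?F f ?G _ A B]
    by (simp add: lookup_add distrib_left single_add sum.distrib)
qed

lemma pair_mult_single:
  "pair_mult A B (Poly_Mapping.single p c) (Poly_Mapping.single p' c') =
    Poly_Mapping.single (fst p \<otimes>\<^bsub>A\<^esub> fst p', snd p \<otimes>\<^bsub>B\<^esub> snd p') (c * c')"
  by (simp add: pair_mult_def)

text \<open>Multiplication is biadditive, so every law reduces to single pairs by nested inductions
  on the supports. On single pairs it is the corresponding law of A and of B, valid because the
  inductions never leave the carriers.\<close>

lemma ring_pair_algebra:
  assumes "ring A" "ring B"
  shows "ring (pair_algebra A B :: (('a \<times> 'b) \<Rightarrow>\<^sub>0 'k::field) ring)"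
proof -
  interpret A: ring A by fact
  interpret B: ring B by fact
  let ?C = "carrier A \<times> carrier B"
  have add: "Poly_Mapping.keys (f + g) \<subseteq> ?C"
    if "Poly_Mapping.keys f \<subseteq> ?C" "Poly_Mapping.keys g \<subseteq> ?C" for f g :: "('a \<times> 'b) \<Rightarrow>\<^sub>0 'k"
    using Poly_Mapping.keys_add[of f g] that by blast
  have closed: "Poly_Mapping.keys (pair_mult A B f g) \<subseteq> ?C"
    if f: "Poly_Mapping.keys f \<subseteq> ?C" and g: "Poly_Mapping.keys g \<subseteq> ?C" for f g :: "('a \<times> 'b) \<Rightarrow>\<^sub>0 'k"
    using f
  proof (induction rule: poly_mapping_induct_on)
    case (single_add f p c)
    have "Poly_Mapping.keys (pair_mult A B (Poly_Mapping.single p c) g) \<subseteq> ?C"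
      using g
    proof (induction rule: poly_mapping_induct_on)
      case (single_add g p' c')
      with \<open>p \<in> ?C\<close> show ?case
        unfolding pair_mult_add by (intro add) (auto simp: pair_mult_single)
    qed simp
    with single_add show ?case
      unfolding pair_mult_add by (intro add) auto
  qed simp
  have assoc: "pair_mult A B (pair_mult A B f g) h = pair_mult A B f (pair_mult A B g h)"
    if f: "Poly_Mapping.keys f \<subseteq> ?C" and g: "Poly_Mapping.keys g \<subseteq> ?C" and h: "Poly_Mapping.keys h \<subseteq> ?C"
    for f g h :: "('a \<times> 'b) \<Rightarrow>\<^sub>0 'k"
    using f
  proof (induction rule: poly_mapping_induct_on)
    case (single_add f p c)
    note p = single_add(2)
    have "pair_mult A B (pair_mult A B (Poly_Mapping.single p c) g) h =
        pair_mult A B (Poly_Mapping.single p c) (pair_mult A B g h)"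
      using g
    proof (induction rule: poly_mapping_induct_on)
      case (single_add g p' c')
      note p' = single_add(2)
      have "pair_mult A B (pair_mult A B (Poly_Mapping.single p c) (Poly_Mapping.single p' c')) h =
          pair_mult A B (Poly_Mapping.single p c) (pair_mult A B (Poly_Mapping.single p' c') h)"
        using h
      proof (induction rule: poly_mapping_induct_on)
        case (single_add h p'' c'')
        with p p' show ?case
          by (auto simp: pair_mult_add pair_mult_single A.m_assoc B.m_assoc mult.assoc)
      qed simp
      with single_add show ?case by (simp add: pair_mult_add)
    qed simp
    with single_add show ?case by (simp add: pair_mult_add)
  qed simp
  have one: "pair_mult A B (Poly_Mapping.single (\<one>\<^bsub>A\<^esub>, \<one>\<^bsub>B\<^esub>) 1) f = f"
    "pair_mult A B f (Poly_Mapping.single (\<one>\<^bsub>A\<^esub>, \<one>\<^bsub>B\<^esub>) 1) = f"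
    if "Poly_Mapping.keys f \<subseteq> ?C" for f :: "('a \<times> 'b) \<Rightarrow>\<^sub>0 'k"
    using that
    by (induction rule: poly_mapping_induct_on) (auto simp: pair_mult_add pair_mult_single)
  show ?thesis
  proof (intro ringI abelian_groupI monoidI)
    fix f :: "('a \<times> 'b) \<Rightarrow>\<^sub>0 'k" assume "f \<in> carrier (pair_algebra A B)"
    then show "\<exists>g\<in>carrier (pair_algebra A B). g \<oplus>\<^bsub>pair_algebra A B\<^esub> f = \<zero>\<^bsub>pair_algebra A B\<^esub>"
      by (intro bexI[of _ "- f"]) simp_all
  qed (use add closed assoc one in \<open>auto simp: pair_mult_add add.assoc add.commute\<close>)
qed


section \<open>Coordinates on the enveloping algebra\<close>

text \<open>
  \<open>\<Lambda> \<otimes> \<Lambda>\<close> is encoded as \<open>'k lam lam\<close>: the outer coordinates belong to the factor acting from the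
  left on bimodules, the inner ones to the factor acting from the right.
\<close>

definition llscale :: "'k::field \<Rightarrow> 'k lam lam \<Rightarrow> 'k lam lam"
  where "llscale c U = Lam (lscale c (c1 U)) (lscale c (cx U)) (lscale c (cy U)) (lscale c (cw U))"

lemma llscale_sel [simp]:
  "c1 (llscale c U) = lscale c (c1 U)" "cx (llscale c U) = lscale c (cx U)"
  "cy (llscale c U) = lscale c (cy U)" "cw (llscale c U) = lscale c (cw U)"
  by (simp_all add: llscale_def)

interpretation ll: linear_ext llscale
  by standard (simp_all add: lam_eq_iff algebra_simps)

definition tens :: "'k::field lam \<Rightarrow> 'k lam \<Rightarrow> 'k lam lam"
  where "tens u v = Lam (lscale (c1 u) v) (lscale (cx u) v) (lscale (cy u) v) (lscale (cw u) v)"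

lemma tens_sel [simp]:
  "c1 (tens u v) = lscale (c1 u) v" "cx (tens u v) = lscale (cx u) v"
  "cy (tens u v) = lscale (cy u) v" "cw (tens u v) = lscale (cw u) v"
  by (simp_all add: tens_def)

text \<open>The bilinear extension of (u \<otimes> v)(u' \<otimes> v') = uu' \<otimes> v'v. The
  inner coordinates are multiplied in reverse order because they act from the right.\<close>

definition llmul :: "'k::field \<Rightarrow> 'k lam lam \<Rightarrow> 'k lam lam \<Rightarrow> 'k lam lam"
  where "llmul q U V = Lam (lmul q (c1 V) (c1 U))
    (lmul q (cx V) (c1 U) + lmul q (c1 V) (cx U))
    (lmul q (cy V) (c1 U) + lmul q (c1 V) (cy U))
    (lmul q (cw V) (c1 U) + lmul q (c1 V) (cw U) + lmul q (cx V) (cy U) - lscale q (lmul q (cy V) (cx U)))"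

lemma llmul_sel [simp]:
  "c1 (llmul q U V) = lmul q (c1 V) (c1 U)"
  "cx (llmul q U V) = lmul q (cx V) (c1 U) + lmul q (c1 V) (cx U)"
  "cy (llmul q U V) = lmul q (cy V) (c1 U) + lmul q (c1 V) (cy U)"
  "cw (llmul q U V) =
    lmul q (cw V) (c1 U) + lmul q (c1 V) (cw U) + lmul q (cx V) (cy U) - lscale q (lmul q (cy V) (cx U))"
  by (simp_all add: llmul_def)

text \<open>The bilinear extension of (u \<otimes> v)m = umv, expanded along the outer basis 1, x,
  y, yx.\<close>

definition act :: "'k::field \<Rightarrow> 'k lam lam \<Rightarrow> 'k lam \<Rightarrow> 'k lam"
  where "act q U m = lmul q m (c1 U) + lmul q lX (lmul q m (cx U)) + lmul q lY (lmul q m (cy U))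
    + lmul q lW (lmul q m (cw U))"

lemma llmul_add:
  "llmul q (U + U') V = llmul q U V + llmul q U' V" "llmul q U (V + V') = llmul q U V + llmul q U V'"
  by (simp_all add: lam_eq_iff [of "llmul _ _ _"] lmul_distrib lam.scale_right_distrib)

lemma llmul_llscale:
  "llmul q (llscale c U) V = llscale c (llmul q U V)" "llmul q U (llscale c V) = llscale c (llmul q U V)"
  by (simp_all add: lam_eq_iff algebra_simps)

lemma llmul_zero [simp]: "llmul q 0 V = 0" "llmul q U 0 = 0"
  by (simp_all add: lam_eq_iff [of "llmul _ _ _"])

lemma llmul_tens: "llmul q (tens u v) (tens u' v') = tens (lmul q u u') (lmul q v' v)"
  by (simp add: lam_eq_iff algebra_simps)

lemma act_add: "act q (U + V) m = act q U m + act q V m" "act q U (m + n) = act q U m + act q U n"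
  by (simp_all add: act_def lmul_distrib)

lemma act_llscale: "act q (llscale c U) m = lscale c (act q U m)"
  by (simp add: act_def lam.scale_right_distrib)

lemma act_zero [simp]: "act q 0 m = 0" "act q U 0 = 0"
  by (simp_all add: act_def)

lemma act_tens: "act q (tens u v) m = lmul q u (lmul q m v)"
  by (simp add: act_def lam_eq_iff algebra_simps)

lemma act_llmul: "act q (llmul q U V) m = act q U (act q V m)"
proof -
  have "act q (llmul q U V) m = act q U (act q V m)"
    unfolding act_def llmul_sel lmul_distrib lmul_assoc
    by (simp add: lam_eq_iff algebra_simps)
  then show ?thesis .
qed

section \<open>The tensor ideal as the kernel of the coordinate map\<close>

abbreviation env :: "'k::field \<Rightarrow> (((letter, 'k) free_algebra set \<times> (letter, 'k) free_algebra set) \<Rightarrow>\<^sub>0 'k) set ring"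
  where "env q \<equiv> enveloping_algebra (Lambda q) (Lambda_unit q)"

abbreviation reg :: "'k::field \<Rightarrow> ((((letter, 'k) free_algebra set \<times> (letter, 'k) free_algebra set) \<Rightarrow>\<^sub>0 'k) set,
    (letter, 'k) free_algebra set) module"
  where "reg q \<equiv> regular_bimodule (Lambda q) (Lambda_unit q)"

definition prs :: "'k::field \<Rightarrow> (((letter, 'k) free_algebra set \<times> (letter, 'k) free_algebra set) \<Rightarrow>\<^sub>0 'k) ring"
  where "prs q = pair_algebra (opposite_ring (Lambda q)) (Lambda q)"

definition tid :: "'k::field \<Rightarrow> (((letter, 'k) free_algebra set \<times> (letter, 'k) free_algebra set) \<Rightarrow>\<^sub>0 'k) set"
  where "tid q = tensor_ideal (opposite_ring (Lambda q)) (Lambda_unit q) (Lambda q) (Lambda_unit q)"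

lemma opposite_ring_sel [simp]:
  "carrier (opposite_ring A) = carrier A" "a \<otimes>\<^bsub>opposite_ring A\<^esub> b = b \<otimes>\<^bsub>A\<^esub> a"
  "a \<oplus>\<^bsub>opposite_ring A\<^esub> b = a \<oplus>\<^bsub>A\<^esub> b" "\<one>\<^bsub>opposite_ring A\<^esub> = \<one>\<^bsub>A\<^esub>" "\<zero>\<^bsub>opposite_ring A\<^esub> = \<zero>\<^bsub>A\<^esub>"
  by (simp_all add: opposite_ring_def)

lemma ring_opposite_ring:
  assumes "ring A"
  shows "ring (opposite_ring A)"
proof -
  interpret ring A by fact
  have "\<exists>y\<in>carrier A. y \<oplus>\<^bsub>A\<^esub> x = \<zero>\<^bsub>A\<^esub>" if "x \<in> carrier A" for x
    using that by (intro bexI[of _ "\<ominus>\<^bsub>A\<^esub> x"] l_neg a_inv_closed)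
  then show ?thesis
    by (intro ringI abelian_groupI monoidI) (simp_all add: a_ac m_assoc l_distr r_distr)
qed

lemma ring_prs: "ring (prs q)"
  unfolding prs_def by (intro ring_pair_algebra ring_opposite_ring ring_Lambda)

lemma prs_sel [simp]:
  "carrier (prs q) = {f. Poly_Mapping.keys f \<subseteq> carrier (Lambda q) \<times> carrier (Lambda q)}"
  "f \<otimes>\<^bsub>prs q\<^esub> g = pair_mult (opposite_ring (Lambda q)) (Lambda q) f g"
  "f \<oplus>\<^bsub>prs q\<^esub> g = f + g"
  "\<zero>\<^bsub>prs q\<^esub> = 0"
  "\<one>\<^bsub>prs q\<^esub> = Poly_Mapping.single (\<one>\<^bsub>Lambda q\<^esub>, \<one>\<^bsub>Lambda q\<^esub>) 1"
  by (simp_all add: prs_def)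

lemma prs_a_inv [simp]: "f \<in> carrier (prs q) \<Longrightarrow> \<ominus>\<^bsub>prs q\<^esub> f = - f"
  by (rule abelian_group.minus_equality[OF ring.is_abelian_group[OF ring_prs]]) simp_all

text \<open>In a pair (a, b) the entry b acts from the left and a from the right. The outer tensor
  factor is therefore the second entry of the pair.\<close>

definition tcoord :: "'k::field \<Rightarrow> (((letter, 'k) free_algebra set \<times> (letter, 'k) free_algebra set) \<Rightarrow>\<^sub>0 'k) \<Rightarrow> 'k lam lam"
  where "tcoord q = ll.lext (\<lambda>p. tens (lam_of q (snd p)) (lam_of q (fst p)))"

lemma tcoord_add: "tcoord q (f + g) = tcoord q f + tcoord q g"
  and tcoord_diff: "tcoord q (f - g) = tcoord q f - tcoord q g"
  and tcoord_uminus: "tcoord q (- f) = - tcoord q f"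
  and tcoord_zero [simp]: "tcoord q 0 = 0"
  and tcoord_single [simp]: "tcoord q (Poly_Mapping.single p c) = llscale c (tens (lam_of q (snd p)) (lam_of q (fst p)))"
  by (simp_all add: tcoord_def ll.lext_add ll.lext_diff ll.lext_uminus)

lemma tcoord_mult:
  assumes f: "f \<in> carrier (prs q)" and g: "g \<in> carrier (prs q)"
  shows "tcoord q (f \<otimes>\<^bsub>prs q\<^esub> g) = llmul q (tcoord q f) (tcoord q g)"
proof -
  have "Poly_Mapping.keys f \<subseteq> carrier (Lambda q) \<times> carrier (Lambda q)" using f by simp
  then show ?thesis
  proof (induction rule: poly_mapping_induct_on)
    case (single_add f p c)
    note p = single_add(2)
    have "Poly_Mapping.keys g \<subseteq> carrier (Lambda q) \<times> carrier (Lambda q)" using g by simp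
    then have "tcoord q (Poly_Mapping.single p c \<otimes>\<^bsub>prs q\<^esub> g) =
        llmul q (tcoord q (Poly_Mapping.single p c)) (tcoord q g)"
    proof (induction rule: poly_mapping_induct_on)
      case (single_add g p' c')
      with p show ?case
        by (auto simp: pair_mult_add pair_mult_single tcoord_add llmul_add llmul_llscale llmul_tens lam_of_hom)
    qed simp
    with single_add show ?case
      by (simp add: pair_mult_add tcoord_add llmul_add)
  qed simp
qed

lemma keys_diff_subset:
  "Poly_Mapping.keys f \<subseteq> S \<Longrightarrow> Poly_Mapping.keys g \<subseteq> S \<Longrightarrow> Poly_Mapping.keys (f - g) \<subseteq> S"
  using keys_diff[of f g] by blast

lemma tensor_relations_carrier:
  "tensor_relations (opposite_ring (Lambda q)) (Lambda_unit q) (Lambda q) (Lambda_unit q) \<subseteq> carrier (prs q)"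
proof -
  interpret L: ring "Lambda q" by (rule ring_Lambda)
  show ?thesis
    unfolding tensor_relations_def Let_def prs_sel
    by (intro subsetI; elim UnE CollectE exE conjE; hypsubst; intro CollectI keys_diff_subset)
       (simp_all add: Lambda_unit_eq)
qed

lemma tid_ideal: "ideal (tid q) (prs q)"
  unfolding tid_def tensor_ideal_def prs_def[symmetric]
  by (intro ring.genideal_ideal ring_prs tensor_relations_carrier)

lemma tid_closed:
  "0 \<in> tid q"
  "f \<in> tid q \<Longrightarrow> g \<in> tid q \<Longrightarrow> f + g \<in> tid q"
  "f \<in> tid q \<Longrightarrow> - f \<in> tid q"
  "f \<in> tid q \<Longrightarrow> g \<in> tid q \<Longrightarrow> f - g \<in> tid q"
proof -
  interpret ideal "tid q" "prs q" by (rule tid_ideal)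
  note sub = is_additive_subgroup
  show "0 \<in> tid q" using additive_subgroup.zero_closed[OF sub] by simp
  show plus: "f \<in> tid q \<Longrightarrow> g \<in> tid q \<Longrightarrow> f + g \<in> tid q" for f g
    using additive_subgroup.a_closed[OF sub, of f g] by simp
  show minus: "- f \<in> tid q" if "f \<in> tid q" for f
  proof -
    have "f \<in> carrier (prs q)"
      using that additive_subgroup.a_subset[OF sub] by blast
    from additive_subgroup.a_inv_closed[OF sub that] show ?thesis
      by (simp only: prs_a_inv[OF \<open>f \<in> carrier (prs q)\<close>])
  qed
  show "f \<in> tid q \<Longrightarrow> g \<in> tid q \<Longrightarrow> f - g \<in> tid q"
    using plus[of f "- g"] minus by simp
qed

definition tsing :: "'k::field \<Rightarrow> 'k lam \<Rightarrow> 'k lam \<Rightarrow> 'k \<Rightarrow> (((letter, 'k) free_algebra set \<times> (letter, 'k) free_algebra set) \<Rightarrow>\<^sub>0 'k)"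
  where "tsing q u v c = Poly_Mapping.single (of_lam q u, of_lam q v) c"

lemma tid_relations:
  "tsing q (u + u') v 1 - tsing q u v 1 - tsing q u' v 1 \<in> tid q" (is ?A)
  "tsing q u (v + v') 1 - tsing q u v 1 - tsing q u v' 1 \<in> tid q" (is ?B)
  "tsing q (lscale c u) v 1 - tsing q u v c \<in> tid q" (is ?C)
  "tsing q u (lscale c v) 1 - tsing q u v c \<in> tid q" (is ?D)
proof -
  have sub: "tensor_relations (opposite_ring (Lambda q)) (Lambda_unit q) (Lambda q) (Lambda_unit q) \<subseteq> tid q"
    unfolding tid_def tensor_ideal_def prs_def[symmetric]
    by (intro ring.genideal_self ring_prs tensor_relations_carrier)
  let ?t = "\<lambda>a b c. Poly_Mapping.single (a, b) c"
  have 1: "?t (a \<oplus>\<^bsub>Lambda q\<^esub> a') b 1 - ?t a b 1 - ?t a' b 1 \<in> tid q"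
    "?t a (b \<oplus>\<^bsub>Lambda q\<^esub> b') 1 - ?t a b 1 - ?t a b' 1 \<in> tid q"
    "?t (a \<otimes>\<^bsub>Lambda q\<^esub> Lambda_unit q c) b 1 - ?t a b c \<in> tid q"
    "?t a (Lambda_unit q c \<otimes>\<^bsub>Lambda q\<^esub> b) 1 - ?t a b c \<in> tid q"
    if "a \<in> carrier (Lambda q)" "a' \<in> carrier (Lambda q)" "b \<in> carrier (Lambda q)" "b' \<in> carrier (Lambda q)"
    for a a' b b' c
    using that by (intro subsetD[OF sub]; unfold tensor_relations_def Let_def opposite_ring_sel; blast)+
  from 1(1)[of "of_lam q u" "of_lam q u'" "of_lam q v" "of_lam q v"] show ?A
    by (simp add: tsing_def of_lam_hom)
  from 1(2)[of "of_lam q u" "of_lam q u" "of_lam q v" "of_lam q v'"] show ?B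
    by (simp add: tsing_def of_lam_hom)
  from 1(3)[of "of_lam q u" "of_lam q u" "of_lam q v" "of_lam q v" c] show ?C
    by (simp add: tsing_def of_lam_hom Lambda_unit_eq)
  from 1(4)[of "of_lam q u" "of_lam q u" "of_lam q v" "of_lam q v" c] show ?D
    by (simp add: tsing_def of_lam_hom Lambda_unit_eq)
qed

definition tnf :: "'k::field \<Rightarrow> 'k lam lam \<Rightarrow> (((letter, 'k) free_algebra set \<times> (letter, 'k) free_algebra set) \<Rightarrow>\<^sub>0 'k)"
  where "tnf q U = tsing q (c1 U) lone 1 + tsing q (cx U) lX 1 + tsing q (cy U) lY 1 + tsing q (cw U) lW 1"

lemma tcoord_tsing: "tcoord q (tsing q u v c) = llscale c (tens v u)"
  by (simp add: tsing_def)

lemma tcoord_tnf [simp]: "tcoord q (tnf q U) = U"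
  by (simp add: tnf_def tcoord_add tcoord_tsing lam_eq_iff)

lemma tsing_carrier: "tsing q u v c \<in> carrier (prs q)"
  by (simp add: tsing_def)

lemma prs_add_closed: "f \<in> carrier (prs q) \<Longrightarrow> g \<in> carrier (prs q) \<Longrightarrow> f + g \<in> carrier (prs q)"
  using Poly_Mapping.keys_add[of f g] by auto

lemma tnf_carrier: "tnf q U \<in> carrier (prs q)"
  unfolding tnf_def by (intro prs_add_closed tsing_carrier)

text \<open>A single tensor is not additive in its entries as a formal sum, so even the normal form
  is additive only up to the bilinearity relations.\<close>

lemma tnf_add: "tnf q (U + V) - tnf q U - tnf q V \<in> tid q"
proof -
  let ?d = "\<lambda>u u' v. tsing q (u + u') v 1 - tsing q u v 1 - tsing q u' v 1"
  have "tnf q (U + V) - tnf q U - tnf q V =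
      ?d (c1 U) (c1 V) lone + ?d (cx U) (cx V) lX + ?d (cy U) (cy V) lY + ?d (cw U) (cw V) lW"
    by (simp add: tnf_def)
  then show ?thesis
    by (simp only: tid_closed tid_relations)
qed

text \<open>The scalar is absorbed into the first entry, and v is expanded in the basis. The terms
  \<open>f\<close> split off one summand of v at a time, and the terms \<open>e\<close> carry its
  coefficient across the tensor sign.\<close>

lemma tnf_single: "tsing q u v c - tnf q (llscale c (tens v u)) \<in> tid q"
proof -
  define u' where "u' = lscale c u"
  define e where "e a b = tsing q (lscale a u') b 1 - tsing q u' (lscale a b) 1" for a b
  have e: "e a b \<in> tid q" for a b
  proof -
    have "e a b = (tsing q (lscale a u') b 1 - tsing q u' b a) - (tsing q u' (lscale a b) 1 - tsing q u' b a)"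
      by (simp add: e_def)
    then show ?thesis by (simp only: tid_closed tid_relations)
  qed
  define f where "f a b = tsing q u' (a + b) 1 - tsing q u' a 1 - tsing q u' b 1" for a b
  have f: "f a b \<in> tid q" for a b
    unfolding f_def by (rule tid_relations)
  let ?a = "lscale (c1 v) lone" and ?b = "lscale (cx v) lX"
    and ?c = "lscale (cy v) lY" and ?d = "lscale (cw v) lW"
  have v: "v = ?a + ?b + ?c + ?d" by (rule lam_decomp)
  have "tsing q u v c - tnf q (llscale c (tens v u)) =
      - (tsing q u' v 1 - tsing q u v c) + f (?a + ?b + ?c) ?d + f (?a + ?b) ?c + f ?a ?b
      - e (c1 v) lone - e (cx v) lX - e (cy v) lY - e (cw v) lW"
    unfolding f_def e_def using v[symmetric]
    by (simp add: tnf_def u'_def mult.commute)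
  then show ?thesis
    unfolding u'_def by (simp only: tid_closed tid_relations f[unfolded u'_def] e)
qed

lemma diff_tnf:
  assumes "f \<in> carrier (prs q)"
  shows "f - tnf q (tcoord q f) \<in> tid q"
proof -
  have "Poly_Mapping.keys f \<subseteq> carrier (Lambda q) \<times> carrier (Lambda q)" using assms by simp
  then show ?thesis
  proof (induction rule: poly_mapping_induct_on)
    case zero
    have "- (tnf q (0 + 0) - tnf q 0 - tnf q 0) \<in> tid q"
      by (intro tid_closed tnf_add)
    then have "tnf q 0 \<in> tid q" by simp
    then show ?case using tid_closed(3) by simp
  next
    case (single_add f p c)
    define U where "U = tcoord q (Poly_Mapping.single p c)"
    have "Poly_Mapping.single p c = tsing q (lam_of q (fst p)) (lam_of q (snd p)) c"
      using single_add by (auto simp: tsing_def)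
    then have "Poly_Mapping.single p c - tnf q U \<in> tid q"
      using tnf_single[of q "lam_of q (fst p)" "lam_of q (snd p)" c]
      by (simp add: U_def tcoord_tsing)
    moreover have "Poly_Mapping.single p c + f - tnf q (tcoord q (Poly_Mapping.single p c + f)) =
        (Poly_Mapping.single p c - tnf q U) + (f - tnf q (tcoord q f))
        - (tnf q (U + tcoord q f) - tnf q U - tnf q (tcoord q f))"
      by (simp add: U_def tcoord_add)
    ultimately show ?case
      using single_add by (simp only: tid_closed tnf_add)
  qed
qed

lemma ideal_tcoord_kernel: "ideal {f \<in> carrier (prs q). tcoord q f = 0} (prs q)"
proof (rule idealI)
  show "ring (prs q)" by (rule ring_prs)
  show "subgroup {f \<in> carrier (prs q). tcoord q f = 0} (add_monoid (prs q))"
  proof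
    fix f assume f: "f \<in> {f \<in> carrier (prs q). tcoord q f = 0}"
    then have "\<ominus>\<^bsub>prs q\<^esub> f \<in> {f \<in> carrier (prs q). tcoord q f = 0}"
      using prs_a_inv[of f q] by (simp add: tcoord_uminus)
    then show "inv\<^bsub>add_monoid (prs q)\<^esub> f \<in> {f \<in> carrier (prs q). tcoord q f = 0}"
      by (simp add: a_inv_def)
  next
    fix f g assume "f \<in> {f \<in> carrier (prs q). tcoord q f = 0}" "g \<in> {f \<in> carrier (prs q). tcoord q f = 0}"
    then show "f \<otimes>\<^bsub>add_monoid (prs q)\<^esub> g \<in> {f \<in> carrier (prs q). tcoord q f = 0}"
      using prs_add_closed[of f q g] by (simp add: tcoord_add)
  qed auto
  interpret ring "prs q" by (rule ring_prs)
  fix f g assume f: "f \<in> {f \<in> carrier (prs q). tcoord q f = 0}" and g: "g \<in> carrier (prs q)"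
  then show "g \<otimes>\<^bsub>prs q\<^esub> f \<in> {f \<in> carrier (prs q). tcoord q f = 0}"
    "f \<otimes>\<^bsub>prs q\<^esub> g \<in> {f \<in> carrier (prs q). tcoord q f = 0}"
    using tcoord_mult[of g q f] tcoord_mult[of f q g] m_closed[of f g] m_closed[of g f]
    by (simp_all del: prs_sel)
qed

text \<open>The relations have coordinates 0 because \<open>tens\<close> is bilinear. Conversely, an
  element with coordinates 0 is congruent to \<open>tnf q 0\<close>, and that formal sum lies in the
  ideal although it is not the zero function.\<close>

lemma tid_eq: "tid q = {f \<in> carrier (prs q). tcoord q f = 0}"
proof
  have "tensor_relations (opposite_ring (Lambda q)) (Lambda_unit q) (Lambda q) (Lambda_unit q)
      \<subseteq> {f \<in> carrier (prs q). tcoord q f = 0}" (is "?T \<subseteq> _")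
  proof
    fix f assume f: "f \<in> ?T"
    moreover have "tcoord q f = 0"
      using f unfolding tensor_relations_def Let_def
      by (elim UnE CollectE exE conjE; hypsubst)
         (simp_all add: tcoord_diff lam_of_hom Lambda_unit_eq lam_eq_iff distrib_right distrib_left)
    ultimately show "f \<in> {f \<in> carrier (prs q). tcoord q f = 0}"
      using tensor_relations_carrier by blast
  qed
  then show "tid q \<subseteq> {f \<in> carrier (prs q). tcoord q f = 0}"
    unfolding tid_def tensor_ideal_def prs_def[symmetric]
    by (rule ring.genideal_minimal[OF ring_prs ideal_tcoord_kernel])
  have "tnf q 0 \<in> tid q"
    using tid_closed(3)[OF tnf_add[of q 0 0]] by simp
  show "{f \<in> carrier (prs q). tcoord q f = 0} \<subseteq> tid q"
  proof
    fix f assume "f \<in> {f \<in> carrier (prs q). tcoord q f = 0}"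
    then show "f \<in> tid q"
      using tid_closed(2)[OF diff_tnf[of f q] \<open>tnf q 0 \<in> tid q\<close>] by simp
  qed
qed

section \<open>The enveloping algebra and the regular bimodule in coordinates\<close>

definition tcls :: "'k::field \<Rightarrow> (((letter, 'k) free_algebra set \<times> (letter, 'k) free_algebra set) \<Rightarrow>\<^sub>0 'k)
    \<Rightarrow> (((letter, 'k) free_algebra set \<times> (letter, 'k) free_algebra set) \<Rightarrow>\<^sub>0 'k) set"
  where "tcls q f = tid q +>\<^bsub>prs q\<^esub> f"

lemma tcls_eq:
  assumes "f \<in> carrier (prs q)"
  shows "tcls q f = {g \<in> carrier (prs q). tcoord q g = tcoord q f}"
proof -
  have 1: "g \<in> tcls q f \<longleftrightarrow> (\<exists>h\<in>carrier (prs q). tcoord q h = 0 \<and> g = h + f)" for g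
    unfolding tcls_def a_r_coset_def r_coset_def tid_eq by auto
  have 2: "- f \<in> carrier (prs q)" using assms by simp
  have "g \<in> tcls q f \<longleftrightarrow> g \<in> carrier (prs q) \<and> tcoord q g = tcoord q f" for g
  proof
    assume "g \<in> carrier (prs q) \<and> tcoord q g = tcoord q f"
    with 2 show "g \<in> tcls q f"
      using prs_add_closed[of g q "- f"] unfolding 1
      by (intro bexI[of _ "g - f"]) (simp_all add: tcoord_diff)
  qed (use assms prs_add_closed in \<open>auto simp: 1 tcoord_add simp del: prs_sel\<close>)
  then show ?thesis by blast
qed

lemma tcls_eq_iff:
  "f \<in> carrier (prs q) \<Longrightarrow> g \<in> carrier (prs q) \<Longrightarrow> tcls q f = tcls q g \<longleftrightarrow> tcoord q f = tcoord q g"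
proof
  assume f: "f \<in> carrier (prs q)" and g: "g \<in> carrier (prs q)"
  {
    assume "tcls q f = tcls q g"
    moreover have "f \<in> tcls q f" unfolding tcls_eq[OF f] using f by (intro CollectI conjI refl)
    ultimately show "tcoord q f = tcoord q g" unfolding tcls_eq[OF g] by blast
  next
    assume "tcoord q f = tcoord q g"
    then show "tcls q f = tcls q g" by (simp only: tcls_eq[OF f] tcls_eq[OF g])
  }
qed

lemma env_eq: "env q = prs q Quot tid q"
  unfolding enveloping_algebra_def tensor_algebra_def prs_def tid_def ..

lemma ring_env: "ring (env q)"
  unfolding env_eq by (rule ideal.quotient_is_ring[OF tid_ideal])

lemma carrier_env: "carrier (env q) = tcls q ` carrier (prs q)"
  unfolding env_eq FactRing_def A_RCOSETS_def RCOSETS_def tcls_def a_r_coset_def by auto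

lemma tcls_hom:
  "f \<in> carrier (prs q) \<Longrightarrow> g \<in> carrier (prs q) \<Longrightarrow> tcls q f \<otimes>\<^bsub>env q\<^esub> tcls q g = tcls q (f \<otimes>\<^bsub>prs q\<^esub> g)"
  "f \<in> carrier (prs q) \<Longrightarrow> g \<in> carrier (prs q) \<Longrightarrow> tcls q f \<oplus>\<^bsub>env q\<^esub> tcls q g = tcls q (f + g)"
  "\<one>\<^bsub>env q\<^esub> = tcls q \<one>\<^bsub>prs q\<^esub>" "\<zero>\<^bsub>env q\<^esub> = tcls q 0"
  using ring_hom_memE(2-4)[OF ideal.rcos_ring_hom[OF tid_ideal[of q]]]
    ring_hom_zero[OF ideal.rcos_ring_hom[OF tid_ideal[of q]] ring_prs
      ideal.quotient_is_ring[OF tid_ideal[of q]]]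
  unfolding env_eq tcls_def by simp_all

definition ecoord :: "'k::field \<Rightarrow> (((letter, 'k) free_algebra set \<times> (letter, 'k) free_algebra set) \<Rightarrow>\<^sub>0 'k) set \<Rightarrow> 'k lam lam"
  where "ecoord q r = the_elem (tcoord q ` r)"

definition env_of :: "'k::field \<Rightarrow> 'k lam lam \<Rightarrow> (((letter, 'k) free_algebra set \<times> (letter, 'k) free_algebra set) \<Rightarrow>\<^sub>0 'k) set"
  where "env_of q U = tcls q (tnf q U)"

lemma ecoord_tcls:
  assumes "f \<in> carrier (prs q)"
  shows "ecoord q (tcls q f) = tcoord q f"
proof -
  have "tcoord q ` tcls q f = {tcoord q f}"
    using assms by (auto simp: tcls_eq simp del: prs_sel)
  then show ?thesis by (simp add: ecoord_def)
qed

lemma ecoord_env_of [simp]: "ecoord q (env_of q U) = U"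
  by (simp add: env_of_def ecoord_tcls[OF tnf_carrier])

lemma env_of_carrier [simp]: "env_of q U \<in> carrier (env q)"
  by (simp add: env_of_def carrier_env tnf_carrier del: prs_sel)

lemma env_of_ecoord [simp]: "r \<in> carrier (env q) \<Longrightarrow> env_of q (ecoord q r) = r"
  by (clarsimp simp: carrier_env env_of_def ecoord_tcls tcls_eq_iff tnf_carrier simp del: prs_sel)

lemma ecoord_inj: "r \<in> carrier (env q) \<Longrightarrow> s \<in> carrier (env q) \<Longrightarrow> ecoord q r = ecoord q s \<Longrightarrow> r = s"
  by (metis env_of_ecoord)

lemma ecoord_hom:
  "r \<in> carrier (env q) \<Longrightarrow> s \<in> carrier (env q) \<Longrightarrow> ecoord q (r \<otimes>\<^bsub>env q\<^esub> s) = llmul q (ecoord q r) (ecoord q s)"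
  "r \<in> carrier (env q) \<Longrightarrow> s \<in> carrier (env q) \<Longrightarrow> ecoord q (r \<oplus>\<^bsub>env q\<^esub> s) = ecoord q r + ecoord q s"
  "ecoord q \<one>\<^bsub>env q\<^esub> = tens lone lone" "ecoord q \<zero>\<^bsub>env q\<^esub> = 0"
proof -
  interpret ring "prs q" by (rule ring_prs)
  show "r \<in> carrier (env q) \<Longrightarrow> s \<in> carrier (env q) \<Longrightarrow> ecoord q (r \<otimes>\<^bsub>env q\<^esub> s) = llmul q (ecoord q r) (ecoord q s)"
    by (auto simp: carrier_env tcls_hom ecoord_tcls tcoord_mult simp del: prs_sel)
  show "r \<in> carrier (env q) \<Longrightarrow> s \<in> carrier (env q) \<Longrightarrow> ecoord q (r \<oplus>\<^bsub>env q\<^esub> s) = ecoord q r + ecoord q s"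
    by (auto simp: carrier_env tcls_hom ecoord_tcls prs_add_closed tcoord_add simp del: prs_sel)
  show "ecoord q \<one>\<^bsub>env q\<^esub> = tens lone lone"
    unfolding tcls_hom(3) ecoord_tcls[OF one_closed] by (simp add: lam_of_hom)
  show "ecoord q \<zero>\<^bsub>env q\<^esub> = 0"
    using zero_closed unfolding tcls_hom(4) by (subst ecoord_tcls) simp_all
qed

lemma env_of_hom:
  "env_of q U \<otimes>\<^bsub>env q\<^esub> env_of q V = env_of q (llmul q U V)"
  "env_of q U \<oplus>\<^bsub>env q\<^esub> env_of q V = env_of q (U + V)"
  "\<one>\<^bsub>env q\<^esub> = env_of q (tens lone lone)" "\<zero>\<^bsub>env q\<^esub> = env_of q 0"
proof -
  interpret ring "env q" by (rule ring_env)
  show "env_of q U \<otimes>\<^bsub>env q\<^esub> env_of q V = env_of q (llmul q U V)"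
    "env_of q U \<oplus>\<^bsub>env q\<^esub> env_of q V = env_of q (U + V)"
    "\<one>\<^bsub>env q\<^esub> = env_of q (tens lone lone)" "\<zero>\<^bsub>env q\<^esub> = env_of q 0"
    by (rule ecoord_inj[of _ q]; simp add: ecoord_hom)+
qed

lemma enveloping_unit_eq: "enveloping_unit (Lambda q) (Lambda_unit q) c = env_of q (llscale c (tens lone lone))"
proof -
  let ?f = "Poly_Mapping.single (\<one>\<^bsub>Lambda q\<^esub>, \<one>\<^bsub>Lambda q\<^esub>) c"
  have f: "?f \<in> carrier (prs q)"
    by (simp add: of_lam_hom)
  have "enveloping_unit (Lambda q) (Lambda_unit q) c = tcls q ?f"
    unfolding enveloping_unit_def tensor_unit_def tcls_def tid_def prs_def by simp
  also have "\<dots> = env_of q (ecoord q (tcls q ?f))"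
    using f by (intro env_of_ecoord[symmetric]) (auto simp: carrier_env simp del: prs_sel)
  finally show ?thesis
    by (simp only: ecoord_tcls[OF f]) (simp add: lam_of_hom)
qed

lemma reg_sel [simp]:
  "carrier (reg q) = carrier (Lambda q)" "a \<oplus>\<^bsub>reg q\<^esub> b = a \<oplus>\<^bsub>Lambda q\<^esub> b" "\<zero>\<^bsub>reg q\<^esub> = \<zero>\<^bsub>Lambda q\<^esub>"
  by (simp_all add: regular_bimodule_def)

text \<open>The sum over a representative depends only on the coordinates of that representative, so
  its values over a whole class form a singleton. This makes \<open>the_elem\<close> in the
  definition of the action meaningful.\<close>

lemma reg_smult:
  assumes r: "r \<in> carrier (env q)" and m: "m \<in> carrier (Lambda q)"
  shows "r \<odot>\<^bsub>reg q\<^esub> m = of_lam q (act q (ecoord q r) (lam_of q m))"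
proof -
  interpret L: ring "Lambda q" by (rule ring_Lambda)
  define F where "F f = (\<Oplus>\<^bsub>Lambda q\<^esub>p\<in>Poly_Mapping.keys f.
    Lambda_unit q (Poly_Mapping.lookup f p) \<otimes>\<^bsub>Lambda q\<^esub> (snd p \<otimes>\<^bsub>Lambda q\<^esub> m \<otimes>\<^bsub>Lambda q\<^esub> fst p))"
    for f :: "((letter, 'a) free_algebra set \<times> (letter, 'a) free_algebra set) \<Rightarrow>\<^sub>0 'a"
  have F: "F f = of_lam q (act q (tcoord q f) (lam_of q m))" if f: "f \<in> carrier (prs q)" for f
  proof (rule lam_of_inj)
    have cl: "(\<lambda>p. Lambda_unit q (Poly_Mapping.lookup f p) \<otimes>\<^bsub>Lambda q\<^esub>
        (snd p \<otimes>\<^bsub>Lambda q\<^esub> m \<otimes>\<^bsub>Lambda q\<^esub> fst p)) \<in> Poly_Mapping.keys f \<rightarrow> carrier (Lambda q)"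
      using f m by (auto simp: Lambda_unit_eq)
    then show "F f \<in> carrier (Lambda q)"
      unfolding F_def by (rule L.finsum_closed)
    have "lam_of q (F f) = (\<Sum>p\<in>Poly_Mapping.keys f. lscale (Poly_Mapping.lookup f p)
        (lmul q (lmul q (lam_of q (snd p)) (lam_of q m)) (lam_of q (fst p))))"
      unfolding F_def using f m
      by (subst lam_of_finsum[OF _ cl]) (auto simp: lam_of_hom Lambda_unit_eq intro!: sum.cong)
    also have "\<dots> = (\<Sum>p\<in>Poly_Mapping.keys f. act q (llscale (Poly_Mapping.lookup f p)
        (tens (lam_of q (snd p)) (lam_of q (fst p)))) (lam_of q m))"
      by (simp add: act_llscale act_tens lmul_assoc)
    also have "\<dots> = act q (tcoord q f) (lam_of q m)"
      unfolding tcoord_def ll.lext_def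
      by (induction rule: finite_induct[OF finite_keys[of f]]) (simp_all add: act_add)
    finally show "lam_of q (F f) = lam_of q (of_lam q (act q (tcoord q f) (lam_of q m)))"
      by simp
  qed simp
  obtain f where f: "f \<in> carrier (prs q)" "r = tcls q f"
    using r by (auto simp: carrier_env)
  have er: "ecoord q r = tcoord q f"
    unfolding f(2) by (rule ecoord_tcls[OF f(1)])
  have "f \<in> r" "\<And>g. g \<in> r \<Longrightarrow> F g = of_lam q (act q (ecoord q r) (lam_of q m))"
    unfolding er using f(1) F by (simp_all add: f(2) tcls_eq del: prs_sel)
  then have "F ` r = {of_lam q (act q (ecoord q r) (lam_of q m))}"
    by blast
  then show ?thesis
    unfolding regular_bimodule_def by (simp flip: F_def)
qed

lemma left_module_reg: "left_module (env q) (reg q)"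
proof -
  interpret L: ring "Lambda q" by (rule ring_Lambda)
  interpret R: ring "env q" by (rule ring_env)
  have "\<exists>y\<in>carrier (Lambda q). y \<oplus>\<^bsub>Lambda q\<^esub> x = \<zero>\<^bsub>Lambda q\<^esub>" if "x \<in> carrier (Lambda q)" for x
    using that by (intro bexI[of _ "\<ominus>\<^bsub>Lambda q\<^esub> x"] L.l_neg L.a_inv_closed)
  then have "abelian_group (reg q)"
    by (intro abelian_groupI) (simp_all add: L.a_ac)
  then interpret M: abelian_group "reg q" .
  show ?thesis
    by standard
       (simp_all add: reg_smult ecoord_hom lam_of_hom of_lam_hom act_add act_llmul act_tens)
qed


section \<open>Linear maps and coboundaries\<close>

lemma (in abelian_group) add_eq_self_imp_zero:
  assumes "b = a \<oplus> b" "a \<in> carrier G" "b \<in> carrier G"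
  shows "a = \<zero>"
proof -
  have "a \<oplus> b = \<zero> \<oplus> b" using assms by simp
  then show ?thesis
    using assms(2,3) add.right_cancel[of b a "\<zero>"] by simp
qed

lemma lm_closed: "f \<in> linear_maps R M N \<Longrightarrow> x \<in> carrier M \<Longrightarrow> f x \<in> carrier N"
  by (auto simp: linear_maps_def)

lemma lm_add:
  "f \<in> linear_maps R M N \<Longrightarrow> x \<in> carrier M \<Longrightarrow> y \<in> carrier M \<Longrightarrow> f (x \<oplus>\<^bsub>M\<^esub> y) = f x \<oplus>\<^bsub>N\<^esub> f y"
  by (auto simp: linear_maps_def)

lemma lm_smult:
  "f \<in> linear_maps R M N \<Longrightarrow> a \<in> carrier R \<Longrightarrow> x \<in> carrier M \<Longrightarrow> f (a \<odot>\<^bsub>M\<^esub> x) = a \<odot>\<^bsub>N\<^esub> f x"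
  by (auto simp: linear_maps_def)

lemma lm_eqI:
  assumes "f \<in> linear_maps R M N" "g \<in> linear_maps R M N" "\<And>x. x \<in> carrier M \<Longrightarrow> f x = g x"
  shows "f = g"
  using assms unfolding linear_maps_def by (blast intro: PiE_ext)

lemma lm_zero:
  assumes "left_module R M" "left_module R N" "f \<in> linear_maps R M N"
  shows "f \<zero>\<^bsub>M\<^esub> = \<zero>\<^bsub>N\<^esub>"
proof -
  interpret M: left_module R M by fact
  interpret N: left_module R N by fact
  have "f (\<zero>\<^bsub>R\<^esub> \<odot>\<^bsub>M\<^esub> \<zero>\<^bsub>M\<^esub>) = \<zero>\<^bsub>R\<^esub> \<odot>\<^bsub>N\<^esub> f \<zero>\<^bsub>M\<^esub>"
    using assms(3) by (intro lm_smult) auto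
  then show ?thesis
    using lm_closed[OF assms(3), of "\<zero>\<^bsub>M\<^esub>"] by (simp add: M.smult_l_zero N.smult_l_zero)
qed

lemma left_module_uminus:
  assumes "left_module R M" "a \<in> carrier R" "x \<in> carrier M"
  shows "a \<odot>\<^bsub>M\<^esub> (\<ominus>\<^bsub>M\<^esub> x) = \<ominus>\<^bsub>M\<^esub> (a \<odot>\<^bsub>M\<^esub> x)"
proof -
  interpret M: left_module R M by fact
  have "a \<odot>\<^bsub>M\<^esub> (\<ominus>\<^bsub>M\<^esub> x) \<oplus>\<^bsub>M\<^esub> a \<odot>\<^bsub>M\<^esub> x = \<zero>\<^bsub>M\<^esub>"
    using assms M.smult_r_distr[of a "\<ominus>\<^bsub>M\<^esub> x" x] by (simp add: M.l_neg M.smult_r_zero)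
  then show ?thesis
    using assms by (metis M.a_inv_closed M.minus_equality M.smult_closed)
qed

lemma lm_compose:
  assumes "left_module R M" "f \<in> linear_maps R M N" "g \<in> linear_maps R N L"
  shows "compose (carrier M) g f \<in> linear_maps R M L"
proof -
  interpret M: left_module R M by fact
  show ?thesis
    using assms(2,3)
    by (auto simp: linear_maps_def compose_def PiE_iff Pi_iff M.smult_closed)
qed

lemma lm_zero_map:
  assumes "left_module R M" "left_module R N"
  shows "(\<lambda>x\<in>carrier M. \<zero>\<^bsub>N\<^esub>) \<in> linear_maps R M N"
proof -
  interpret M: left_module R M by fact
  interpret N: left_module R N by fact
  show ?thesis
    by (auto simp: linear_maps_def M.smult_closed N.smult_r_zero)
qed

lemma lm_id:
  assumes "left_module R M"
  shows "(\<lambda>x\<in>carrier M. x) \<in> linear_maps R M M"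
proof -
  interpret M: left_module R M by fact
  show ?thesis
    by (auto simp: linear_maps_def M.smult_closed)
qed

lemma lm_plus:
  assumes "left_module R M" "left_module R N" "f \<in> linear_maps R M N" "g \<in> linear_maps R M N"
  shows "(\<lambda>x\<in>carrier M. f x \<oplus>\<^bsub>N\<^esub> g x) \<in> linear_maps R M N"
proof -
  interpret M: left_module R M by fact
  interpret N: left_module R N by fact
  note [simp] = lm_closed[OF assms(3)] lm_closed[OF assms(4)] lm_add[OF assms(3)] lm_add[OF assms(4)]
    lm_smult[OF assms(3)] lm_smult[OF assms(4)]
  show ?thesis
    unfolding linear_maps_def
    by (auto simp: M.smult_closed N.smult_r_distr N.smult_closed N.a_ac)
qed

lemma lm_minus:
  assumes "left_module R M" "left_module R N" "f \<in> linear_maps R M N" "g \<in> linear_maps R M N"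
  shows "(\<lambda>x\<in>carrier M. f x \<ominus>\<^bsub>N\<^esub> g x) \<in> linear_maps R M N"
proof -
  interpret M: left_module R M by fact
  interpret N: left_module R N by fact
  note [simp] = lm_closed[OF assms(3)] lm_closed[OF assms(4)] lm_add[OF assms(3)] lm_add[OF assms(4)]
    lm_smult[OF assms(3)] lm_smult[OF assms(4)]
  show ?thesis
    unfolding linear_maps_def
    by (auto simp: M.smult_closed N.smult_r_distr N.smult_closed N.minus_add N.a_ac a_minus_def
        left_module_uminus[OF assms(2)])
qed

text \<open>The images of the basis vectors of the ambient free module are lifted one by one, and
  the section \<open>s\<close> restricts the result to P. The hypothesis is that the image of f lies
  in that of g, rather than that g is onto, because the differentials of a resolution only reach the
  next kernel.\<close>

lemma projective_lift:
  fixes P :: "('r, 'p, 'x) module_scheme"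
  assumes P: "projective_module R P" and A: "left_module R A" and B: "left_module R B"
    and g: "g \<in> linear_maps R A B" and f: "f \<in> linear_maps R P B"
    and im: "\<And>x. x \<in> carrier P \<Longrightarrow> f x \<in> g ` carrier A"
  shows "\<exists>h\<in>linear_maps R P A. \<forall>x\<in>carrier P. g (h x) = f x"
proof -
  interpret A: left_module R A by fact
  have R: "ring R" by (rule A.R.ring_axioms)
  have P': "left_module R P" using P by (simp add: projective_module_def)
  obtain I :: "'p set" and s r where s: "s \<in> linear_maps R P (free_module R I)"
    and r: "r \<in> linear_maps R (free_module R I) P" and rs: "\<And>x. x \<in> carrier P \<Longrightarrow> r (s x) = x"
    using P unfolding projective_module_def by blast
  let ?F = "free_module R I"
  have F: "left_module R ?F" using R by (rule left_module_free_module)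
  have "\<forall>i\<in>I. \<exists>a\<in>carrier A. g a = f (r (basis_vector R i))"
    using im lm_closed[OF r] basis_vector_in_carrier[OF R] by (metis imageE)
  then obtain \<phi> where \<phi>: "\<And>i. i \<in> I \<Longrightarrow> \<phi> i \<in> carrier A" "\<And>i. i \<in> I \<Longrightarrow> g (\<phi> i) = f (r (basis_vector R i))"
    by metis
  define e where "e = linear_extension R I A \<phi>"
  have e: "e \<in> linear_maps R ?F A"
    unfolding e_def using \<phi> by (intro A.linear_extension_linear) auto
  have eq: "g (e v) = f (r v)" if v: "v \<in> carrier ?F" for v
  proof -
    have "compose (carrier ?F) g e v = compose (carrier ?F) f r v"
    proof (rule linear_maps_eq_on_basis[OF R B lm_compose[OF F e g] lm_compose[OF F r f] _ v])
      fix i assume i: "i \<in> I"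
      then have "e (basis_vector R i) = \<phi> i"
        unfolding e_def using \<phi> by (intro A.linear_extension_basis_vector) auto
      then show "compose (carrier ?F) g e (basis_vector R i) = compose (carrier ?F) f r (basis_vector R i)"
        using \<phi> i basis_vector_in_carrier[OF R i] by (simp add: compose_def)
    qed
    with v show ?thesis by (simp add: compose_def)
  qed
  show ?thesis
    using lm_compose[OF P' s e] eq lm_closed[OF s] rs
    by (intro bexI[of _ "compose (carrier P) e s"]) (simp_all add: compose_def)
qed


section \<open>Comparison of resolutions\<close>

locale resolution =
  fixes R :: "('r, 'x) ring_scheme" and P :: "nat \<Rightarrow> ('r, 'p) module" and d :: "nat \<Rightarrow> 'p \<Rightarrow> 'p"
    and e :: "'p \<Rightarrow> 'm" and M :: "('r, 'm, 'y) module_scheme"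
  assumes resolution: "projective_resolution R P d e M" and left_module_M: "left_module R M"
begin

lemma projective: "projective_module R (P n)"
  using resolution by (simp add: projective_resolution_def)

lemma left_module_P: "left_module R (P n)"
  using projective[of n] by (simp add: projective_module_def)

lemma d_lm: "d n \<in> linear_maps R (P (Suc n)) (P n)"
  using resolution by (simp add: projective_resolution_def)

lemma e_lm: "e \<in> linear_maps R (P 0) M"
  using resolution by (simp add: projective_resolution_def)

lemma e_surj: "e ` carrier (P 0) = carrier M"
  using resolution by (simp add: projective_resolution_def)

lemma d_closed: "x \<in> carrier (P (Suc n)) \<Longrightarrow> d n x \<in> carrier (P n)"
  using d_lm by (rule lm_closed)

lemma exact_0: "d 0 ` carrier (P (Suc 0)) = {x \<in> carrier (P 0). e x = \<zero>\<^bsub>M\<^esub>}"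
  using resolution by (simp add: projective_resolution_def)

lemma exact_Suc: "d (Suc n) ` carrier (P (Suc (Suc n))) = {x \<in> carrier (P (Suc n)). d n x = \<zero>\<^bsub>P n\<^esub>}"
  using resolution by (simp add: projective_resolution_def)

lemma e_d: "x \<in> carrier (P (Suc 0)) \<Longrightarrow> e (d 0 x) = \<zero>\<^bsub>M\<^esub>"
  using exact_0 by blast

lemma d_d: "x \<in> carrier (P (Suc (Suc n))) \<Longrightarrow> d n (d (Suc n) x) = \<zero>\<^bsub>P n\<^esub>"
  using exact_Suc by blast

lemma coboundaries_lm:
  assumes "left_module R N" "w \<in> coboundaries R P d N n"
  shows "w \<in> linear_maps R (P n) N"
  using assms lm_zero_map[OF left_module_P assms(1)] lm_compose[OF left_module_P d_lm]
  by (cases n) (auto simp: coboundaries_def hom_group_def)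

lemma coboundaries_d:
  assumes N: "left_module R N" and w: "w \<in> coboundaries R P d N n" and x: "x \<in> carrier (P (Suc n))"
  shows "w (d n x) = \<zero>\<^bsub>N\<^esub>"
proof (cases n)
  case 0
  with w x d_closed[OF x] show ?thesis by (simp add: coboundaries_def hom_group_def)
next
  case (Suc m)
  with w obtain u where u: "u \<in> linear_maps R (P m) N" "w = compose (carrier (P (Suc m))) u (d m)"
    by (auto simp: coboundaries_def)
  with x Suc show ?thesis
    using d_closed[of x n] d_d[of x m] lm_zero[OF left_module_P N u(1)] by (simp add: compose_def)
qed

lemma coboundaries_cocycles:
  "left_module R N \<Longrightarrow> w \<in> coboundaries R P d N n \<Longrightarrow> w \<in> cocycles R P d N n"
  by (auto simp: cocycles_def coboundaries_d coboundaries_lm)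

lemma coboundaries_compose:
  assumes N: "left_module R N" and L: "left_module R L"
    and w: "w \<in> coboundaries R P d N n" and f: "f \<in> linear_maps R N L"
  shows "compose (carrier (P n)) f w \<in> coboundaries R P d L n"
proof (cases n)
  case 0
  with w show ?thesis
    using lm_zero[OF N L f] by (auto simp: coboundaries_def hom_group_def compose_def)
next
  case (Suc m)
  with w obtain u where u: "u \<in> linear_maps R (P m) N" "w = compose (carrier (P (Suc m))) u (d m)"
    by (auto simp: coboundaries_def)
  have "compose (carrier (P n)) f w = compose (carrier (P (Suc m))) (compose (carrier (P m)) f u) (d m)"
    using d_closed by (auto simp: compose_def u Suc fun_eq_iff)
  moreover have "compose (carrier (P m)) f u \<in> linear_maps R (P m) L"
    by (rule lm_compose[OF left_module_P u(1) f])
  ultimately show ?thesis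
    by (auto simp: coboundaries_def Suc)
qed

lemma coboundaries_zero: "(\<lambda>x\<in>carrier (P n). \<zero>\<^bsub>N\<^esub>) \<in> coboundaries R P d N n" if N: "left_module R N"
proof (cases n)
  case (Suc m)
  have "(\<lambda>x\<in>carrier (P n). \<zero>\<^bsub>N\<^esub>) = compose (carrier (P n)) (\<lambda>x\<in>carrier (P m). \<zero>\<^bsub>N\<^esub>) (d m)"
    using d_closed by (auto simp: compose_def Suc fun_eq_iff)
  then show ?thesis
    using lm_zero_map[OF left_module_P N] by (auto simp: coboundaries_def Suc)
qed (simp add: coboundaries_def hom_group_def)

lemma coboundaries_plus:
  assumes N: "left_module R N" and v: "v \<in> coboundaries R P d N n" and w: "w \<in> coboundaries R P d N n"
  shows "(\<lambda>x\<in>carrier (P n). v x \<oplus>\<^bsub>N\<^esub> w x) \<in> coboundaries R P d N n"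
proof (cases n)
  case 0
  interpret N: left_module R N by fact
  from 0 v w show ?thesis by (auto simp: coboundaries_def hom_group_def)
next
  case (Suc m)
  obtain v' w' where u: "v' \<in> linear_maps R (P m) N" "v = compose (carrier (P (Suc m))) v' (d m)"
    "w' \<in> linear_maps R (P m) N" "w = compose (carrier (P (Suc m))) w' (d m)"
    using v w Suc by (auto simp: coboundaries_def)
  have "(\<lambda>x\<in>carrier (P n). v x \<oplus>\<^bsub>N\<^esub> w x) =
      compose (carrier (P (Suc m))) (\<lambda>x\<in>carrier (P m). v' x \<oplus>\<^bsub>N\<^esub> w' x) (d m)"
    using d_closed by (auto simp: compose_def u Suc fun_eq_iff)
  with lm_plus[OF left_module_P N u(1,3)] show ?thesis
    by (auto simp: coboundaries_def Suc)
qed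

lemma coboundaries_minus:
  assumes N: "left_module R N" and v: "v \<in> coboundaries R P d N n" and w: "w \<in> coboundaries R P d N n"
  shows "(\<lambda>x\<in>carrier (P n). v x \<ominus>\<^bsub>N\<^esub> w x) \<in> coboundaries R P d N n"
proof (cases n)
  case 0
  interpret N: left_module R N by fact
  from 0 v w show ?thesis by (auto simp: coboundaries_def hom_group_def a_minus_def)
next
  case (Suc m)
  obtain v' w' where u: "v' \<in> linear_maps R (P m) N" "v = compose (carrier (P (Suc m))) v' (d m)"
    "w' \<in> linear_maps R (P m) N" "w = compose (carrier (P (Suc m))) w' (d m)"
    using v w Suc by (auto simp: coboundaries_def)
  have "(\<lambda>x\<in>carrier (P n). v x \<ominus>\<^bsub>N\<^esub> w x) =
      compose (carrier (P (Suc m))) (\<lambda>x\<in>carrier (P m). v' x \<ominus>\<^bsub>N\<^esub> w' x) (d m)"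
    using d_closed by (auto simp: compose_def u Suc fun_eq_iff)
  with lm_minus[OF left_module_P N u(1,3)] show ?thesis
    by (auto simp: coboundaries_def Suc)
qed

end

text \<open>The two-resolution form of \<open>chain_lift\<close>. With n = 0 and g the augmentation
  it describes a comparison map of resolutions; with P = Q it describes the lifts that enter the
  Yoneda product. Both kinds can then be composed and compared by the same lemmas.\<close>

definition lifting ::
  "('r, 'x) ring_scheme \<Rightarrow> (nat \<Rightarrow> ('r, 'p) module) \<Rightarrow> (nat \<Rightarrow> 'p \<Rightarrow> 'p)
    \<Rightarrow> (nat \<Rightarrow> ('r, 'q) module) \<Rightarrow> (nat \<Rightarrow> 'q \<Rightarrow> 'q) \<Rightarrow> ('q \<Rightarrow> 'm)
    \<Rightarrow> nat \<Rightarrow> ('p \<Rightarrow> 'm) \<Rightarrow> (nat \<Rightarrow> 'p \<Rightarrow> 'q) \<Rightarrow> bool"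
  where "lifting R P dP Q dQ eQ n g G \<longleftrightarrow>
    (\<forall>i. G i \<in> linear_maps R (P (n + i)) (Q i)) \<and>
    (\<forall>x\<in>carrier (P n). eQ (G 0 x) = g x) \<and>
    (\<forall>i. \<forall>x\<in>carrier (P (Suc (n + i))). dQ i (G (Suc i) x) = G i (dP (n + i) x))"

lemma chain_lift_eq: "chain_lift R P d e n g G \<longleftrightarrow> lifting R P d P d e n g G"
  by (simp add: chain_lift_def lifting_def)

lemma liftingD:
  assumes "lifting R P dP Q dQ eQ n g G"
  shows "G i \<in> linear_maps R (P (n + i)) (Q i)"
    "x \<in> carrier (P n) \<Longrightarrow> eQ (G 0 x) = g x"
    "x \<in> carrier (P (Suc (n + i))) \<Longrightarrow> dQ i (G (Suc i) x) = G i (dP (n + i) x)"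
  using assms by (auto simp: lifting_def)

lemma lifting_exists:
  assumes "resolution R P dP eP M" "resolution R Q dQ eQ M"
    and g: "g \<in> cocycles R P dP M n"
  shows "\<exists>G. lifting R P dP Q dQ eQ n g G"
proof -
  interpret P: resolution R P dP eP M by fact
  interpret Q: resolution R Q dQ eQ M by fact
  \<comment> \<open>The invariant demands that composing with the differential of P lands in
    boundaries of Q; this is what projectivity needs to build the next component.\<close>
  define A where "A i h \<longleftrightarrow> h \<in> linear_maps R (P (n + i)) (Q i) \<and>
    (\<forall>x\<in>carrier (P (Suc (n + i))). h (dP (n + i) x) \<in> dQ i ` carrier (Q (Suc i))) \<and>
    (i = 0 \<longrightarrow> (\<forall>x\<in>carrier (P n). eQ (h x) = g x))" for i h
  have "\<exists>G. \<forall>i. A i (G i) \<and> (\<forall>x\<in>carrier (P (Suc (n + i))). dQ i (G (Suc i) x) = G i (dP (n + i) x))"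
  proof (rule dependent_nat_choice)
    have gl: "g \<in> linear_maps R (P n) M" using g by (simp add: cocycles_def)
    then obtain h where h: "h \<in> linear_maps R (P n) (Q 0)" "\<And>x. x \<in> carrier (P n) \<Longrightarrow> eQ (h x) = g x"
      using projective_lift[OF P.projective[of n] Q.left_module_P Q.left_module_M Q.e_lm gl]
        lm_closed[OF gl] by (auto simp: Q.e_surj)
    have "h (dP n x) \<in> dQ 0 ` carrier (Q (Suc 0))" if "x \<in> carrier (P (Suc n))" for x
      unfolding Q.exact_0 using h g that P.d_closed[OF that] lm_closed[OF h(1)]
      by (simp add: cocycles_def)
    with h have "A 0 h" by (simp add: A_def)
    then show "\<exists>h. A 0 h" by (rule exI[of "A 0"])
  next
    fix h i assume h: "A i h"
    then have hl: "h \<in> linear_maps R (P (n + i)) (Q i)" by (simp add: A_def)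
    let ?f = "compose (carrier (P (Suc (n + i)))) h (dP (n + i))"
    have f: "?f \<in> linear_maps R (P (Suc (n + i))) (Q i)"
      by (rule lm_compose[OF P.left_module_P P.d_lm hl])
    obtain h' where h': "h' \<in> linear_maps R (P (Suc (n + i))) (Q (Suc i))"
      "\<And>x. x \<in> carrier (P (Suc (n + i))) \<Longrightarrow> dQ i (h' x) = h (dP (n + i) x)"
      using projective_lift[OF P.projective Q.left_module_P Q.left_module_P Q.d_lm f] h
      by (auto simp: A_def compose_def)
    have "h' (dP (Suc (n + i)) x) \<in> dQ (Suc i) ` carrier (Q (Suc (Suc i)))"
      if "x \<in> carrier (P (Suc (Suc (n + i))))" for x
      unfolding Q.exact_Suc using that P.d_closed[OF that] h' lm_closed[OF h'(1)] P.d_d[OF that]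
        lm_zero[OF P.left_module_P Q.left_module_P hl] by simp
    with h' show "\<exists>h'. A (Suc i) h' \<and>
        (\<forall>x\<in>carrier (P (Suc (n + i))). dQ i (h' x) = h (dP (n + i) x))"
      by (intro exI[of _ h']) (simp add: A_def)
  qed
  then show ?thesis
    by (auto simp: A_def lifting_def)
qed

text \<open>The usual null homotopy, with its half that factors through the differential of P
  recorded as a coboundary \<open>w\<close> with values in \<open>Q m\<close>. Since the only
  coboundary in degree 0 is the zero map, the case n = m = 0 is covered without a term of P in
  degree -1.\<close>

lemma lifting_null_homotopic:
  assumes "resolution R P dP eP M" "resolution R Q dQ eQ M"
    and G: "lifting R P dP Q dQ eQ n g G" and g: "g \<in> coboundaries R P dP M n"
  shows "\<exists>w\<in>coboundaries R P dP (Q m) (n + m). \<exists>v\<in>linear_maps R (P (n + m)) (Q (Suc m)).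
    \<forall>x\<in>carrier (P (n + m)). G m x = w x \<oplus>\<^bsub>Q m\<^esub> dQ m (v x)"
proof -
  interpret P: resolution R P dP eP M by fact
  interpret Q: resolution R Q dQ eQ M by fact
  note G = liftingD[OF G]
  have lift: "\<exists>v\<in>linear_maps R (P k) (Q (Suc i)). \<forall>x\<in>carrier (P k). f x = w x \<oplus>\<^bsub>Q i\<^esub> dQ i (v x)"
    if f: "f \<in> linear_maps R (P k) (Q i)" and w: "w \<in> linear_maps R (P k) (Q i)"
      and im: "\<And>x. x \<in> carrier (P k) \<Longrightarrow> f x \<ominus>\<^bsub>Q i\<^esub> w x \<in> dQ i ` carrier (Q (Suc i))"
    for f w k i
  proof -
    interpret Qi: left_module R "Q i" by (rule Q.left_module_P)
    obtain v where v: "v \<in> linear_maps R (P k) (Q (Suc i))"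
      "\<And>x. x \<in> carrier (P k) \<Longrightarrow> dQ i (v x) = f x \<ominus>\<^bsub>Q i\<^esub> w x"
      using projective_lift[OF P.projective Q.left_module_P Q.left_module_P Q.d_lm
          lm_minus[OF P.left_module_P Q.left_module_P f w]] im by auto
    have "f x = w x \<oplus>\<^bsub>Q i\<^esub> dQ i (v x)" if "x \<in> carrier (P k)" for x
      using v(2)[OF that] lm_closed[OF f that] lm_closed[OF w that]
      by (simp add: a_minus_def Qi.a_lcomm Qi.r_neg)
    with v(1) show ?thesis by blast
  qed
  show ?thesis
  proof (induction m)
    case 0
    interpret Q0: left_module R "Q 0" by (rule Q.left_module_P)
    interpret M: left_module R M by (rule Q.left_module_M)
    have G0: "G 0 \<in> linear_maps R (P n) (Q 0)" using G(1)[of 0] by simp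
    have "\<exists>w\<in>coboundaries R P dP (Q 0) n. \<forall>x\<in>carrier (P n). eQ (w x) = g x"
    proof (cases n)
      case 0
      with g show ?thesis
        using P.coboundaries_zero[OF Q.left_module_P, of 0 0] lm_zero[OF Q.left_module_P Q.left_module_M Q.e_lm]
        by (intro bexI[of _ "\<lambda>x\<in>carrier (P 0). \<zero>\<^bsub>Q 0\<^esub>"]) (auto simp: coboundaries_def hom_group_def)
    next
      case (Suc k)
      with g obtain u where u: "u \<in> linear_maps R (P k) M" "g = compose (carrier (P n)) u (dP k)"
        by (auto simp: coboundaries_def)
      obtain h where h: "h \<in> linear_maps R (P k) (Q 0)" "\<And>x. x \<in> carrier (P k) \<Longrightarrow> eQ (h x) = u x"
        using projective_lift[OF P.projective Q.left_module_P Q.left_module_M Q.e_lm u(1)] lm_closed[OF u(1)]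
        by (auto simp: Q.e_surj)
      have "compose (carrier (P n)) h (dP k) \<in> coboundaries R P dP (Q 0) n"
        using h(1) by (simp add: coboundaries_def Suc)
      moreover have "eQ (compose (carrier (P n)) h (dP k) x) = g x" if "x \<in> carrier (P n)" for x
        using that P.d_closed[of x k] h(2) by (simp add: u(2) compose_def Suc)
      ultimately show ?thesis by blast
    qed
    then obtain w where w: "w \<in> coboundaries R P dP (Q 0) n" "\<And>x. x \<in> carrier (P n) \<Longrightarrow> eQ (w x) = g x"
      by blast
    have wl: "w \<in> linear_maps R (P n) (Q 0)"
      by (rule P.coboundaries_lm[OF Q.left_module_P w(1)])
    have "G 0 x \<ominus>\<^bsub>Q 0\<^esub> w x \<in> dQ 0 ` carrier (Q (Suc 0))" if x: "x \<in> carrier (P n)" for x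
    proof -
      note c = lm_closed[OF G0 x] lm_closed[OF wl x]
      have "eQ (G 0 x) = eQ ((G 0 x \<ominus>\<^bsub>Q 0\<^esub> w x) \<oplus>\<^bsub>Q 0\<^esub> w x)"
        using c by (simp add: a_minus_def Q0.a_assoc Q0.l_neg)
      also have "\<dots> = eQ (G 0 x \<ominus>\<^bsub>Q 0\<^esub> w x) \<oplus>\<^bsub>M\<^esub> eQ (w x)"
        using c by (intro lm_add[OF Q.e_lm]) auto
      finally have "eQ (w x) = eQ (G 0 x \<ominus>\<^bsub>Q 0\<^esub> w x) \<oplus>\<^bsub>M\<^esub> eQ (w x)"
        using G(2)[OF x] w(2)[OF x] by simp
      then have "eQ (G 0 x \<ominus>\<^bsub>Q 0\<^esub> w x) = \<zero>\<^bsub>M\<^esub>"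
        by (rule M.add_eq_self_imp_zero) (use c lm_closed[OF Q.e_lm] in auto)
      with c show ?thesis
        unfolding Q.exact_0 by simp
    qed
    from lift[OF G0 wl this] w(1) show ?case by auto
  next
    case (Suc m)
    interpret Qm: left_module R "Q m" by (rule Q.left_module_P)
    interpret QS: left_module R "Q (Suc m)" by (rule Q.left_module_P)
    from Suc obtain w v where w: "w \<in> coboundaries R P dP (Q m) (n + m)"
      and v: "v \<in> linear_maps R (P (n + m)) (Q (Suc m))"
      and eq: "\<And>x. x \<in> carrier (P (n + m)) \<Longrightarrow> G m x = w x \<oplus>\<^bsub>Q m\<^esub> dQ m (v x)"
      by blast
    \<comment> \<open>The homotopy found at stage m, composed with the differential of P, is the new
      coboundary. After subtracting it \<open>G (Suc m)\<close> takes values in cycles: the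
      contribution of \<open>w\<close> disappears because a coboundary vanishes on
      boundaries.\<close>
    define u where "u = compose (carrier (P (Suc (n + m)))) v (dP (n + m))"
    have u: "u \<in> coboundaries R P dP (Q (Suc m)) (n + Suc m)"
      using v by (auto simp: coboundaries_def u_def)
    have ul: "u \<in> linear_maps R (P (n + Suc m)) (Q (Suc m))"
      by (rule P.coboundaries_lm[OF Q.left_module_P u])
    have "G (Suc m) x \<ominus>\<^bsub>Q (Suc m)\<^esub> u x \<in> dQ (Suc m) ` carrier (Q (Suc (Suc m)))"
      if x: "x \<in> carrier (P (n + Suc m))" for x
    proof -
      note c = lm_closed[OF G(1) x] lm_closed[OF ul x]
      have x': "dP (n + m) x \<in> carrier (P (n + m))" using x P.d_closed by simp
      have "dQ m (G (Suc m) x) = dQ m ((G (Suc m) x \<ominus>\<^bsub>Q (Suc m)\<^esub> u x) \<oplus>\<^bsub>Q (Suc m)\<^esub> u x)"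
        using c by (simp add: a_minus_def QS.a_assoc QS.l_neg)
      also have "\<dots> = dQ m (G (Suc m) x \<ominus>\<^bsub>Q (Suc m)\<^esub> u x) \<oplus>\<^bsub>Q m\<^esub> dQ m (u x)"
        using c by (intro lm_add[OF Q.d_lm]) auto
      finally have "dQ m (G (Suc m) x) = dQ m (G (Suc m) x \<ominus>\<^bsub>Q (Suc m)\<^esub> u x) \<oplus>\<^bsub>Q m\<^esub> dQ m (u x)" .
      moreover have "dQ m (G (Suc m) x) = dQ m (u x)"
        using G(3)[of x m] x x' eq[OF x'] P.coboundaries_d[OF Q.left_module_P w, of x]
          Q.d_closed[OF lm_closed[OF v x']]
        by (simp add: u_def compose_def)
      ultimately have "dQ m (G (Suc m) x \<ominus>\<^bsub>Q (Suc m)\<^esub> u x) = \<zero>\<^bsub>Q m\<^esub>"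
        by (intro Qm.add_eq_self_imp_zero[of "dQ m (u x)"]) (use c lm_closed[OF Q.d_lm] in auto)
      with c show ?thesis
        unfolding Q.exact_Suc by simp
    qed
    from lift[OF G(1) ul this] u show ?case by auto
  qed
qed

text \<open>The cocycle f kills the half of the homotopy that ends with the differential of Q, and
  the other half is a coboundary already before f is applied.\<close>

lemma lifting_coboundary:
  assumes P: "resolution R P dP eP M" and Q: "resolution R Q dQ eQ M"
    and G: "lifting R P dP Q dQ eQ n g G" and g: "g \<in> coboundaries R P dP M n"
    and f: "f \<in> cocycles R Q dQ M m"
  shows "compose (carrier (P (n + m))) f (G m) \<in> coboundaries R P dP M (n + m)"
proof -
  interpret P: resolution R P dP eP M by fact
  interpret Q: resolution R Q dQ eQ M by fact
  interpret M: left_module R M by (rule Q.left_module_M)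
  obtain w v where w: "w \<in> coboundaries R P dP (Q m) (n + m)"
    and v: "v \<in> linear_maps R (P (n + m)) (Q (Suc m))"
    and eq: "\<And>x. x \<in> carrier (P (n + m)) \<Longrightarrow> G m x = w x \<oplus>\<^bsub>Q m\<^esub> dQ m (v x)"
    using lifting_null_homotopic[OF P Q G g] by blast
  have fl: "f \<in> linear_maps R (Q m) M" using f by (simp add: cocycles_def)
  have wl: "w \<in> linear_maps R (P (n + m)) (Q m)"
    by (rule P.coboundaries_lm[OF Q.left_module_P w])
  have "compose (carrier (P (n + m))) f (G m) = compose (carrier (P (n + m))) f w"
  proof
    fix x
    show "compose (carrier (P (n + m))) f (G m) x = compose (carrier (P (n + m))) f w x"
      using f eq[of x] lm_add[OF fl lm_closed[OF wl] Q.d_closed[OF lm_closed[OF v]], of x x]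
        lm_closed[OF v, of x] lm_closed[OF fl lm_closed[OF wl], of x]
      by (auto simp: compose_def cocycles_def)
  qed
  with P.coboundaries_compose[OF Q.left_module_P Q.left_module_M w fl] show ?thesis by simp
qed

lemma lifting_minus:
  assumes P: "resolution R P dP eP M" and Q: "resolution R Q dQ eQ M"
    and G: "lifting R P dP Q dQ eQ n g G" and G': "lifting R P dP Q dQ eQ n g' G'"
  shows "lifting R P dP Q dQ eQ n (\<lambda>x\<in>carrier (P n). g x \<ominus>\<^bsub>M\<^esub> g' x)
    (\<lambda>i. \<lambda>x\<in>carrier (P (n + i)). G i x \<ominus>\<^bsub>Q i\<^esub> G' i x)"
proof -
  interpret P: resolution R P dP eP M by fact
  interpret Q: resolution R Q dQ eQ M by fact
  interpret M: left_module R M by (rule Q.left_module_M)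
  note G = liftingD[OF G] and G' = liftingD[OF G']
  have minus: "f (a \<ominus>\<^bsub>N\<^esub> b) = f a \<ominus>\<^bsub>L\<^esub> f b"
    if "left_module R N" "left_module R L" "f \<in> linear_maps R N L" "a \<in> carrier N" "b \<in> carrier N"
    for f a b and N :: "('a, 'q) module" and L :: "('a, 'v, 'w) module_scheme"
  proof -
    interpret N: left_module R N by fact
    interpret L: left_module R L by fact
    have "f (\<ominus>\<^bsub>N\<^esub> b) \<oplus>\<^bsub>L\<^esub> f b = \<zero>\<^bsub>L\<^esub>"
      using lm_add[OF that(3), of "\<ominus>\<^bsub>N\<^esub> b" b] that lm_zero[OF that(1-3)] by (simp add: N.l_neg)
    then have "f (\<ominus>\<^bsub>N\<^esub> b) = \<ominus>\<^bsub>L\<^esub> f b"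
      using that lm_closed[OF that(3)] by (metis L.minus_equality N.a_inv_closed)
    then show ?thesis
      using that by (simp add: a_minus_def lm_add[OF that(3)])
  qed
  have 0: "G 0 x \<in> carrier (Q 0)" "G' 0 x \<in> carrier (Q 0)" if "x \<in> carrier (P n)" for x
    using lm_closed[OF G(1)[of 0]] lm_closed[OF G'(1)[of 0]] that by simp_all
  have S: "G (Suc i) x \<in> carrier (Q (Suc i))" "G' (Suc i) x \<in> carrier (Q (Suc i))"
    if "x \<in> carrier (P (Suc (n + i)))" for x i
    using lm_closed[OF G(1)[of "Suc i"]] lm_closed[OF G'(1)[of "Suc i"]] that by simp_all
  show ?thesis
    unfolding lifting_def
    using G(2,3) G'(2,3) P.d_closed
    by (auto intro!: lm_minus P.left_module_P Q.left_module_P G(1) G'(1)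
        simp: minus[OF Q.left_module_P Q.left_module_M Q.e_lm] minus[OF Q.left_module_P Q.left_module_P Q.d_lm]
        0 S)
qed

text \<open>The difference of two lifts lifts the difference of the two cocycles, which is a
  coboundary by assumption. This single statement yields independence of the lift, independence of
  the representative, and the fact that round trips between two resolutions are the identity on
  Ext.\<close>

lemma lifting_unique:
  assumes P: "resolution R P dP eP M" and Q: "resolution R Q dQ eQ M"
    and G: "lifting R P dP Q dQ eQ n g G" and G': "lifting R P dP Q dQ eQ n g' G'"
    and g: "(\<lambda>x\<in>carrier (P n). g x \<ominus>\<^bsub>M\<^esub> g' x) \<in> coboundaries R P dP M n"
    and f: "f \<in> cocycles R Q dQ M m"
  shows "(\<lambda>x\<in>carrier (P (n + m)). f (G m x) \<ominus>\<^bsub>M\<^esub> f (G' m x)) \<in> coboundaries R P dP M (n + m)"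
proof -
  interpret P: resolution R P dP eP M by fact
  interpret Q: resolution R Q dQ eQ M by fact
  interpret M: left_module R M by (rule Q.left_module_M)
  interpret Qm: left_module R "Q m" by (rule Q.left_module_P)
  have fl: "f \<in> linear_maps R (Q m) M" using f by (simp add: cocycles_def)
  have "f (a \<ominus>\<^bsub>Q m\<^esub> b) = f a \<ominus>\<^bsub>M\<^esub> f b" if "a \<in> carrier (Q m)" "b \<in> carrier (Q m)" for a b
  proof -
    have "f (\<ominus>\<^bsub>Q m\<^esub> b) \<oplus>\<^bsub>M\<^esub> f b = \<zero>\<^bsub>M\<^esub>"
      using lm_add[OF fl, of "\<ominus>\<^bsub>Q m\<^esub> b" b] that lm_zero[OF Q.left_module_P Q.left_module_M fl]
      by (simp add: Qm.l_neg)
    then have "f (\<ominus>\<^bsub>Q m\<^esub> b) = \<ominus>\<^bsub>M\<^esub> f b"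
      using that lm_closed[OF fl] by (metis M.minus_equality Qm.a_inv_closed)
    then show ?thesis
      using that by (simp add: a_minus_def lm_add[OF fl])
  qed
  then have "(\<lambda>x\<in>carrier (P (n + m)). f (G m x) \<ominus>\<^bsub>M\<^esub> f (G' m x)) =
      compose (carrier (P (n + m))) f (\<lambda>x\<in>carrier (P (n + m)). G m x \<ominus>\<^bsub>Q m\<^esub> G' m x)"
    using lm_closed[OF liftingD(1)[OF G]] lm_closed[OF liftingD(1)[OF G']]
    by (auto simp: compose_def fun_eq_iff)
  then show ?thesis
    using lifting_coboundary[OF P Q lifting_minus[OF P Q G G'] g f] by simp
qed

lemma lifting_id:
  assumes "resolution R P d e M"
  shows "lifting R P d P d e 0 e (\<lambda>i. \<lambda>x\<in>carrier (P i). x)"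
proof -
  interpret P: resolution R P d e M by fact
  show ?thesis
    using lm_id[OF P.left_module_P] P.d_closed by (auto simp: lifting_def)
qed

lemma lifting_compose_left:
  assumes P: "resolution R P dP eP M" and S: "resolution R S dS eS M" and Q: "resolution R Q dQ eQ M"
    and B: "lifting R S dS Q dQ eQ 0 eS B" and G: "lifting R P dP S dS eS n g G"
  shows "lifting R P dP Q dQ eQ n g (\<lambda>i. compose (carrier (P (n + i))) (B i) (G i))"
proof -
  interpret P: resolution R P dP eP M by fact
  interpret S: resolution R S dS eS M by fact
  note B = liftingD[OF B, simplified] and G = liftingD[OF G]
  have 0: "G 0 x \<in> carrier (S 0)" if "x \<in> carrier (P n)" for x
    using lm_closed[OF G(1)[of 0]] that by simp
  have Su: "G (Suc i) x \<in> carrier (S (Suc i))" if "x \<in> carrier (P (Suc (n + i)))" for x i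
    using lm_closed[OF G(1)[of "Suc i"]] that by simp
  show ?thesis
    unfolding lifting_def
  proof (intro conjI allI ballI)
    show "compose (carrier (P (n + i))) (B i) (G i) \<in> linear_maps R (P (n + i)) (Q i)" for i
      by (rule lm_compose[OF P.left_module_P G(1) B(1)])
  qed (use 0 Su B(2,3) G(2,3) P.d_closed in \<open>simp_all add: compose_def\<close>)
qed

lemma lifting_compose_right:
  assumes P: "resolution R P dP eP M" and S: "resolution R S dS eS M"
    and B: "lifting R P dP S dS eS 0 eP B" and G: "lifting R S dS Q dQ eQ n g G"
  shows "lifting R P dP Q dQ eQ n (compose (carrier (P n)) g (B n))
    (\<lambda>i. compose (carrier (P (n + i))) (G i) (B (n + i)))"
proof -
  interpret P: resolution R P dP eP M by fact
  interpret S: resolution R S dS eS M by fact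
  note B = liftingD[OF B, simplified] and G = liftingD[OF G]
  have c: "B i x \<in> carrier (S i)" if "x \<in> carrier (P i)" for i x
    using lm_closed[OF B(1)] that .
  show ?thesis
    unfolding lifting_def
  proof (intro conjI allI ballI)
    show "compose (carrier (P (n + i))) (G i) (B (n + i)) \<in> linear_maps R (P (n + i)) (Q i)" for i
      by (rule lm_compose[OF P.left_module_P B(1) G(1)])
  qed (use c B(2,3) G(2,3) P.d_closed in \<open>simp_all add: compose_def\<close>)
qed


section \<open>Ext groups\<close>

context resolution
begin

abbreviation "ecls \<equiv> ext_class R P d M"

lemma ext_class_eq: "ecls n f = (\<lambda>b. \<lambda>x\<in>carrier (P n). b x \<oplus>\<^bsub>M\<^esub> f x) ` coboundaries R P d M n"
  by (auto simp: ext_class_def r_coset_def hom_group_def)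

lemma cocycles_lm: "f \<in> cocycles R P d M n \<Longrightarrow> f \<in> linear_maps R (P n) M"
  by (simp add: cocycles_def)

lemma ext_class_self:
  assumes "f \<in> cocycles R P d M n"
  shows "f \<in> ecls n f"
proof -
  interpret M: left_module R M by (rule left_module_M)
  have "f = (\<lambda>x\<in>carrier (P n). (\<lambda>x\<in>carrier (P n). \<zero>\<^bsub>M\<^esub>) x \<oplus>\<^bsub>M\<^esub> f x)"
    using cocycles_lm[OF assms] lm_closed[OF cocycles_lm[OF assms]]
    by (auto simp: linear_maps_def PiE_iff extensional_def)
  then show ?thesis
    unfolding ext_class_eq using coboundaries_zero[OF left_module_M, of n] by blast
qed

lemma ext_class_eq_iff:
  assumes f: "f \<in> cocycles R P d M n" and g: "g \<in> cocycles R P d M n"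
  shows "ecls n f = ecls n g \<longleftrightarrow> (\<lambda>x\<in>carrier (P n). f x \<ominus>\<^bsub>M\<^esub> g x) \<in> coboundaries R P d M n"
proof -
  interpret M: left_module R M by (rule left_module_M)
  have fc: "f x \<in> carrier M" and gc: "g x \<in> carrier M" if "x \<in> carrier (P n)" for x
    using lm_closed[OF cocycles_lm[OF f] that] lm_closed[OF cocycles_lm[OF g] that] by auto
  have bc: "b x \<in> carrier M" if "b \<in> coboundaries R P d M n" "x \<in> carrier (P n)" for b x
    using lm_closed[OF coboundaries_lm[OF left_module_M that(1)] that(2)] .
  let ?h = "\<lambda>x\<in>carrier (P n). f x \<ominus>\<^bsub>M\<^esub> g x"
  show ?thesis
  proof
    assume eq: "ecls n f = ecls n g"
    have "f \<in> ecls n g" using ext_class_self[OF f] by (simp only: eq)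
    then obtain b where b: "f = (\<lambda>x\<in>carrier (P n). b x \<oplus>\<^bsub>M\<^esub> g x)" "b \<in> coboundaries R P d M n"
      unfolding ext_class_eq by (rule imageE)
    have "?h = b"
    proof (rule lm_eqI)
      show "?h x = b x" if "x \<in> carrier (P n)" for x
        using that gc bc[OF b(2)] by (simp add: b(1) a_minus_def M.a_assoc M.r_neg)
      show "?h \<in> linear_maps R (P n) M"
        by (rule lm_minus[OF left_module_P left_module_M cocycles_lm[OF f] cocycles_lm[OF g]])
      show "b \<in> linear_maps R (P n) M"
        by (rule coboundaries_lm[OF left_module_M b(2)])
    qed
    with b show "?h \<in> coboundaries R P d M n" by simp
  next
    assume h: "?h \<in> coboundaries R P d M n"
    show "ecls n f = ecls n g"
    proof
      show "ecls n f \<subseteq> ecls n g"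
      proof
        fix u assume "u \<in> ecls n f"
        then obtain b where b: "b \<in> coboundaries R P d M n" "u = (\<lambda>x\<in>carrier (P n). b x \<oplus>\<^bsub>M\<^esub> f x)"
          unfolding ext_class_eq by blast
        have "u = (\<lambda>x\<in>carrier (P n). (\<lambda>x\<in>carrier (P n). b x \<oplus>\<^bsub>M\<^esub> ?h x) x \<oplus>\<^bsub>M\<^esub> g x)"
          unfolding b(2)
          by (intro restrict_ext) (simp add: fc gc bc[OF b(1)] a_minus_def M.a_assoc M.l_neg)
        with coboundaries_plus[OF left_module_M b(1) h] show "u \<in> ecls n g"
          unfolding ext_class_eq by blast
      qed
      show "ecls n g \<subseteq> ecls n f"
      proof
        have cancel: "\<ominus>\<^bsub>M\<^esub> s \<oplus>\<^bsub>M\<^esub> (t \<oplus>\<^bsub>M\<^esub> s) = t" if "s \<in> carrier M" "t \<in> carrier M" for s t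
          using that by (simp add: M.a_lcomm[of _ t] M.l_neg)
        fix u assume "u \<in> ecls n g"
        then obtain b where b: "b \<in> coboundaries R P d M n" "u = (\<lambda>x\<in>carrier (P n). b x \<oplus>\<^bsub>M\<^esub> g x)"
          unfolding ext_class_eq by blast
        have "u = (\<lambda>x\<in>carrier (P n). (\<lambda>x\<in>carrier (P n). b x \<ominus>\<^bsub>M\<^esub> ?h x) x \<oplus>\<^bsub>M\<^esub> f x)"
          unfolding b(2)
          by (intro restrict_ext)
             (simp add: fc gc bc[OF b(1)] a_minus_def M.minus_add M.a_assoc M.l_neg cancel)
        with coboundaries_minus[OF left_module_M b(1) h] show "u \<in> ecls n f"
          unfolding ext_class_eq by blast
      qed
    qed
  qed
qed

lemma cocycles_plus:
  assumes "f \<in> cocycles R P d M n" "g \<in> cocycles R P d M n"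
  shows "(\<lambda>x\<in>carrier (P n). f x \<oplus>\<^bsub>M\<^esub> g x) \<in> cocycles R P d M n"
proof -
  interpret M: left_module R M by (rule left_module_M)
  show ?thesis
    using assms lm_plus[OF left_module_P left_module_M] d_closed by (simp add: cocycles_def)
qed

lemma ext_class_mem:
  assumes f: "f \<in> cocycles R P d M n" and g: "g \<in> ecls n f"
  shows "g \<in> cocycles R P d M n" "ecls n g = ecls n f"
    "(\<lambda>x\<in>carrier (P n). g x \<ominus>\<^bsub>M\<^esub> f x) \<in> coboundaries R P d M n"
proof -
  interpret M: left_module R M by (rule left_module_M)
  obtain b where b: "b \<in> coboundaries R P d M n" "g = (\<lambda>x\<in>carrier (P n). b x \<oplus>\<^bsub>M\<^esub> f x)"
    using g unfolding ext_class_eq by blast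
  show g': "g \<in> cocycles R P d M n"
    unfolding b(2) by (rule cocycles_plus[OF coboundaries_cocycles[OF left_module_M b(1)] f])
  have bl: "b \<in> linear_maps R (P n) M"
    by (rule coboundaries_lm[OF left_module_M b(1)])
  have "(\<lambda>x\<in>carrier (P n). g x \<ominus>\<^bsub>M\<^esub> f x) = b"
  proof (rule lm_eqI)
    show "(\<lambda>x\<in>carrier (P n). g x \<ominus>\<^bsub>M\<^esub> f x) x = b x" if "x \<in> carrier (P n)" for x
      using that lm_closed[OF bl that] lm_closed[OF cocycles_lm[OF f] that]
      by (simp add: b(2) a_minus_def M.a_assoc M.r_neg)
  qed (use lm_minus[OF left_module_P left_module_M cocycles_lm[OF g'] cocycles_lm[OF f]] bl in auto)
  with b show "(\<lambda>x\<in>carrier (P n). g x \<ominus>\<^bsub>M\<^esub> f x) \<in> coboundaries R P d M n" by simp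
  then show "ecls n g = ecls n f"
    using ext_class_eq_iff[OF g' f] by blast
qed

lemma Ext_carrier: "carrier (Ext R P d M n) = ecls n ` cocycles R P d M n"
  by (auto simp: Ext_def FactGroup_def RCOSETS_def ext_class_def r_coset_def)

lemma Ext_one: "\<one>\<^bsub>Ext R P d M n\<^esub> = ecls n (\<lambda>x\<in>carrier (P n). \<zero>\<^bsub>M\<^esub>)"
proof -
  interpret M: left_module R M by (rule left_module_M)
  have "(\<lambda>x\<in>carrier (P n). b x \<oplus>\<^bsub>M\<^esub> (\<lambda>x\<in>carrier (P n). \<zero>\<^bsub>M\<^esub>) x) = b"
    if "b \<in> coboundaries R P d M n" for b
    using coboundaries_lm[OF left_module_M that] lm_closed[OF coboundaries_lm[OF left_module_M that]]
    by (auto simp: linear_maps_def PiE_iff extensional_def fun_eq_iff)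
  then have "ecls n (\<lambda>x\<in>carrier (P n). \<zero>\<^bsub>M\<^esub>) = coboundaries R P d M n"
    unfolding ext_class_eq by (simp cong: image_cong)
  then show ?thesis
    by (simp add: Ext_def FactGroup_def)
qed

lemma Ext_mult:
  assumes f: "f \<in> cocycles R P d M n" and g: "g \<in> cocycles R P d M n"
  shows "ecls n f \<otimes>\<^bsub>Ext R P d M n\<^esub> ecls n g = ecls n (\<lambda>x\<in>carrier (P n). f x \<oplus>\<^bsub>M\<^esub> g x)"
proof -
  interpret M: left_module R M by (rule left_module_M)
  have fc: "f x \<in> carrier M" and gc: "g x \<in> carrier M" if "x \<in> carrier (P n)" for x
    using lm_closed[OF cocycles_lm[OF f] that] lm_closed[OF cocycles_lm[OF g] that] by auto
  have bc: "b x \<in> carrier M" if "b \<in> coboundaries R P d M n" "x \<in> carrier (P n)" for b x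
    using lm_closed[OF coboundaries_lm[OF left_module_M that(1)] that(2)] .
  have "ecls n f \<otimes>\<^bsub>Ext R P d M n\<^esub> ecls n g =
      (\<Union>u\<in>ecls n f. \<Union>v\<in>ecls n g. {\<lambda>x\<in>carrier (P n). u x \<oplus>\<^bsub>M\<^esub> v x})"
    by (simp add: Ext_def FactGroup_def set_mult_def hom_group_def)
  also have "\<dots> = ecls n (\<lambda>x\<in>carrier (P n). f x \<oplus>\<^bsub>M\<^esub> g x)"
  proof (intro equalityI subsetI)
    fix w assume "w \<in> (\<Union>u\<in>ecls n f. \<Union>v\<in>ecls n g. {\<lambda>x\<in>carrier (P n). u x \<oplus>\<^bsub>M\<^esub> v x})"
    then obtain b c where b: "b \<in> coboundaries R P d M n" and c: "c \<in> coboundaries R P d M n"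
      and w: "w = (\<lambda>x\<in>carrier (P n). (b x \<oplus>\<^bsub>M\<^esub> f x) \<oplus>\<^bsub>M\<^esub> (c x \<oplus>\<^bsub>M\<^esub> g x))"
      unfolding ext_class_eq by (auto cong: restrict_cong)
    have "w = (\<lambda>x\<in>carrier (P n). (\<lambda>x\<in>carrier (P n). b x \<oplus>\<^bsub>M\<^esub> c x) x \<oplus>\<^bsub>M\<^esub> (\<lambda>x\<in>carrier (P n). f x \<oplus>\<^bsub>M\<^esub> g x) x)"
      unfolding w by (intro restrict_ext) (simp add: fc gc bc[OF b] bc[OF c] M.a_ac)
    then show "w \<in> ecls n (\<lambda>x\<in>carrier (P n). f x \<oplus>\<^bsub>M\<^esub> g x)"
      unfolding ext_class_eq using coboundaries_plus[OF left_module_M b c] by blast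
  next
    fix w assume "w \<in> ecls n (\<lambda>x\<in>carrier (P n). f x \<oplus>\<^bsub>M\<^esub> g x)"
    then obtain b where b: "b \<in> coboundaries R P d M n"
      and w: "w = (\<lambda>x\<in>carrier (P n). b x \<oplus>\<^bsub>M\<^esub> (\<lambda>x\<in>carrier (P n). f x \<oplus>\<^bsub>M\<^esub> g x) x)"
      unfolding ext_class_eq by blast
    have "w = (\<lambda>x\<in>carrier (P n). (\<lambda>x\<in>carrier (P n). b x \<oplus>\<^bsub>M\<^esub> f x) x \<oplus>\<^bsub>M\<^esub> g x)"
      unfolding w by (intro restrict_ext) (simp add: fc gc bc[OF b] M.a_ac)
    moreover have "(\<lambda>x\<in>carrier (P n). b x \<oplus>\<^bsub>M\<^esub> f x) \<in> ecls n f"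
      unfolding ext_class_eq using b by blast
    ultimately show "w \<in> (\<Union>u\<in>ecls n f. \<Union>v\<in>ecls n g. {\<lambda>x\<in>carrier (P n). u x \<oplus>\<^bsub>M\<^esub> v x})"
      using ext_class_self[OF g] by blast
  qed
  finally show ?thesis .
qed

lemma Ext_comm_group: "comm_group (Ext R P d M n)"
proof -
  interpret M: left_module R M by (rule left_module_M)
  have z: "(\<lambda>x\<in>carrier (P n). \<zero>\<^bsub>M\<^esub>) \<in> cocycles R P d M n"
    using coboundaries_cocycles[OF left_module_M coboundaries_zero[OF left_module_M]] .
  have neg: "(\<lambda>x\<in>carrier (P n). (\<lambda>x\<in>carrier (P n). \<zero>\<^bsub>M\<^esub>) x \<ominus>\<^bsub>M\<^esub> f x) \<in> cocycles R P d M n"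
    if "f \<in> cocycles R P d M n" for f
    using that lm_minus[OF left_module_P left_module_M cocycles_lm[OF z] cocycles_lm[OF that]] d_closed
    by (simp add: cocycles_def a_minus_def)
  show ?thesis
  proof (rule comm_groupI)
    fix U assume "U \<in> carrier (Ext R P d M n)"
    then obtain f where f: "f \<in> cocycles R P d M n" "U = ecls n f" by (auto simp: Ext_carrier)
    note fc = lm_closed[OF cocycles_lm[OF f(1)]]
    have 0: "(\<lambda>x\<in>carrier (P n). (\<lambda>x\<in>carrier (P n). \<zero>\<^bsub>M\<^esub>) x \<oplus>\<^bsub>M\<^esub> f x) = f"
      using cocycles_lm[OF f(1)] fc by (auto simp: linear_maps_def PiE_iff extensional_def fun_eq_iff)
    then show "\<one>\<^bsub>Ext R P d M n\<^esub> \<otimes>\<^bsub>Ext R P d M n\<^esub> U = U"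
      by (simp only: f(2) Ext_one Ext_mult[OF z f(1)])
    let ?g = "\<lambda>x\<in>carrier (P n). (\<lambda>x\<in>carrier (P n). \<zero>\<^bsub>M\<^esub>) x \<ominus>\<^bsub>M\<^esub> f x"
    have "(\<lambda>x\<in>carrier (P n). ?g x \<oplus>\<^bsub>M\<^esub> f x) = (\<lambda>x\<in>carrier (P n). \<zero>\<^bsub>M\<^esub>)"
      using fc by (auto simp: fun_eq_iff a_minus_def M.l_neg)
    then have "ecls n ?g \<otimes>\<^bsub>Ext R P d M n\<^esub> U = \<one>\<^bsub>Ext R P d M n\<^esub>"
      by (simp only: f(2) Ext_one Ext_mult[OF neg[OF f(1)] f(1)])
    then show "\<exists>V\<in>carrier (Ext R P d M n). V \<otimes>\<^bsub>Ext R P d M n\<^esub> U = \<one>\<^bsub>Ext R P d M n\<^esub>"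
      using neg[OF f(1)] by (auto simp: Ext_carrier)
  next
    show "\<one>\<^bsub>Ext R P d M n\<^esub> \<in> carrier (Ext R P d M n)"
      using z by (auto simp: Ext_carrier Ext_one)
  next
    fix U V assume "U \<in> carrier (Ext R P d M n)" "V \<in> carrier (Ext R P d M n)"
    then obtain f g where f: "f \<in> cocycles R P d M n" "U = ecls n f"
      and g: "g \<in> cocycles R P d M n" "V = ecls n g" by (auto simp: Ext_carrier)
    show "U \<otimes>\<^bsub>Ext R P d M n\<^esub> V \<in> carrier (Ext R P d M n)"
      using f g cocycles_plus by (auto simp: Ext_carrier Ext_mult)
    have "(\<lambda>x\<in>carrier (P n). f x \<oplus>\<^bsub>M\<^esub> g x) = (\<lambda>x\<in>carrier (P n). g x \<oplus>\<^bsub>M\<^esub> f x)"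
      using lm_closed[OF cocycles_lm[OF f(1)]] lm_closed[OF cocycles_lm[OF g(1)]]
      by (auto simp: fun_eq_iff M.a_comm)
    then show "U \<otimes>\<^bsub>Ext R P d M n\<^esub> V = V \<otimes>\<^bsub>Ext R P d M n\<^esub> U"
      using f g by (simp add: Ext_mult)
    fix W assume "W \<in> carrier (Ext R P d M n)"
    then obtain h where h: "h \<in> cocycles R P d M n" "W = ecls n h" by (auto simp: Ext_carrier)
    have "(\<lambda>x\<in>carrier (P n). (\<lambda>x\<in>carrier (P n). f x \<oplus>\<^bsub>M\<^esub> g x) x \<oplus>\<^bsub>M\<^esub> h x) =
        (\<lambda>x\<in>carrier (P n). f x \<oplus>\<^bsub>M\<^esub> (\<lambda>x\<in>carrier (P n). g x \<oplus>\<^bsub>M\<^esub> h x) x)"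
      using lm_closed[OF cocycles_lm[OF f(1)]] lm_closed[OF cocycles_lm[OF g(1)]] lm_closed[OF cocycles_lm[OF h(1)]]
      by (auto simp: fun_eq_iff M.a_assoc)
    then show "U \<otimes>\<^bsub>Ext R P d M n\<^esub> V \<otimes>\<^bsub>Ext R P d M n\<^esub> W = U \<otimes>\<^bsub>Ext R P d M n\<^esub> (V \<otimes>\<^bsub>Ext R P d M n\<^esub> W)"
      using f g h by (simp only: Ext_mult cocycles_plus)
  qed
qed

end


section \<open>The Koszul bimodule resolution\<close>

text \<open>The exponents of the monomials X^i Y^j of degree n. They index the basis of the n-th
  term of the Koszul resolution, which therefore has rank n + 1.\<close>

definition KI :: "nat \<Rightarrow> (nat \<times> nat) set" where "KI n = {(i, j). i + j = n}"

lemma KI_iff [simp]: "(i, j) \<in> KI n \<longleftrightarrow> i + j = n"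
  by (simp add: KI_def)

lemma finite_KI [simp]: "finite (KI n)"
  by (rule finite_subset[of _ "{..n} \<times> {..n}"]) (auto simp: KI_def)

text \<open>Summation by parts: the two shifts i to i + 1 and j to j + 1 are moved from one factor
  of a pairing to the other. The zero branches stand for the monomials on the edge that have no
  predecessor.\<close>

lemma sum_KI_shift:
  fixes f g :: "nat \<Rightarrow> nat \<Rightarrow> 'b::comm_monoid_add"
  shows "(\<Sum>(i, j)\<in>KI n. f i j + g i j) =
    (\<Sum>(i, j)\<in>KI (Suc n). (case i of 0 \<Rightarrow> 0 | Suc a \<Rightarrow> f a j) + (case j of 0 \<Rightarrow> 0 | Suc b \<Rightarrow> g i b))"
proof -
  have m: "(Suc c, b) \<in> (\<lambda>(i, j). (Suc i, j)) ` KI n \<longleftrightarrow> c + b = n"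
    "(b, Suc c) \<in> (\<lambda>(i, j). (i, Suc j)) ` KI n \<longleftrightarrow> b + c = n"
    "(0, b) \<notin> (\<lambda>(i, j). (Suc i, j)) ` KI n" "(b, 0) \<notin> (\<lambda>(i, j). (i, Suc j)) ` KI n" for b c
    by (auto simp: image_iff split_beta Bex_def KI_def)
  have K: "KI (Suc n) = insert (0, Suc n) ((\<lambda>(i, j). (Suc i, j)) ` KI n)"
    "KI (Suc n) = insert (Suc n, 0) ((\<lambda>(i, j). (i, Suc j)) ` KI n)"
  proof -
    have "(a, b) \<in> KI (Suc n) \<longleftrightarrow> (a, b) \<in> insert (0, Suc n) ((\<lambda>(i, j). (Suc i, j)) ` KI n)" for a b
      by (cases a) (simp_all only: m insert_iff KI_iff, auto)
    then show "KI (Suc n) = insert (0, Suc n) ((\<lambda>(i, j). (Suc i, j)) ` KI n)" by auto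
    have "(a, b) \<in> KI (Suc n) \<longleftrightarrow> (a, b) \<in> insert (Suc n, 0) ((\<lambda>(i, j). (i, Suc j)) ` KI n)" for a b
      by (cases b) (simp_all only: m insert_iff KI_iff, auto)
    then show "KI (Suc n) = insert (Suc n, 0) ((\<lambda>(i, j). (i, Suc j)) ` KI n)" by auto
  qed
  have 1: "(\<Sum>(i, j)\<in>KI (Suc n). case i of 0 \<Rightarrow> 0 | Suc a \<Rightarrow> f a j) = (\<Sum>(i, j)\<in>KI n. f i j)"
    unfolding K(1) by (subst sum.insert, simp, rule m, subst sum.reindex) (auto simp: inj_on_def intro!: sum.cong)
  have 2: "(\<Sum>(i, j)\<in>KI (Suc n). case j of 0 \<Rightarrow> 0 | Suc b \<Rightarrow> g i b) = (\<Sum>(i, j)\<in>KI n. g i j)"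
    unfolding K(2) by (subst sum.insert, simp, rule m, subst sum.reindex) (auto simp: inj_on_def intro!: sum.cong)
  show ?thesis
    by (simp only: split_def sum.distrib 1[unfolded split_def] 2[unfolded split_def])
qed

text \<open>Pairs of exponents are grouped by their sum, as in collecting the coefficients of a
  product of polynomials.\<close>

lemma sum_KI_add:
  fixes f :: "nat \<times> nat \<Rightarrow> nat \<times> nat \<Rightarrow> 'b::comm_monoid_add"
  shows "(\<Sum>p\<in>KI m. \<Sum>p'\<in>KI n. f p p') =
    (\<Sum>r\<in>KI (n + m). \<Sum>(p, p')\<in>{(p, p') \<in> KI m \<times> KI n. (fst p + fst p', snd p + snd p') = r}. f p p')"
proof -
  have "(\<Sum>r\<in>KI (n + m). \<Sum>(p, p')\<in>{x \<in> KI m \<times> KI n. (\<lambda>(p, p'). (fst p + fst p', snd p + snd p')) x = r}. f p p')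
      = (\<Sum>(p, p')\<in>KI m \<times> KI n. f p p')"
    by (rule sum.group) auto
  moreover have "{(p, p') \<in> KI m \<times> KI n. (fst p + fst p', snd p + snd p') = r} =
      {x \<in> KI m \<times> KI n. (\<lambda>(p, p'). (fst p + fst p', snd p + snd p')) x = r}" for r
    by auto
  ultimately show ?thesis
    by (simp only: sum.cartesian_product)
qed

text \<open>Read off from the ring \<open>env q\<close>, which spares an expansion in sixteen
  coordinates.\<close>

lemma llmul_assoc: "llmul q (llmul q U V) W = llmul q U (llmul q V W)"
proof -
  interpret ring "env q" by (rule ring_env)
  have "ecoord q (env_of q U \<otimes>\<^bsub>env q\<^esub> env_of q V \<otimes>\<^bsub>env q\<^esub> env_of q W) =
      ecoord q (env_of q U \<otimes>\<^bsub>env q\<^esub> (env_of q V \<otimes>\<^bsub>env q\<^esub> env_of q W))"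
    by (simp only: m_assoc env_of_carrier)
  then show ?thesis
    by (simp only: env_of_hom ecoord_env_of)
qed

lemma llmul_sum:
  "llmul q (sum f A) V = (\<Sum>i\<in>A. llmul q (f i) V)" "llmul q U (sum f A) = (\<Sum>i\<in>A. llmul q U (f i))"
  by (induction A rule: infinite_finite_induct) (simp_all add: llmul_add)

lemma act_sum: "act q (sum f A) m = (\<Sum>i\<in>A. act q (f i) m)" "act q U (sum g A) = (\<Sum>i\<in>A. act q U (g i))"
  by (induction A rule: infinite_finite_induct) (simp_all add: act_add)

lemma act_lscale: "act q U (lscale c m) = lscale c (act q U m)"
  by (simp add: act_def lam.scale_right_distrib)

section \<open>The terms and the differential of the Koszul resolution\<close>

abbreviation KQ :: "'k::field \<Rightarrow> nat \<Rightarrow>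
    ((((letter, 'k) free_algebra set \<times> (letter, 'k) free_algebra set) \<Rightarrow>\<^sub>0 'k) set,
     nat \<times> nat \<Rightarrow> (((letter, 'k) free_algebra set \<times> (letter, 'k) free_algebra set) \<Rightarrow>\<^sub>0 'k) set) module"
  where "KQ q n \<equiv> free_module (env q) (KI n)"

definition coords :: "'k::field \<Rightarrow> (nat \<times> nat \<Rightarrow> (((letter, 'k) free_algebra set \<times> (letter, 'k) free_algebra set) \<Rightarrow>\<^sub>0 'k) set)
    \<Rightarrow> nat \<Rightarrow> nat \<Rightarrow> 'k lam lam"
  where "coords q v i j = ecoord q (v (i, j))"

definition of_coords :: "'k::field \<Rightarrow> nat \<Rightarrow> (nat \<Rightarrow> nat \<Rightarrow> 'k lam lam)
    \<Rightarrow> nat \<times> nat \<Rightarrow> (((letter, 'k) free_algebra set \<times> (letter, 'k) free_algebra set) \<Rightarrow>\<^sub>0 'k) set"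
  where "of_coords q n V = (\<lambda>(i, j). if i + j = n then env_of q (V i j) else \<zero>\<^bsub>env q\<^esub>)"

lemma left_module_KQ: "left_module (env q) (KQ q n)"
  by (rule left_module_free_module[OF ring_env])

lemma KQ_carrier: "v \<in> carrier (KQ q n) \<longleftrightarrow>
    (\<forall>i j. i + j = n \<longrightarrow> v (i, j) \<in> carrier (env q)) \<and> (\<forall>i j. i + j \<noteq> n \<longrightarrow> v (i, j) = \<zero>\<^bsub>env q\<^esub>)"
proof -
  have "finite {p. v p \<noteq> \<zero>\<^bsub>env q\<^esub>}" if "\<forall>i j. i + j \<noteq> n \<longrightarrow> v (i, j) = \<zero>\<^bsub>env q\<^esub>"
    by (rule finite_subset[OF _ finite_KI[of n]]) (use that in auto)
  then show ?thesis
    by (auto simp: free_module_def)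
qed

lemma KQ_closed: "v \<in> carrier (KQ q n) \<Longrightarrow> v (i, j) \<in> carrier (env q)"
  using ring.ring_simprules(2)[OF ring_env, of q] by (cases "i + j = n") (auto simp: KQ_carrier)

lemma of_coords_carrier [simp]: "of_coords q n V \<in> carrier (KQ q n)"
  by (simp add: KQ_carrier of_coords_def)

lemma coords_of_coords [simp]: "coords q (of_coords q n V) i j = (if i + j = n then V i j else 0)"
  by (simp add: coords_def of_coords_def ecoord_hom)

lemma of_coords_coords [simp]:
  assumes "v \<in> carrier (KQ q n)"
  shows "of_coords q n (coords q v) = v"
  using assms by (auto simp: of_coords_def coords_def KQ_carrier fun_eq_iff)

lemma coords_inj:
  assumes "v \<in> carrier (KQ q n)" "w \<in> carrier (KQ q n)" "\<And>i j. i + j = n \<Longrightarrow> coords q v i j = coords q w i j"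
  shows "v = w"
proof -
  have "of_coords q n (coords q v) = of_coords q n (coords q w)"
    using assms(3) by (auto simp: of_coords_def fun_eq_iff)
  with assms(1,2) show ?thesis by simp
qed

lemma coords_add:
  "v \<in> carrier (KQ q n) \<Longrightarrow> w \<in> carrier (KQ q n) \<Longrightarrow>
    coords q (v \<oplus>\<^bsub>KQ q n\<^esub> w) i j = coords q v i j + coords q w i j"
  using KQ_closed[of v q n i j] KQ_closed[of w q n i j]
  by (simp add: coords_def free_module_def[of "env q" "KI n"] ecoord_hom)

lemma coords_smult:
  "r \<in> carrier (env q) \<Longrightarrow> v \<in> carrier (KQ q n) \<Longrightarrow>
    coords q (r \<odot>\<^bsub>KQ q n\<^esub> v) i j = llmul q (ecoord q r) (coords q v i j)"
  using KQ_closed[of v q n i j] by (simp add: coords_def free_module_def[of "env q" "KI n"] ecoord_hom)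

lemma coords_zero: "coords q \<zero>\<^bsub>KQ q n\<^esub> i j = 0"
  by (simp add: coords_def free_module_def ecoord_hom)

lemma coords_basis: "i + j = n \<Longrightarrow> coords q (basis_vector (env q) (i, j)) a b = (if a = i \<and> b = j then tens lone lone else 0)"
  by (simp add: coords_def basis_vector_def ecoord_hom)

definition llinear :: "'k::field \<Rightarrow> ((nat \<Rightarrow> nat \<Rightarrow> 'k lam lam) \<Rightarrow> nat \<Rightarrow> nat \<Rightarrow> 'k lam lam) \<Rightarrow> bool"
  where "llinear q \<Phi> \<longleftrightarrow>
    (\<forall>V W i j. \<Phi> (\<lambda>i j. V i j + W i j) i j = \<Phi> V i j + \<Phi> W i j) \<and>
    (\<forall>U V i j. \<Phi> (\<lambda>i j. llmul q U (V i j)) i j = llmul q U (\<Phi> V i j))"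

definition kmap :: "'k::field \<Rightarrow> nat \<Rightarrow> nat \<Rightarrow> ((nat \<Rightarrow> nat \<Rightarrow> 'k lam lam) \<Rightarrow> nat \<Rightarrow> nat \<Rightarrow> 'k lam lam)
    \<Rightarrow> (nat \<times> nat \<Rightarrow> (((letter, 'k) free_algebra set \<times> (letter, 'k) free_algebra set) \<Rightarrow>\<^sub>0 'k) set)
    \<Rightarrow> (nat \<times> nat \<Rightarrow> (((letter, 'k) free_algebra set \<times> (letter, 'k) free_algebra set) \<Rightarrow>\<^sub>0 'k) set)"
  where "kmap q m n \<Phi> = (\<lambda>v\<in>carrier (KQ q m). of_coords q n (\<Phi> (coords q v)))"

lemma coords_kmap:
  "v \<in> carrier (KQ q m) \<Longrightarrow> coords q (kmap q m n \<Phi> v) i j = (if i + j = n then \<Phi> (coords q v) i j else 0)"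
  by (simp add: kmap_def)

lemma kmap_lm:
  assumes "llinear q \<Phi>"
  shows "kmap q m n \<Phi> \<in> linear_maps (env q) (KQ q m) (KQ q n)"
proof -
  interpret m: left_module "env q" "KQ q m" by (rule left_module_KQ)
  interpret n: left_module "env q" "KQ q n" by (rule left_module_KQ)
  have c: "kmap q m n \<Phi> v \<in> carrier (KQ q n)" if "v \<in> carrier (KQ q m)" for v
    using that by (simp add: kmap_def)
  have "kmap q m n \<Phi> (v \<oplus>\<^bsub>KQ q m\<^esub> w) = kmap q m n \<Phi> v \<oplus>\<^bsub>KQ q n\<^esub> kmap q m n \<Phi> w"
    if v: "v \<in> carrier (KQ q m)" and w: "w \<in> carrier (KQ q m)" for v w
  proof (rule coords_inj)
    have "coords q (v \<oplus>\<^bsub>KQ q m\<^esub> w) = (\<lambda>i j. coords q v i j + coords q w i j)"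
      using coords_add[OF v w] by (simp add: fun_eq_iff)
    then show "coords q (kmap q m n \<Phi> (v \<oplus>\<^bsub>KQ q m\<^esub> w)) i j = coords q (kmap q m n \<Phi> v \<oplus>\<^bsub>KQ q n\<^esub> kmap q m n \<Phi> w) i j"
      if "i + j = n" for i j
      using assms v w that by (simp add: coords_add c coords_kmap llinear_def)
  qed (use v w c in simp_all)
  moreover have "kmap q m n \<Phi> (r \<odot>\<^bsub>KQ q m\<^esub> v) = r \<odot>\<^bsub>KQ q n\<^esub> kmap q m n \<Phi> v"
    if r: "r \<in> carrier (env q)" and v: "v \<in> carrier (KQ q m)" for r v
  proof (rule coords_inj)
    have "coords q (r \<odot>\<^bsub>KQ q m\<^esub> v) = (\<lambda>i j. llmul q (ecoord q r) (coords q v i j))"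
      using coords_smult[OF r v] by (simp add: fun_eq_iff)
    then show "coords q (kmap q m n \<Phi> (r \<odot>\<^bsub>KQ q m\<^esub> v)) i j = coords q (r \<odot>\<^bsub>KQ q n\<^esub> kmap q m n \<Phi> v) i j"
      if "i + j = n" for i j
      using assms r v that by (simp add: coords_smult c coords_kmap llinear_def m.smult_closed)
  qed (use r v c in \<open>simp_all add: m.smult_closed n.smult_closed\<close>)
  ultimately show ?thesis
    using c by (auto simp: linear_maps_def kmap_def)
qed

text \<open>For i + j = n, \<open>kA q n j\<close> is the coefficient of the generator with index
  (i, j) in the boundary of (i + 1, j), and \<open>kB q n i\<close> the one in the boundary of (i, j
  + 1). The powers of q come from X^i Y^j X = q^j X^(i+1) Y^j and Y X^i Y^j = q^i X^i
  Y^(j+1).\<close>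

definition kA :: "'k::field \<Rightarrow> nat \<Rightarrow> nat \<Rightarrow> 'k lam lam"
  where "kA q n j = tens lX lone + llscale ((- 1) ^ Suc n * q ^ j) (tens lone lX)"

definition kB :: "'k::field \<Rightarrow> nat \<Rightarrow> nat \<Rightarrow> 'k lam lam"
  where "kB q n i = llscale (q ^ i) (tens lY lone) + llscale ((- 1) ^ Suc n) (tens lone lY)"

definition kD :: "'k::field \<Rightarrow> nat \<Rightarrow> (nat \<Rightarrow> nat \<Rightarrow> 'k lam lam) \<Rightarrow> nat \<Rightarrow> nat \<Rightarrow> 'k lam lam"
  where "kD q n V i j = llmul q (V (Suc i) j) (kA q n j) + llmul q (V i (Suc j)) (kB q n i)"

definition kd :: "'k::field \<Rightarrow> nat
    \<Rightarrow> (nat \<times> nat \<Rightarrow> (((letter, 'k) free_algebra set \<times> (letter, 'k) free_algebra set) \<Rightarrow>\<^sub>0 'k) set)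
    \<Rightarrow> (nat \<times> nat \<Rightarrow> (((letter, 'k) free_algebra set \<times> (letter, 'k) free_algebra set) \<Rightarrow>\<^sub>0 'k) set)"
  where "kd q n = kmap q (Suc n) n (kD q n)"

lemma kd_lm: "kd q n \<in> linear_maps (env q) (KQ q (Suc n)) (KQ q n)"
  unfolding kd_def
  by (rule kmap_lm) (simp add: llinear_def kD_def llmul_add llmul_assoc)

lemma coords_kd:
  "v \<in> carrier (KQ q (Suc n)) \<Longrightarrow> coords q (kd q n v) i j = (if i + j = n then kD q n (coords q v) i j else 0)"
  unfolding kd_def by (rule coords_kmap)


subsection \<open>Cochains\<close>

text \<open>
  A family \<open>z\<close> of elements of \<open>\<Lambda>\<close> stands for \<open>\<Sum> z\<^sub>i\<^sub>j X\<^sup>i Y\<^sup>j\<close> in \<open>\<Lambda> \<otimes> \<Lambda>\<^sup>!\<close>, where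
  \<open>Y X = q X Y\<close> in the Koszul dual \<open>\<Lambda>\<^sup>!\<close>; the differential is the graded commutator with \<open>xX + yY\<close>.
\<close>

definition kdiff :: "'k::field \<Rightarrow> (nat \<Rightarrow> nat \<Rightarrow> 'k lam) \<Rightarrow> nat \<Rightarrow> nat \<Rightarrow> 'k lam"
  where "kdiff q z i j =
    (case i of 0 \<Rightarrow> 0 | Suc a \<Rightarrow> lmul q lX (z a j) + lscale ((- 1) ^ Suc (a + j) * q ^ j) (lmul q (z a j) lX)) +
    (case j of 0 \<Rightarrow> 0 | Suc b \<Rightarrow> lscale (q ^ i) (lmul q lY (z i b)) + lscale ((- 1) ^ Suc (i + b)) (lmul q (z i b) lY))"

text \<open>Only the entries of z with i + j = n are used, so one family z can describe cochains in
  all degrees at once.\<close>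

definition cochain :: "'k::field \<Rightarrow> nat \<Rightarrow> (nat \<Rightarrow> nat \<Rightarrow> 'k lam)
    \<Rightarrow> (nat \<times> nat \<Rightarrow> (((letter, 'k) free_algebra set \<times> (letter, 'k) free_algebra set) \<Rightarrow>\<^sub>0 'k) set)
    \<Rightarrow> (letter, 'k) free_algebra set"
  where "cochain q n z = (\<lambda>v\<in>carrier (KQ q n). of_lam q (\<Sum>(i, j)\<in>KI n. act q (coords q v i j) (z i j)))"

lemma lam_of_cochain:
  "v \<in> carrier (KQ q n) \<Longrightarrow> lam_of q (cochain q n z v) = (\<Sum>(i, j)\<in>KI n. act q (coords q v i j) (z i j))"
  by (simp add: cochain_def)

lemma cochain_lm: "cochain q n z \<in> linear_maps (env q) (KQ q n) (reg q)"
proof -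
  interpret n: left_module "env q" "KQ q n" by (rule left_module_KQ)
  have c: "cochain q n z v \<in> carrier (Lambda q)" if "v \<in> carrier (KQ q n)" for v
    using that by (simp add: cochain_def)
  have "cochain q n z (v \<oplus>\<^bsub>KQ q n\<^esub> w) = cochain q n z v \<oplus>\<^bsub>Lambda q\<^esub> cochain q n z w"
    if "v \<in> carrier (KQ q n)" "w \<in> carrier (KQ q n)" for v w
    using that by (simp add: cochain_def of_lam_hom coords_add act_add sum.distrib split_def)
  moreover have "cochain q n z (r \<odot>\<^bsub>KQ q n\<^esub> v) = r \<odot>\<^bsub>reg q\<^esub> cochain q n z v"
    if "r \<in> carrier (env q)" "v \<in> carrier (KQ q n)" for r v
    using that by (simp add: c reg_smult lam_of_cochain)
      (simp add: cochain_def n.smult_closed coords_smult act_llmul act_sum split_def)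
  ultimately show ?thesis
    using c by (auto simp: linear_maps_def cochain_def)
qed

lemma cochain_basis:
  assumes "i + j = n"
  shows "lam_of q (cochain q n z (basis_vector (env q) (i, j))) = z i j"
proof -
  have "lam_of q (cochain q n z (basis_vector (env q) (i, j))) =
      (\<Sum>(a, b)\<in>KI n. act q (coords q (basis_vector (env q) (i, j)) a b) (z a b))"
    using assms by (intro lam_of_cochain basis_vector_in_carrier ring_env) simp
  also have "\<dots> = (\<Sum>p\<in>KI n. if p = (i, j) then z i j else 0)"
    by (rule sum.cong) (auto simp: coords_basis[OF assms] act_tens split: if_splits)
  also have "\<dots> = z i j"
    using assms by simp
  finally show ?thesis .
qed

lemma cochain_surj:
  assumes f: "f \<in> linear_maps (env q) (KQ q n) (reg q)"
  shows "f = cochain q n (\<lambda>i j. lam_of q (f (basis_vector (env q) (i, j))))"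
proof (rule lm_eqI[OF f cochain_lm])
  fix v assume v: "v \<in> carrier (KQ q n)"
  show "f v = cochain q n (\<lambda>i j. lam_of q (f (basis_vector (env q) (i, j)))) v"
  proof (rule linear_maps_eq_on_basis[OF ring_env left_module_reg f cochain_lm _ v])
    fix p assume p: "p \<in> KI n"
    then obtain i j where ij: "p = (i, j)" "i + j = n" by (auto simp: KI_def)
    have b: "basis_vector (env q) p \<in> carrier (KQ q n)"
      using p by (intro basis_vector_in_carrier ring_env)
    show "f (basis_vector (env q) p) = cochain q n (\<lambda>i j. lam_of q (f (basis_vector (env q) (i, j)))) (basis_vector (env q) p)"
      using lm_closed[OF f b] lm_closed[OF cochain_lm b] ij
      by (intro lam_of_inj[of _ q]) (simp_all add: cochain_basis)
  qed
qed

lemma cochain_eq_iff: "cochain q n z = cochain q n z' \<longleftrightarrow> (\<forall>i j. i + j = n \<longrightarrow> z i j = z' i j)"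
proof
  assume "cochain q n z = cochain q n z'"
  then show "\<forall>i j. i + j = n \<longrightarrow> z i j = z' i j"
    using cochain_basis by metis
next
  assume "\<forall>i j. i + j = n \<longrightarrow> z i j = z' i j"
  then have "(\<Sum>(i, j)\<in>KI n. act q (coords q v i j) (z i j)) = (\<Sum>(i, j)\<in>KI n. act q (coords q v i j) (z' i j))" for v
    by (intro sum.cong) auto
  then show "cochain q n z = cochain q n z'"
    by (simp add: cochain_def)
qed

lemma act_kA: "act q (kA q n j) m = lmul q lX m + lscale ((- 1) ^ Suc n * q ^ j) (lmul q m lX)"
  by (simp only: kA_def act_add act_llscale act_tens lmul_lone)

lemma act_kB: "act q (kB q n i) m = lscale (q ^ i) (lmul q lY m) + lscale ((- 1) ^ Suc n) (lmul q m lY)"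
  by (simp only: kB_def act_add act_llscale act_tens lmul_lone)

text \<open>Evaluating on a boundary lets \<open>kA\<close> and \<open>kB\<close> act on the entries
  of z, where they become the graded commutators with x and y. Summation by parts then collects them
  at the shifted indices, which gives \<open>kdiff\<close>.\<close>

lemma cochain_kd:
  assumes v: "v \<in> carrier (KQ q (Suc n))"
  shows "cochain q n z (kd q n v) = cochain q (Suc n) (kdiff q z) v"
proof (rule lam_of_inj[of _ q])
  have c: "kd q n v \<in> carrier (KQ q n)" using lm_closed[OF kd_lm v] .
  show "cochain q n z (kd q n v) \<in> carrier (Lambda q)" "cochain q (Suc n) (kdiff q z) v \<in> carrier (Lambda q)"
    using lm_closed[OF cochain_lm c] lm_closed[OF cochain_lm v] by simp_all
  let ?V = "coords q v"
  have "lam_of q (cochain q n z (kd q n v)) = (\<Sum>(i, j)\<in>KI n. act q (?V (Suc i) j)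
      (lmul q lX (z i j) + lscale ((- 1) ^ Suc (i + j) * q ^ j) (lmul q (z i j) lX)) +
      act q (?V i (Suc j)) (lscale (q ^ i) (lmul q lY (z i j)) + lscale ((- 1) ^ Suc (i + j)) (lmul q (z i j) lY)))"
    unfolding lam_of_cochain[OF c] using v
    by (intro sum.cong) (auto simp: coords_kd kD_def act_add(1) act_llmul act_kA act_kB)
  also have "\<dots> = (\<Sum>(i, j)\<in>KI (Suc n). act q (?V i j) (kdiff q z i j))"
    unfolding sum_KI_shift[of "\<lambda>i j. act q (?V (Suc i) j)
      (lmul q lX (z i j) + lscale ((- 1) ^ Suc (i + j) * q ^ j) (lmul q (z i j) lX))"]
    by (intro sum.cong) (auto simp: kdiff_def act_add(2) split: nat.split)
  finally show "lam_of q (cochain q n z (kd q n v)) = lam_of q (cochain q (Suc n) (kdiff q z) v)"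
    by (simp add: lam_of_cochain[OF v])
qed

definition kone :: "nat \<Rightarrow> nat \<Rightarrow> 'k::field lam"
  where "kone i j = (if i = 0 \<and> j = 0 then lone else 0)"

text \<open>The multiplication map from \<Lambda> \<otimes> \<Lambda> to \<Lambda>. Writing it as
  the cochain of the unit family makes it subject to the general formulas for cochains.\<close>

definition keps :: "'k::field
    \<Rightarrow> (nat \<times> nat \<Rightarrow> (((letter, 'k) free_algebra set \<times> (letter, 'k) free_algebra set) \<Rightarrow>\<^sub>0 'k) set)
    \<Rightarrow> (letter, 'k) free_algebra set"
  where "keps q = cochain q 0 kone"

lemma KI_0: "KI 0 = {(0, 0)}"
  by (auto simp: KI_def)

lemma lam_of_keps: "v \<in> carrier (KQ q 0) \<Longrightarrow> lam_of q (keps q v) = act q (coords q v 0 0) lone"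
  by (simp add: keps_def lam_of_cochain KI_0 kone_def)


subsection \<open>Exactness\<close>

text \<open>
  Exactness is checked with left and right factors interchanged, so that the four outer components of
  an element are components with values in the left Koszul complex, which has the contraction \<open>ksec\<close>.
  The other half of the differential raises the degree in the right factor, so a cycle is
  killed by correcting the components of right degree \<open>0\<close>, \<open>1\<close>, \<open>2\<close> in turn.
\<close>

definition ltrans :: "'k lam lam \<Rightarrow> 'k lam lam"
  where "ltrans U = Lam (Lam (c1 (c1 U)) (c1 (cx U)) (c1 (cy U)) (c1 (cw U)))
    (Lam (cx (c1 U)) (cx (cx U)) (cx (cy U)) (cx (cw U)))
    (Lam (cy (c1 U)) (cy (cx U)) (cy (cy U)) (cy (cw U)))
    (Lam (cw (c1 U)) (cw (cx U)) (cw (cy U)) (cw (cw U)))"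

lemma ltrans_ltrans [simp]: "ltrans (ltrans U) = U"
  by (simp add: ltrans_def)

text \<open>The differential of the Koszul complex of left \<Lambda>-modules that resolves k. It
  multiplies the left tensor factor on its right and leaves the other factor alone.\<close>

definition lD :: "'k::field \<Rightarrow> (nat \<Rightarrow> nat \<Rightarrow> 'k lam) \<Rightarrow> nat \<Rightarrow> nat \<Rightarrow> 'k lam"
  where "lD q v i j = lmul q (v (Suc i) j) lX + lscale (q ^ i) (lmul q (v i (Suc j)) lY)"

text \<open>The scaled terms come from 1 \<otimes> x and 1 \<otimes> y, which multiply the right
  factor on its left: \<open>c1\<close> feeds \<open>cx\<close> and \<open>cy\<close>, and these
  feed \<open>cw\<close>. The coefficient -q in the last entry is that of xy = -q yx.\<close>

definition tD :: "'k::field \<Rightarrow> nat \<Rightarrow> (nat \<Rightarrow> nat \<Rightarrow> 'k lam lam) \<Rightarrow> nat \<Rightarrow> nat \<Rightarrow> 'k lam lam"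
  where "tD q n V i j = Lam
    (lD q (\<lambda>i j. c1 (V i j)) i j)
    (lD q (\<lambda>i j. cx (V i j)) i j + lscale ((- 1) ^ Suc n * q ^ j) (c1 (V (Suc i) j)))
    (lD q (\<lambda>i j. cy (V i j)) i j + lscale ((- 1) ^ Suc n) (c1 (V i (Suc j))))
    (lD q (\<lambda>i j. cw (V i j)) i j + lscale ((- 1) ^ Suc n)
      (cx (V i (Suc j)) - lscale (q * q ^ j) (cy (V (Suc i) j))))"

lemma ltrans_kD: "ltrans (kD q n V i j) = tD q n (\<lambda>i j. ltrans (V i j)) i j"
  by (simp add: lam_eq_iff tD_def lD_def kD_def kA_def kB_def ltrans_def algebra_simps)

definition ksec :: "(nat \<Rightarrow> nat \<Rightarrow> 'k::field lam) \<Rightarrow> nat \<Rightarrow> nat \<Rightarrow> 'k lam"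
  where "ksec v i j = (case i of Suc a \<Rightarrow> Lam (cx (v a j)) 0 (cw (v a j)) 0
    | 0 \<Rightarrow> (case j of Suc b \<Rightarrow> Lam (cy (v 0 b)) 0 0 0 | 0 \<Rightarrow> 0))"

text \<open>The section divides by x wherever a power of X can be removed. The y-entry at (i + 1, j)
  need not be treated: on a cycle it equals q^(i+1) times the x-entry at (i, j + 1). At i = 0 the
  y-entry is divided off, and there its coefficient is q^0 = 1. So no division by q occurs, and q =
  0 is included.\<close>

lemma lD_ksec:
  assumes "\<And>a b. a + b = n \<Longrightarrow> lD q v a b = 0" and "i + j = Suc n"
  shows "lD q (ksec v) i j = v i j"
proof (cases i)
  case 0
  then obtain b where b: "j = Suc b" using assms(2) by (cases j) auto
  with 0 assms(1)[of 0 b] assms(2) show ?thesis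
    by (simp add: lD_def ksec_def lam_eq_iff)
next
  case (Suc a)
  then show ?thesis
    using assms(1)[of a j] assms(2) by (simp add: lD_def ksec_def lam_eq_iff)
qed

lemma tD_tD: "tD q n (tD q (Suc n) W) i j = 0"
  by (simp add: lam_eq_iff tD_def lD_def algebra_simps)

lemma tD_linear:
  "tD q n (\<lambda>i j. V i j + W i j) i j = tD q n V i j + tD q n W i j"
  "tD q n (\<lambda>i j. V i j - W i j) i j = tD q n V i j - tD q n W i j"
  by (simp_all add: lam_eq_iff tD_def lD_def algebra_simps)

lemma lD_zero [simp]: "lD q (\<lambda>i j. 0) i j = 0"
  by (simp add: lD_def)

lemma tD_cong:
  assumes "\<And>a b. a + b = Suc n \<Longrightarrow> V a b = W a b" "i + j = n"
  shows "tD q n V i j = tD q n W i j"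
  using assms by (simp add: tD_def lD_def)

definition kstep0 :: "(nat \<Rightarrow> nat \<Rightarrow> 'k::field lam lam) \<Rightarrow> nat \<Rightarrow> nat \<Rightarrow> 'k lam lam"
  where "kstep0 V i j = Lam (ksec (\<lambda>i j. c1 (V i j)) i j) 0 0 0"
definition kstep1 :: "(nat \<Rightarrow> nat \<Rightarrow> 'k::field lam lam) \<Rightarrow> nat \<Rightarrow> nat \<Rightarrow> 'k lam lam"
  where "kstep1 V i j = Lam 0 (ksec (\<lambda>i j. cx (V i j)) i j) (ksec (\<lambda>i j. cy (V i j)) i j) 0"
definition kstep2 :: "(nat \<Rightarrow> nat \<Rightarrow> 'k::field lam lam) \<Rightarrow> nat \<Rightarrow> nat \<Rightarrow> 'k lam lam"
  where "kstep2 V i j = Lam 0 0 0 (ksec (\<lambda>i j. cw (V i j)) i j)"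

lemma tD_exact:
  assumes V: "\<And>i j. i + j = n \<Longrightarrow> tD q n V i j = 0"
  shows "\<exists>W. \<forall>i j. i + j = Suc n \<longrightarrow> tD q (Suc n) W i j = V i j"
proof -
  define V1 where "V1 i j = V i j - tD q (Suc n) (kstep0 V) i j" for i j
  define V2 where "V2 i j = V1 i j - tD q (Suc n) (kstep1 V1) i j" for i j
  define V3 where "V3 i j = V2 i j - tD q (Suc n) (kstep2 V2) i j" for i j
  have cyc1: "tD q n V1 i j = 0" if "i + j = n" for i j
    using that unfolding V1_def by (simp only: tD_linear tD_tD V diff_zero)
  have cyc2: "tD q n V2 i j = 0" if "i + j = n" for i j
    using that unfolding V2_def by (simp only: tD_linear tD_tD cyc1 diff_zero)
  \<comment> \<open>The row of right degree 0 contains no mixed term, so \<open>ksec\<close> applies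
    to it. Once that row is zero the same holds for the rows \<open>cx\<close> and
    \<open>cy\<close>, and after them for \<open>cw\<close>.\<close>
  have x0: "lD q (\<lambda>i j. c1 (V i j)) i j = 0" if "i + j = n" for i j
    using V[OF that] by (simp add: tD_def lam_eq_iff)
  have z0: "c1 (V1 i j) = 0" if "i + j = Suc n" for i j
    using lD_ksec[OF x0 that] by (simp add: V1_def tD_def kstep0_def)
  have x1: "lD q (\<lambda>i j. cx (V1 i j)) i j = 0" "lD q (\<lambda>i j. cy (V1 i j)) i j = 0" if "i + j = n" for i j
    using cyc1[OF that] z0[of "Suc i" j] z0[of i "Suc j"] that by (simp_all add: tD_def lam_eq_iff)
  have z1: "c1 (V2 i j) = 0" "cx (V2 i j) = 0" "cy (V2 i j) = 0" if "i + j = Suc n" for i j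
    using lD_ksec[OF x1(1) that] lD_ksec[OF x1(2) that] z0 that
    by (simp_all add: V2_def tD_def kstep1_def)
  have x2: "lD q (\<lambda>i j. cw (V2 i j)) i j = 0" if "i + j = n" for i j
    using cyc2[OF that] z1[of "Suc i" j] z1[of i "Suc j"] that by (simp add: tD_def lam_eq_iff)
  have z2: "V3 i j = 0" if "i + j = Suc n" for i j
    using lD_ksec[OF x2 that] z1[OF that]
    by (simp add: V3_def tD_def kstep2_def lam_eq_iff[of "_ - _"])
  have "tD q (Suc n) (\<lambda>i j. kstep0 V i j + kstep1 V1 i j + kstep2 V2 i j) i j = V i j"
    if "i + j = Suc n" for i j
    using z2[OF that] by (simp only: tD_linear) (simp add: V3_def V2_def V1_def algebra_simps)
  then show ?thesis by blast
qed

text \<open>In degree 0 the augmentation takes the place of the cycle condition. The family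
  \<open>V\<close> is constant only for convenience, since the formulas read it at (0, 0)
  alone.\<close>

lemma tD_exact_0:
  fixes U :: "'k::field lam lam"
  assumes "c1 U + lmul q (cx U) lX + lmul q (cy U) lY + lmul q (cw U) lW = 0"
  shows "\<exists>W. tD q 0 W 0 0 = U"
proof -
  define V :: "nat \<Rightarrow> nat \<Rightarrow> 'k lam lam" where "V i j = U" for i j
  define V1 where "V1 i j = V i j - tD q 0 (kstep0 V) i j" for i j
  define V2 where "V2 i j = V1 i j - tD q 0 (kstep1 V1) i j" for i j
  define V3 where "V3 i j = V2 i j - tD q 0 (kstep2 V2) i j" for i j
  have "V3 0 0 = 0"
    using assms
    by (simp add: V3_def V2_def V1_def V_def tD_def kstep0_def kstep1_def kstep2_def lD_def ksec_def lam_eq_iff algebra_simps)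
  then have "tD q 0 (\<lambda>i j. kstep0 V i j + kstep1 V1 i j + kstep2 V2 i j) 0 0 = U"
    by (simp only: tD_linear) (simp add: V3_def V2_def V1_def V_def algebra_simps)
  then show ?thesis by blast
qed

lemma act_ltrans:
  "act q U lone = c1 (ltrans U) + lmul q (cx (ltrans U)) lX + lmul q (cy (ltrans U)) lY + lmul q (cw (ltrans U)) lW"
  by (simp add: act_def ltrans_def lam_eq_iff algebra_simps)

lemma ltrans_zero_iff [simp]: "ltrans U = 0 \<longleftrightarrow> U = (0 :: 'k::field lam lam)"
  by (auto simp: ltrans_def lam_eq_iff)

lemma ltrans_kD': "kD q n V i j = ltrans (tD q n (\<lambda>i j. ltrans (V i j)) i j)"
  by (metis ltrans_kD ltrans_ltrans)

lemma kd_kd: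
  assumes v: "v \<in> carrier (KQ q (Suc (Suc n)))"
  shows "kd q n (kd q (Suc n) v) = \<zero>\<^bsub>KQ q n\<^esub>"
proof (rule coords_inj)
  interpret n: left_module "env q" "KQ q n" by (rule left_module_KQ)
  have c: "kd q (Suc n) v \<in> carrier (KQ q (Suc n))" by (rule lm_closed[OF kd_lm v])
  show "kd q n (kd q (Suc n) v) \<in> carrier (KQ q n)" by (rule lm_closed[OF kd_lm c])
  show "\<zero>\<^bsub>KQ q n\<^esub> \<in> carrier (KQ q n)" by simp
  fix i j assume ij: "i + j = n"
  have "ltrans (coords q (kd q n (kd q (Suc n) v)) i j) =
      tD q n (tD q (Suc n) (\<lambda>i j. ltrans (coords q v i j))) i j"
    using ij unfolding coords_kd[OF c] if_P[OF ij] ltrans_kD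
    by (intro tD_cong) (simp_all add: coords_kd[OF v] ltrans_kD)
  then show "coords q (kd q n (kd q (Suc n) v)) i j = coords q \<zero>\<^bsub>KQ q n\<^esub> i j"
    by (simp add: tD_tD coords_zero)
qed

lemma keps_kd:
  assumes v: "v \<in> carrier (KQ q (Suc 0))"
  shows "keps q (kd q 0 v) = \<zero>\<^bsub>reg q\<^esub>"
proof (rule lam_of_inj[of _ q])
  have c: "kd q 0 v \<in> carrier (KQ q 0)" by (rule lm_closed[OF kd_lm v])
  show "keps q (kd q 0 v) \<in> carrier (Lambda q)"
    using lm_closed[OF cochain_lm c] by (simp add: keps_def)
  show "\<zero>\<^bsub>reg q\<^esub> \<in> carrier (Lambda q)"
    by (simp add: of_lam_hom)
  show "lam_of q (keps q (kd q 0 v)) = lam_of q \<zero>\<^bsub>reg q\<^esub>"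
    unfolding lam_of_keps[OF c] coords_kd[OF v]
    by (simp add: kD_def act_add act_llmul act_kA act_kB lam_of_hom act_zero flip: act_add(2))
qed

lemma Koszul_resolution: "projective_resolution (env q) (KQ q) (kd q) (keps q) (reg q)"
  unfolding projective_resolution_def
proof (intro conjI allI)
  show "projective_module (env q) (KQ q n)" for n
    by (rule projective_free_module[OF ring_env])
  show "kd q n \<in> linear_maps (env q) (KQ q (Suc n)) (KQ q n)" for n
    by (rule kd_lm)
  show eps: "keps q \<in> linear_maps (env q) (KQ q 0) (reg q)"
    unfolding keps_def by (rule cochain_lm)
  show "keps q ` carrier (KQ q 0) = carrier (reg q)"
  proof
    show "keps q ` carrier (KQ q 0) \<subseteq> carrier (reg q)"
      using lm_closed[OF eps] by blast
    show "carrier (reg q) \<subseteq> keps q ` carrier (KQ q 0)"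
    proof
      fix m assume m: "m \<in> carrier (reg q)"
      let ?v = "of_coords q 0 (\<lambda>i j. tens (lam_of q m) lone)"
      have "keps q ?v = m"
        using m lm_closed[OF eps of_coords_carrier]
        by (intro lam_of_inj[of _ q]) (simp_all add: lam_of_keps act_tens)
      then show "m \<in> keps q ` carrier (KQ q 0)"
        by (intro image_eqI[of _ _ ?v]) simp_all
    qed
  qed
  show "kd q 0 ` carrier (KQ q 1) = {x \<in> carrier (KQ q 0). keps q x = \<zero>\<^bsub>reg q\<^esub>}"
  proof (intro equalityI subsetI)
    fix x assume "x \<in> kd q 0 ` carrier (KQ q 1)"
    then show "x \<in> {x \<in> carrier (KQ q 0). keps q x = \<zero>\<^bsub>reg q\<^esub>}"
      using lm_closed[OF kd_lm[of q 0]] keps_kd by auto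
  next
    fix x assume "x \<in> {x \<in> carrier (KQ q 0). keps q x = \<zero>\<^bsub>reg q\<^esub>}"
    then have x: "x \<in> carrier (KQ q 0)" and "lam_of q (keps q x) = 0"
      by (simp_all add: lam_of_hom)
    then obtain W where W: "tD q 0 W 0 0 = ltrans (coords q x 0 0)"
      using tD_exact_0[of "ltrans (coords q x 0 0)" q] by (auto simp: lam_of_keps act_ltrans)
    let ?w = "of_coords q (Suc 0) (\<lambda>i j. ltrans (W i j))"
    have "kd q 0 ?w = x"
    proof (rule coords_inj[OF lm_closed[OF kd_lm of_coords_carrier] x])
      fix i j :: nat assume ij: "i + j = 0"
      have "tD q 0 (\<lambda>i j. ltrans (coords q ?w i j)) 0 0 = tD q 0 W 0 0"
        by (rule tD_cong) simp_all
      then have "coords q (kd q 0 ?w) i j = ltrans (tD q 0 W 0 0)"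
        unfolding coords_kd[OF of_coords_carrier] ltrans_kD' using ij by simp
      with W ij show "coords q (kd q 0 ?w) i j = coords q x i j" by simp
    qed
    then show "x \<in> kd q 0 ` carrier (KQ q 1)"
      by (intro image_eqI[of _ _ ?w]) simp_all
  qed
  fix n
  show "kd q (Suc n) ` carrier (KQ q (Suc (Suc n))) = {x \<in> carrier (KQ q (Suc n)). kd q n x = \<zero>\<^bsub>KQ q n\<^esub>}"
  proof (intro equalityI subsetI)
    fix x assume "x \<in> kd q (Suc n) ` carrier (KQ q (Suc (Suc n)))"
    then show "x \<in> {x \<in> carrier (KQ q (Suc n)). kd q n x = \<zero>\<^bsub>KQ q n\<^esub>}"
      using lm_closed[OF kd_lm[of q "Suc n"]] kd_kd by auto
  next
    fix x assume "x \<in> {x \<in> carrier (KQ q (Suc n)). kd q n x = \<zero>\<^bsub>KQ q n\<^esub>}"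
    then have x: "x \<in> carrier (KQ q (Suc n))" and 0: "coords q (kd q n x) i j = 0" for i j
      by (simp_all add: coords_zero)
    have "tD q n (\<lambda>i j. ltrans (coords q x i j)) i j = 0" if "i + j = n" for i j
      using 0[of i j] that by (simp add: coords_kd[OF x] ltrans_kD')
    from tD_exact[OF this] obtain W
      where W: "\<And>i j. i + j = Suc n \<Longrightarrow> tD q (Suc n) W i j = ltrans (coords q x i j)"
      by blast
    let ?w = "of_coords q (Suc (Suc n)) (\<lambda>i j. ltrans (W i j))"
    have "kd q (Suc n) ?w = x"
    proof (rule coords_inj[OF lm_closed[OF kd_lm of_coords_carrier] x])
      fix i j :: nat assume ij: "i + j = Suc n"
      have "tD q (Suc n) (\<lambda>i j. ltrans (coords q ?w i j)) i j = tD q (Suc n) W i j"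
        by (rule tD_cong) (simp_all add: ij)
      then have "coords q (kd q (Suc n) ?w) i j = ltrans (tD q (Suc n) W i j)"
        unfolding coords_kd[OF of_coords_carrier] ltrans_kD' using ij by simp
      with W[OF ij] show "coords q (kd q (Suc n) ?w) i j = coords q x i j" by simp
    qed
    then show "x \<in> kd q (Suc n) ` carrier (KQ q (Suc (Suc n)))"
      by (intro image_eqI[of _ _ ?w]) simp_all
  qed
qed


subsection \<open>Liftings of cocycles\<close>

text \<open>The map dual to multiplication by z on the right in \<Lambda> \<otimes>
  \<open>\<Lambda>\<^sup>!\<close>: the factor q^(ja) is that of Y^j X^a = q^(ja) X^a Y^j, and the
  entry of z acts from the right.\<close>

definition kG :: "'k::field \<Rightarrow> nat \<Rightarrow> (nat \<Rightarrow> nat \<Rightarrow> 'k lam) \<Rightarrow> (nat \<Rightarrow> nat \<Rightarrow> 'k lam lam) \<Rightarrow> nat \<Rightarrow> nat \<Rightarrow> 'k lam lam"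
  where "kG q n z V i j = (\<Sum>(a, b)\<in>KI n. llmul q (V (i + a) (j + b)) (llscale (q ^ (j * a)) (tens lone (z a b))))"

lemma kG_linear: "llinear q (kG q n z)"
  by (simp add: llinear_def kG_def llmul_add llmul_sum llmul_assoc sum.distrib split_def)

text \<open>The half x \<otimes> 1 commutes with 1 \<otimes> u and cancels. The other half leaves
  the x-part of the differential of u, up to a sign and a power of q that depend on the target index
  only.\<close>

lemma kA_commutator:
  "llmul q (kA q (n + m) (j + b)) (llscale (q ^ (j * c)) (tens lone u)) -
    llmul q (llscale (q ^ (j * c)) (tens lone u)) (kA q m j) =
    llscale ((- 1) ^ m * q ^ (j * Suc c))
      (tens lone (lmul q lX u + lscale ((- 1) ^ Suc n * q ^ b) (lmul q u lX)))"
  by (simp add: kA_def llmul_add llmul_llscale llmul_tens lam_eq_iff power_add algebra_simps)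

text \<open>Here the power of q attached to u is taken at j on one side and at j + 1 on the other.
  The gain of q^a is exactly what lets the halves y \<otimes> 1 cancel.\<close>

lemma kB_commutator:
  "llmul q (kB q (n + m) (i + a)) (llscale (q ^ (j * a)) (tens lone u)) -
    llmul q (llscale (q ^ (Suc j * a)) (tens lone u)) (kB q m i) =
    llscale ((- 1) ^ m * q ^ (j * a))
      (tens lone (lscale (q ^ a) (lmul q lY u) + lscale ((- 1) ^ Suc n) (lmul q u lY)))"
  by (simp add: kB_def llmul_add llmul_llscale llmul_tens lam_eq_iff power_add algebra_simps)

lemma tens_add: "tens u (v + w) = tens u v + tens u w"
  by (simp add: lam_eq_iff algebra_simps)

text \<open>After summation by parts both sides are combinations of the same entries of V. By the
  two commutator formulas their coefficients differ by a multiple of 1 \<otimes>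
  \<open>kdiff q z a b\<close>, which is zero for a cocycle.\<close>

lemma kG_chain:
  assumes z: "\<And>i j. i + j = Suc n \<Longrightarrow> kdiff q z i j = 0"
  shows "kG q n z (kD q (n + m) V) i j = kD q m (kG q n z V) i j"
proof -
  let ?t = "\<lambda>j a b. llscale (q ^ (j * a)) (tens lone (z a b))"
  have "kG q n z (kD q (n + m) V) i j = (\<Sum>(a, b)\<in>KI n.
      llmul q (V (i + Suc a) (j + b)) (llmul q (kA q (n + m) (j + b)) (?t j a b)) +
      llmul q (V (i + a) (j + Suc b)) (llmul q (kB q (n + m) (i + a)) (?t j a b)))"
    by (simp add: kG_def kD_def llmul_add llmul_assoc)
  also have "\<dots> = (\<Sum>(a, b)\<in>KI (Suc n). llmul q (V (i + a) (j + b))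
      ((case a of 0 \<Rightarrow> 0 | Suc c \<Rightarrow> llmul q (kA q (n + m) (j + b)) (?t j c b)) +
       (case b of 0 \<Rightarrow> 0 | Suc c \<Rightarrow> llmul q (kB q (n + m) (i + a)) (?t j a c))))"
    unfolding sum_KI_shift[of "\<lambda>a b. llmul q (V (i + Suc a) (j + b)) (llmul q (kA q (n + m) (j + b)) (?t j a b))"]
    by (intro sum.cong) (auto simp: llmul_add split: nat.split)
  also have "\<dots> = (\<Sum>(a, b)\<in>KI (Suc n). llmul q (V (i + a) (j + b))
      ((case a of 0 \<Rightarrow> 0 | Suc c \<Rightarrow> llmul q (?t j c b) (kA q m j)) +
       (case b of 0 \<Rightarrow> 0 | Suc c \<Rightarrow> llmul q (?t (Suc j) a c) (kB q m i))))"
  proof (intro sum.cong refl, clarify)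
    fix a b assume "(a, b) \<in> KI (Suc n)"
    then have ab: "a + b = Suc n" by simp
    have "(case a of 0 \<Rightarrow> 0 | Suc c \<Rightarrow> llmul q (kA q (n + m) (j + b)) (?t j c b)) +
        (case b of 0 \<Rightarrow> 0 | Suc c \<Rightarrow> llmul q (kB q (n + m) (i + a)) (?t j a c)) -
        ((case a of 0 \<Rightarrow> 0 | Suc c \<Rightarrow> llmul q (?t j c b) (kA q m j)) +
        (case b of 0 \<Rightarrow> 0 | Suc c \<Rightarrow> llmul q (?t (Suc j) a c) (kB q m i))) =
        llscale ((- 1) ^ m * q ^ (j * a)) (tens lone (kdiff q z a b))"
    proof -
      have 1: "(case a of 0 \<Rightarrow> 0 | Suc c \<Rightarrow> llmul q (kA q (n + m) (j + b)) (?t j c b)) -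
          (case a of 0 \<Rightarrow> 0 | Suc c \<Rightarrow> llmul q (?t j c b) (kA q m j)) =
          llscale ((- 1) ^ m * q ^ (j * a)) (tens lone (case a of 0 \<Rightarrow> 0 | Suc c \<Rightarrow>
            lmul q lX (z c b) + lscale ((- 1) ^ Suc (c + b) * q ^ b) (lmul q (z c b) lX)))"
        using ab kA_commutator[of q n m j b _ "z _ b"]
        by (cases a) (auto simp: lam_eq_iff[of _ "0 :: 'a lam lam"] lam_eq_iff[of "tens _ _"] tens_def)
      have 2: "(case b of 0 \<Rightarrow> 0 | Suc c \<Rightarrow> llmul q (kB q (n + m) (i + a)) (?t j a c)) -
          (case b of 0 \<Rightarrow> 0 | Suc c \<Rightarrow> llmul q (?t (Suc j) a c) (kB q m i)) =
          llscale ((- 1) ^ m * q ^ (j * a)) (tens lone (case b of 0 \<Rightarrow> 0 | Suc c \<Rightarrow>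
            lscale (q ^ a) (lmul q lY (z a c)) + lscale ((- 1) ^ Suc (a + c)) (lmul q (z a c) lY)))"
        using ab kB_commutator[of q n m i a j "z a _"]
        by (cases b) (auto simp: lam_eq_iff[of _ "0 :: 'a lam lam"] lam_eq_iff[of "tens _ _"] tens_def)
      show ?thesis
        unfolding kdiff_def tens_add ll.scale_right_distrib 1[symmetric] 2[symmetric]
        by (simp add: algebra_simps)
    qed
    also have "\<dots> = 0"
      by (simp add: z[OF ab] lam_eq_iff)
    finally show "llmul q (V (i + a) (j + b))
      ((case a of 0 \<Rightarrow> 0 | Suc c \<Rightarrow> llmul q (kA q (n + m) (j + b)) (?t j c b)) +
       (case b of 0 \<Rightarrow> 0 | Suc c \<Rightarrow> llmul q (kB q (n + m) (i + a)) (?t j a c))) =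
      llmul q (V (i + a) (j + b))
      ((case a of 0 \<Rightarrow> 0 | Suc c \<Rightarrow> llmul q (?t j c b) (kA q m j)) +
       (case b of 0 \<Rightarrow> 0 | Suc c \<Rightarrow> llmul q (?t (Suc j) a c) (kB q m i)))"
      by simp
  qed
  also have "\<dots> = (\<Sum>(a, b)\<in>KI n.
      llmul q (V (i + Suc a) (j + b)) (llmul q (?t j a b) (kA q m j)) +
      llmul q (V (i + a) (j + Suc b)) (llmul q (?t (Suc j) a b) (kB q m i)))"
    unfolding sum_KI_shift[of "\<lambda>a b. llmul q (V (i + Suc a) (j + b)) (llmul q (?t j a b) (kA q m j))"]
    by (intro sum.cong) (auto simp: llmul_add split: nat.split)
  also have "\<dots> = kD q m (kG q n z V) i j"
    by (simp add: kG_def kD_def llmul_sum sum.distrib split_def llmul_assoc)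
  finally show ?thesis .
qed


lemma (in abelian_group) minus_eqI:
  assumes "b \<oplus> c = a" "b \<in> carrier G" "c \<in> carrier G"
  shows "a \<ominus> c = b"
  unfolding assms(1)[symmetric] using assms(2,3) by (simp add: a_minus_def a_assoc r_neg)

section \<open>Comparing Ext rings along a chain map\<close>

lemma lifting_cocycle:
  assumes P: "resolution R P dP eP M" and Q: "resolution R Q dQ eQ M"
    and G: "lifting R P dP Q dQ eQ n g G" and f: "f \<in> cocycles R Q dQ M m"
  shows "compose (carrier (P (n + m))) f (G m) \<in> cocycles R P dP M (n + m)"
proof -
  interpret P: resolution R P dP eP M by fact
  note G = liftingD[OF G]
  have "f (G m (dP (n + m) x)) = \<zero>\<^bsub>M\<^esub>" if x: "x \<in> carrier (P (Suc (n + m)))" for x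
    using f G(3)[OF x] lm_closed[OF G(1)[of "Suc m"]] x by (simp add: cocycles_def flip: G(3)[OF x])
  then show ?thesis
    using f P.d_closed lm_compose[OF P.left_module_P G(1)[of m], of f M]
    by (simp add: cocycles_def compose_def)
qed

lemma coboundary_lifting:
  assumes P: "resolution R P dP eP M" and Q: "resolution R Q dQ eQ M"
    and G: "lifting R P dP Q dQ eQ n g G" and w: "w \<in> coboundaries R Q dQ M m"
  shows "compose (carrier (P (n + m))) w (G m) \<in> coboundaries R P dP M (n + m)"
proof -
  interpret P: resolution R P dP eP M by fact
  note G = liftingD[OF G]
  show ?thesis
  proof (cases m)
    case 0
    with w have "compose (carrier (P (n + m))) w (G m) = (\<lambda>x\<in>carrier (P (n + m)). \<zero>\<^bsub>M\<^esub>)"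
      using lm_closed[OF G(1)[of 0]] by (auto simp: coboundaries_def hom_group_def compose_def fun_eq_iff)
    then show ?thesis
      using P.coboundaries_zero[OF P.left_module_M] by simp
  next
    case (Suc k)
    with w obtain u where u: "u \<in> linear_maps R (Q k) M" "w = compose (carrier (Q (Suc k))) u (dQ k)"
      by (auto simp: coboundaries_def)
    have "compose (carrier (P (n + m))) w (G m) =
        compose (carrier (P (Suc (n + k)))) (compose (carrier (P (n + k))) u (G k)) (dP (n + k))"
      using lm_closed[OF G(1)[of "Suc k"]] P.d_closed G(3)
      by (auto simp: Suc u compose_def fun_eq_iff)
    with lm_compose[OF P.left_module_P G(1) u(1)] Suc show ?thesis
      by (auto simp: coboundaries_def)
  qed
qed

text \<open>The chain map B covers the identity of M. In the application P is the given resolution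
  and Q the Koszul resolution, and classes computed on Q are transported to P by
  \<open>pull\<close>.\<close>

locale comparison = P: resolution R P dP eP M + Q: resolution R Q dQ eQ M
  for R :: "('r, 'x) ring_scheme" and P :: "nat \<Rightarrow> ('r, 'p) module" and dP eP
    and Q :: "nat \<Rightarrow> ('r, 'q) module" and dQ eQ and M :: "('r, 'm, 'y) module_scheme" +
  fixes B assumes B: "lifting R P dP Q dQ eQ 0 eP B"
begin

definition pull :: "nat \<Rightarrow> ('q \<Rightarrow> 'm) \<Rightarrow> 'p \<Rightarrow> 'm"
  where "pull n f = compose (carrier (P n)) f (B n)"

lemma B_lm: "B n \<in> linear_maps R (P n) (Q n)"
  using liftingD(1)[OF B, of n] by simp

lemma B_closed: "x \<in> carrier (P n) \<Longrightarrow> B n x \<in> carrier (Q n)"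
  by (rule lm_closed[OF B_lm])

lemma pull_cocycle: "f \<in> cocycles R Q dQ M n \<Longrightarrow> pull n f \<in> cocycles R P dP M n"
  unfolding pull_def
  using lifting_cocycle[OF P.resolution_axioms Q.resolution_axioms B, of f n] by simp

lemma pull_plus:
  "pull n (\<lambda>x\<in>carrier (Q n). f x \<oplus>\<^bsub>M\<^esub> g x) = (\<lambda>x\<in>carrier (P n). pull n f x \<oplus>\<^bsub>M\<^esub> pull n g x)"
  by (auto simp: pull_def compose_def fun_eq_iff B_closed)

lemma pull_minus:
  "pull n (\<lambda>x\<in>carrier (Q n). f x \<ominus>\<^bsub>M\<^esub> g x) = (\<lambda>x\<in>carrier (P n). pull n f x \<ominus>\<^bsub>M\<^esub> pull n g x)"
  by (auto simp: pull_def compose_def fun_eq_iff B_closed)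

text \<open>Only the reflection of coboundaries needs an argument. A comparison A in the other
  direction makes the composite of A and B homotopic to the identity of Q, so a cocycle h differs by
  a coboundary from its pullback along B and then A.\<close>

lemma ext_class_pull_iff:
  assumes f: "f \<in> cocycles R Q dQ M n" and g: "g \<in> cocycles R Q dQ M n"
  shows "P.ecls n (pull n f) = P.ecls n (pull n g) \<longleftrightarrow>
    (\<lambda>x\<in>carrier (Q n). f x \<ominus>\<^bsub>M\<^esub> g x) \<in> coboundaries R Q dQ M n" (is "?L \<longleftrightarrow> ?h \<in> _")
proof -
  interpret M: left_module R M by (rule P.left_module_M)
  have L: "?L \<longleftrightarrow> pull n ?h \<in> coboundaries R P dP M n"
    unfolding pull_minus by (rule P.ext_class_eq_iff[OF pull_cocycle[OF f] pull_cocycle[OF g]])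
  have hl: "?h \<in> linear_maps R (Q n) M"
    by (rule lm_minus[OF Q.left_module_P Q.left_module_M Q.cocycles_lm[OF f] Q.cocycles_lm[OF g]])
  have hc: "?h \<in> cocycles R Q dQ M n"
    using f g hl Q.d_closed by (simp add: cocycles_def a_minus_def)
  have "?h \<in> coboundaries R Q dQ M n" if p: "pull n ?h \<in> coboundaries R P dP M n"
  proof -
    have e: "eQ \<in> cocycles R Q dQ M 0"
      using Q.e_lm Q.e_d by (simp add: cocycles_def)
    obtain A where A: "lifting R Q dQ P dP eP 0 eQ A"
      using lifting_exists[OF Q.resolution_axioms P.resolution_axioms e] by blast
    note Al = liftingD(1)[OF A, simplified]
    have 1: "compose (carrier (Q n)) (pull n ?h) (A n) \<in> coboundaries R Q dQ M n"
      using coboundary_lifting[OF Q.resolution_axioms P.resolution_axioms A p] by simp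
    have BA: "lifting R Q dQ Q dQ eQ 0 eQ (\<lambda>i. compose (carrier (Q (0 + i))) (B i) (A i))"
      by (rule lifting_compose_left[OF Q.resolution_axioms P.resolution_axioms Q.resolution_axioms B A])
    have z: "(\<lambda>x\<in>carrier (Q 0). eQ x \<ominus>\<^bsub>M\<^esub> eQ x) \<in> coboundaries R Q dQ M 0"
      using lm_closed[OF Q.e_lm] by (simp add: coboundaries_def hom_group_def a_minus_def M.r_neg cong: restrict_cong)
    have 2: "(\<lambda>x\<in>carrier (Q n). ?h x \<ominus>\<^bsub>M\<^esub> ?h (B n (A n x))) \<in> coboundaries R Q dQ M n"
      using lifting_unique[OF Q.resolution_axioms Q.resolution_axioms lifting_id[OF Q.resolution_axioms] BA z hc]
      by (simp add: compose_def cong: restrict_cong)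
    have "?h = (\<lambda>x\<in>carrier (Q n). (\<lambda>x\<in>carrier (Q n). ?h x \<ominus>\<^bsub>M\<^esub> ?h (B n (A n x))) x \<oplus>\<^bsub>M\<^esub>
        compose (carrier (Q n)) (pull n ?h) (A n) x)" (is "_ = ?k")
    proof
      fix x
      show "?h x = ?k x"
      proof (cases "x \<in> carrier (Q n)")
        case True
        then have "A n x \<in> carrier (P n)" "B n (A n x) \<in> carrier (Q n)"
          using lm_closed[OF Al] B_closed by auto
        with True lm_closed[OF hl True] lm_closed[OF hl \<open>B n (A n x) \<in> carrier (Q n)\<close>] show ?thesis
          by (simp add: compose_def pull_def a_minus_def M.a_assoc M.l_neg)
      qed simp
    qed
    with Q.coboundaries_plus[OF Q.left_module_M 2 1] show ?thesis by simp
  qed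
  moreover have "pull n ?h \<in> coboundaries R P dP M n" if "?h \<in> coboundaries R Q dQ M n"
    using coboundary_lifting[OF P.resolution_axioms Q.resolution_axioms B that] by (simp add: pull_def)
  ultimately show ?thesis
    unfolding L by blast
qed

text \<open>A cocycle on P is first pulled back to Q along a comparison A; pulling it back again
  along B changes it by a coboundary, since the round trip on P covers the identity of M.\<close>

lemma ext_class_pull_surj:
  assumes "U \<in> carrier (Ext R P dP M n)"
  shows "\<exists>f\<in>cocycles R Q dQ M n. U = P.ecls n (pull n f)"
proof -
  interpret M: left_module R M by (rule P.left_module_M)
  obtain g where g: "g \<in> cocycles R P dP M n" "U = P.ecls n g"
    using assms by (auto simp: P.Ext_carrier)
  have e: "eQ \<in> cocycles R Q dQ M 0"
    using Q.e_lm Q.e_d by (simp add: cocycles_def)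
  obtain A where A: "lifting R Q dQ P dP eP 0 eQ A"
    using lifting_exists[OF Q.resolution_axioms P.resolution_axioms e] by blast
  let ?f = "compose (carrier (Q n)) g (A n)"
  have f: "?f \<in> cocycles R Q dQ M n"
    using lifting_cocycle[OF Q.resolution_axioms P.resolution_axioms A g(1)] by simp
  have AB: "lifting R P dP P dP eP 0 eP (\<lambda>i. compose (carrier (P (0 + i))) (A i) (B i))"
    by (rule lifting_compose_left[OF P.resolution_axioms Q.resolution_axioms P.resolution_axioms A B])
  have z: "(\<lambda>x\<in>carrier (P 0). eP x \<ominus>\<^bsub>M\<^esub> eP x) \<in> coboundaries R P dP M 0"
    using lm_closed[OF P.e_lm] by (simp add: coboundaries_def hom_group_def a_minus_def M.r_neg cong: restrict_cong)
  have "(\<lambda>x\<in>carrier (P n). g x \<ominus>\<^bsub>M\<^esub> pull n ?f x) \<in> coboundaries R P dP M n"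
    using lifting_unique[OF P.resolution_axioms P.resolution_axioms lifting_id[OF P.resolution_axioms] AB z g(1)]
    by (simp add: compose_def pull_def B_closed cong: restrict_cong)
  then have "P.ecls n g = P.ecls n (pull n ?f)"
    using P.ext_class_eq_iff[OF g(1) pull_cocycle[OF f]] by simp
  with f g(2) show ?thesis by blast
qed

text \<open>A lift G known on Q determines the product on P. For any lift F chosen on P, the
  composites of F followed by B and of B followed by G are maps from P to Q that cover cohomologous
  cocycles, so they agree after applying f, up to a coboundary. The same comparison shows that the
  set inside \<open>yoneda_product\<close> has a single element.\<close>

lemma yoneda_product_pull:
  assumes f: "f \<in> cocycles R Q dQ M m" and g: "g \<in> cocycles R Q dQ M n"
    and G: "lifting R Q dQ Q dQ eQ n g G"
  shows "yoneda_product R P dP eP M m n (P.ecls m (pull m f)) (P.ecls n (pull n g)) =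
    P.ecls (n + m) (pull (n + m) (compose (carrier (Q (n + m))) f (G m)))" (is "_ = ?c")
proof -
  interpret M: left_module R M by (rule P.left_module_M)
  have fG: "compose (carrier (Q (n + m))) f (G m) \<in> cocycles R Q dQ M (n + m)"
    by (rule lifting_cocycle[OF Q.resolution_axioms Q.resolution_axioms G f])
  have eq: "P.ecls (n + m) (compose (carrier (P (n + m))) f' (F m)) = ?c"
    if f': "f' \<in> P.ecls m (pull m f)" and g': "g' \<in> P.ecls n (pull n g)"
      and F: "chain_lift R P dP eP n g' F" for f' g' F
  proof -
    note F = F[unfolded chain_lift_eq]
    note Fl = liftingD(1)[OF F]
    note f' = P.ext_class_mem[OF pull_cocycle[OF f] f']
    note g' = P.ext_class_mem[OF pull_cocycle[OF g] g']
    have f'F: "compose (carrier (P (n + m))) f' (F m) \<in> cocycles R P dP M (n + m)"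
      by (rule lifting_cocycle[OF P.resolution_axioms P.resolution_axioms F f'(1)])
    have pF: "compose (carrier (P (n + m))) (pull m f) (F m) \<in> cocycles R P dP M (n + m)"
      by (rule lifting_cocycle[OF P.resolution_axioms P.resolution_axioms F pull_cocycle[OF f]])
    have "P.ecls (n + m) (compose (carrier (P (n + m))) f' (F m)) =
        P.ecls (n + m) (compose (carrier (P (n + m))) (pull m f) (F m))"
      unfolding P.ext_class_eq_iff[OF f'F pF]
      using coboundary_lifting[OF P.resolution_axioms P.resolution_axioms F f'(3)] lm_closed[OF Fl]
      by (simp add: compose_def cong: restrict_cong)
    also have "\<dots> = ?c"
      unfolding P.ext_class_eq_iff[OF pF pull_cocycle[OF fG]]
    proof -
      have "lifting R P dP Q dQ eQ n g' (\<lambda>i. compose (carrier (P (n + i))) (B i) (F i))"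
        by (rule lifting_compose_left[OF P.resolution_axioms P.resolution_axioms Q.resolution_axioms B F])
      moreover have "lifting R P dP Q dQ eQ n (pull n g) (\<lambda>i. compose (carrier (P (n + i))) (G i) (B (n + i)))"
        unfolding pull_def
        by (rule lifting_compose_right[OF P.resolution_axioms Q.resolution_axioms B G])
      ultimately have "(\<lambda>x\<in>carrier (P (n + m)). f (compose (carrier (P (n + m))) (B m) (F m) x) \<ominus>\<^bsub>M\<^esub>
          f (compose (carrier (P (n + m))) (G m) (B (n + m)) x)) \<in> coboundaries R P dP M (n + m)"
        by (rule lifting_unique[OF P.resolution_axioms Q.resolution_axioms _ _ g'(3) f])
      then show "(\<lambda>x\<in>carrier (P (n + m)). compose (carrier (P (n + m))) (pull m f) (F m) x \<ominus>\<^bsub>M\<^esub>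
          pull (n + m) (compose (carrier (Q (n + m))) f (G m)) x) \<in> coboundaries R P dP M (n + m)"
        using lm_closed[OF Fl] by (simp add: compose_def pull_def B_closed cong: restrict_cong)
    qed
    finally show ?thesis .
  qed
  \<comment> \<open>At least one lift has to exist, otherwise the set under \<open>the_elem\<close>
    would be empty.\<close>
  obtain F where F: "chain_lift R P dP eP n (pull n g) F"
    using lifting_exists[OF P.resolution_axioms P.resolution_axioms pull_cocycle[OF g]]
    unfolding chain_lift_eq by blast
  have "{P.ecls (n + m) (compose (carrier (P (n + m))) f' (G' m)) | f' g' G'.
      f' \<in> P.ecls m (pull m f) \<and> g' \<in> P.ecls n (pull n g) \<and> chain_lift R P dP eP n g' G'} = {?c}"
    (is "?S = _")
  proof (intro equalityI subsetI)
    fix u assume "u \<in> ?S"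
    then show "u \<in> {?c}" using eq by blast
  next
    have "P.ecls (n + m) (compose (carrier (P (n + m))) (pull m f) (F m)) \<in> ?S"
      using F P.ext_class_self[OF pull_cocycle[OF f]] P.ext_class_self[OF pull_cocycle[OF g]] by blast
    moreover have "P.ecls (n + m) (compose (carrier (P (n + m))) (pull m f) (F m)) = ?c"
      using F P.ext_class_self[OF pull_cocycle[OF f]] P.ext_class_self[OF pull_cocycle[OF g]] by (intro eq)
    moreover fix u assume "u \<in> {?c}"
    ultimately show "u \<in> ?S" by simp
  qed
  then show ?thesis
    unfolding yoneda_product_def by simp
qed

end


section \<open>Hochschild cohomology as the cohomology of \<open>\<Lambda> \<otimes> \<Lambda>\<^sup>!\<close>\<close>

text \<open>The product of \<Lambda> \<otimes> \<open>\<Lambda>\<^sup>!\<close>, with Y^b X^(i-a) =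
  q^(b(i-a)) X^(i-a) Y^b. No sign appears when factors are interchanged, because the elements of
  \<Lambda> have cohomological degree 0.\<close>

definition kconv :: "'k::field \<Rightarrow> (nat \<Rightarrow> nat \<Rightarrow> 'k lam) \<Rightarrow> (nat \<Rightarrow> nat \<Rightarrow> 'k lam) \<Rightarrow> nat \<Rightarrow> nat \<Rightarrow> 'k lam"
  where "kconv q z z' i j = (\<Sum>a\<le>i. \<Sum>b\<le>j. lscale (q ^ (b * (i - a))) (lmul q (z a b) (z' (i - a) (j - b))))"

definition kpart :: "'k::field \<Rightarrow> nat \<Rightarrow> (nat \<Rightarrow> nat \<Rightarrow> 'k lam) \<Rightarrow> (nat \<Rightarrow> nat \<Rightarrow> 'k lam) \<Rightarrow> nat \<Rightarrow> nat \<Rightarrow> 'k lam"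
  where "kpart q m z z' i j = (\<Sum>(a, b)\<in>{(a, b) \<in> {..i} \<times> {..j}. a + b = m}.
    lscale (q ^ (b * (i - a))) (lmul q (z a b) (z' (i - a) (j - b))))"

lemma kconv_eq_sum_kpart: "kconv q z z' i j = (\<Sum>m\<le>i + j. kpart q m z z' i j)"
proof -
  let ?f = "\<lambda>(a, b). lscale (q ^ (b * (i - a))) (lmul q (z a b) (z' (i - a) (j - b)))"
  have "(\<Sum>m\<in>{..i + j}. sum ?f {x \<in> {..i} \<times> {..j}. (\<lambda>(a, b). a + b) x = m}) = sum ?f ({..i} \<times> {..j})"
    by (rule sum.group) auto
  moreover have "{x \<in> {..i} \<times> {..j}. (\<lambda>(a, b). a + b) x = m} = {(a, b) \<in> {..i} \<times> {..j}. a + b = m}" for m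
    by auto
  ultimately show ?thesis
    by (simp only: kconv_def kpart_def sum.cartesian_product)
qed

lemma kpart_eq:
  assumes "i + j = n + m"
  shows "kpart q m z z' i j = (\<Sum>(p, p')\<in>{(p, p') \<in> KI m \<times> KI n. (fst p + fst p', snd p + snd p') = (i, j)}.
    lscale (q ^ (snd p * fst p')) (lmul q (z (fst p) (snd p)) (z' (fst p') (snd p'))))"
  unfolding kpart_def
  by (rule sum.reindex_bij_witness[of _ "\<lambda>(p, p'). p" "\<lambda>p. (p, (i - fst p, j - snd p))"])
     (use assms in auto)

lemma kdiff_cong:
  "(\<And>a b. Suc (a + b) = i + j \<Longrightarrow> z a b = z' a b) \<Longrightarrow> kdiff q z i j = kdiff q z' i j"
  by (auto simp: kdiff_def split: nat.split)

lemma kdiff_add: "kdiff q (\<lambda>i j. z i j + z' i j) i j = kdiff q z i j + kdiff q z' i j"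
  by (auto simp: kdiff_def lmul_distrib lam.scale_right_distrib split: nat.split)

lemma kdiff_zero [simp]: "kdiff q (\<lambda>i j. 0) i j = 0"
  by (auto simp: kdiff_def split: nat.split)

definition kcocycles :: "'k::field \<Rightarrow> (nat \<Rightarrow> nat \<Rightarrow> 'k lam) set"
  where "kcocycles q = {z. finite {(i, j). z i j \<noteq> 0} \<and> (\<forall>i j. kdiff q z i j = 0)}"

text \<open>The interface between homological algebra and computation: a ring H that is the
  cohomology of the complex of families z, with its grading and scalars. All three parts of the
  theorem are proved from it. Cocycles are finitely supported because H is a direct sum, whereas the
  y that witnesses an equality may be any family, which makes it possible to solve the equation
  index by index.\<close>

locale HH_model =
  fixes q :: "'k::field" and H :: "'h ring" (structure) and HC :: "nat \<Rightarrow> 'h set" and \<eta> :: "'k \<Rightarrow> 'h"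
    and \<pi> :: "(nat \<Rightarrow> nat \<Rightarrow> 'k lam) \<Rightarrow> 'h"
  assumes pi_surj: "\<pi> ` kcocycles q = carrier H"
    and pi_add: "\<And>z z'. z \<in> kcocycles q \<Longrightarrow> z' \<in> kcocycles q \<Longrightarrow> \<pi> (\<lambda>i j. z i j + z' i j) = \<pi> z \<oplus>\<^bsub>H\<^esub> \<pi> z'"
    and pi_mult: "\<And>z z'. z \<in> kcocycles q \<Longrightarrow> z' \<in> kcocycles q \<Longrightarrow> \<pi> (kconv q z z') = \<pi> z \<otimes>\<^bsub>H\<^esub> \<pi> z'"
    and kconv_closed: "\<And>z z'. z \<in> kcocycles q \<Longrightarrow> z' \<in> kcocycles q \<Longrightarrow> kconv q z z' \<in> kcocycles q"
    and pi_one: "\<pi> kone = \<one>\<^bsub>H\<^esub>"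
    and pi_zero: "\<pi> (\<lambda>i j. 0) = \<zero>\<^bsub>H\<^esub>"
    and pi_unit: "\<eta> c = \<pi> (\<lambda>i j. lscale c (kone i j))"
    and pi_eq_iff: "\<And>z z'. z \<in> kcocycles q \<Longrightarrow> z' \<in> kcocycles q \<Longrightarrow>
      \<pi> z = \<pi> z' \<longleftrightarrow> (\<exists>y. \<forall>i j. z i j - z' i j = kdiff q y i j)"
    and pi_component: "HC n = \<pi> ` {z \<in> kcocycles q. \<forall>i j. i + j \<noteq> n \<longrightarrow> z i j = 0}"

locale HH_resolution =
  fixes q :: "'k::field"
    and P :: "nat \<Rightarrow> (((letter, 'k) free_algebra set \<times> (letter, 'k) free_algebra set \<Rightarrow>\<^sub>0 'k) set, 'p) module"
    and d :: "nat \<Rightarrow> 'p \<Rightarrow> 'p" and \<epsilon> :: "'p \<Rightarrow> (letter, 'k) free_algebra set"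
  assumes res: "projective_resolution (env q) P d \<epsilon> (reg q)"
begin

sublocale P: resolution "env q" P d \<epsilon> "reg q"
  by (rule resolution.intro[OF res left_module_reg])

sublocale Q: resolution "env q" "KQ q" "kd q" "keps q" "reg q"
  by (rule resolution.intro[OF Koszul_resolution left_module_reg])

definition beta :: "nat \<Rightarrow> 'p \<Rightarrow> _"
  where "beta = (SOME B. lifting (env q) P d (KQ q) (kd q) (keps q) 0 \<epsilon> B)"

lemma beta: "lifting (env q) P d (KQ q) (kd q) (keps q) 0 \<epsilon> beta"
proof -
  have "\<epsilon> \<in> cocycles (env q) P d (reg q) 0"
    using P.e_lm P.e_d by (simp add: cocycles_def)
  then show ?thesis
    unfolding beta_def
    using lifting_exists[OF P.resolution_axioms Q.resolution_axioms] by (metis someI_ex)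
qed

sublocale comparison "env q" P d \<epsilon> "KQ q" "kd q" "keps q" "reg q" beta
  by (intro comparison.intro comparison_axioms.intro P.resolution_axioms Q.resolution_axioms beta)

abbreviation "E n \<equiv> Ext (env q) P d (reg q) n"

definition Psi :: "nat \<Rightarrow> (nat \<Rightarrow> nat \<Rightarrow> 'k lam) \<Rightarrow> ('p \<Rightarrow> (letter, 'k) free_algebra set) set"
  where "Psi n z = P.ecls n (pull n (cochain q n z))"

text \<open>The condition in one degree only, with arbitrary entries of z elsewhere. Products and
  lifts are handled degree by degree before the degrees are glued together.\<close>

definition ncocycle :: "nat \<Rightarrow> (nat \<Rightarrow> nat \<Rightarrow> 'k lam) \<Rightarrow> bool"
  where "ncocycle n z \<longleftrightarrow> (\<forall>i j. i + j = Suc n \<longrightarrow> kdiff q z i j = 0)"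

lemma cochain_zero_iff: "(\<forall>v\<in>carrier (KQ q n). cochain q n z v = \<zero>\<^bsub>reg q\<^esub>) \<longleftrightarrow> (\<forall>i j. i + j = n \<longrightarrow> z i j = 0)"
proof
  assume L: "\<forall>v\<in>carrier (KQ q n). cochain q n z v = \<zero>\<^bsub>reg q\<^esub>"
  show "\<forall>i j. i + j = n \<longrightarrow> z i j = 0"
  proof (intro allI impI)
    fix i j assume ij: "i + j = n"
    then have "basis_vector (env q) (i, j) \<in> carrier (KQ q n)"
      by (intro basis_vector_in_carrier ring_env) simp
    with L cochain_basis[OF ij, of q z] show "z i j = 0" by (simp add: lam_of_hom)
  qed
next
  assume "\<forall>i j. i + j = n \<longrightarrow> z i j = 0"
  then have "cochain q n z = cochain q n (\<lambda>i j. 0)"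
    by (simp add: cochain_eq_iff)
  then show "\<forall>v\<in>carrier (KQ q n). cochain q n z v = \<zero>\<^bsub>reg q\<^esub>"
    by (simp add: cochain_def of_lam_hom)
qed

lemma cochain_cocycle_iff: "cochain q n z \<in> cocycles (env q) (KQ q) (kd q) (reg q) n \<longleftrightarrow> ncocycle n z"
  by (simp add: cocycles_def cochain_lm cochain_kd cochain_zero_iff ncocycle_def del: reg_sel)

lemma cochain_minus:
  "(\<lambda>v\<in>carrier (KQ q n). cochain q n z v \<ominus>\<^bsub>reg q\<^esub> cochain q n z' v) = cochain q n (\<lambda>i j. z i j - z' i j)"
proof (rule lm_eqI[OF lm_minus[OF left_module_KQ left_module_reg cochain_lm cochain_lm] cochain_lm])
  interpret M: left_module "env q" "reg q" by (rule left_module_reg)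
  fix v assume v: "v \<in> carrier (KQ q n)"
  have c: "cochain q n y v \<in> carrier (reg q)" for y
    by (rule lm_closed[OF cochain_lm v])
  have "cochain q n (\<lambda>i j. z i j - z' i j) v \<oplus>\<^bsub>reg q\<^esub> cochain q n z' v = cochain q n z v"
    using v by (simp add: cochain_def of_lam_hom split_def flip: sum.distrib act_add(2))
  then have "cochain q n z v \<ominus>\<^bsub>reg q\<^esub> cochain q n z' v = cochain q n (\<lambda>i j. z i j - z' i j) v"
    by (rule M.minus_eqI[OF _ c c])
  with v show "(\<lambda>v\<in>carrier (KQ q n). cochain q n z v \<ominus>\<^bsub>reg q\<^esub> cochain q n z' v) v = cochain q n (\<lambda>i j. z i j - z' i j) v"
    by simp
qed

lemma cochain_plus:
  "(\<lambda>v\<in>carrier (KQ q n). cochain q n z v \<oplus>\<^bsub>reg q\<^esub> cochain q n z' v) = cochain q n (\<lambda>i j. z i j + z' i j)"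
  by (auto simp: fun_eq_iff cochain_def of_lam_hom split_def act_add(2) sum.distrib)

lemma cochain_coboundary_iff:
  "cochain q n z \<in> coboundaries (env q) (KQ q) (kd q) (reg q) n \<longleftrightarrow>
    (\<exists>y. \<forall>i j. i + j = n \<longrightarrow> z i j = kdiff q y i j)"
proof (cases n)
  case 0
  have "cochain q 0 z = (\<lambda>v\<in>carrier (KQ q 0). \<zero>\<^bsub>reg q\<^esub>) \<longleftrightarrow> (\<forall>i j. i + j = 0 \<longrightarrow> z i j = 0)"
    unfolding cochain_zero_iff[symmetric] by (auto simp: fun_eq_iff cochain_def)
  then show ?thesis
    by (simp add: 0 coboundaries_def hom_group_def kdiff_def)
next
  case (Suc m)
  have eq: "compose (carrier (KQ q (Suc m))) (cochain q m y) (kd q m) = cochain q (Suc m) (kdiff q y)" for y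
    by (auto simp: fun_eq_iff compose_def cochain_kd) (auto simp: cochain_def)
  have "cochain q n z \<in> coboundaries (env q) (KQ q) (kd q) (reg q) n \<longleftrightarrow>
      (\<exists>g\<in>linear_maps (env q) (KQ q m) (reg q). cochain q n z = compose (carrier (KQ q (Suc m))) g (kd q m))"
    by (auto simp: Suc coboundaries_def)
  also have "\<dots> \<longleftrightarrow> (\<exists>y. cochain q n z = cochain q n (kdiff q y))"
    unfolding Suc eq[symmetric] using cochain_surj cochain_lm by metis
  finally show ?thesis
    by (simp add: cochain_eq_iff)
qed

lemma Psi_eq_iff:
  assumes "ncocycle n z" "ncocycle n z'"
  shows "Psi n z = Psi n z' \<longleftrightarrow> (\<exists>y. \<forall>i j. i + j = n \<longrightarrow> z i j - z' i j = kdiff q y i j)"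
  unfolding Psi_def
  using ext_class_pull_iff[of "cochain q n z" n "cochain q n z'"] assms
  by (simp add: cochain_cocycle_iff cochain_minus cochain_coboundary_iff del: reg_sel)

lemma Psi_cong: "(\<And>i j. i + j = n \<Longrightarrow> z i j = z' i j) \<Longrightarrow> Psi n z = Psi n z'"
  unfolding Psi_def using cochain_eq_iff[of q n z z'] by simp

lemma Psi_carrier: "ncocycle n z \<Longrightarrow> Psi n z \<in> carrier (E n)"
  unfolding Psi_def by (auto simp: P.Ext_carrier intro!: imageI pull_cocycle simp: cochain_cocycle_iff)

lemma Psi_surj:
  assumes "U \<in> carrier (E n)"
  shows "\<exists>z. ncocycle n z \<and> U = Psi n z"
proof -
  obtain f where f: "f \<in> cocycles (env q) (KQ q) (kd q) (reg q) n" "U = P.ecls n (pull n f)"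
    using ext_class_pull_surj[OF assms] by blast
  from cochain_surj[OF Q.cocycles_lm[OF f(1)]] obtain z where z: "f = cochain q n z" by blast
  with f show ?thesis
    by (auto simp: Psi_def cochain_cocycle_iff)
qed

lemma Psi_add:
  "ncocycle n z \<Longrightarrow> ncocycle n z' \<Longrightarrow> Psi n (\<lambda>i j. z i j + z' i j) = Psi n z \<otimes>\<^bsub>E n\<^esub> Psi n z'"
  unfolding Psi_def
  by (subst P.Ext_mult) (simp_all add: pull_cocycle cochain_cocycle_iff flip: cochain_plus pull_plus del: reg_sel)

lemma ncocycle_zero [simp]: "ncocycle n (\<lambda>i j. 0)"
  by (simp add: ncocycle_def)

lemma ncocycle_add: "ncocycle n z \<Longrightarrow> ncocycle n z' \<Longrightarrow> ncocycle n (\<lambda>i j. z i j + z' i j)"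
  by (simp add: ncocycle_def kdiff_add)

lemma Psi_zero: "Psi n (\<lambda>i j. 0) = \<one>\<^bsub>E n\<^esub>"
proof -
  interpret comm_group "E n" by (rule P.Ext_comm_group)
  have "Psi n (\<lambda>i j. 0) = Psi n (\<lambda>i j. 0) \<otimes>\<^bsub>E n\<^esub> Psi n (\<lambda>i j. 0)"
    using Psi_add[of n "\<lambda>i j. 0" "\<lambda>i j. 0"] by simp
  then show ?thesis
    using Psi_carrier[OF ncocycle_zero] by (metis l_cancel_one')
qed

text \<open>The element 1 \<otimes> z' acts by right multiplication, so evaluating z on the lift of
  z' gives the entries z z' in this order. Grouping by the total exponent turns the double sum into
  the slice of \<open>kconv\<close> in which the left factor has degree m.\<close>

lemma cochain_kG:
  assumes v: "v \<in> carrier (KQ q (n + m))"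
  shows "cochain q m z (kmap q (n + m) m (kG q n z') v) = cochain q (n + m) (kpart q m z z') v"
proof (rule lam_of_inj[of _ q])
  have c: "kmap q (n + m) m (kG q n z') v \<in> carrier (KQ q m)"
    by (rule lm_closed[OF kmap_lm[OF kG_linear] v])
  show "cochain q m z (kmap q (n + m) m (kG q n z') v) \<in> carrier (Lambda q)"
    "cochain q (n + m) (kpart q m z z') v \<in> carrier (Lambda q)"
    using lm_closed[OF cochain_lm c] lm_closed[OF cochain_lm v] by simp_all
  let ?V = "coords q v"
  have "lam_of q (cochain q m z (kmap q (n + m) m (kG q n z') v)) =
      (\<Sum>p\<in>KI m. \<Sum>p'\<in>KI n. act q (?V (fst p + fst p') (snd p + snd p'))
        (lscale (q ^ (snd p * fst p')) (lmul q (z (fst p) (snd p)) (z' (fst p') (snd p')))))"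
    unfolding lam_of_cochain[OF c] split_def
    by (intro sum.cong refl)
       (auto simp: coords_kmap[OF v] kG_def split_def act_sum act_llmul act_llscale act_tens act_lscale)
  also have "\<dots> = (\<Sum>(i, j)\<in>KI (n + m). act q (?V i j) (kpart q m z z' i j))"
    unfolding sum_KI_add
  proof (intro sum.cong refl, clarify)
    fix i j assume "(i, j) \<in> KI (n + m)"
    then show "(\<Sum>(p, p')\<in>{(p, p') \<in> KI m \<times> KI n. (fst p + fst p', snd p + snd p') = (i, j)}.
        act q (?V (fst p + fst p') (snd p + snd p'))
        (lscale (q ^ (snd p * fst p')) (lmul q (z (fst p) (snd p)) (z' (fst p') (snd p'))))) =
        act q (?V i j) (kpart q m z z' i j)"
      by (subst kpart_eq[of i j n m]) (auto simp: act_sum split_def intro!: sum.cong)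
  qed
  finally show "lam_of q (cochain q m z (kmap q (n + m) m (kG q n z') v)) =
      lam_of q (cochain q (n + m) (kpart q m z z') v)"
    unfolding lam_of_cochain[OF v] .
qed

lemma kG_lifting:
  assumes z: "ncocycle n z"
  shows "lifting (env q) (KQ q) (kd q) (KQ q) (kd q) (keps q) n (cochain q n z) (\<lambda>i. kmap q (n + i) i (kG q n z))"
  unfolding lifting_def
proof (intro conjI allI ballI)
  show lm: "kmap q (n + i) i (kG q n z) \<in> linear_maps (env q) (KQ q (n + i)) (KQ q i)" for i
    by (rule kmap_lm[OF kG_linear])
  fix v assume v: "v \<in> carrier (KQ q n)"
  have c: "kmap q n 0 (kG q n z) v \<in> carrier (KQ q 0)"
    using lm_closed[OF lm[of 0]] v by simp
  have "keps q (kmap q n 0 (kG q n z) v) = cochain q n z v"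
  proof (rule lam_of_inj[of _ q])
    show "keps q (kmap q n 0 (kG q n z) v) \<in> carrier (Lambda q)" "cochain q n z v \<in> carrier (Lambda q)"
      using lm_closed[OF cochain_lm c] lm_closed[OF cochain_lm v] by (simp_all add: keps_def)
    show "lam_of q (keps q (kmap q n 0 (kG q n z) v)) = lam_of q (cochain q n z v)"
      unfolding lam_of_keps[OF c] lam_of_cochain[OF v]
      by (simp add: coords_kmap[OF v] kG_def act_sum act_llmul act_llscale act_tens split_def)
  qed
  then show "keps q (kmap q (n + 0) 0 (kG q n z) v) = cochain q n z v" by simp
next
  have lm: "kmap q (n + i) i (kG q n z) \<in> linear_maps (env q) (KQ q (n + i)) (KQ q i)" for i
    by (rule kmap_lm[OF kG_linear])
  fix m v assume v: "v \<in> carrier (KQ q (Suc (n + m)))"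
  have c: "kmap q (n + Suc m) (Suc m) (kG q n z) v \<in> carrier (KQ q (Suc m))"
    using lm_closed[OF lm[of "Suc m"]] v by simp
  have c': "kd q (n + m) v \<in> carrier (KQ q (n + m))"
    by (rule lm_closed[OF kd_lm v])
  show "kd q m (kmap q (n + Suc m) (Suc m) (kG q n z) v) = kmap q (n + m) m (kG q n z) (kd q (n + m) v)"
  proof (rule coords_inj[OF lm_closed[OF kd_lm c] lm_closed[OF lm c']])
    fix i j assume ij: "i + j = m"
    have 1: "kD q m (coords q (kmap q (n + Suc m) (Suc m) (kG q n z) v)) i j = kD q m (kG q n z (coords q v)) i j"
      using ij v by (simp add: kD_def coords_kmap)
    have 2: "kG q n z (coords q (kd q (n + m) v)) i j = kG q n z (kD q (n + m) (coords q v)) i j"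
      using ij unfolding kG_def by (intro sum.cong) (auto simp: coords_kd[OF v])
    show "coords q (kd q m (kmap q (n + Suc m) (Suc m) (kG q n z) v)) i j =
        coords q (kmap q (n + m) m (kG q n z) (kd q (n + m) v)) i j"
      unfolding coords_kd[OF c] coords_kmap[OF c'] 1 2
      using ij z by (simp add: kG_chain ncocycle_def)
  qed
qed

lemma Psi_mult:
  assumes z: "ncocycle m z" and z': "ncocycle n z'"
  shows "ncocycle (n + m) (kpart q m z z')"
    "yoneda_product (env q) P d \<epsilon> (reg q) m n (Psi m z) (Psi n z') = Psi (n + m) (kpart q m z z')"
proof -
  have eq: "compose (carrier (KQ q (n + m))) (cochain q m z) (kmap q (n + m) m (kG q n z')) =
      cochain q (n + m) (kpart q m z z')"
    by (auto simp: fun_eq_iff compose_def cochain_kG) (auto simp: cochain_def)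
  show "ncocycle (n + m) (kpart q m z z')"
    using lifting_cocycle[OF Q.resolution_axioms Q.resolution_axioms kG_lifting[OF z'], of "cochain q m z" m]
    by (simp add: eq cochain_cocycle_iff z)
  show "yoneda_product (env q) P d \<epsilon> (reg q) m n (Psi m z) (Psi n z') = Psi (n + m) (kpart q m z z')"
    unfolding Psi_def using yoneda_product_pull[OF _ _ kG_lifting[OF z'], of "cochain q m z" m]
    by (simp add: cochain_cocycle_iff z z' eq)
qed

lemma Psi_sum:
  assumes "finite A" "\<And>i. i \<in> A \<Longrightarrow> ncocycle n (f i)"
  shows "ncocycle n (\<lambda>a b. \<Sum>i\<in>A. f i a b) \<and> (\<Otimes>\<^bsub>E n\<^esub>i\<in>A. Psi n (f i)) = Psi n (\<lambda>a b. \<Sum>i\<in>A. f i a b)"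
  using assms
proof (induction A)
  case empty
  interpret comm_group "E n" by (rule P.Ext_comm_group)
  show ?case by (simp add: Psi_zero)
next
  case (insert i A)
  interpret comm_group "E n" by (rule P.Ext_comm_group)
  from insert show ?case
    by (simp add: Psi_add ncocycle_add Psi_carrier Pi_iff)
qed

definition Pi' :: "(nat \<Rightarrow> nat \<Rightarrow> 'k lam) \<Rightarrow> nat \<Rightarrow> ('p \<Rightarrow> (letter, 'k) free_algebra set) set"
  where "Pi' z n = Psi n z"

abbreviation "HHr \<equiv> HH (Lambda q) (Lambda_unit q) P d \<epsilon>"

lemma kcocycles_ncocycle: "z \<in> kcocycles q \<Longrightarrow> ncocycle n z"
  by (simp add: kcocycles_def ncocycle_def)

lemma HH_sel:
  "carrier HHr = {x \<in> (\<Pi>\<^sub>E n\<in>UNIV. carrier (E n)). finite {n \<in> UNIV. x n \<noteq> \<one>\<^bsub>E n\<^esub>}}"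
  "a \<oplus>\<^bsub>HHr\<^esub> b = (\<lambda>n. a n \<otimes>\<^bsub>E n\<^esub> b n)"
  "\<zero>\<^bsub>HHr\<^esub> = (\<lambda>n. \<one>\<^bsub>E n\<^esub>)"
  "a \<otimes>\<^bsub>HHr\<^esub> b = (\<lambda>n. \<Otimes>\<^bsub>E n\<^esub>i\<in>{..n}. yoneda_product (env q) P d \<epsilon> (reg q) i (n - i) (a i) (b (n - i)))"
  "\<one>\<^bsub>HHr\<^esub> = (\<lambda>n. if n = 0 then P.ecls 0 \<epsilon> else \<one>\<^bsub>E n\<^esub>)"
  by (simp_all add: HH_def Ext_ring_def Let_def carrier_sum_group P.Ext_comm_group comm_group.axioms(2) restrict_UNIV)

lemma pull_kunit:
  "Psi 0 (\<lambda>i j. lscale c (kone i j)) =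
    P.ecls 0 (\<lambda>x\<in>carrier (P 0). enveloping_unit (Lambda q) (Lambda_unit q) c \<odot>\<^bsub>reg q\<^esub> \<epsilon> x)"
proof -
  have "pull 0 (cochain q 0 (\<lambda>i j. lscale c (kone i j))) x =
      enveloping_unit (Lambda q) (Lambda_unit q) c \<odot>\<^bsub>reg q\<^esub> \<epsilon> x" if x: "x \<in> carrier (P 0)" for x
  proof (rule lam_of_inj[of _ q])
    have b: "beta 0 x \<in> carrier (KQ q 0)" by (rule B_closed[OF x])
    have e: "\<epsilon> x \<in> carrier (Lambda q)" using lm_closed[OF P.e_lm x] by simp
    show "pull 0 (cochain q 0 (\<lambda>i j. lscale c (kone i j))) x \<in> carrier (Lambda q)"
      using lm_closed[OF cochain_lm b] x by (simp add: pull_def compose_def)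
    show "enveloping_unit (Lambda q) (Lambda_unit q) c \<odot>\<^bsub>reg q\<^esub> \<epsilon> x \<in> carrier (Lambda q)"
      using e by (simp add: enveloping_unit_eq reg_smult)
    have "lam_of q (\<epsilon> x) = act q (coords q (beta 0 x) 0 0) lone"
      using liftingD(2)[OF beta x] lam_of_keps[OF b] by simp
    then show "lam_of q (pull 0 (cochain q 0 (\<lambda>i j. lscale c (kone i j))) x) =
        lam_of q (enveloping_unit (Lambda q) (Lambda_unit q) c \<odot>\<^bsub>reg q\<^esub> \<epsilon> x)"
      using x e by (simp add: pull_def compose_def lam_of_cochain[OF b] KI_0 kone_def act_lscale
          enveloping_unit_eq reg_smult act_llscale act_tens)
  qed
  then have "pull 0 (cochain q 0 (\<lambda>i j. lscale c (kone i j))) =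
      (\<lambda>x\<in>carrier (P 0). enveloping_unit (Lambda q) (Lambda_unit q) c \<odot>\<^bsub>reg q\<^esub> \<epsilon> x)"
    by (auto simp: fun_eq_iff pull_def compose_def)
  then show ?thesis
    by (simp add: Psi_def)
qed

lemma Psi_kone: "Psi 0 kone = P.ecls 0 \<epsilon>"
proof -
  have "pull 0 (keps q) x = \<epsilon> x" for x
    using liftingD(2)[OF beta] P.e_lm
    by (cases "x \<in> carrier (P 0)") (auto simp: pull_def compose_def linear_maps_def PiE_iff extensional_def)
  then have "pull 0 (keps q) = \<epsilon>" by blast
  then show ?thesis
    by (simp add: Psi_def keps_def)
qed

lemma Psi_outside:
  "(\<And>i j. i + j = n \<Longrightarrow> z i j = 0) \<Longrightarrow> Psi n z = \<one>\<^bsub>E n\<^esub>"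
  using Psi_cong[of n z "\<lambda>i j. 0"] by (simp add: Psi_zero)

lemma Pi'_carrier:
  assumes z: "z \<in> kcocycles q"
  shows "Pi' z \<in> carrier HHr"
proof -
  have "{n. Psi n z \<noteq> \<one>\<^bsub>E n\<^esub>} \<subseteq> (\<lambda>(i, j). i + j) ` {(i, j). z i j \<noteq> 0}"
  proof
    fix n assume "n \<in> {n. Psi n z \<noteq> \<one>\<^bsub>E n\<^esub>}"
    then obtain i j where "i + j = n" "z i j \<noteq> 0" using Psi_outside by blast
    then show "n \<in> (\<lambda>(i, j). i + j) ` {(i, j). z i j \<noteq> 0}" by force
  qed
  then have "finite {n. Psi n z \<noteq> \<one>\<^bsub>E n\<^esub>}"
    by (rule finite_subset) (use z in \<open>simp add: kcocycles_def\<close>)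
  then show ?thesis
    using Psi_carrier[OF kcocycles_ncocycle[OF z]] by (auto simp: HH_sel Pi'_def)
qed

text \<open>Representing cocycles are chosen separately in each degree and glued along i + j.
  Choosing 0 wherever the class is trivial makes the glued family finitely supported, and
  homogeneous if the element is.\<close>

lemma Pi'_preimage:
  assumes x: "x \<in> carrier HHr"
  shows "\<exists>z\<in>kcocycles q. Pi' z = x \<and> (\<forall>i j. x (i + j) = \<one>\<^bsub>E (i + j)\<^esub> \<longrightarrow> z i j = 0)"
proof -
  have "\<forall>n. \<exists>z. ncocycle n z \<and> x n = Psi n z \<and> (x n = \<one>\<^bsub>E n\<^esub> \<longrightarrow> z = (\<lambda>i j. 0))"
  proof
    fix n
    show "\<exists>z. ncocycle n z \<and> x n = Psi n z \<and> (x n = \<one>\<^bsub>E n\<^esub> \<longrightarrow> z = (\<lambda>i j. 0))"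
    proof (cases "x n = \<one>\<^bsub>E n\<^esub>")
      case True
      then show ?thesis by (intro exI[of _ "\<lambda>i j. 0"]) (simp add: Psi_zero)
    next
      case False
      with x Psi_surj[of "x n" n] show ?thesis by (auto simp: HH_sel PiE_iff)
    qed
  qed
  then obtain Z where Z: "\<And>n. ncocycle n (Z n)" "\<And>n. x n = Psi n (Z n)" "\<And>n. x n = \<one>\<^bsub>E n\<^esub> \<Longrightarrow> Z n = (\<lambda>i j. 0)"
    by metis
  define z where "z i j = Z (i + j) i j" for i j
  have "{(i, j). z i j \<noteq> 0} \<subseteq> (\<Union>n\<in>{n \<in> UNIV. x n \<noteq> \<one>\<^bsub>E n\<^esub>}. KI n)"
    using Z(3) by (auto simp: z_def)
  then have "finite {(i, j). z i j \<noteq> 0}"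
    by (rule finite_subset) (use x in \<open>auto simp: HH_sel\<close>)
  moreover have "kdiff q z i j = 0" for i j
  proof (cases "i + j")
    case 0
    then show ?thesis by (simp add: kdiff_def)
  next
    case (Suc n)
    then have "kdiff q z i j = kdiff q (Z n) i j"
      by (intro kdiff_cong) (simp add: z_def)
    with Z(1)[of n] Suc show ?thesis by (simp add: ncocycle_def)
  qed
  ultimately have "z \<in> kcocycles q" by (simp add: kcocycles_def)
  moreover have "Pi' z = x"
    using Z(2) Psi_cong[of _ z] by (auto simp: Pi'_def z_def fun_eq_iff)
  moreover have "z i j = 0" if "x (i + j) = \<one>\<^bsub>E (i + j)\<^esub>" for i j
    using Z(3)[OF that] by (simp add: z_def)
  ultimately show ?thesis by blast
qed

lemma kconv_support:
  assumes "finite {(i, j). z i j \<noteq> 0}" "finite {(i, j). z' i j \<noteq> 0}"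
  shows "finite {(i, j). kconv q z z' i j \<noteq> 0}"
proof (rule finite_subset)
  let ?S = "(\<lambda>((a, b), (c, d)). (a + c, b + d)) ` ({(i, j). z i j \<noteq> 0} \<times> {(i, j). z' i j \<noteq> 0})"
  show "finite ?S" using assms by simp
  show "{(i, j). kconv q z z' i j \<noteq> 0} \<subseteq> ?S"
  proof clarify
    fix i j assume "kconv q z z' i j \<noteq> 0"
    then obtain a b where ab: "a \<le> i" "b \<le> j" and "lscale (q ^ (b * (i - a))) (lmul q (z a b) (z' (i - a) (j - b))) \<noteq> 0"
      unfolding kconv_def by (metis (no_types, lifting) sum.not_neutral_contains_not_neutral atMost_iff)
    then have "z a b \<noteq> 0" "z' (i - a) (j - b) \<noteq> 0" by auto
    with ab show "(i, j) \<in> ?S"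
      by (intro image_eqI[of _ _ "((a, b), (i - a, j - b))"]) auto
  qed
qed

lemma ncocycle_kconv:
  assumes z: "z \<in> kcocycles q" and z': "z' \<in> kcocycles q"
  shows "ncocycle n (kconv q z z')"
proof -
  have "ncocycle n (kpart q i z z')" if "i \<in> {..n}" for i
    using Psi_mult(1)[OF kcocycles_ncocycle[OF z, of i] kcocycles_ncocycle[OF z', of "n - i"]] that by simp
  then have "ncocycle n (\<lambda>a b. \<Sum>i\<in>{..n}. kpart q i z z' a b)"
    using Psi_sum[of "{..n}" n "\<lambda>i. kpart q i z z'"] by simp
  moreover have "kdiff q (\<lambda>a b. \<Sum>i\<in>{..n}. kpart q i z z' a b) i j = kdiff q (kconv q z z') i j"
    if "i + j = Suc n" for i j
    by (rule kdiff_cong) (use that in \<open>simp add: kconv_eq_sum_kpart\<close>)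
  ultimately show ?thesis
    by (simp add: ncocycle_def)
qed

lemma kconv_kcocycles:
  assumes z: "z \<in> kcocycles q" and z': "z' \<in> kcocycles q"
  shows "kconv q z z' \<in> kcocycles q"
proof -
  have "kdiff q (kconv q z z') i j = 0" for i j
  proof (cases "i + j")
    case 0
    then show ?thesis by (simp add: kdiff_def)
  next
    case (Suc n)
    with ncocycle_kconv[OF z z', of n] show ?thesis by (simp add: ncocycle_def)
  qed
  then show ?thesis
    using kconv_support[of z z'] z z' by (simp add: kcocycles_def)
qed

lemma Pi'_mult:
  assumes z: "z \<in> kcocycles q" and z': "z' \<in> kcocycles q"
  shows "Pi' (kconv q z z') = Pi' z \<otimes>\<^bsub>HHr\<^esub> Pi' z'"
proof
  fix n
  interpret comm_group "E n" by (rule P.Ext_comm_group)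
  have 1: "ncocycle n (kpart q i z z')"
    "yoneda_product (env q) P d \<epsilon> (reg q) i (n - i) (Psi i z) (Psi (n - i) z') = Psi n (kpart q i z z')"
    if "i \<in> {..n}" for i
    using Psi_mult[OF kcocycles_ncocycle[OF z, of i] kcocycles_ncocycle[OF z', of "n - i"]] that by simp_all
  have "(Pi' z \<otimes>\<^bsub>HHr\<^esub> Pi' z') n = (\<Otimes>\<^bsub>E n\<^esub>i\<in>{..n}. Psi n (kpart q i z z'))"
    unfolding HH_sel Pi'_def using 1 by (intro finprod_cong') (auto intro: Psi_carrier)
  also have "\<dots> = Psi n (\<lambda>a b. \<Sum>i\<in>{..n}. kpart q i z z' a b)"
    using Psi_sum[of "{..n}" n "\<lambda>i. kpart q i z z'"] 1 by simp
  also have "\<dots> = Psi n (kconv q z z')"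
    by (rule Psi_cong) (auto simp: kconv_eq_sum_kpart)
  finally show "Pi' (kconv q z z') n = (Pi' z \<otimes>\<^bsub>HHr\<^esub> Pi' z') n"
    by (simp add: Pi'_def)
qed

lemma HH_component_eq:
  "HH_component (Lambda q) (Lambda_unit q) P d n = {a \<in> carrier HHr. \<forall>m. m \<noteq> n \<longrightarrow> a m = \<one>\<^bsub>E m\<^esub>}"
  by (simp add: HH_component_def Ext_component_def HH_def Ext_ring_def Let_def)

sublocale HH_model q HHr "HH_component (Lambda q) (Lambda_unit q) P d"
  "HH_unit (Lambda q) (Lambda_unit q) P d \<epsilon>" Pi'
proof
  show "Pi' ` kcocycles q = carrier HHr"
    using Pi'_carrier Pi'_preimage by blast
  show "Pi' (\<lambda>i j. z i j + z' i j) = Pi' z \<oplus>\<^bsub>HHr\<^esub> Pi' z'"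
    if "z \<in> kcocycles q" "z' \<in> kcocycles q" for z z'
    using that by (simp add: HH_sel Pi'_def Psi_add kcocycles_ncocycle fun_eq_iff)
  show "Pi' (kconv q z z') = Pi' z \<otimes>\<^bsub>HHr\<^esub> Pi' z'"
    if "z \<in> kcocycles q" "z' \<in> kcocycles q" for z z'
    by (rule Pi'_mult[OF that])
  show "kconv q z z' \<in> kcocycles q" if "z \<in> kcocycles q" "z' \<in> kcocycles q" for z z'
    by (rule kconv_kcocycles[OF that])
  have out: "Psi n (\<lambda>i j. lscale c (kone i j)) = \<one>\<^bsub>E n\<^esub>" "Psi n kone = \<one>\<^bsub>E n\<^esub>" if "n > 0" for n c
    by (rule Psi_outside; use that in \<open>auto simp: kone_def lam_eq_iff\<close>)+
  show "Pi' kone = \<one>\<^bsub>HHr\<^esub>"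
    unfolding HH_sel by (rule ext) (simp add: Pi'_def Psi_kone out)
  show "Pi' (\<lambda>i j. 0) = \<zero>\<^bsub>HHr\<^esub>"
    by (simp add: HH_sel Pi'_def Psi_zero fun_eq_iff)
  show "HH_unit (Lambda q) (Lambda_unit q) P d \<epsilon> c = Pi' (\<lambda>i j. lscale c (kone i j))" for c
    unfolding HH_unit_def Let_def by (rule ext) (simp add: Pi'_def pull_kunit out)
  show "Pi' z = Pi' z' \<longleftrightarrow> (\<exists>y. \<forall>i j. z i j - z' i j = kdiff q y i j)"
    if z: "z \<in> kcocycles q" "z' \<in> kcocycles q" for z z'
  proof -
    have "Pi' z = Pi' z' \<longleftrightarrow> (\<forall>n. \<exists>y. \<forall>i j. i + j = n \<longrightarrow> z i j - z' i j = kdiff q y i j)"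
      using Psi_eq_iff[OF kcocycles_ncocycle[OF z(1)] kcocycles_ncocycle[OF z(2)]]
      by (simp add: fun_eq_iff Pi'_def)
    also have "\<dots> \<longleftrightarrow> (\<exists>y. \<forall>i j. z i j - z' i j = kdiff q y i j)"
    proof
      assume "\<forall>n. \<exists>y. \<forall>i j. i + j = n \<longrightarrow> z i j - z' i j = kdiff q y i j"
      then obtain y where y: "\<And>n i j. i + j = n \<Longrightarrow> z i j - z' i j = kdiff q (y n) i j" by metis
      \<comment> \<open>The differential at (i, j) reads entries of degree i + j - 1, so the entry
        used there must come from the witness for degree i + j: hence the successor.\<close>
      have "z i j - z' i j = kdiff q (\<lambda>i j. y (Suc (i + j)) i j) i j" for i j
        unfolding y[OF refl] by (rule kdiff_cong) auto
      then show "\<exists>y. \<forall>i j. z i j - z' i j = kdiff q y i j" by blast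
    qed blast
    finally show ?thesis .
  qed
  show "HH_component (Lambda q) (Lambda_unit q) P d n =
      Pi' ` {z \<in> kcocycles q. \<forall>i j. i + j \<noteq> n \<longrightarrow> z i j = 0}" for n
  proof (intro equalityI subsetI)
    fix x assume "x \<in> HH_component (Lambda q) (Lambda_unit q) P d n"
    then have x: "x \<in> carrier HHr" "\<And>m. m \<noteq> n \<Longrightarrow> x m = \<one>\<^bsub>E m\<^esub>" by (auto simp: HH_component_eq)
    from Pi'_preimage[OF x(1)] x(2) show "x \<in> Pi' ` {z \<in> kcocycles q. \<forall>i j. i + j \<noteq> n \<longrightarrow> z i j = 0}"
      by blast
  next
    fix x assume "x \<in> Pi' ` {z \<in> kcocycles q. \<forall>i j. i + j \<noteq> n \<longrightarrow> z i j = 0}"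
    then obtain z where z: "z \<in> kcocycles q" "\<And>i j. i + j \<noteq> n \<Longrightarrow> z i j = 0" "x = Pi' z" by blast
    then show "x \<in> HH_component (Lambda q) (Lambda_unit q) P d n"
      using Pi'_carrier[OF z(1)] Psi_outside[of _ z] by (auto simp: HH_component_eq Pi'_def)
  qed
qed

end


section \<open>Cocycles and coboundaries in coordinates\<close>

text \<open>The coefficients of xX^(i+1)Y^j and of yX^iY^(j+1) in the differential of X^iY^j are
  \<open>kp q i j\<close> and \<open>kr q i j\<close>.\<close>

definition kp :: "'k::field \<Rightarrow> nat \<Rightarrow> nat \<Rightarrow> 'k" where "kp q i j = 1 - (- 1) ^ (i + j) * q ^ j"
definition kr :: "'k::field \<Rightarrow> nat \<Rightarrow> nat \<Rightarrow> 'k" where "kr q i j = q ^ i - (- 1) ^ (i + j)"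

text \<open>Each entry is fed by one multihomogeneous part. For yx the indices with i = 0 or j = 0
  stand apart: they belong to parts in which X^iY^j would have a negative exponent, so at most one
  middle term remains.\<close>

lemma kdiff_sel:
  "c1 (kdiff q y i j) = 0"
  "cx (kdiff q y 0 j) = 0" "cx (kdiff q y (Suc i) j) = kp q i j * c1 (y i j)"
  "cy (kdiff q y i 0) = 0" "cy (kdiff q y i (Suc j)) = kr q i j * c1 (y i j)"
  "cw (kdiff q y 0 0) = 0"
  "cw (kdiff q y 0 (Suc j)) = (1 + (- 1) ^ j * q) * cx (y 0 j)"
  "cw (kdiff q y (Suc i) 0) = - ((q + (- 1) ^ i) * cy (y i 0))"
  "cw (kdiff q y (Suc i) (Suc j)) = q * (kr q i j * cx (y (Suc i) j) - kp q i j * cy (y i (Suc j)))"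
  by (auto simp: kdiff_def kp_def kr_def algebra_simps split: nat.split)

lemma kcocycles_iff:
  "z \<in> kcocycles q \<longleftrightarrow> finite {(i, j). z i j \<noteq> 0} \<and>
    (\<forall>i j. kp q i j * c1 (z i j) = 0 \<and> kr q i j * c1 (z i j) = 0) \<and>
    (\<forall>i j. q * (kr q i j * cx (z (Suc i) j) - kp q i j * cy (z i (Suc j))) = 0) \<and>
    (\<forall>j. (1 + (- 1) ^ j * q) * cx (z 0 j) = 0) \<and> (\<forall>i. (q + (- 1) ^ i) * cy (z i 0) = 0)" (is "_ \<longleftrightarrow> _ \<and> ?R")
proof -
  have "(\<forall>i j. kdiff q z i j = 0) \<longleftrightarrow> ?R"
  proof
    assume L: "\<forall>i j. kdiff q z i j = 0"
    have 1: "cx (kdiff q z i j) = 0" "cy (kdiff q z i j) = 0" "cw (kdiff q z i j) = 0" for i j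
      using L by simp_all
    show ?R
      using 1(1)[of "Suc _"] 1(2)[of _ "Suc _"] 1(3)[of "Suc _" "Suc _"] 1(3)[of 0 "Suc _"] 1(3)[of "Suc _" 0]
      by (simp only: kdiff_sel neg_equal_0_iff_equal simp_thms)
  next
    assume R: ?R
    have "kdiff q z i j = 0" for i j
      by (cases i; cases j) (use R in \<open>auto simp: lam_eq_iff kdiff_sel\<close>)
    then show "\<forall>i j. kdiff q z i j = 0" by blast
  qed
  then show ?thesis
    by (simp only: kcocycles_def mem_Collect_eq)
qed

text \<open>The differential respects the multihomogeneous parts, so the equation for y splits into
  independent scalar equations and the solutions can be chosen separately.\<close>

lemma coboundary_iff:
  "(\<exists>y. \<forall>i j. z i j = kdiff q y i j) \<longleftrightarrow>
    (\<forall>i j. c1 (z i j) = 0) \<and> (\<forall>j. cx (z 0 j) = 0) \<and> (\<forall>i. cy (z i 0) = 0) \<and> cw (z 0 0) = 0 \<and>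
    (\<forall>i j. \<exists>t. cx (z (Suc i) j) = kp q i j * t \<and> cy (z i (Suc j)) = kr q i j * t) \<and>
    (\<forall>i j. \<exists>s t. cw (z (Suc i) (Suc j)) = q * (kr q i j * s - kp q i j * t)) \<and>
    (\<forall>j. \<exists>t. cw (z 0 (Suc j)) = (1 + (- 1) ^ j * q) * t) \<and>
    (\<forall>i. \<exists>t. cw (z (Suc i) 0) = - ((q + (- 1) ^ i) * t))" (is "?L \<longleftrightarrow> ?R")
proof
  assume ?L
  then obtain y where "\<And>i j. z i j = kdiff q y i j" by blast
  then show ?R
    by (simp only: kdiff_sel) blast
next
  assume R: ?R
  obtain \<alpha> where \<alpha>: "\<And>i j. cx (z (Suc i) j) = kp q i j * \<alpha> i j" "\<And>i j. cy (z i (Suc j)) = kr q i j * \<alpha> i j"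
    using R by metis
  obtain \<beta> \<gamma> where \<beta>\<gamma>: "\<And>i j. cw (z (Suc i) (Suc j)) = q * (kr q i j * \<beta> i j - kp q i j * \<gamma> i j)"
    using R by metis
  obtain \<beta>0 where \<beta>0: "\<And>j. cw (z 0 (Suc j)) = (1 + (- 1) ^ j * q) * \<beta>0 j"
    using R by metis
  obtain \<gamma>0 where \<gamma>0: "\<And>i. cw (z (Suc i) 0) = - ((q + (- 1) ^ i) * \<gamma>0 i)"
    using R by metis
  \<comment> \<open>The x-entries at i = 0 and the y-entries at j = 0 solve the edge equations. All
    others belong to interior parts and are shifted by one.\<close>
  define y where "y i j = Lam (\<alpha> i j) (case i of 0 \<Rightarrow> \<beta>0 j | Suc a \<Rightarrow> \<beta> a j)
    (case j of 0 \<Rightarrow> \<gamma>0 i | Suc b \<Rightarrow> \<gamma> i b) 0" for i j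
  have "z i j = kdiff q y i j" for i j
    by (cases i; cases j) (use R in \<open>simp_all add: lam_eq_iff kdiff_sel \<alpha> \<beta>\<gamma> \<beta>0 \<gamma>0 y_def\<close>)
  then show ?L by blast
qed

section \<open>Monomial cochains and the algebra of cochains\<close>

definition kmono :: "'k::field lam \<Rightarrow> nat \<Rightarrow> nat \<Rightarrow> nat \<Rightarrow> nat \<Rightarrow> 'k lam"
  where "kmono u i j a b = (if a = i \<and> b = j then u else 0)"

lemma kmono_support [simp]: "finite {(a, b). kmono u i j a b \<noteq> 0}"
  by (rule finite_subset[of _ "{(i, j)}"]) (auto simp: kmono_def)

lemma kone_eq_kmono: "kone = kmono lone 0 0"
  by (simp add: kone_def kmono_def fun_eq_iff)

lemma kmono_cocycle_iff:
  "kmono u i j \<in> kcocycles q \<longleftrightarrow>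
    lmul q lX u + lscale ((- 1) ^ Suc (i + j) * q ^ j) (lmul q u lX) = 0 \<and>
    lscale (q ^ i) (lmul q lY u) + lscale ((- 1) ^ Suc (i + j)) (lmul q u lY) = 0" (is "_ \<longleftrightarrow> ?A = 0 \<and> ?B = 0")
proof -
  have k: "kdiff q (kmono u i j) a b = (if a = Suc i \<and> b = j then ?A else 0) + (if a = i \<and> b = Suc j then ?B else 0)"
    for a b
    by (cases a; cases b) (auto simp: kdiff_def kmono_def)
  have "kdiff q (kmono u i j) (Suc i) j = ?A" "kdiff q (kmono u i j) i (Suc j) = ?B"
    unfolding k by simp_all
  moreover have "kdiff q (kmono u i j) a b = 0" if "?A = 0" "?B = 0" for a b
    unfolding k that by simp
  ultimately show ?thesis
    by (auto simp: kcocycles_def)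
qed

lemma kmono_lW [simp]: "kmono (lscale t lW) i j \<in> kcocycles q"
  by (simp add: kmono_cocycle_iff lam_eq_iff)

lemma kcocycles_closed:
  "z \<in> kcocycles q \<Longrightarrow> z' \<in> kcocycles q \<Longrightarrow> (\<lambda>i j. z i j + z' i j) \<in> kcocycles q"
  "z \<in> kcocycles q \<Longrightarrow> (\<lambda>i j. lscale t (z i j)) \<in> kcocycles q"
  "(\<lambda>i j. 0) \<in> kcocycles q" "kone \<in> kcocycles q"
proof -
  show "(\<lambda>i j. z i j + z' i j) \<in> kcocycles q" if "z \<in> kcocycles q" "z' \<in> kcocycles q"
  proof -
    have "finite {(i, j). z i j + z' i j \<noteq> 0}"
      by (rule finite_subset[of _ "{(i, j). z i j \<noteq> 0} \<union> {(i, j). z' i j \<noteq> 0}"])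
         (use that in \<open>auto simp: kcocycles_def\<close>)
    with that show ?thesis by (simp add: kcocycles_def kdiff_add)
  qed
  show "(\<lambda>i j. lscale t (z i j)) \<in> kcocycles q" if "z \<in> kcocycles q"
  proof -
    have "finite {(i, j). lscale t (z i j) \<noteq> 0}"
      by (rule finite_subset[of _ "{(i, j). z i j \<noteq> 0}"]) (use that in \<open>auto simp: kcocycles_def\<close>)
    moreover have "kdiff q (\<lambda>i j. lscale t (z i j)) i j = lscale t (kdiff q z i j)" for i j
      by (auto simp: kdiff_def lam_eq_iff algebra_simps split: nat.split)
    ultimately show ?thesis using that by (simp add: kcocycles_def)
  qed
  show "(\<lambda>i j. 0) \<in> kcocycles q" by (simp add: kcocycles_def)
  show "kone \<in> kcocycles q"
    unfolding kone_eq_kmono by (simp add: kmono_cocycle_iff lam_eq_iff)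
qed

lemma kcocycles_uminus: "z \<in> kcocycles q \<Longrightarrow> (\<lambda>i j. - z i j) \<in> kcocycles q"
  using kcocycles_closed(2)[of z q "- 1"] by simp

lemma kconv_kone: "kconv q (\<lambda>i j. lscale t (kone i j)) z = (\<lambda>i j. lscale t (z i j))" "kconv q z kone = z"
proof -
  have "kconv q (\<lambda>i j. lscale t (kone i j)) z i j = lscale t (z i j)" for i j
  proof -
    have "kconv q (\<lambda>i j. lscale t (kone i j)) z i j = (\<Sum>a\<le>i. \<Sum>b\<le>j. if b = 0 then if a = 0 then lscale t (z i j) else 0 else 0)"
      unfolding kconv_def by (intro sum.cong refl) (auto simp: kone_def)
    then show ?thesis by simp
  qed
  then show "kconv q (\<lambda>i j. lscale t (kone i j)) z = (\<lambda>i j. lscale t (z i j))" by blast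
  have "kconv q z kone i j = z i j" for i j
  proof -
    have "kconv q z kone i j = (\<Sum>a\<le>i. \<Sum>b\<le>j. if b = j then if a = i then z i j else 0 else 0)"
      unfolding kconv_def by (intro sum.cong refl) (auto simp: kone_def)
    then show ?thesis by simp
  qed
  then show "kconv q z kone = z" by blast
qed

lemma kconv_distrib:
  "kconv q (\<lambda>i j. u i j + v i j) w = (\<lambda>i j. kconv q u w i j + kconv q v w i j)"
  "kconv q w (\<lambda>i j. u i j + v i j) = (\<lambda>i j. kconv q w u i j + kconv q w v i j)"
  by (simp_all add: kconv_def fun_eq_iff lmul_distrib lam.scale_right_distrib sum.distrib)

lemma sum_triangle:
  fixes f :: "nat \<Rightarrow> nat \<Rightarrow> nat \<Rightarrow> 'b::comm_monoid_add"
  shows "(\<Sum>a\<le>n. \<Sum>c\<le>a. f c (a - c) (n - a)) = (\<Sum>c\<le>n. \<Sum>a\<le>n - c. f c a (n - c - a))"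
  using fps_mult_assoc_lemma[of f n n] by (simp add: atMost_atLeast0)

text \<open>Both bracketings carry the cost q^(da' + da'' + b'a'') of sorting X^cY^d X^a'Y^b'
  X^a''Y^b''. The auxiliary facts \<open>ex1\<close> and \<open>ex2\<close> are this identity for
  exponents that arise as truncated differences; the rest is an exchange of triangular sums in each
  exponent.\<close>

lemma kconv_assoc: "kconv q (kconv q u v) w = kconv q u (kconv q v w)"
proof (intro ext)
  fix i j
  let ?F = "\<lambda>c a' a'' d b' b''. lscale (q ^ (d * a' + d * a'' + b' * a''))
    (lmul q (u c d) (lmul q (v a' b') (w a'' b'')))"
  have ex1: "q ^ (b * s) * q ^ (d * t) = q ^ (d * t + d * s + (b - d) * s)" if "d \<le> b" for b d s t
  proof -
    have "b * s + d * t = d * t + d * s + (b - d) * s"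
      using that by (simp add: diff_mult_distrib)
    then show ?thesis by (simp only: power_add[symmetric])
  qed
  have ex2: "q ^ (d * s) * q ^ (b * (s - t)) = q ^ (d * t + d * (s - t) + b * (s - t))" if "t \<le> s" for b d s t
  proof -
    have "d * s + b * (s - t) = d * t + d * (s - t) + b * (s - t)"
      using that by (simp add: diff_mult_distrib2)
    then show ?thesis by (simp only: power_add[symmetric])
  qed
  have ex2': "q ^ (d * (i - c)) * q ^ (b * (i - (c + t))) =
      q ^ (d * t + d * (i - (c + t)) + b * (i - (c + t)))" if "t \<le> i - c" for b c d t
    using ex2[OF that] by (simp only: diff_diff_left)
  have "kconv q (kconv q u v) w i j =
      (\<Sum>a\<le>i. \<Sum>b\<le>j. \<Sum>c\<le>a. \<Sum>d\<le>b. ?F c (a - c) (i - a) d (b - d) (j - b))"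
    unfolding kconv_def
    by (intro sum.cong refl)
       (auto simp: lmul_sum lmul_assoc lam.scale_sum_right ex1 intro!: sum.cong)
  also have "\<dots> = (\<Sum>a\<le>i. \<Sum>c\<le>a. \<Sum>b\<le>j. \<Sum>d\<le>b. ?F c (a - c) (i - a) d (b - d) (j - b))"
    by (rule sum.cong[OF refl], rule sum.swap)
  also have "\<dots> = (\<Sum>a\<le>i. \<Sum>c\<le>a. \<Sum>d\<le>j. \<Sum>b\<le>j - d. ?F c (a - c) (i - a) d b (j - d - b))"
  proof -
    have "(\<Sum>b\<le>j. \<Sum>d\<le>b. ?F c (a - c) (i - a) d (b - d) (j - b)) =
        (\<Sum>d\<le>j. \<Sum>b\<le>j - d. ?F c (a - c) (i - a) d b (j - d - b))" for a c
      by (rule sum_triangle[of "\<lambda>d b' b''. ?F c (a - c) (i - a) d b' b''" j])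
    then show ?thesis by (simp only:)
  qed
  also have "\<dots> = (\<Sum>c\<le>i. \<Sum>a\<le>i - c. \<Sum>d\<le>j. \<Sum>b\<le>j - d. ?F c a (i - c - a) d b (j - d - b))"
    by (rule sum_triangle[of "\<lambda>c a' a''. \<Sum>d\<le>j. \<Sum>b\<le>j - d. ?F c a' a'' d b (j - d - b)" i])
  also have "\<dots> = (\<Sum>c\<le>i. \<Sum>d\<le>j. \<Sum>a\<le>i - c. \<Sum>b\<le>j - d. ?F c a (i - c - a) d b (j - d - b))"
    by (rule sum.cong[OF refl], rule sum.swap)
  also have "\<dots> = kconv q u (kconv q v w) i j"
    unfolding kconv_def
    by (intro sum.cong refl)
       (auto simp: lmul_sum lam.scale_sum_right ex2' intro!: sum.cong)
  finally show "kconv q (kconv q u v) w i j = kconv q u (kconv q v w) i j" .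
qed

lemma kconv_kmono:
  "kconv q (kmono u a b) (kmono v c d) = kmono (lscale (q ^ (b * c)) (lmul q u v)) (a + c) (b + d)"
proof (intro ext)
  fix i j
  have "kconv q (kmono u a b) (kmono v c d) i j =
      (\<Sum>s\<le>i. \<Sum>t\<le>j. if t = b then if s = a then
        if i = a + c \<and> j = b + d then lscale (q ^ (b * c)) (lmul q u v) else 0 else 0 else 0)"
    unfolding kconv_def by (intro sum.cong refl) (auto simp: kmono_def)
  also have "\<dots> = kmono (lscale (q ^ (b * c)) (lmul q u v)) (a + c) (b + d) i j"
  proof (cases "i = a + c \<and> j = b + d")
    case False
    then show ?thesis
      by (intro trans[OF sum.neutral]) (auto simp: kmono_def intro!: sum.neutral)
  qed (auto simp: kmono_def)
  finally show "kconv q (kmono u a b) (kmono v c d) i j = kmono (lscale (q ^ (b * c)) (lmul q u v)) (a + c) (b + d) i j" .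
qed


section \<open>The ring structure of Hochschild cohomology\<close>

context HH_model
begin

lemma pi_closed: "z \<in> kcocycles q \<Longrightarrow> \<pi> z \<in> carrier H"
  using pi_surj by blast

lemma carrier_E:
  assumes "x \<in> carrier H" obtains z where "z \<in> kcocycles q" "x = \<pi> z"
  using assms pi_surj by blast

text \<open>The ring laws descend along \<pi> from those of \<open>kconv\<close> on cocycles, so
  associativity of the Yoneda product needs no argument about resolutions.\<close>

sublocale ring H
proof (intro ringI abelian_groupI monoidI)
  note simps = pi_add[symmetric] pi_mult[symmetric] pi_one[symmetric] pi_zero[symmetric]
    kconv_closed kcocycles_closed pi_closed
  show "x \<oplus>\<^bsub>H\<^esub> y \<in> carrier H" "x \<otimes>\<^bsub>H\<^esub> y \<in> carrier H"
    if "x \<in> carrier H" "y \<in> carrier H" for x y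
    using that by (auto elim!: carrier_E simp: simps)
  show "\<zero>\<^bsub>H\<^esub> \<in> carrier H" "\<one>\<^bsub>H\<^esub> \<in> carrier H" by (simp_all add: simps)
  show "x \<oplus>\<^bsub>H\<^esub> y \<oplus>\<^bsub>H\<^esub> z = x \<oplus>\<^bsub>H\<^esub> (y \<oplus>\<^bsub>H\<^esub> z)" "x \<otimes>\<^bsub>H\<^esub> y \<otimes>\<^bsub>H\<^esub> z = x \<otimes>\<^bsub>H\<^esub> (y \<otimes>\<^bsub>H\<^esub> z)"
    "(x \<oplus>\<^bsub>H\<^esub> y) \<otimes>\<^bsub>H\<^esub> z = x \<otimes>\<^bsub>H\<^esub> z \<oplus>\<^bsub>H\<^esub> y \<otimes>\<^bsub>H\<^esub> z"
    "z \<otimes>\<^bsub>H\<^esub> (x \<oplus>\<^bsub>H\<^esub> y) = z \<otimes>\<^bsub>H\<^esub> x \<oplus>\<^bsub>H\<^esub> z \<otimes>\<^bsub>H\<^esub> y"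
    if "x \<in> carrier H" "y \<in> carrier H" "z \<in> carrier H" for x y z
    using that by (auto elim!: carrier_E simp: simps add.assoc kconv_assoc kconv_distrib)
  show "x \<oplus>\<^bsub>H\<^esub> y = y \<oplus>\<^bsub>H\<^esub> x" if "x \<in> carrier H" "y \<in> carrier H" for x y
    using that by (auto elim!: carrier_E simp: simps add.commute)
  fix x assume "x \<in> carrier H"
  then obtain z where z: "z \<in> kcocycles q" "x = \<pi> z" by (rule carrier_E)
  show "\<zero>\<^bsub>H\<^esub> \<oplus>\<^bsub>H\<^esub> x = x" using z by (simp add: simps)
  show "\<one>\<^bsub>H\<^esub> \<otimes>\<^bsub>H\<^esub> x = x" "x \<otimes>\<^bsub>H\<^esub> \<one>\<^bsub>H\<^esub> = x"
    using z kconv_kone(1)[of q 1 z] by (simp_all add: simps kconv_kone(2))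
  show "\<exists>y\<in>carrier H. y \<oplus>\<^bsub>H\<^esub> x = \<zero>\<^bsub>H\<^esub>"
    using z kcocycles_uminus[OF z(1)]
    by (intro bexI[of _ "\<pi> (\<lambda>i j. - z i j)"]) (simp_all add: simps)
qed

lemma pi_eq_iff': "z \<in> kcocycles q \<Longrightarrow> z' \<in> kcocycles q \<Longrightarrow>
    \<pi> z = \<pi> z' \<longleftrightarrow> \<pi> (\<lambda>i j. z i j - z' i j) = \<zero>"
  using pi_eq_iff[of z z'] pi_eq_iff[of "\<lambda>i j. z i j - z' i j" "\<lambda>i j. 0"]
    kcocycles_closed(1)[OF _ kcocycles_uminus, of z q z'] kcocycles_closed(3)[of q]
  by (simp add: pi_zero)

lemma pi_zero_iff: "z \<in> kcocycles q \<Longrightarrow> \<pi> z = \<zero> \<longleftrightarrow> (\<exists>y. \<forall>i j. z i j = kdiff q y i j)"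
  using pi_eq_iff[of z "\<lambda>i j. 0"] kcocycles_closed(3)[of q] by (simp add: pi_zero)

abbreviation "K \<equiv> range \<eta>"

lemma eta_mult: "z \<in> kcocycles q \<Longrightarrow> \<eta> c \<otimes> \<pi> z = \<pi> (\<lambda>i j. lscale c (z i j))"
  unfolding pi_unit
  by (simp add: pi_mult[symmetric] kcocycles_closed kconv_kone)

lemma eta_hom: "\<eta> \<in> ring_hom (ring_of_type_algebra :: 'k ring) H"
proof (rule ring_hom_memI)
  show "\<eta> x \<in> carrier H" for x
    unfolding pi_unit by (simp add: pi_closed kcocycles_closed)
  show "\<eta> (x \<otimes>\<^bsub>ring_of_type_algebra\<^esub> y) = \<eta> x \<otimes> \<eta> y" for x y
    using eta_mult[of "\<lambda>i j. lscale y (kone i j)" x] kcocycles_closed(2)[OF kcocycles_closed(4)[of q], of y]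
    by (simp add: pi_unit ring_of_type_algebra_def)
  show "\<eta> (x \<oplus>\<^bsub>ring_of_type_algebra\<^esub> y) = \<eta> x \<oplus> \<eta> y" for x y
    by (simp add: pi_unit ring_of_type_algebra_def pi_add[symmetric] kcocycles_closed lam.scale_left_distrib)
  show "\<eta> \<one>\<^bsub>ring_of_type_algebra\<^esub> = \<one>"
    by (simp add: pi_unit ring_of_type_algebra_def pi_one)
qed

text \<open>Every coboundary vanishes at the index (0, 0), where the unit family has the entry
  1.\<close>

lemma one_not_zero: "\<one> \<noteq> \<zero>"
proof
  assume "\<one> = \<zero>"
  then have "\<pi> kone = \<zero>" by (simp add: pi_one)
  then obtain y where "kone 0 0 = kdiff q y 0 0"
    using pi_zero_iff[OF kcocycles_closed(4)] by blast
  then show False by (simp add: kone_def kdiff_def lam_eq_iff)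
qed

lemma subfield_K: "subfield K H"
proof -
  interpret k: field "ring_of_type_algebra :: 'k ring" by (rule field_from_type_algebra)
  interpret h: ring_hom_ring "ring_of_type_algebra :: 'k ring" H \<eta>
    by (rule ring_hom_ringI2[OF k.ring_axioms ring_axioms eta_hom])
  have "subfield (carrier (ring_of_type_algebra :: 'k ring)) ring_of_type_algebra"
    by (rule k.subfieldI'[OF k.carrier_is_subring]) (simp add: k.field_Units)
  from h.img_is_subfield(2)[OF this one_not_zero] show ?thesis
    by (simp add: ring_of_type_algebra_def)
qed

text \<open>The functionals L induce an injection of the classes of Z into k^I whose image contains
  every unit vector. The induction removes one coordinate l: the classes with coordinate 0 at l form
  a subspace to which the hypotheses pass, and the dual vector \<open>z0\<close> spans a
  complementary line.\<close>

lemma dimension_coordinates: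
  assumes "finite I" and "Z \<subseteq> kcocycles q" and "(\<lambda>i j. 0) \<in> Z"
    and "\<And>z z'. z \<in> Z \<Longrightarrow> z' \<in> Z \<Longrightarrow> (\<lambda>i j. z i j + z' i j) \<in> Z"
    and "\<And>z t. z \<in> Z \<Longrightarrow> (\<lambda>i j. lscale t (z i j)) \<in> Z"
    and add: "\<And>z z' l. L (\<lambda>i j. z i j + z' i j) l = L z l + L z' l"
    and scale: "\<And>z t l. L (\<lambda>i j. lscale t (z i j)) l = t * L z l"
    and "\<And>z. z \<in> Z \<Longrightarrow> \<pi> z = \<zero> \<longleftrightarrow> (\<forall>l\<in>I. L z l = 0)"
    and "\<And>l. l \<in> I \<Longrightarrow> \<exists>z\<in>Z. \<forall>l'\<in>I. L z l' = (if l' = l then 1 else 0)"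
  shows "dimension (card I) K (\<pi> ` Z)"
  using assms(1-5,8,9)
proof (induction I arbitrary: Z rule: finite_induct)
  case empty
  then have "\<pi> ` Z = {\<zero>}" by auto
  then show ?case by simp
next
  case (insert l I)
  note Z = insert.prems
  define Z' where "Z' = {z \<in> Z. L z l = 0}"
  have sub: "z \<in> kcocycles q" if "z \<in> Z" for z using Z(1) that by blast
  have L0: "L (\<lambda>i j. 0) l' = 0" for l'
    using scale[of 0 "\<lambda>i j. 0" l'] by simp
  obtain z0 where z0: "z0 \<in> Z" "L z0 l = 1" "\<And>l'. l' \<in> I \<Longrightarrow> L z0 l' = 0"
    using Z(6)[of l] insert.hyps(2) by (metis insertCI)
  have IH: "dimension (card I) K (\<pi> ` Z')"
  proof (rule insert.IH)
    show "\<pi> z = \<zero> \<longleftrightarrow> (\<forall>l\<in>I. L z l = 0)" if "z \<in> Z'" for z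
      using that Z(5)[of z] by (auto simp: Z'_def)
    show "\<exists>z\<in>Z'. \<forall>l'\<in>I. L z l' = (if l' = l'' then 1 else 0)" if l'': "l'' \<in> I" for l''
    proof -
      obtain z where "z \<in> Z" "\<forall>l'\<in>insert l I. L z l' = (if l' = l'' then 1 else 0)"
        using Z(6)[of l''] l'' by blast
      with l'' insert.hyps(2) show ?thesis
        by (intro bexI[of _ z]) (auto simp: Z'_def)
    qed
  qed (use Z in \<open>auto simp: Z'_def add scale L0\<close>)
  have "\<pi> z0 \<notin> \<pi> ` Z'"
  proof
    assume "\<pi> z0 \<in> \<pi> ` Z'"
    then obtain z where z: "z \<in> Z'" "\<pi> z0 = \<pi> z" by blast
    let ?d = "\<lambda>i j. z0 i j + lscale (- 1) (z i j)"
    have "?d \<in> Z"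
      by (intro Z(3) Z(4)) (use z0 z in \<open>auto simp: Z'_def\<close>)
    moreover have "\<pi> ?d = \<zero>"
      using pi_eq_iff'[of z0 z] z z0 sub by (simp add: Z'_def)
    ultimately have "L ?d l = 0" using Z(5) by blast
    then show False
      using z0 z by (simp only: add scale) (simp add: Z'_def)
  qed
  moreover have "\<pi> z0 \<in> carrier H" using sub z0 pi_closed by blast
  moreover have "\<pi> ` Z = line_extension K (\<pi> z0) (\<pi> ` Z')"
  proof (intro equalityI subsetI)
    fix x assume "x \<in> \<pi> ` Z"
    then obtain z where z: "z \<in> Z" "x = \<pi> z" by blast
    let ?w = "\<lambda>i j. z i j + lscale (- L z l) (z0 i j)"
    have w: "?w \<in> Z'"
      unfolding Z'_def mem_Collect_eq add scale
      by (intro conjI Z(3) Z(4)) (use z z0 in auto)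
    have "x = \<pi> (\<lambda>i j. lscale (L z l) (z0 i j) + ?w i j)"
      by (simp add: z(2) lam_eq_iff)
    also have "\<dots> = \<eta> (L z l) \<otimes> \<pi> z0 \<oplus> \<pi> ?w"
      using z z0 w sub Z(4) by (subst pi_add) (auto simp: eta_mult Z'_def)
    finally show "x \<in> line_extension K (\<pi> z0) (\<pi> ` Z')"
      unfolding line_extension_mem_iff using w by blast
  next
    fix x assume "x \<in> line_extension K (\<pi> z0) (\<pi> ` Z')"
    then obtain c z where z: "z \<in> Z'" "x = \<eta> c \<otimes> \<pi> z0 \<oplus> \<pi> z"
      unfolding line_extension_mem_iff by blast
    then have "x = \<pi> (\<lambda>i j. lscale c (z0 i j) + z i j)"
      using z0 sub Z(4) by (subst pi_add) (auto simp: eta_mult Z'_def)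
    moreover have "(\<lambda>i j. lscale c (z0 i j) + z i j) \<in> Z"
      using Z(3,4) z z0 by (simp add: Z'_def)
    ultimately show "x \<in> \<pi> ` Z" by blast
  qed
  ultimately show ?case
    using Suc_dim[OF _ _ IH, of "\<pi> z0"] insert.hyps by simp
qed

lemma has_hilbert_seriesI:
  assumes "\<And>n. dimension (f n) K (HC n)" and "\<And>n. fps_nth s n = of_nat (f n)"
  shows "has_hilbert_series H K HC s"
proof -
  have "finite_dimension K (HC n)" for n
    using assms(1) by (rule finite_dimensionI)
  moreover have "dim K (HC n) = f n" for n
    using dimI[OF subfield_K assms(1)[of n]] by (simp add: over_def)
  ultimately show ?thesis
    unfolding has_hilbert_series_def using assms(2) by (auto simp: fps_eq_iff)
qed

lemma dimension_component:
  assumes "finite I"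
    and add: "\<And>z z' l. L (\<lambda>i j. z i j + z' i j) l = L z l + L z' l"
    and scale: "\<And>z t l. L (\<lambda>i j. lscale t (z i j)) l = t * L z l"
    and "\<And>z. z \<in> kcocycles q \<Longrightarrow> (\<And>i j. i + j \<noteq> n \<Longrightarrow> z i j = 0) \<Longrightarrow> \<pi> z = \<zero> \<longleftrightarrow> (\<forall>l\<in>I. L z l = 0)"
    and "\<And>l. l \<in> I \<Longrightarrow> \<exists>z\<in>kcocycles q. (\<forall>i j. i + j \<noteq> n \<longrightarrow> z i j = 0) \<and> (\<forall>l'\<in>I. L z l' = (if l' = l then 1 else 0))"
  shows "dimension (card I) K (HC n)"
  unfolding pi_component
proof (rule dimension_coordinates[where L = L])
  show "\<exists>z\<in>{z \<in> kcocycles q. \<forall>i j. i + j \<noteq> n \<longrightarrow> z i j = 0}. \<forall>l'\<in>I. L z l' = (if l' = l then 1 else 0)"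
    if "l \<in> I" for l
    using assms(5)[OF that] by blast
qed (use assms(1-4) kcocycles_closed(1,2)[where q = q] kcocycles_closed(3)[of q] in auto)

end


section \<open>The case \<open>q = 0\<close>\<close>

text \<open>Exactness of the Koszul complex on (p, r) at its middle term: a single nonzero entry
  supplies the quotient, and the relation takes care of the other equation.\<close>

lemma span_pair_iff:
  fixes b c p r :: "'k::field"
  assumes "p \<noteq> 0 \<or> r \<noteq> 0"
  shows "(\<exists>t. b = p * t \<and> c = r * t) \<longleftrightarrow> r * b = p * c"
proof
  assume eq: "r * b = p * c"
  show "\<exists>t. b = p * t \<and> c = r * t"
  proof (cases "p = 0")
    case True
    with assms eq show ?thesis by (intro exI[of _ "c / r"]) auto
  next
    case False
    with eq show ?thesis by (intro exI[of _ "b / p"]) (auto simp: field_simps)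
  qed
qed (auto simp: algebra_simps)

lemma card_KI: "card (KI n) = Suc n"
proof -
  have "KI n = (\<lambda>i. (i, n - i)) ` {..n}"
    by (auto simp: KI_def image_iff)
  then show ?thesis
    by (simp add: card_image inj_on_def)
qed

lemma kp_0: "kp 0 i j = (if j = 0 then 1 - (- 1) ^ i else 1)"
  and kr_0: "kr 0 i j = (if i = 0 then 1 - (- 1) ^ j else - ((- 1) ^ (i + j)))"
  by (simp_all add: kp_def kr_def power_0_left)

lemma kp_kr_0: "(i, j) \<noteq> (0, 0) \<Longrightarrow> kp (0 :: 'k::field) i j \<noteq> 0 \<or> kr (0 :: 'k) i j \<noteq> 0"
  by (auto simp: kp_0 kr_0)

context HH_model
begin

lemma c1_cocycle_0:
  assumes q: "q = 0" and z: "z \<in> kcocycles q" and ij: "(i, j) \<noteq> (0, 0)"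
  shows "c1 (z i j) = 0"
proof -
  have "kp q i j * c1 (z i j) = 0" "kr q i j * c1 (z i j) = 0"
    using z unfolding kcocycles_iff by blast+
  then show ?thesis
    using kp_kr_0[OF ij, where 'k = 'k] by (auto simp: q)
qed

text \<open>At q = 0 the map onto yx vanishes in interior parts, so those entries survive. On the
  edges it has coefficient 1 or \<plusminus>1, so the x- and y-entries vanish there on cocycles and
  the entries of yx are coboundaries, except at (0, 0), which receives nothing. In the part of
  X^0Y^0 all coefficients are 0, so x and y both survive; in every other interior part one
  combination of them does.\<close>

lemma pi_zero_iff_0:
  assumes q: "q = 0" and z: "z \<in> kcocycles q"
  shows "\<pi> z = \<zero> \<longleftrightarrow> c1 (z 0 0) = 0 \<and> cw (z 0 0) = 0 \<and> cx (z 1 0) = 0 \<and> cy (z 0 1) = 0 \<and>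
    (\<forall>i j. (i, j) \<noteq> (0, 0) \<longrightarrow> kr q i j * cx (z (Suc i) j) - kp q i j * cy (z i (Suc j)) = 0) \<and>
    (\<forall>i j. cw (z (Suc i) (Suc j)) = 0)"
proof -
  have a: "c1 (z i j) = 0" if "(i, j) \<noteq> (0, 0)" for i j
    by (rule c1_cocycle_0[OF q z that])
  have a': "(\<forall>i j. c1 (z i j) = 0) \<longleftrightarrow> c1 (z 0 0) = 0"
    using a by (metis prod.inject)
  have b: "cx (z 0 j) = 0" for j
    using z unfolding kcocycles_iff by (simp add: q)
  have c: "cy (z i 0) = 0" for i
    using z unfolding kcocycles_iff by (simp add: q)
  have p: "(\<forall>i j. \<exists>t. cx (z (Suc i) j) = kp q i j * t \<and> cy (z i (Suc j)) = kr q i j * t) \<longleftrightarrow>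
      cx (z 1 0) = 0 \<and> cy (z 0 1) = 0 \<and>
      (\<forall>i j. (i, j) \<noteq> (0, 0) \<longrightarrow> kr q i j * cx (z (Suc i) j) - kp q i j * cy (z i (Suc j)) = 0)"
    (is "(\<forall>i j. ?P i j) \<longleftrightarrow> ?R")
  proof -
    have 0: "?P 0 0 \<longleftrightarrow> cx (z 1 0) = 0 \<and> cy (z 0 1) = 0"
      by (simp add: q kp_0 kr_0)
    have 1: "?P i j \<longleftrightarrow> kr q i j * cx (z (Suc i) j) - kp q i j * cy (z i (Suc j)) = 0"
      if "(i, j) \<noteq> (0, 0)" for i j
      using span_pair_iff[of "kp q i j" "kr q i j"] kp_kr_0[OF that, where 'k = 'k] by (simp add: q)
    show ?thesis
    proof
      assume "\<forall>i j. ?P i j"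
      then show ?R using 0 1 by blast
    next
      assume R: ?R
      have "?P i j" for i j
        using R 0 1 by (cases "(i, j) = (0, 0)") auto
      then show "\<forall>i j. ?P i j" by blast
    qed
  qed
  have e: "(\<exists>t. cw (z 0 (Suc j)) = (1 + (- 1) ^ j * q) * t)" "(\<exists>t. cw (z (Suc j) 0) = - ((q + (- 1) ^ j) * t))" for j
  proof -
    show "\<exists>t. cw (z 0 (Suc j)) = (1 + (- 1) ^ j * q) * t" by (simp add: q)
    have "cw (z (Suc j) 0) = - ((q + (- 1) ^ j) * (- ((- 1) ^ j * cw (z (Suc j) 0))))"
      by (simp add: q mult.assoc[symmetric] power_mult_distrib[symmetric])
    then show "\<exists>t. cw (z (Suc j) 0) = - ((q + (- 1) ^ j) * t)" by blast
  qed
  show ?thesis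
    unfolding pi_zero_iff[OF z] coboundary_iff a' p using b c e by (simp add: q)
qed

text \<open>The first index names the kind of class: 0 and 1 are the classes 1 and yx in degree 0, 2
  is the middle term of the part (i, j), 3 is yx in that part, and 4 is the additional class yY of
  the part (0, 0), where the middle cohomology has dimension two and kind 2 stands for xX.\<close>

definition coord0 :: "(nat \<Rightarrow> nat \<Rightarrow> 'k lam) \<Rightarrow> nat \<times> nat \<times> nat \<Rightarrow> 'k"
  where "coord0 z = (\<lambda>(k, i, j).
    if k = 0 then c1 (z 0 0) else if k = 1 then cw (z 0 0)
    else if k = 2 then (if i = 0 \<and> j = 0 then cx (z 1 0)
      else kr q i j * cx (z (Suc i) j) - kp q i j * cy (z i (Suc j)))
    else if k = 3 then cw (z (Suc i) (Suc j)) else cy (z 0 1))"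

lemma coord0_kmono:
  assumes "(i, j) \<noteq> (0, 0)"
  shows "coord0 (kmono (lscale t lX) (Suc i) j) l = (if l = (2, i, j) then kr q i j * t else 0)"
    "coord0 (kmono (lscale t lY) i (Suc j)) l = (if l = (2, i, j) then - kp q i j * t else 0)"
  using assms by (cases l; auto simp: coord0_def kmono_def)+

lemma coord0_kmono_lW: "coord0 (kmono (lscale t lW) (Suc i) (Suc j)) l = (if l = (3, i, j) then t else 0)"
  by (cases l; auto simp: coord0_def kmono_def)

definition index0 :: "nat \<Rightarrow> (nat \<times> nat \<times> nat) set"
  where "index0 n = (case n of 0 \<Rightarrow> {(0, 0, 0), (1, 0, 0)}
    | Suc m \<Rightarrow> Pair 2 ` KI m \<union> (case m of 0 \<Rightarrow> {(4, 0, 0)} | Suc k \<Rightarrow> Pair 3 ` KI k))"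

lemma finite_index0: "finite (index0 n)"
  by (simp add: index0_def split: nat.split)

lemma card_index0: "card (index0 n) = (if n = 0 then 2 else if n = 1 then 2 else 2 * n - 1)"
proof -
  have KI0: "KI 0 = {(0, 0)}" by (auto simp: KI_def)
  have "card (Pair (2::nat) ` KI m \<union> Pair 3 ` KI k) = Suc m + Suc k" for m k
    by (subst card_Un_disjoint) (auto simp: card_image inj_on_def card_KI)
  then show ?thesis
    by (auto simp: index0_def KI0 split: nat.split)
qed

lemma dimension_component_0:
  assumes q: "q = 0"
  shows "dimension (card (index0 n)) K (HC n)"
proof (rule dimension_component[where L = coord0])
  show "finite (index0 n)" by (rule finite_index0)
  show "coord0 (\<lambda>i j. z i j + z' i j) l = coord0 z l + coord0 z' l" for z z' l
    by (simp add: coord0_def split_def algebra_simps)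
  show "coord0 (\<lambda>i j. lscale t (z i j)) l = t * coord0 z l" for t z l
    by (simp add: coord0_def split_def algebra_simps)
next
  fix z assume z: "z \<in> kcocycles q" and deg: "\<And>i j. i + j \<noteq> n \<Longrightarrow> z i j = 0"
  consider "n = 0" | "n = 1" | k where "n = Suc (Suc k)"
    by (metis One_nat_def not0_implies_Suc)
  then show "\<pi> z = \<zero> \<longleftrightarrow> (\<forall>l\<in>index0 n. coord0 z l = 0)"
  proof cases
    case 1
    then have "z i j = 0" if "(i, j) \<noteq> (0, 0)" for i j using deg that by auto
    then show ?thesis
      unfolding pi_zero_iff_0[OF q z] by (auto simp: index0_def coord0_def 1)
  next
    case 2
    then have zz: "z i j = 0" if "(i, j) \<notin> {(1, 0), (0, 1)}" for i j
      using that by (intro deg) (auto simp: add_is_1)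
    have "z (Suc i) (Suc j) = 0" "z 0 0 = 0" for i j by (rule zz, simp)+
    moreover have "z (Suc i) j = 0" "z i (Suc j) = 0" if "(i, j) \<noteq> (0, 0)" for i j
      using that by (auto intro!: zz)
    ultimately show ?thesis
      unfolding pi_zero_iff_0[OF q z] by (auto simp: index0_def coord0_def 2 KI_0)
  next
    case (3 k)
    have 0: "z 0 0 = 0" "z 1 0 = 0" "z 0 1 = 0" by (rule deg, simp add: 3)+
    have 1: "z (Suc i) j = 0" "z i (Suc j) = 0" if "(i, j) \<notin> KI (Suc k)" for i j
      using that by (auto intro!: deg simp: 3)
    have 2: "z (Suc i) (Suc j) = 0" if "(i, j) \<notin> KI k" for i j
      using that by (auto intro!: deg simp: 3)
    have n: "index0 n = Pair 2 ` KI (Suc k) \<union> Pair 3 ` KI k"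
      by (simp add: index0_def 3)
    have "(\<forall>l\<in>index0 n. coord0 z l = 0) \<longleftrightarrow>
        (\<forall>i j. (i, j) \<in> KI (Suc k) \<longrightarrow> kr q i j * cx (z (Suc i) j) - kp q i j * cy (z i (Suc j)) = 0) \<and>
        (\<forall>i j. (i, j) \<in> KI k \<longrightarrow> cw (z (Suc i) (Suc j)) = 0)"
    proof -
      have bp: "(\<forall>l\<in>Pair c ` A. Q l) \<longleftrightarrow> (\<forall>i j. (i, j) \<in> A \<longrightarrow> Q (c, i, j))"
        for c :: nat and A and Q :: "nat \<times> nat \<times> nat \<Rightarrow> bool"
        by auto
      then show ?thesis
        unfolding n ball_Un bp by (auto simp: coord0_def) (metis add_is_0 nat.distinct(1) neq0_conv)
    qed
    also have "\<dots> \<longleftrightarrow> \<pi> z = \<zero>"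
      unfolding pi_zero_iff_0[OF q z] using 0 1 2
      by (metis (no_types, lifting) KI_iff add_is_0 diff_self lam_simps(1-4) mult_zero_right nat.distinct(1) prod.inject)
    finally show ?thesis by blast
  qed
next
  fix l assume l: "l \<in> index0 n"
  have X: "kmono (lscale t lX) (Suc i) j \<in> kcocycles q" "kmono (lscale t lY) i (Suc j) \<in> kcocycles q" for t i j
    by (simp_all add: kmono_cocycle_iff q lam_eq_iff)
  have W: "kmono (lscale t lW) i j \<in> kcocycles q" for t i j by simp
  have deg: "(\<forall>a b. a + b \<noteq> n \<longrightarrow> kmono u i j a b = 0)" if "i + j = n" for u i j
    using that by (auto simp: kmono_def)
  have *: "\<exists>z\<in>kcocycles q. (\<forall>i j. i + j \<noteq> n \<longrightarrow> z i j = 0) \<and> (\<forall>l'\<in>index0 n. coord0 z l' = (if l' = l then 1 else 0))"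
    if "kmono u i j \<in> kcocycles q" "i + j = n" "\<And>l'. l' \<in> index0 n \<Longrightarrow> coord0 (kmono u i j) l' = (if l' = l then 1 else 0)"
    for u i j
    using that deg by blast
  obtain k i j where kij: "l = (k, i, j)" by (cases l)
  consider "n = 0" "l = (0, 0, 0)" | "n = 0" "l = (1, 0, 0)" | "n = 1" "l = (2, 0, 0)" | "n = 1" "l = (4, 0, 0)"
    | "k = 2" "i + j + 1 = n" "(i, j) \<noteq> (0, 0)" | "k = 3" "i + j + 2 = n"
    using l by (auto simp: index0_def kij KI_def split: nat.splits) (cases i, auto)
  then show "\<exists>z\<in>kcocycles q. (\<forall>i j. i + j \<noteq> n \<longrightarrow> z i j = 0) \<and> (\<forall>l'\<in>index0 n. coord0 z l' = (if l' = l then 1 else 0))"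
  proof cases
    case 1
    then show ?thesis
      using kcocycles_closed(4)[of q] unfolding kone_eq_kmono
      by (intro *[of lone 0 0]) (auto simp: index0_def coord0_def kmono_def)
  next
    case 2
    then show ?thesis
      using W[of 1] by (intro *[of lW 0 0]) (auto simp: index0_def coord0_def kmono_def)
  next
    case 3
    then show ?thesis
      using X(1)[of 1 0 0] by (intro *[of lX 1 0]) (auto simp: index0_def coord0_def kmono_def KI_0)
  next
    case 4
    then show ?thesis
      using X(2)[of 1 0 0] by (intro *[of lY 0 1]) (auto simp: index0_def coord0_def kmono_def KI_0)
  next
    case 5
    \<comment> \<open>A dual vector is a multiple of x or of y, according to which coefficient can
      be inverted. The sign in the second choice is that of y in the combination measured by
      \<open>coord0\<close>.\<close>
    show ?thesis
    proof (cases "kr q i j = 0")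
      case True
      then have kp: "kp q i j \<noteq> 0" using kp_kr_0[OF 5(3), where 'k = 'k] q by simp
      have "coord0 (kmono (lscale (- 1 / kp q i j) lY) i (Suc j)) l' = (if l' = l then 1 else 0)" for l'
        unfolding coord0_kmono[OF 5(3)] kij using kp 5(1) by simp
      then show ?thesis
        by (intro *[of "lscale (- 1 / kp q i j) lY" i "Suc j"] X) (use 5(2) in simp_all)
    next
      case False
      then have "coord0 (kmono (lscale (1 / kr q i j) lX) (Suc i) j) l' = (if l' = l then 1 else 0)" for l'
        unfolding coord0_kmono[OF 5(3)] kij using 5(1) by simp
      then show ?thesis
        by (intro *[of "lscale (1 / kr q i j) lX" "Suc i" j] X) (use 5(2) in simp_all)
    qed
  next
    case 6
    then show ?thesis
      by (intro *[of "lscale 1 lW" "Suc i" "Suc j"] W; (simp only: coord0_kmono_lW kij)?)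
  qed
qed

lemma hilbert_series_0:
  assumes q: "q = 0"
  shows "has_hilbert_series H K HC (1 + (1 + fps_X ^ 3) / (1 - fps_X) ^ 2)"
proof (rule has_hilbert_seriesI[OF dimension_component_0[OF q]])
  \<comment> \<open>The coefficients 1, 2, 3, 5, 7, ... of (1 + t^3)/(1 - t)^2. Multiplying by 1 - t
    gives 1, 1, 1, 2, 2, ..., and multiplying once more gives 1 + t^3. They are the dimensions
    except in degree 0, where the class yx accounts for the additional 1 in the series.\<close>
  define g where "g = Abs_fps (\<lambda>n. if n = 0 then 1 else if n = 1 then 2 else of_nat (2 * n - 1) :: rat)"
  define h where "h = Abs_fps (\<lambda>n. if n < 3 then 1 else 2 :: rat)"
  have "g * (1 - fps_X) = h"
  proof (rule fps_ext)
    fix n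
    have "(g * (1 - fps_X)) $ n = g $ n - (if n = 0 then 0 else g $ (n - 1))"
      by (simp add: right_diff_distrib)
    also have "\<dots> = h $ n"
      by (auto simp: g_def h_def of_nat_diff not_less numeral_3_eq_3 le_Suc_eq)
    finally show "(g * (1 - fps_X)) $ n = h $ n" .
  qed
  moreover have "h * (1 - fps_X) = 1 + fps_X ^ 3"
  proof (rule fps_ext)
    fix n
    have "(h * (1 - fps_X)) $ n = h $ n - (if n = 0 then 0 else h $ (n - 1))"
      by (simp add: right_diff_distrib)
    also have "\<dots> = (1 + fps_X ^ 3) $ n"
      by (auto simp: h_def fps_X_power_nth)
    finally show "(h * (1 - fps_X)) $ n = (1 + fps_X ^ 3) $ n" .
  qed
  ultimately have "g * (1 - fps_X) ^ 2 = 1 + fps_X ^ 3"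
    by (simp add: power2_eq_square mult.assoc[symmetric])
  moreover have "(1 - fps_X :: rat fps) ^ 2 \<noteq> 0"
  proof
    assume "(1 - fps_X :: rat fps) ^ 2 = 0"
    then have "((1 - fps_X :: rat fps) ^ 2) $ 0 = 0" by simp
    then show False by (simp add: power2_eq_square)
  qed
  ultimately have "(1 + fps_X ^ 3) / (1 - fps_X) ^ 2 = g"
    by (metis nonzero_mult_div_cancel_right)
  then show "(1 + (1 + fps_X ^ 3) / (1 - fps_X) ^ 2 :: rat fps) $ n = of_nat (card (index0 n))" for n
    by (auto simp: g_def card_index0)
qed

text \<open>
  A cocycle has its \<open>1\<close>-component in degree \<open>0\<close> only. Hence the \<open>x\<close>- and \<open>y\<close>-components of a product
  lie in degrees in which one of the factors has such components, although classes with such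
  components exist in arbitrarily high degrees.
\<close>

lemma not_fin_gen_0:
  assumes q: "q = 0"
  shows "\<not> fin_gen_algebra H K"
proof
  assume "fin_gen_algebra H K"
  then obtain F where F: "finite F" "F \<subseteq> carrier H" "generate_ring H (K \<union> F) = carrier H"
    unfolding fin_gen_algebra_def by blast
  have a: "c1 (z i j) = 0" if "z \<in> kcocycles q" "(i, j) \<noteq> (0, 0)" for z i j
    by (rule c1_cocycle_0[OF q that])
  \<comment> \<open>The entries of yx stay unrestricted, because the product of an x-entry and a
    y-entry may create them in degrees above D.\<close>
  define T where "T D = {z \<in> kcocycles q. \<forall>i j. D < i + j \<longrightarrow> cx (z i j) = 0 \<and> cy (z i j) = 0}" for D
  have T_mono: "T D \<subseteq> T D'" if "D \<le> D'" for D D'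
    using that by (auto simp: T_def)
  have T_ex: "\<exists>D. z \<in> T D" if "z \<in> kcocycles q" for z
  proof -
    define S where "S = (\<lambda>(i, j). i + j) ` {(i, j). z i j \<noteq> 0}"
    define m where "m = Max S"
    have S: "finite S" using that by (simp add: S_def kcocycles_def)
    have "z i j = 0" if "m < i + j" for i j
    proof (rule ccontr)
      assume "z i j \<noteq> 0"
      then have "i + j \<in> S" by (auto simp: S_def intro!: image_eqI[of _ _ "(i, j)"])
      with S have "i + j \<le> m" unfolding m_def by (rule Max_ge)
      with that show False by simp
    qed
    then have "z \<in> T m" using that by (simp add: T_def)
    then show ?thesis ..
  qed
  have "\<exists>D. F \<subseteq> \<pi> ` T D"
    using F(1,2)
  proof (induction F)
    case (insert f F)
    then obtain D where D: "F \<subseteq> \<pi> ` T D" by blast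
    obtain z where z: "z \<in> kcocycles q" "f = \<pi> z" using insert.prems by (auto elim: carrier_E)
    then obtain D' where "z \<in> T D'" using T_ex by blast
    with D z(2) T_mono[of D "max D D'"] T_mono[of D' "max D D'"] have "insert f F \<subseteq> \<pi> ` T (max D D')"
      by auto
    then show ?case ..
  qed simp
  then obtain D where D: "F \<subseteq> \<pi> ` T D" ..
  have gen: "x \<in> \<pi> ` T D" if "x \<in> generate_ring H (K \<union> F)" for x
    using that
  proof (induction rule: generate_ring.induct)
    case one
    have "kone \<in> T D" using kcocycles_closed(4) by (auto simp: T_def kone_def)
    then show ?case by (auto simp flip: pi_one)
  next
    case (incl x)
    have "\<eta> c \<in> \<pi> ` T D" for c
      unfolding pi_unit
      by (rule imageI) (use kcocycles_closed(2)[OF kcocycles_closed(4)[of q], of c] in \<open>auto simp: T_def kone_def\<close>)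
    with incl D show ?case by blast
  next
    case (a_inv x)
    then obtain z where z: "z \<in> T D" "x = \<pi> z" by blast
    have "\<pi> (\<lambda>i j. - z i j) \<oplus> \<pi> z = \<zero>"
      using z kcocycles_uminus[of z q] by (simp add: T_def pi_add[symmetric] pi_zero)
    then have "\<ominus> x = \<pi> (\<lambda>i j. - z i j)"
      using z kcocycles_uminus[of z q] pi_closed by (intro minus_equality) (auto simp: T_def)
    then show ?case
      using z kcocycles_uminus[of z q] by (auto simp: T_def)
  next
    case (eng_add x y)
    then obtain z w where z: "z \<in> T D" "x = \<pi> z" "w \<in> T D" "y = \<pi> w" by blast
    then have "x \<oplus> y = \<pi> (\<lambda>i j. z i j + w i j)" "(\<lambda>i j. z i j + w i j) \<in> T D"
      by (auto simp: T_def pi_add kcocycles_closed)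
    then show ?case by blast
  next
    case (eng_mult x y)
    then obtain z w where z: "z \<in> T D" "x = \<pi> z" "w \<in> T D" "y = \<pi> w" by blast
    then have zw: "z \<in> kcocycles q" "w \<in> kcocycles q" by (auto simp: T_def)
    have "cx (kconv q z w i j) = 0" "cy (kconv q z w i j) = 0" if ij: "D < i + j" for i j
    proof -
      have 0: "c1 (z a b) * f (w (i - a) (j - b)) = 0" "f (z a b) * c1 (w (i - a) (j - b)) = 0"
        if f: "f = cx \<or> f = cy" and ab: "a \<le> i" "b \<le> j" for f a b
      proof -
        have "f (z i j) = 0" "f (w i j) = 0" using z ij f by (auto simp: T_def)
        moreover have "c1 (z a b) = 0 \<or> a = 0 \<and> b = 0"
          using a[OF zw(1), of a b] by (cases "(a, b) = (0, 0)") simp_all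
        moreover have "c1 (w (i - a) (j - b)) = 0 \<or> a = i \<and> b = j"
          using a[OF zw(2), of "i - a" "j - b"] ab by (cases "(i - a, j - b) = (0, 0)") simp_all
        ultimately show "c1 (z a b) * f (w (i - a) (j - b)) = 0" "f (z a b) * c1 (w (i - a) (j - b)) = 0"
          by auto
      qed
      show "cx (kconv q z w i j) = 0" "cy (kconv q z w i j) = 0"
        by (auto simp: kconv_def lam_sum 0 intro!: sum.neutral)
    qed
    then have "kconv q z w \<in> T D" using zw by (simp add: T_def kconv_closed)
    then show ?case using z zw by (auto simp: pi_mult[symmetric])
  qed
  \<comment> \<open>This cocycle has degree D + 3. If it were cohomologous to a member of
    \<open>T D\<close>, the x-entry would force a multiple 1 of the differential of X^(D+1)Y. The
    y-entry of that differential is \<plusminus>1 and would have nothing to match it.\<close>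
  let ?m = "kmono lX (Suc (Suc D)) 1"
  have m: "?m \<in> kcocycles q"
    by (simp add: kmono_cocycle_iff q lam_eq_iff)
  then have "\<pi> ?m \<in> \<pi> ` T D"
    using gen F(3) pi_closed by blast
  then obtain z where z: "z \<in> T D" "\<pi> ?m = \<pi> z" by blast
  then obtain y where y: "\<And>i j. ?m i j - z i j = kdiff q y i j"
    using pi_eq_iff[OF m, of z] by (auto simp: T_def)
  have "cx (z (Suc (Suc D)) 1) = 0" "cy (z (Suc D) 2) = 0" using z(1) by (simp_all add: T_def)
  then have "1 = kp q (Suc D) 1 * c1 (y (Suc D) 1)" "0 = kr q (Suc D) 1 * c1 (y (Suc D) 1)"
    using arg_cong[OF y[of "Suc (Suc D)" 1], of cx] arg_cong[OF y[of "Suc D" "Suc 1"], of cy]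
    by (simp_all only: kdiff_sel) (simp_all add: kmono_def numeral_2_eq_2)
  then show False
    by (simp add: q kp_0 kr_0)
qed

end


section \<open>The case of a root of unity\<close>

lemma (in ring) combinations_closed:
  assumes F: "finite F" "F \<subseteq> carrier R" and S: "S \<subseteq> carrier R" "\<zero> \<in> S"
    "\<And>s t. s \<in> S \<Longrightarrow> t \<in> S \<Longrightarrow> s \<oplus> t \<in> S"
  defines "M \<equiv> {h. \<exists>c\<in>F \<rightarrow> S. h = (\<Oplus>v\<in>F. c v \<otimes> v)}"
  shows "g \<in> M \<Longrightarrow> h \<in> M \<Longrightarrow> g \<oplus> h \<in> M" and "s \<in> S \<Longrightarrow> v \<in> F \<Longrightarrow> s \<otimes> v \<in> M" and "\<zero> \<in> M"
proof -
  assume "g \<in> M" "h \<in> M"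
  then obtain b c where b: "b \<in> F \<rightarrow> S" "g = (\<Oplus>v\<in>F. b v \<otimes> v)" and c: "c \<in> F \<rightarrow> S" "h = (\<Oplus>v\<in>F. c v \<otimes> v)"
    by (auto simp: M_def)
  have in_R: "b v \<in> carrier R" "c v \<in> carrier R" "v \<in> carrier R" if "v \<in> F" for v
    using that b(1) c(1) S(1) F(2) by auto
  have "(\<Oplus>v\<in>F. (b v \<oplus> c v) \<otimes> v) = (\<Oplus>v\<in>F. b v \<otimes> v \<oplus> c v \<otimes> v)"
    by (rule finsum_cong') (auto simp: in_R l_distr)
  also have "\<dots> = g \<oplus> h"
    unfolding b(2) c(2) by (rule finsum_addf) (auto simp: in_R)
  finally show "g \<oplus> h \<in> M"
    unfolding M_def using b(1) c(1) S(3) by (intro CollectI bexI[of _ "\<lambda>v. b v \<oplus> c v"]) auto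
next
  assume s: "s \<in> S" and v: "v \<in> F"
  have in_R: "s \<in> carrier R" "\<And>u. u \<in> F \<Longrightarrow> u \<in> carrier R" using s F S by auto
  have "(\<Oplus>u\<in>F. (if u = v then s else \<zero>) \<otimes> u) = (\<Oplus>u\<in>F. if v = u then s \<otimes> u else \<zero>)"
    using in_R by (intro finsum_cong') auto
  also have "\<dots> = s \<otimes> v"
    using F in_R v by (intro finsum_singleton) auto
  finally show "s \<otimes> v \<in> M"
    unfolding M_def using s S(2) by (intro CollectI bexI[of _ "\<lambda>u. if u = v then s else \<zero>"]) auto
next
  have "(\<Oplus>u\<in>F. \<zero> \<otimes> u) = (\<Oplus>u\<in>F. \<zero>)"
    using F by (intro finsum_cong') auto
  also have "\<dots> = \<zero>" by simp
  finally show "\<zero> \<in> M"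
    unfolding M_def using S(2) by (intro CollectI bexI[of _ "\<lambda>u. \<zero>"]) auto
qed

lemma sum_multiples:
  fixes g :: "nat \<Rightarrow> 'b::comm_monoid_add"
  assumes "N > 0" and "\<And>a. \<not> N dvd a \<Longrightarrow> g a = 0"
  shows "(\<Sum>a\<le>N * i. g a) = (\<Sum>a\<le>i. g (N * a))"
proof -
  have "(\<Sum>a\<le>N * i. g a) = (\<Sum>a\<in>(\<lambda>a. N * a) ` {..i}. g a)"
  proof (rule sum.mono_neutral_right)
    show "\<forall>a\<in>{..N * i} - (\<lambda>a. N * a) ` {..i}. g a = 0"
    proof
      fix a assume a: "a \<in> {..N * i} - (\<lambda>a. N * a) ` {..i}"
      have "\<not> N dvd a"
      proof
        assume "N dvd a"
        then obtain k where "a = N * k" by (rule dvdE)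
        with a assms(1) show False by auto
      qed
      then show "g a = 0" by (rule assms(2))
    qed
  qed auto
  also have "\<dots> = (\<Sum>a\<le>i. g (N * a))"
    using assms(1) by (subst sum.reindex) (auto simp: inj_on_def)
  finally show ?thesis .
qed

text \<open>Evenness of N gives the signs (-1)^(i+j) the period N in each exponent as well.\<close>

locale HH_root = HH_model q H HC \<eta> \<pi>
  for q :: "'k::field" and H :: "'h ring" (structure) and HC \<eta> \<pi> +
  fixes N :: nat
  assumes N: "N > 0" "even N" "q ^ N = 1"
begin

lemma q_nonzero: "q \<noteq> 0"
  using N by (metis power_0_left zero_neq_one neq0_conv)

lemma q_N [simp]: "q ^ (N * i) = 1"
  by (simp add: power_mult N)

lemma sign_N [simp]: "(- 1 :: 'k) ^ (N * i) = 1"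
  using N(2) by simp

text \<open>The polynomial subring \<open>k[X\<^sup>N, Y\<^sup>N]\<close>; the inner variable is \<open>X\<^sup>N\<close>.\<close>

definition of_poly :: "'k poly poly \<Rightarrow> nat \<Rightarrow> nat \<Rightarrow> 'k lam"
  where "of_poly p i j =
    (if N dvd i \<and> N dvd j then lscale (poly.coeff (poly.coeff p (j div N)) (i div N)) lone else 0)"

lemma of_poly_mult_N: "of_poly p (N * i) (N * j) = lscale (poly.coeff (poly.coeff p j) i) lone"
  using N(1) by (simp add: of_poly_def)

lemma of_poly_support: "finite {(i, j). of_poly p i j \<noteq> 0}"
proof (rule finite_subset)
  let ?S = "\<Union>j\<le>Polynomial.degree p. (\<lambda>i. (N * i, N * j)) ` {..degree (poly.coeff p j)}"
  show "finite ?S" by simp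
  show "{(i, j). of_poly p i j \<noteq> 0} \<subseteq> ?S"
  proof clarify
    fix i j assume nz: "of_poly p i j \<noteq> 0"
    then obtain a b where ab: "i = N * a" "j = N * b"
      by (auto simp: of_poly_def elim!: dvdE split: if_splits)
    with nz have c: "poly.coeff (poly.coeff p b) a \<noteq> 0" by (auto simp: of_poly_mult_N)
    then have "b \<le> Polynomial.degree p" by (metis Polynomial.coeff_0 Polynomial.le_degree)
    moreover have "a \<le> Polynomial.degree (poly.coeff p b)" using c by (rule Polynomial.le_degree)
    ultimately show "(i, j) \<in> ?S" using ab by auto
  qed
qed

lemma of_poly_cocycle: "of_poly p \<in> kcocycles q"
proof -
  have "kp q i j * c1 (of_poly p i j) = 0 \<and> kr q i j * c1 (of_poly p i j) = 0" for i j
    by (auto simp: of_poly_def kp_def kr_def power_add elim!: dvdE)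
  moreover have "cx (of_poly p i j) = 0" "cy (of_poly p i j) = 0" for i j
    by (auto simp: of_poly_def)
  ultimately show ?thesis
    using of_poly_support unfolding kcocycles_iff by simp
qed

text \<open>Only exponents divisible by N contribute, and there every twisting factor is a power of
  q^N = 1. What remains is the product of polynomials in two commuting variables.\<close>

lemma of_poly_kconv: "of_poly (p * r) = kconv q (of_poly p) (of_poly r)"
proof (intro ext)
  fix i j
  show "of_poly (p * r) i j = kconv q (of_poly p) (of_poly r) i j"
  proof (cases "N dvd i \<and> N dvd j")
    case True
    then obtain a b where ab: "i = N * a" "j = N * b" by (auto elim!: dvdE)
    have "kconv q (of_poly p) (of_poly r) i j = (\<Sum>s\<le>a. \<Sum>t\<le>b.
        lscale (q ^ (N * t * (i - N * s))) (lmul q (of_poly p (N * s) (N * t)) (of_poly r (i - N * s) (j - N * t))))"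
      unfolding kconv_def ab
      by (subst sum_multiples[OF N(1)], simp add: of_poly_def, subst sum_multiples[OF N(1)])
         (simp_all add: of_poly_def)
    also have "\<dots> = (\<Sum>s\<le>a. \<Sum>t\<le>b. lscale (poly.coeff (poly.coeff p t) s * poly.coeff (poly.coeff r (b - t)) (a - s)) lone)"
      by (intro sum.cong refl) (simp add: ab of_poly_mult_N mult.assoc flip: diff_mult_distrib2)
    also have "\<dots> = (\<Sum>t\<le>b. \<Sum>s\<le>a. lscale (poly.coeff (poly.coeff p t) s * poly.coeff (poly.coeff r (b - t)) (a - s)) lone)"
      by (rule sum.swap)
    also have "\<dots> = of_poly (p * r) i j"
      by (simp add: ab of_poly_mult_N Polynomial.coeff_mult Polynomial.coeff_sum lam.scale_sum_left)
    finally show ?thesis ..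
  next
    case False
    have "lscale (q ^ (b * (i - a))) (lmul q (of_poly p a b) (of_poly r (i - a) (j - b))) = 0"
      if "a \<le> i" "b \<le> j" for a b
    proof (cases "N dvd a \<and> N dvd b \<and> N dvd (i - a) \<and> N dvd (j - b)")
      case True
      then have "N dvd a + (i - a)" "N dvd b + (j - b)" by (auto intro: dvd_add)
      with False that show ?thesis by simp
    qed (auto simp: of_poly_def)
    then have "kconv q (of_poly p) (of_poly r) i j = 0"
      unfolding kconv_def by (intro sum.neutral ballI) auto
    with False show ?thesis by (auto simp: of_poly_def)
  qed
qed

lemma of_poly_add: "of_poly (p + r) = (\<lambda>i j. of_poly p i j + of_poly r i j)"
  by (auto simp: of_poly_def lam.scale_left_distrib fun_eq_iff)

lemma of_poly_const: "of_poly [:[:c:]:] = (\<lambda>i j. lscale c (kone i j))"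
  using N(1) by (auto simp: of_poly_def kone_def fun_eq_iff Polynomial.coeff_pCons split: nat.split elim!: dvdE)

definition phi :: "'k poly poly \<Rightarrow> 'h"
  where "phi p = \<pi> (of_poly p)"

lemma phi_hom: "phi \<in> ring_hom (ring_of_type_algebra :: 'k poly poly ring) H"
proof (rule ring_hom_memI)
  show "phi \<one>\<^bsub>ring_of_type_algebra\<^esub> = \<one>"
    using of_poly_const[of 1] by (simp add: phi_def ring_of_type_algebra_def pi_one one_pCons)
qed (simp_all add: phi_def ring_of_type_algebra_def of_poly_kconv of_poly_add pi_mult pi_add
    of_poly_cocycle pi_closed)

text \<open>Coboundaries have no entry in \<open>c1\<close>, which is where \<open>of_poly\<close>
  stores the coefficients.\<close>

lemma phi_inj: "inj phi"
proof (rule injI)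
  fix p r assume "phi p = phi r"
  then obtain y where y: "\<And>i j. of_poly p i j - of_poly r i j = kdiff q y i j"
    unfolding phi_def pi_eq_iff[OF of_poly_cocycle of_poly_cocycle] by blast
  have "poly.coeff (poly.coeff p j) i = poly.coeff (poly.coeff r j) i" for i j
    using arg_cong[OF y[of "N * i" "N * j"], of c1] by (simp add: kdiff_sel of_poly_mult_N)
  then show "p = r" by (simp add: poly_eq_iff)
qed

lemma polynomial_subring: "polynomial_subring_in_two H \<eta> (range phi)"
  unfolding polynomial_subring_in_two_def
  by (intro bexI[OF _ phi_hom] conjI phi_inj refl allI) (simp add: phi_def of_poly_const pi_unit)

text \<open>If the dimension were n, the n + 1 classes of 1, X^N, ..., X^(nN) could not be
  independent. They are, since coboundaries have no entry in \<open>c1\<close>. The set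
  \<open>Z\<close> is their span, described entry by entry.\<close>

lemma infinite_dimensional: "\<not> finite_dimension K (carrier H)"
proof
  assume "finite_dimension K (carrier H)"
  then obtain n where n: "dimension n K (carrier H)" by (auto simp: finite_dimension_def)
  define Z where "Z = {z \<in> kcocycles q. \<forall>i j. z i j =
    (if j = 0 \<and> N dvd i \<and> i \<le> N * n then lscale (c1 (z i j)) lone else 0)}"
  have Z: "z i j = (if j = 0 \<and> N dvd i \<and> i \<le> N * n then lscale (c1 (z i j)) lone else 0)" if "z \<in> Z" for z i j
    using that unfolding Z_def by blast
  have "dimension (card {..n}) K (\<pi> ` Z)"
  proof (rule dimension_coordinates[where L = "\<lambda>z l. c1 (z (N * l) 0)"])
    fix z assume z: "z \<in> Z"
    then have zc: "z \<in> kcocycles q" by (simp add: Z_def)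
    show "\<pi> z = \<zero> \<longleftrightarrow> (\<forall>l\<in>{..n}. c1 (z (N * l) 0) = 0)"
    proof
      assume "\<pi> z = \<zero>"
      then show "\<forall>l\<in>{..n}. c1 (z (N * l) 0) = 0"
        unfolding pi_zero_iff[OF zc] by (auto simp: kdiff_sel)
    next
      assume L: "\<forall>l\<in>{..n}. c1 (z (N * l) 0) = 0"
      have "z i j = 0" for i j
        using Z[OF z, of i j] L N(1) by (auto elim!: dvdE split: if_splits)
      then have "z = (\<lambda>i j. 0)" by blast
      then show "\<pi> z = \<zero>" by (simp add: pi_zero)
    qed
  next
    fix z z' assume z: "z \<in> Z" "z' \<in> Z"
    have "z i j + z' i j = (if j = 0 \<and> N dvd i \<and> i \<le> N * n then lscale (c1 (z i j + z' i j)) lone else 0)" for i j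
      by (subst Z[OF z(1)], subst Z[OF z(2)]) (auto simp: lam.scale_left_distrib)
    with z show "(\<lambda>i j. z i j + z' i j) \<in> Z"
      unfolding Z_def by (auto intro!: kcocycles_closed)
  next
    fix z t assume z: "z \<in> Z"
    have "lscale t (z i j) = (if j = 0 \<and> N dvd i \<and> i \<le> N * n then lscale (c1 (lscale t (z i j))) lone else 0)" for i j
      by (subst Z[OF z]) auto
    with z show "(\<lambda>i j. lscale t (z i j)) \<in> Z"
      unfolding Z_def by (auto intro!: kcocycles_closed)
  next
    fix l assume l: "l \<in> {..n}"
    let ?z = "of_poly (Polynomial.monom (Polynomial.monom 1 l) 0)"
    have "?z i j = (if i = N * l \<and> j = 0 then lone else 0)" for i j
      using N(1) by (auto simp: of_poly_def elim!: dvdE)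
    with l N(1) of_poly_cocycle[of "Polynomial.monom (Polynomial.monom 1 l) 0"] show "\<exists>z\<in>Z. \<forall>l'\<in>{..n}. c1 (z (N * l') 0) = (if l' = l then 1 else 0)"
      by (intro bexI[of _ ?z]) (auto simp: Z_def)
  next
    show "(\<lambda>i j. 0) \<in> Z" using kcocycles_closed(3)[of q] by (simp add: Z_def)
  qed (auto simp: Z_def)
  then obtain Vs where Vs: "set Vs \<subseteq> carrier H" "independent K Vs" "length Vs = Suc n"
    using exists_base[OF subfield_K] by (metis card_atMost)
  then show False
    using independent_length_le_dimension[OF subfield_K n Vs(2,1)] by simp
qed

text \<open>The cocycle condition for a monomial involves i and j only through q^i, q^j and the
  sign, all of which survive reduction modulo N.\<close>

lemma kmono_cocycle_mod:
  assumes "kmono u i j \<in> kcocycles q"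
  shows "kmono u (i mod N) (j mod N) \<in> kcocycles q"
proof -
  have "q ^ (i mod N) = q ^ i" "q ^ (j mod N) = q ^ j" for i j
    using q_N[of "i div N"] q_N[of "j div N"] power_add[of q "N * (i div N)" "i mod N"] power_add[of q "N * (j div N)" "j mod N"]
    by simp_all
  moreover have "(- 1 :: 'k) ^ (i mod N + j mod N) = (- 1) ^ (i + j)"
  proof -
    have "(- 1 :: 'k) ^ (i mod N) = (- 1) ^ i" for i
      using sign_N[of "i div N"] power_add[of "- 1 :: 'k" "N * (i div N)" "i mod N"] by simp
    then show ?thesis by (simp add: power_add)
  qed
  ultimately show ?thesis
    using assms unfolding kmono_cocycle_iff by simp
qed

text \<open>The twist is q to a multiple of N, hence 1, so multiplication by X^(Na)Y^(Nb) simply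
  shifts the exponents.\<close>

lemma phi_mult_kmono:
  assumes "kmono u (i mod N) (j mod N) \<in> kcocycles q"
  shows "phi (Polynomial.monom (Polynomial.monom t (i div N)) (j div N)) \<otimes> \<pi> (kmono u (i mod N) (j mod N)) = \<pi> (kmono (lscale t u) i j)"
proof -
  have "of_poly (Polynomial.monom (Polynomial.monom t a) b) = kmono (lscale t lone) (N * a) (N * b)" for a b
    using N(1) by (auto simp: of_poly_def kmono_def fun_eq_iff elim!: dvdE)
  then have "kconv q (of_poly (Polynomial.monom (Polynomial.monom t (i div N)) (j div N))) (kmono u (i mod N) (j mod N)) = kmono (lscale t u) i j"
    by (simp add: kconv_kmono mult.assoc)
  then show ?thesis
    unfolding phi_def using assms by (simp add: pi_mult[symmetric] of_poly_cocycle)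
qed

definition gens :: "'h set"
  where "gens = \<pi> ` {z. \<exists>u\<in>{lone, lX, lY, lW}. \<exists>i<N. \<exists>j<N. z = kmono u i j \<and> z \<in> kcocycles q}"

lemma gens: "finite gens" "gens \<subseteq> carrier H"
proof -
  have "{z. \<exists>u\<in>{lone, lX, lY, lW}. \<exists>i<N. \<exists>j<N. z = kmono u i j \<and> z \<in> kcocycles q} \<subseteq>
      (\<lambda>(u, i, j). kmono u i j) ` ({lone, lX, lY, lW} \<times> {..<N} \<times> {..<N})"
  proof
    fix z assume "z \<in> {z. \<exists>u\<in>{lone, lX, lY, lW}. \<exists>i<N. \<exists>j<N. z = kmono u i j \<and> z \<in> kcocycles q}"
    then obtain u i j where "u \<in> {lone, lX, lY, lW}" "i < N" "j < N" "z = kmono u i j" by blast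
    then show "z \<in> (\<lambda>(u, i, j). kmono u i j) ` ({lone, lX, lY, lW} \<times> {..<N} \<times> {..<N})"
      by (intro image_eqI[of _ _ "(u, i, j)"]) simp_all
  qed
  then have "finite {z. \<exists>u\<in>{lone, lX, lY, lW}. \<exists>i<N. \<exists>j<N. z = kmono u i j \<and> z \<in> kcocycles q}"
    by (rule finite_subset) simp
  then show "finite gens" by (simp only: gens_def finite_imageI)
  show "gens \<subseteq> carrier H" by (auto simp: gens_def pi_closed)
qed

definition comb :: "'h set"
  where "comb = {h. \<exists>c\<in>gens \<rightarrow> range phi. h = (\<Oplus>v\<in>gens. c v \<otimes> v)}"

lemma comb:
  "g \<in> comb \<Longrightarrow> h \<in> comb \<Longrightarrow> g \<oplus> h \<in> comb" "s \<in> range phi \<Longrightarrow> v \<in> gens \<Longrightarrow> s \<otimes> v \<in> comb" "\<zero> \<in> comb"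
proof -
  have "\<zero> = phi 0"
  proof -
    have "of_poly 0 = (\<lambda>i j. 0)" by (auto simp: of_poly_def fun_eq_iff)
    then show ?thesis by (simp add: phi_def pi_zero)
  qed
  then have 0: "\<zero> \<in> range phi" by blast
  have plus: "s \<oplus> t \<in> range phi" if st: "s \<in> range phi" "t \<in> range phi" for s t
  proof -
    obtain p r where "s = phi p" "t = phi r" using st by blast
    then have "s \<oplus> t = phi (p + r)"
      by (simp add: phi_def of_poly_add pi_add of_poly_cocycle)
    then show ?thesis by blast
  qed
  have sub: "range phi \<subseteq> carrier H"
    by (auto simp: phi_def pi_closed of_poly_cocycle)
  show "g \<in> comb \<Longrightarrow> h \<in> comb \<Longrightarrow> g \<oplus> h \<in> comb" "s \<in> range phi \<Longrightarrow> v \<in> gens \<Longrightarrow> s \<otimes> v \<in> comb" "\<zero> \<in> comb"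
    unfolding comb_def by (intro combinations_closed[OF gens sub 0 plus]; assumption)+
qed

text \<open>The alternative t = 0 is there because a monomial that is not a cocycle may still be
  listed with coefficient zero in the expansion of a cocycle.\<close>

lemma kmono_comb:
  assumes "u \<in> {lone, lX, lY, lW}" "t = 0 \<or> kmono u i j \<in> kcocycles q"
  shows "\<pi> (kmono (lscale t u) i j) \<in> comb" "kmono (lscale t u) i j \<in> kcocycles q"
proof -
  have z: "kmono (lscale 0 u) i j = (\<lambda>i j. 0)" by (auto simp: kmono_def fun_eq_iff)
  show "\<pi> (kmono (lscale t u) i j) \<in> comb"
  proof (cases "t = 0")
    case True
    then show ?thesis using comb(3) by (simp only: z pi_zero)
  next
    case False
    with assms have c: "kmono u (i mod N) (j mod N) \<in> kcocycles q"
      using kmono_cocycle_mod by blast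
    have "i mod N < N" "j mod N < N" using N(1) by simp_all
    with c assms(1) have "\<pi> (kmono u (i mod N) (j mod N)) \<in> gens"
      unfolding gens_def by blast
    then show ?thesis
      using comb(2) phi_mult_kmono[OF c, of t] by (metis rangeI)
  qed
  have "kmono (lscale t u) i j = (\<lambda>a b. lscale t (kmono u i j a b))"
    by (auto simp: kmono_def fun_eq_iff)
  then show "kmono (lscale t u) i j \<in> kcocycles q"
    using assms(2) kcocycles_closed(2)[of "kmono u i j" q t] kcocycles_closed(3)[of q] by auto
qed

text \<open>If every monomial that occurs in z is a cocycle by itself, the class of z is the sum of
  the classes of these monomials. No condition on yx appears because its monomials are always
  cocycles.\<close>

lemma pi_comb:
  assumes z: "z \<in> kcocycles q"
    and mono: "\<And>i j. c1 (z i j) = 0 \<or> kmono lone i j \<in> kcocycles q"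
      "\<And>i j. cx (z i j) = 0 \<or> kmono lX i j \<in> kcocycles q" "\<And>i j. cy (z i j) = 0 \<or> kmono lY i j \<in> kcocycles q"
  shows "\<pi> z \<in> comb"
proof -
  have cell: "kmono (z i j) i j \<in> kcocycles q \<and> \<pi> (kmono (z i j) i j) \<in> comb" for i j
  proof -
    have W: "cw (z i j) = 0 \<or> kmono lW i j \<in> kcocycles q"
      using kmono_lW[of 1 i j q] by simp
    note m = kmono_comb[OF _ mono(1)] kmono_comb[OF _ mono(2)] kmono_comb[OF _ mono(3)] kmono_comb[OF _ W]
    have add: "kmono (u + v) i j \<in> kcocycles q \<and> \<pi> (kmono (u + v) i j) \<in> comb"
      if "kmono u i j \<in> kcocycles q \<and> \<pi> (kmono u i j) \<in> comb" "kmono v i j \<in> kcocycles q \<and> \<pi> (kmono v i j) \<in> comb" for u v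
    proof -
      have "kmono (u + v) i j = (\<lambda>a b. kmono u i j a b + kmono v i j a b)"
        by (auto simp: kmono_def fun_eq_iff)
      with that show ?thesis by (simp add: kcocycles_closed pi_add comb(1))
    qed
    show ?thesis
      by (subst (1 2) lam_decomp[of "z i j"]) (intro add conjI m; simp)
  qed
  have "(\<lambda>i j. if (i, j) \<in> S then z i j else 0) \<in> kcocycles q \<and> \<pi> (\<lambda>i j. if (i, j) \<in> S then z i j else 0) \<in> comb"
    if "finite S" for S
    using that
  proof (induction S)
    case empty
    show ?case using comb(3) kcocycles_closed(3)[of q] by (simp add: pi_zero)
  next
    case (insert p S)
    obtain a b where p: "p = (a, b)" by (cases p)
    have "(\<lambda>i j. if (i, j) \<in> insert p S then z i j else 0) =
        (\<lambda>i j. kmono (z a b) a b i j + (if (i, j) \<in> S then z i j else 0))"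
      using insert.hyps(2) by (auto simp: kmono_def fun_eq_iff p)
    with insert.IH cell[of a b] show ?case
      by (simp add: kcocycles_closed pi_add comb(1))
  qed
  note * = this
  define S where "S = {(i, j). z i j \<noteq> 0}"
  have "finite S" using z by (simp add: kcocycles_def S_def)
  moreover have "(\<lambda>i j. if (i, j) \<in> S then z i j else 0) = z"
    by (auto simp: fun_eq_iff S_def)
  ultimately show ?thesis
    using *[of S] by simp
qed

text \<open>
  In a pair of components related by a nonzero pair of coefficients every cocycle is a coboundary, so
  these components can be dropped; the remaining components are cocycles one by one.
\<close>

lemma fin_gen_module: "fin_gen_module_over_subring H (range phi)"
proof -
  have "h \<in> comb" if h: "h \<in> carrier H" for h
  proof -
    obtain z where z: "z \<in> kcocycles q" "h = \<pi> z" using h by (rule carrier_E)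
    define good where "good i j \<longleftrightarrow> kp q i j = 0 \<and> kr q i j = 0" for i j
    \<comment> \<open>The part (i, j) has its x-entry at (i + 1, j) and its y-entry at (i, j + 1),
      which explains the predecessors. The edge entries at i = 0 and j = 0 are kept: the cocycle
      equation there says that the entry or its coefficient is zero.\<close>
    define w where "w i j = Lam (c1 (z i j))
      (case i of 0 \<Rightarrow> cx (z i j) | Suc a \<Rightarrow> if good a j then cx (z i j) else 0)
      (case j of 0 \<Rightarrow> cy (z i j) | Suc b \<Rightarrow> if good i b then cy (z i j) else 0) (cw (z i j))" for i j
    have zi: "kp q i j * c1 (z i j) = 0" "kr q i j * c1 (z i j) = 0"
      "kr q i j * cx (z (Suc i) j) = kp q i j * cy (z i (Suc j))"
      "(1 + (- 1) ^ j * q) * cx (z 0 j) = 0" "(q + (- 1) ^ i) * cy (z i 0) = 0" for i j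
      using z(1) q_nonzero unfolding kcocycles_iff by simp_all
    have "finite {(i, j). w i j \<noteq> 0}"
    proof (rule finite_subset)
      have "w i j = 0" if "z i j = 0" for i j
        using that by (cases i; cases j) (simp_all add: w_def lam_eq_iff)
      then show "{(i, j). w i j \<noteq> 0} \<subseteq> {(i, j). z i j \<noteq> 0}" by blast
    qed (use z(1) in \<open>simp add: kcocycles_def\<close>)
    then have w: "w \<in> kcocycles q"
      unfolding kcocycles_iff using zi by (auto simp: w_def good_def)
    have "\<exists>y. \<forall>i j. z i j - w i j = kdiff q y i j"
      unfolding coboundary_iff
    proof (intro conjI allI)
      fix i j
      show "\<exists>t. cx (z (Suc i) j - w (Suc i) j) = kp q i j * t \<and> cy (z i (Suc j) - w i (Suc j)) = kr q i j * t"
      proof (cases "good i j")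
        case False
        then consider "kp q i j \<noteq> 0" | "kp q i j = 0" "kr q i j \<noteq> 0" by (auto simp: good_def)
        then show ?thesis
        proof cases
          case 1
          with False zi(3)[of i j] show ?thesis
            by (intro exI[of _ "cx (z (Suc i) j) / kp q i j"]) (simp add: w_def field_simps)
        next
          case 2
          with False zi(3)[of i j] show ?thesis
            by (intro exI[of _ "cy (z i (Suc j)) / kr q i j"]) (simp add: w_def)
        qed
      qed (auto simp: w_def)
    qed (auto simp: w_def intro!: exI[of _ "0 :: 'k"])
    then have "\<pi> z = \<pi> w" by (simp only: pi_eq_iff[OF z(1) w])
    moreover have "\<pi> w \<in> comb"
    proof (rule pi_comb[OF w])
      fix i j
      show "c1 (w i j) = 0 \<or> kmono lone i j \<in> kcocycles q"
        using zi(1,2)[of i j] by (auto simp: w_def kmono_cocycle_iff lam_eq_iff kp_def kr_def)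
      show "cx (w i j) = 0 \<or> kmono lX i j \<in> kcocycles q"
        using zi(4)[of j, unfolded mult_eq_0_iff] by (cases i) (auto simp: w_def kmono_cocycle_iff lam_eq_iff good_def kp_def kr_def algebra_simps)
      show "cy (w i j) = 0 \<or> kmono lY i j \<in> kcocycles q"
        using zi(5)[of i, unfolded mult_eq_0_iff] by (cases j) (auto simp: w_def kmono_cocycle_iff lam_eq_iff good_def kp_def kr_def algebra_simps neg_eq_iff_add_eq_0)
    qed
    ultimately show ?thesis using z(2) by simp
  qed
  then show ?thesis
    unfolding fin_gen_module_over_subring_def comb_def using gens by blast
qed

end


section \<open>The generic case\<close>

subsection \<open>The fibre product in coordinates\<close>

text \<open>For q = 1 the relations of \<open>Lambda\<close> are those of the exterior algebra, so
  the coordinates already constructed serve both rings.\<close>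

lemma exterior_algebra_eq: "exterior_algebra = Lambda (1 :: 'k::field)"
  and exterior_ideal_eq: "exterior_ideal = Lambda_ideal (1 :: 'k)"
proof -
  show "exterior_ideal = Lambda_ideal (1 :: 'k)"
    unfolding exterior_ideal_def Lambda_ideal_def Let_def const_one mult_1_left
    by (rule arg_cong[of _ _ "genideal free_algebra"]) blast
  then show "exterior_algebra = Lambda (1 :: 'k)"
    by (simp add: exterior_algebra_def Lambda_def)
qed

lemma c1_list_lam: "c1 (list_lam q w) = (if w = [] then 1 else 0)"
  by (cases w) (simp_all add: letter_lam_def split: letter.split)

lemma lookup_zero_eq_ev: "Poly_Mapping.lookup f 0 = c1 (ev q f)"
proof (induction f rule: poly_mapping_induct)
  case (single_add f a c)
  have "Poly_Mapping.lookup (Poly_Mapping.single a c) 0 = c1 (ev q (Poly_Mapping.single a c))"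
    by (cases a) (auto simp: ev_single c1_list_lam lookup_single when_def zero_word_def)
  with single_add show ?case by (simp add: ev_add lookup_add)
qed simp

lemma exterior_augmentation_eq:
  assumes "s \<in> carrier (Lambda 1)"
  shows "exterior_augmentation s = c1 (lam_of 1 s)"
proof -
  obtain f where f: "s = cls 1 f" using assms by (auto simp: carrier_Lambda)
  have "(\<lambda>f. Poly_Mapping.lookup f 0) ` s = {c1 (ev 1 f)}"
    by (auto simp: f cls_eq lookup_zero_eq_ev[of _ 1])
  then show ?thesis by (simp add: exterior_augmentation_def f)
qed

lemma list_lam_degree:
  "length w = n \<Longrightarrow> (n \<noteq> 0 \<longrightarrow> c1 (list_lam q w) = 0) \<and> (n \<noteq> 1 \<longrightarrow> cx (list_lam q w) = 0 \<and> cy (list_lam q w) = 0)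
    \<and> (n \<noteq> 2 \<longrightarrow> cw (list_lam q w) = 0)"
proof (induction w arbitrary: n)
  case (Cons g w)
  then show ?case
    using Cons.IH[OF refl] by (cases g) (auto simp: letter_lam_def)
qed simp

lemma exterior_component_iff:
  "s \<in> exterior_component n \<longleftrightarrow> s \<in> carrier (Lambda (1 :: 'k::field)) \<and> (n \<noteq> 0 \<longrightarrow> c1 (lam_of 1 s) = 0) \<and>
    (n \<noteq> 1 \<longrightarrow> cx (lam_of 1 s) = 0 \<and> cy (lam_of 1 s) = 0) \<and> (n \<noteq> 2 \<longrightarrow> cw (lam_of 1 s) = 0)" (is "_ \<longleftrightarrow> ?R")
proof
  assume "s \<in> exterior_component n"
  then obtain f where f: "s = cls 1 f" "homogeneous n f"
    by (auto simp: exterior_component_def exterior_ideal_eq cls_def)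
  have "(n \<noteq> 0 \<longrightarrow> c1 (ev 1 f) = 0) \<and> (n \<noteq> 1 \<longrightarrow> cx (ev 1 f) = 0 \<and> cy (ev 1 f) = 0) \<and> (n \<noteq> 2 \<longrightarrow> cw (ev 1 f) = 0)"
  proof -
    have "(n \<noteq> 0 \<longrightarrow> c1 (list_lam 1 (letters x)) = (0 :: 'k)) \<and>
        (n \<noteq> 1 \<longrightarrow> cx (list_lam 1 (letters x)) = (0 :: 'k) \<and> cy (list_lam 1 (letters x)) = (0 :: 'k)) \<and>
        (n \<noteq> 2 \<longrightarrow> cw (list_lam 1 (letters x)) = (0 :: 'k))" if "x \<in> Poly_Mapping.keys f" for x
      using list_lam_degree[of "letters x" n "1 :: 'k"] f(2) that by (simp add: homogeneous_def)
    then show ?thesis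
      unfolding ev_def lam.lext_def lam_sum by (auto intro!: sum.neutral)
  qed
  with f show ?R by (auto simp: carrier_Lambda)
next
  assume R: ?R
  let ?u = "lam_of 1 s"
  have "homogeneous n (nf ?u)"
  proof -
    have "const t * gen g = Poly_Mapping.single (Word [g]) t" for t :: 'k and g :: letter
      by (simp add: const_def gen_def mult_single plus_word_def zero_word_def)
    moreover have "const t * (gen g * gen g') = Poly_Mapping.single (Word [g, g']) t" for t :: 'k and g g' :: letter
      by (simp add: const_def gen_def mult_single plus_word_def zero_word_def)
    ultimately have nf: "nf ?u = Poly_Mapping.single (Word []) (c1 ?u) + Poly_Mapping.single (Word [Letter1]) (cx ?u)
        + Poly_Mapping.single (Word [Letter2]) (cy ?u) + Poly_Mapping.single (Word [Letter2, Letter1]) (cw ?u)"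
      by (simp add: nf_def const_def zero_word_def)
    consider "n = 0" | "n = 1" | "n = 2" | "n \<notin> {0, 1, 2}" by blast
    then show ?thesis
    proof cases
      case 2
      have "Poly_Mapping.keys (Poly_Mapping.single (Word [Letter1]) (cx ?u) + Poly_Mapping.single (Word [Letter2]) (cy ?u))
          \<subseteq> {Word [Letter1], Word [Letter2]}"
        by (rule order_trans[OF Poly_Mapping.keys_add]) auto
      with 2 R nf show ?thesis by (auto simp: homogeneous_def)
    qed (use R nf in \<open>auto simp: homogeneous_def split: if_splits\<close>)
  qed
  moreover have "s = cls 1 (nf ?u)" using R of_lam_lam_of[of s 1] by (simp add: of_lam_def)
  ultimately show "s \<in> exterior_component n"
    unfolding exterior_component_def exterior_ideal_eq cls_def by blast
qed

text \<open>The element a + bz of k[z]/(z^2): a residue class consists of the polynomials with two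
  prescribed lowest coefficients.\<close>

definition dual_of :: "'k::field \<Rightarrow> 'k \<Rightarrow> 'k poly set"
  where "dual_of a b = {p. poly.coeff p 0 = a \<and> poly.coeff p 1 = b}"

lemma dual_ideal_eq: "Idl\<^bsub>ring_of_type_algebra\<^esub> {[:0, 1:] ^ 2 :: 'k::field poly} = dual_of 0 0" (is "?I = _")
proof -
  interpret ring "ring_of_type_algebra :: 'k poly ring" by (rule ring_from_type_algebra)
  have inv: "\<ominus>\<^bsub>ring_of_type_algebra\<^esub> p = - p" for p :: "'k poly"
    by (rule minus_equality) (simp_all add: ring_of_type_algebra_def)
  have I: "ideal ?I (ring_of_type_algebra :: 'k poly ring)"
    by (intro genideal_ideal) (simp add: ring_of_type_algebra_def)
  have D: "ideal (dual_of 0 0) (ring_of_type_algebra :: 'k poly ring)"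
  proof (rule idealI[OF ring_axioms])
    show "subgroup (dual_of 0 0) (add_monoid (ring_of_type_algebra :: 'k poly ring))"
    proof
      fix p :: "'k poly" assume "p \<in> dual_of 0 0"
      then have "\<ominus>\<^bsub>ring_of_type_algebra\<^esub> p \<in> dual_of 0 0" by (simp add: inv dual_of_def)
      then show "inv\<^bsub>add_monoid ring_of_type_algebra\<^esub> p \<in> dual_of 0 0" by (simp add: a_inv_def)
    qed (auto simp: ring_of_type_algebra_def dual_of_def)
  qed (auto simp: ring_of_type_algebra_def dual_of_def Polynomial.coeff_mult)
  show ?thesis
  proof
    show "?I \<subseteq> dual_of 0 0"
      by (rule genideal_minimal[OF D]) (simp add: dual_of_def power2_eq_square)
    show "dual_of 0 0 \<subseteq> ?I"
    proof
      fix p :: "'k poly" assume p: "p \<in> dual_of 0 0"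
      obtain a b r where r: "p = pCons a (pCons b r)" by (metis pCons_cases)
      with p have "p = r * [:0, 1:] ^ 2" by (simp add: dual_of_def power2_eq_square)
      moreover have "[:0, 1:] ^ 2 \<in> ?I"
        using genideal_self[of "{[:0, 1:] ^ 2 :: 'k poly}"] by (simp add: ring_of_type_algebra_def)
      ultimately show "p \<in> ?I"
        using ideal.I_l_closed[OF I, of "[:0, 1:] ^ 2" r] by (simp add: ring_of_type_algebra_def)
    qed
  qed
qed

lemma dual_coset:
  "dual_of 0 0 +>\<^bsub>ring_of_type_algebra\<^esub> p = dual_of (poly.coeff p 0) (poly.coeff p 1)"
proof -
  have 1: "r \<in> dual_of 0 0 +>\<^bsub>ring_of_type_algebra\<^esub> p \<longleftrightarrow> (\<exists>s\<in>dual_of 0 0. r = s + p)" for r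
    by (auto simp: a_r_coset_def r_coset_def ring_of_type_algebra_def)
  show ?thesis
  proof (intro equalityI subsetI)
    fix r assume "r \<in> dual_of (poly.coeff p 0) (poly.coeff p 1)"
    then have "r - p \<in> dual_of 0 0" by (simp add: dual_of_def)
    then show "r \<in> dual_of 0 0 +>\<^bsub>ring_of_type_algebra\<^esub> p"
      unfolding 1 by (rule bexI[rotated]) simp
  next
    fix r assume "r \<in> dual_of 0 0 +>\<^bsub>ring_of_type_algebra\<^esub> p"
    then obtain s where "s \<in> dual_of 0 0" "r = s + p" unfolding 1 by (rule bexE)
    then show "r \<in> dual_of (poly.coeff p 0) (poly.coeff p 1)" by (simp add: dual_of_def)
  qed
qed

lemma dual_numbers_sel:
  "carrier dual_numbers = {dual_of a b | a b :: 'k. True}"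
  "dual_of a b \<otimes>\<^bsub>dual_numbers\<^esub> dual_of a' b' = dual_of (a * a') (a * b' + b * a')"
  "dual_of a b \<oplus>\<^bsub>dual_numbers\<^esub> dual_of a' b' = dual_of (a + a') (b + b')"
  "\<one>\<^bsub>dual_numbers\<^esub> = dual_of 1 (0 :: 'k)" "\<zero>\<^bsub>dual_numbers\<^esub> = dual_of 0 (0 :: 'k)" for a b a' b' :: "'k::field"
proof -
  interpret ring "ring_of_type_algebra :: 'k poly ring" by (rule ring_from_type_algebra)
  have D: "ideal (dual_of 0 0) (ring_of_type_algebra :: 'k poly ring)"
    unfolding dual_ideal_eq[symmetric] by (intro genideal_ideal) (simp add: ring_of_type_algebra_def)
  note hom = ideal.rcos_ring_hom[OF D, unfolded dual_coset]
  have eq: "dual_numbers = (ring_of_type_algebra :: 'k poly ring) Quot dual_of 0 0"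
    by (simp add: dual_numbers_def dual_ideal_eq)
  have "carrier (ring_of_type_algebra :: 'k poly ring) = UNIV"
    by (simp add: ring_of_type_algebra_def)
  then have carrier: "carrier dual_numbers = (\<Union>p :: 'k poly. {dual_of (poly.coeff p 0) (poly.coeff p 1)})"
    unfolding eq FactRing_def partial_object.simps A_RCOSETS_def' dual_coset by simp
  show "carrier dual_numbers = {dual_of a b | a b :: 'k. True}"
  proof (intro equalityI subsetI)
    fix r assume "r \<in> carrier (dual_numbers :: 'k poly set ring)"
    then show "r \<in> {dual_of a b | a b :: 'k. True}" unfolding carrier by blast
  next
    fix r assume "r \<in> {dual_of a b | a b :: 'k. True}"
    then obtain a b :: 'k where "r = dual_of a b" by blast
    then have "r \<in> {dual_of (poly.coeff [:a, b:] 0) (poly.coeff [:a, b:] 1)}" by simp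
    then show "r \<in> carrier dual_numbers" unfolding carrier by blast
  qed
  show "dual_of a b \<otimes>\<^bsub>dual_numbers\<^esub> dual_of a' b' = dual_of (a * a') (a * b' + b * a')"
    using ring_hom_mult[OF hom, of "[:a, b:]" "[:a', b':]"]
    by (simp add: eq ring_of_type_algebra_def mult.commute add.commute)
  show "dual_of a b \<oplus>\<^bsub>dual_numbers\<^esub> dual_of a' b' = dual_of (a + a') (b + b')"
    using ring_hom_add[OF hom, of "[:a, b:]" "[:a', b':]"]
    by (simp add: eq ring_of_type_algebra_def)
  show "\<one>\<^bsub>dual_numbers\<^esub> = dual_of 1 (0 :: 'k)"
    using ring_hom_one[OF hom] by (simp add: eq ring_of_type_algebra_def)
  show "\<zero>\<^bsub>dual_numbers\<^esub> = dual_of 0 (0 :: 'k)"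
    by (simp add: eq FactRing_def)
qed

lemma dual_of_inj: "dual_of a b = dual_of a' b' \<longleftrightarrow> a = a' \<and> b = b'"
proof
  assume eq: "dual_of a b = dual_of a' b'"
  have "[:a, b:] \<in> dual_of a b" by (simp add: dual_of_def)
  then show "a = a' \<and> b = b'" unfolding eq by (simp add: dual_of_def)
qed simp

lemma dual_numbers_augmentation_eq: "dual_numbers_augmentation (dual_of a b) = a"
proof -
  have "[:a, b:] \<in> dual_of a b" by (simp add: dual_of_def)
  moreover have "(\<lambda>p. poly p 0) ` dual_of a b = (\<lambda>p. a) ` dual_of a b"
    by (rule image_cong) (auto simp: dual_of_def poly_0_coeff_0)
  ultimately have "(\<lambda>p. poly p 0) ` dual_of a b = {a}" by auto
  then show ?thesis by (simp add: dual_numbers_augmentation_def)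
qed

text \<open>The pair of a + ez and a + bu1 + cu2 + w u2u1; the common a expresses that the
  augmentations agree. The last basis element is u2u1, not u1u2, because the coordinates use the
  basis element yx.\<close>

definition fibre_of :: "'k::field \<Rightarrow> 'k \<Rightarrow> 'k \<Rightarrow> 'k \<Rightarrow> 'k \<Rightarrow> 'k poly set \<times> (letter, 'k) free_algebra set"
  where "fibre_of a e b c w = (dual_of a e, of_lam 1 (Lam a b c w))"

lemma fibre_of_inj: "fibre_of a e b c w = fibre_of a' e' b' c' w' \<longleftrightarrow> a = a' \<and> e = e' \<and> b = b' \<and> c = c' \<and> w = w'"
proof -
  have "of_lam 1 u = of_lam 1 v \<longleftrightarrow> u = v" for u v :: "'a lam"
    by (metis lam_of_of_lam)
  then show ?thesis by (auto simp: fibre_of_def dual_of_inj)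
qed

lemma fibre_ring_sel:
  "carrier fibre_ring = {fibre_of a e b c w | a e b c w :: 'k. True}"
  "fibre_of a e b c w \<otimes>\<^bsub>fibre_ring\<^esub> fibre_of a' e' b' c' w' =
    fibre_of (a * a') (a * e' + e * a') (a * b' + b * a') (a * c' + c * a') (a * w' + w * a' + c * b' - b * c')"
  "fibre_of a e b c w \<oplus>\<^bsub>fibre_ring\<^esub> fibre_of a' e' b' c' w' = fibre_of (a + a') (e + e') (b + b') (c + c') (w + w')"
  "\<one>\<^bsub>fibre_ring\<^esub> = fibre_of 1 0 0 0 (0 :: 'k)" for a e b c w a' e' b' c' w' :: "'k::field"
proof -
  show "carrier fibre_ring = {fibre_of a e b c w | a e b c w :: 'k. True}"
  proof (intro equalityI subsetI)
    fix x :: "'k poly set \<times> (letter, 'k) free_algebra set" assume "x \<in> carrier fibre_ring"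
    then obtain r s where x: "x = (r, s)" "r \<in> carrier dual_numbers" "s \<in> carrier (Lambda 1)"
      "dual_numbers_augmentation r = exterior_augmentation s"
      by (auto simp: fibre_ring_def fibre_product_def exterior_algebra_eq)
    then obtain a e where r: "r = dual_of a e" by (auto simp: dual_numbers_sel)
    obtain a' b c w where u: "lam_of 1 s = Lam a' b c w" by (cases "lam_of 1 s")
    then have "s = of_lam 1 (Lam a' b c w)" using of_lam_lam_of[OF x(3)] by simp
    moreover have "a = a'"
      using x(3,4) u by (simp add: r dual_numbers_augmentation_eq exterior_augmentation_eq)
    ultimately show "x \<in> {fibre_of a e b c w | a e b c w :: 'k. True}"
      using x(1) r by (auto simp: fibre_of_def)
  next
    fix x :: "'k poly set \<times> (letter, 'k) free_algebra set"
    assume "x \<in> {fibre_of a e b c w | a e b c w :: 'k. True}"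
    then show "x \<in> carrier fibre_ring"
      by (auto simp: fibre_ring_def fibre_product_def exterior_algebra_eq fibre_of_def dual_numbers_sel
          dual_numbers_augmentation_eq exterior_augmentation_eq)
  qed
qed (simp_all add: fibre_ring_def fibre_product_def exterior_algebra_eq fibre_of_def RDirProd_def DirProd_def
      monoid.defs dual_numbers_sel of_lam_hom lmul_def plus_lam_def lone_def)

lemma fibre_component_iff:
  "fibre_of a e b c w \<in> fibre_component n \<longleftrightarrow> (n \<noteq> 0 \<longrightarrow> a = 0 \<and> e = 0) \<and> (n \<noteq> 1 \<longrightarrow> b = 0 \<and> c = 0) \<and> (n \<noteq> 2 \<longrightarrow> w = 0)"
proof -
  have "fibre_of a e b c w \<in> carrier fibre_ring" unfolding fibre_ring_sel(1) by blast
  then have "fibre_of a e b c w \<in> fibre_component n \<longleftrightarrow>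
      (n = 0 \<or> dual_of a e = dual_of 0 0) \<and> of_lam 1 (Lam a b c w) \<in> exterior_component n"
    by (simp add: fibre_component_def fibre_of_def dual_numbers_sel)
  then show ?thesis
    by (auto simp: exterior_component_iff dual_of_inj)
qed


subsection \<open>Cohomology when \<open>q\<close> is not a root of unity\<close>

text \<open>If both numbers vanish, squaring removes the signs and leaves q^(2i) = q^(2j) = 1, so i
  = j = 0 when q is not a root of unity.\<close>

lemma kp_kr_generic:
  assumes "\<not> root_of_unity q" "(i, j) \<noteq> (0, 0)"
  shows "kp q i j \<noteq> 0 \<or> kr q i j \<noteq> 0"
proof (rule ccontr)
  assume "\<not> ?thesis"
  then have 1: "(- 1) ^ (i + j) * q ^ j = 1" and 2: "q ^ i = (- 1) ^ (i + j)"
    by (simp_all add: kp_def kr_def)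
  have sq: "((- 1 :: 'a) ^ n) ^ 2 = 1" for n
    by (simp add: power_mult[symmetric])
  have "q ^ (i * 2) = 1"
    using arg_cong[OF 2, of "\<lambda>t. t ^ 2"] by (simp only: power_mult sq)
  moreover have "q ^ (j * 2) = 1"
    using arg_cong[OF 1, of "\<lambda>t. t ^ 2"] by (simp only: power_mult power_mult_distrib sq) simp
  ultimately show False
    using assms unfolding root_of_unity_def by (metis Pair_inject mult_is_0 neq0_conv zero_neq_numeral)
qed

lemma one_plus_generic:
  assumes "\<not> root_of_unity q"
  shows "1 + (- 1) ^ j * q \<noteq> 0" "q + (- 1) ^ j \<noteq> 0"
proof -
  have sq: "((- 1 :: 'a) ^ j) ^ 2 = 1"
    by (simp add: power_mult[symmetric])
  have q2: "q ^ 2 \<noteq> 1" using assms unfolding root_of_unity_def by (metis zero_less_numeral)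
  show "q + (- 1) ^ j \<noteq> 0"
  proof
    assume "q + (- 1) ^ j = 0"
    then have "q = - ((- 1) ^ j)" by (simp add: eq_neg_iff_add_eq_0)
    then have "q ^ 2 = ((- 1) ^ j) ^ 2" by simp
    with sq q2 show False by simp
  qed
  show "1 + (- 1) ^ j * q \<noteq> 0"
  proof
    assume "1 + (- 1) ^ j * q = 0"
    then have "(- 1) ^ j * q = - 1" by (simp add: eq_neg_iff_add_eq_0 add.commute)
    then have "((- 1) ^ j * q) ^ 2 = 1" by simp
    then have "q ^ 2 = 1" by (simp only: power_mult_distrib sq) simp
    with q2 show False by simp
  qed
qed

locale HH_generic = HH_model q H HC \<eta> \<pi>
  for q :: "'k::field" and H :: "'h ring" (structure) and HC \<eta> \<pi> +
  assumes q: "q \<noteq> 0" "\<not> root_of_unity q"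
begin

lemma vanishing:
  assumes z: "z \<in> kcocycles q"
  shows "(i, j) \<noteq> (0, 0) \<Longrightarrow> c1 (z i j) = 0" "cx (z 0 j) = 0" "cy (z i 0) = 0"
proof -
  show "c1 (z i j) = 0" if "(i, j) \<noteq> (0, 0)"
    using z kp_kr_generic[OF q(2) that] unfolding kcocycles_iff by (metis mult_eq_0_iff)
  have "(1 + (- 1) ^ j * q) * cx (z 0 j) = 0" "(q + (- 1) ^ i) * cy (z i 0) = 0"
    using z unfolding kcocycles_iff by blast+
  then show "cx (z 0 j) = 0" "cy (z i 0) = 0"
    using one_plus_generic[OF q(2)] by simp_all
qed

definition coordA :: "(nat \<Rightarrow> nat \<Rightarrow> 'k lam) \<Rightarrow> nat \<Rightarrow> 'k"
  where "coordA z l = (if l = 0 then c1 (z 0 0) else if l = 1 then cw (z 0 0)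
    else if l = 2 then cx (z 1 0) else if l = 3 then cy (z 0 1) else cw (z 1 1))"

text \<open>Interior parts other than (0, 0) are exact since q and one of the two coefficients are
  nonzero, and on the edges 1 \<plusminus> q and q \<plusminus> 1 are invertible. The part (0, 0)
  has zero differential and contributes 1, xX, yY and yxXY. The remaining class is yx in degree 0,
  which no differential reaches.\<close>

lemma pi_zero_iff_generic:
  assumes z: "z \<in> kcocycles q"
  shows "\<pi> z = \<zero> \<longleftrightarrow> (\<forall>l\<in>{..<5}. coordA z l = 0)"
proof -
  have L: "(\<forall>l\<in>{..<5}. coordA z l = 0) \<longleftrightarrow>
      c1 (z 0 0) = 0 \<and> cw (z 0 0) = 0 \<and> cx (z 1 0) = 0 \<and> cy (z 0 1) = 0 \<and> cw (z 1 1) = 0"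
  proof -
    have "{..<5 :: nat} = {0, 1, 2, 3, 4}" by auto
    then show ?thesis by (simp add: coordA_def)
  qed
  have kk: "kp q 0 0 = 0" "kr q 0 0 = 0" by (simp_all add: kp_def kr_def)
  show ?thesis
    unfolding L pi_zero_iff[OF z]
  proof
    assume "\<exists>y. \<forall>i j. z i j = kdiff q y i j"
    then obtain y where "\<And>i j. z i j = kdiff q y i j" by blast
    then show "c1 (z 0 0) = 0 \<and> cw (z 0 0) = 0 \<and> cx (z 1 0) = 0 \<and> cy (z 0 1) = 0 \<and> cw (z 1 1) = 0"
      using kdiff_sel(3)[of q y 0 0] kdiff_sel(5)[of q y 0 0] kdiff_sel(9)[of q y 0 0]
      by (simp add: kdiff_sel kk)
  next
    assume R: "c1 (z 0 0) = 0 \<and> cw (z 0 0) = 0 \<and> cx (z 1 0) = 0 \<and> cy (z 0 1) = 0 \<and> cw (z 1 1) = 0"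
    show "\<exists>y. \<forall>i j. z i j = kdiff q y i j"
      unfolding coboundary_iff
    proof (intro conjI allI)
      show "c1 (z i j) = 0" for i j
        using R vanishing(1)[OF z, of i j] by (cases "(i, j) = (0, 0)") auto
      show "\<exists>t. cx (z (Suc i) j) = kp q i j * t \<and> cy (z i (Suc j)) = kr q i j * t" for i j
      proof (cases "(i, j) = (0, 0)")
        case False
        have eq: "kr q i j * cx (z (Suc i) j) = kp q i j * cy (z i (Suc j))"
          using z q(1) unfolding kcocycles_iff by simp
        show ?thesis
        proof (cases "kp q i j = 0")
          case True
          with kp_kr_generic[OF q(2) False] eq show ?thesis
            by (intro exI[of _ "cy (z i (Suc j)) / kr q i j"]) auto
        next
          case False
          with eq show ?thesis
            by (intro exI[of _ "cx (z (Suc i) j) / kp q i j"]) (simp add: field_simps)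
        qed
      qed (use R kk in auto)
      show "\<exists>s t. cw (z (Suc i) (Suc j)) = q * (kr q i j * s - kp q i j * t)" for i j
      proof (cases "(i, j) = (0, 0)")
        case True
        with R show ?thesis by (intro exI[of _ 0]) simp
      next
        case False
        then consider "kp q i j \<noteq> 0" | "kr q i j \<noteq> 0" using kp_kr_generic[OF q(2)] by blast
        then show ?thesis
        proof cases
          case 1
          with q(1) show ?thesis
            by (intro exI[of _ 0] exI[of _ "- cw (z (Suc i) (Suc j)) / (q * kp q i j)"]) simp
        next
          case 2
          with q(1) show ?thesis
            by (intro exI[of _ "cw (z (Suc i) (Suc j)) / (q * kr q i j)"] exI[of _ 0]) simp
        qed
      qed
      show "\<exists>t. cw (z 0 (Suc j)) = (1 + (- 1) ^ j * q) * t" for j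
        using one_plus_generic(1)[OF q(2), of j]
        by (intro exI[of _ "cw (z 0 (Suc j)) / (1 + (- 1) ^ j * q)"]) simp
      show "\<exists>t. cw (z (Suc i) 0) = - ((q + (- 1) ^ i) * t)" for i
        using one_plus_generic(2)[OF q(2), of i]
        by (intro exI[of _ "- cw (z (Suc i) 0) / (q + (- 1) ^ i)"]) simp
    qed (use R vanishing[OF z] in auto)
  qed
qed

definition repA :: "nat \<Rightarrow> nat \<Rightarrow> nat \<Rightarrow> 'k lam"
  where "repA l = (if l = 0 then kone else if l = 1 then kmono lW 0 0
    else if l = 2 then kmono lX 1 0 else if l = 3 then kmono lY 0 1 else kmono lW 1 1)"

lemma repA: "repA l \<in> kcocycles q" "l < 5 \<Longrightarrow> l' < 5 \<Longrightarrow> coordA (repA l) l' = (if l' = l then 1 else 0)"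
proof -
  have "kmono lW i j \<in> kcocycles q" for i j using kmono_lW[of 1 i j q] by simp
  moreover have "kmono lX 1 0 \<in> kcocycles q" "kmono lY 0 1 \<in> kcocycles q"
    by (simp_all add: kmono_cocycle_iff lam_eq_iff)
  ultimately show "repA l \<in> kcocycles q"
    using kcocycles_closed(4)[of q] by (simp add: repA_def)
  assume "l < 5" "l' < 5"
  then have "l \<in> {0, 1, 2, 3, 4}" "l' \<in> {0, 1, 2, 3, 4}" by auto
  then show "coordA (repA l) l' = (if l' = l then 1 else 0)"
    by (auto simp: coordA_def repA_def kmono_def kone_def)
qed

lemma coordA_linear:
  "coordA (\<lambda>i j. z i j + z' i j) l = coordA z l + coordA z' l"
  "coordA (\<lambda>i j. lscale t (z i j)) l = t * coordA z l"
  "coordA (\<lambda>i j. z i j - z' i j) l = coordA z l - coordA z' l"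
  by (simp_all add: coordA_def)

lemma dimension_generic: "dimension 5 K (carrier H)"
proof -
  have "dimension (card {..<5::nat}) K (\<pi> ` kcocycles q)"
  proof (rule dimension_coordinates[where L = coordA])
    fix l :: nat assume "l \<in> {..<5}"
    then show "\<exists>z\<in>kcocycles q. \<forall>l'\<in>{..<5}. coordA z l' = (if l' = l then 1 else 0)"
      by (intro bexI[of _ "repA l"]) (simp_all add: repA)
  qed (use pi_zero_iff_generic coordA_linear kcocycles_closed(1,2)[where q = q] kcocycles_closed(3)[of q] in auto)
  then show ?thesis by (simp add: pi_surj)
qed

definition indexA :: "nat \<Rightarrow> nat set"
  where "indexA n = (if n = 0 then {0, 1} else if n = 1 then {2, 3} else if n = 2 then {4} else {})"

lemma coordA_outside: "(\<And>i j. i + j \<noteq> n \<Longrightarrow> z i j = 0) \<Longrightarrow> l < 5 \<Longrightarrow> l \<notin> indexA n \<Longrightarrow> coordA z l = 0"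
  by (auto simp: coordA_def indexA_def split: if_splits)

lemma hilbert_series_generic: "has_hilbert_series H K HC (2 + 2 * fps_X + fps_X ^ 2)"
proof (rule has_hilbert_seriesI)
  fix n
  show "dimension (card (indexA n)) K (HC n)"
  proof (rule dimension_component[where L = coordA])
    show "finite (indexA n)" by (simp add: indexA_def)
    have sub: "indexA n \<subseteq> {..<5}" by (auto simp: indexA_def)
    show "\<pi> z = \<zero> \<longleftrightarrow> (\<forall>l\<in>indexA n. coordA z l = 0)"
      if "z \<in> kcocycles q" "\<And>i j. i + j \<noteq> n \<Longrightarrow> z i j = 0" for z
      unfolding pi_zero_iff_generic[OF that(1)] using coordA_outside[of n z] that(2) sub by blast
    fix l assume l: "l \<in> indexA n"
    then have "\<forall>i j. i + j \<noteq> n \<longrightarrow> repA l i j = 0"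
      by (auto simp: indexA_def repA_def kmono_def kone_def split: if_splits)
    with l sub repA show "\<exists>z\<in>kcocycles q. (\<forall>i j. i + j \<noteq> n \<longrightarrow> z i j = 0) \<and> (\<forall>l'\<in>indexA n. coordA z l' = (if l' = l then 1 else 0))"
      by (intro bexI[of _ "repA l"]) (auto simp: repA(2) subset_iff)
  qed (rule coordA_linear)+
  show "(2 + 2 * fps_X + fps_X ^ 2 :: rat fps) $ n = of_nat (card (indexA n))"
    by (auto simp: indexA_def fps_X_power_nth numeral_fps_const)
qed

text \<open>Under the isomorphism z, u1, u2 correspond to yx, xX, yY. Since (yY)(xX) = q yxXY, the
  product u2u1 corresponds to q times the class with coordinate 4, hence the division by q.\<close>

definition to_fibre :: "(nat \<Rightarrow> nat \<Rightarrow> 'k lam) \<Rightarrow> 'k poly set \<times> (letter, 'k) free_algebra set"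
  where "to_fibre z = fibre_of (coordA z 0) (coordA z 1) (coordA z 2) (coordA z 3) (coordA z 4 / q)"

lemma to_fibre_eq_iff:
  assumes "z \<in> kcocycles q" "z' \<in> kcocycles q"
  shows "to_fibre z = to_fibre z' \<longleftrightarrow> \<pi> z = \<pi> z'"
proof -
  have five: "{..<5 :: nat} = {0, 1, 2, 3, 4}" by auto
  have "(\<lambda>i j. z i j - z' i j) \<in> kcocycles q"
    using kcocycles_closed(1)[OF assms(1) kcocycles_uminus[OF assms(2)]] by simp
  then have "\<pi> z = \<pi> z' \<longleftrightarrow> (\<forall>l\<in>{..<5}. coordA z l = coordA z' l)"
    unfolding pi_eq_iff'[OF assms] by (simp add: pi_zero_iff_generic coordA_linear)
  then show ?thesis
    using q(1) unfolding five to_fibre_def fibre_of_inj by simp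
qed

lemma coordA_kconv:
  assumes z: "z \<in> kcocycles q" and z': "z' \<in> kcocycles q"
  shows "coordA (kconv q z z') 0 = coordA z 0 * coordA z' 0"
    "coordA (kconv q z z') 1 = coordA z 0 * coordA z' 1 + coordA z 1 * coordA z' 0"
    "coordA (kconv q z z') 2 = coordA z 0 * coordA z' 2 + coordA z 2 * coordA z' 0"
    "coordA (kconv q z z') 3 = coordA z 0 * coordA z' 3 + coordA z 3 * coordA z' 0"
    "coordA (kconv q z z') 4 = coordA z 0 * coordA z' 4 + coordA z 4 * coordA z' 0 +
      q * (coordA z 3 * coordA z' 2 - coordA z 2 * coordA z' 3)"
proof -
  have 1: "{..Suc 0} = {0, Suc 0}" by auto
  note v = vanishing[OF z] vanishing[OF z']
  show "coordA (kconv q z z') 0 = coordA z 0 * coordA z' 0"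
    "coordA (kconv q z z') 1 = coordA z 0 * coordA z' 1 + coordA z 1 * coordA z' 0"
    "coordA (kconv q z z') 2 = coordA z 0 * coordA z' 2 + coordA z 2 * coordA z' 0"
    "coordA (kconv q z z') 3 = coordA z 0 * coordA z' 3 + coordA z 3 * coordA z' 0"
    "coordA (kconv q z z') 4 = coordA z 0 * coordA z' 4 + coordA z 4 * coordA z' 0 +
      q * (coordA z 3 * coordA z' 2 - coordA z 2 * coordA z' 3)"
    by (simp_all add: coordA_def kconv_def 1 v algebra_simps)
qed

lemma ring_iso_generic:
  "\<exists>h\<in>ring_iso H (fibre_ring :: ('k poly set \<times> (letter, 'k) free_algebra set) ring). \<forall>n. h ` HC n = fibre_component n"
proof -
  define h where "h x = to_fibre (SOME z. z \<in> kcocycles q \<and> \<pi> z = x)" for x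
  have h: "h (\<pi> z) = to_fibre z" if z: "z \<in> kcocycles q" for z
  proof -
    have "(SOME w. w \<in> kcocycles q \<and> \<pi> w = \<pi> z) \<in> kcocycles q \<and> \<pi> (SOME w. w \<in> kcocycles q \<and> \<pi> w = \<pi> z) = \<pi> z"
      by (rule someI[of _ z]) (use z in simp)
    then show ?thesis
      unfolding h_def using to_fibre_eq_iff z by blast
  qed
  \<comment> \<open>The support clause yields homogeneous representatives of homogeneous elements,
    as required for the statement about the graded components.\<close>
  have sum_rep: "\<exists>z\<in>kcocycles q. to_fibre z = fibre_of a e b c w \<and>
      (\<forall>i j. z i j \<noteq> 0 \<longrightarrow> (i + j = 0 \<and> (a, e) \<noteq> (0, 0)) \<or> (i + j = 1 \<and> (b, c) \<noteq> (0, 0)) \<or> (i + j = 2 \<and> w \<noteq> 0))" for a e b c w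
  proof -
    define z where "z i j = lscale a (repA 0 i j) + lscale e (repA 1 i j) + lscale b (repA 2 i j)
      + lscale c (repA 3 i j) + lscale (q * w) (repA 4 i j)" for i j
    have "z \<in> kcocycles q"
      unfolding z_def by (intro kcocycles_closed(1,2) repA)
    moreover have "coordA z l = a * coordA (repA 0) l + e * coordA (repA 1) l + b * coordA (repA 2) l
        + c * coordA (repA 3) l + (q * w) * coordA (repA 4) l" for l
      unfolding z_def by (simp only: coordA_linear)
    then have "to_fibre z = fibre_of a e b c w"
      using q(1) by (simp add: to_fibre_def repA(2))
    moreover have "\<forall>i j. z i j \<noteq> 0 \<longrightarrow> (i + j = 0 \<and> (a, e) \<noteq> (0, 0)) \<or> (i + j = 1 \<and> (b, c) \<noteq> (0, 0)) \<or> (i + j = 2 \<and> w \<noteq> 0)"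
      by (auto simp: z_def repA_def kmono_def kone_def split: if_splits)
    ultimately show ?thesis by blast
  qed
  have closed: "to_fibre z \<in> carrier fibre_ring" for z
    unfolding to_fibre_def fibre_ring_sel(1) by blast
  have "h \<in> ring_iso H fibre_ring"
    unfolding ring_iso_def
  proof (intro CollectI conjI)
    show "h \<in> ring_hom H fibre_ring"
    proof (rule ring_hom_memI)
      show "h x \<in> carrier fibre_ring" if "x \<in> carrier H" for x
        using that by (auto elim!: carrier_E simp: h closed)
      show "h (x \<otimes> y) = h x \<otimes>\<^bsub>fibre_ring\<^esub> h y" if xy: "x \<in> carrier H" "y \<in> carrier H" for x y
      proof -
        obtain z z' where z: "z \<in> kcocycles q" "x = \<pi> z" "z' \<in> kcocycles q" "y = \<pi> z'"
          using xy by (metis carrier_E)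
        then have "h (x \<otimes> y) = to_fibre (kconv q z z')"
          by (simp add: pi_mult[symmetric] h kconv_closed)
        also have "\<dots> = to_fibre z \<otimes>\<^bsub>fibre_ring\<^esub> to_fibre z'"
          using q(1) unfolding to_fibre_def fibre_ring_sel coordA_kconv[OF z(1,3)] fibre_of_inj
          by (simp add: field_simps)
        finally show ?thesis using z by (simp add: h)
      qed
      show "h (x \<oplus> y) = h x \<oplus>\<^bsub>fibre_ring\<^esub> h y" if xy: "x \<in> carrier H" "y \<in> carrier H" for x y
      proof -
        obtain z z' where z: "z \<in> kcocycles q" "x = \<pi> z" "z' \<in> kcocycles q" "y = \<pi> z'"
          using xy by (metis carrier_E)
        then have "h (x \<oplus> y) = to_fibre (\<lambda>i j. z i j + z' i j)"
          by (simp add: pi_add[symmetric] h kcocycles_closed)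
        also have "\<dots> = to_fibre z \<oplus>\<^bsub>fibre_ring\<^esub> to_fibre z'"
          unfolding to_fibre_def fibre_ring_sel coordA_linear fibre_of_inj
          by (simp add: add_divide_distrib)
        finally show ?thesis using z by (simp add: h)
      qed
      have "h \<one> = to_fibre (repA 0)"
        using h[OF repA(1)[of 0]] by (simp add: repA_def pi_one)
      then show "h \<one> = \<one>\<^bsub>fibre_ring\<^esub>"
        by (simp add: to_fibre_def fibre_ring_sel repA(2))
    qed
    show "bij_betw h (carrier H) (carrier fibre_ring)"
      unfolding bij_betw_def
    proof
      show "inj_on h (carrier H)"
      proof (rule inj_onI)
        fix x y assume "x \<in> carrier H" "y \<in> carrier H" "h x = h y"
        then show "x = y"
          by (metis carrier_E h to_fibre_eq_iff)
      qed
      show "h ` carrier H = carrier fibre_ring"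
      proof (intro equalityI subsetI)
        fix x assume "x \<in> h ` carrier H"
        then show "x \<in> carrier fibre_ring"
          by (auto elim!: carrier_E simp: h closed)
      next
        fix x :: "'k poly set \<times> (letter, 'k) free_algebra set"
        assume "x \<in> carrier fibre_ring"
        then obtain a e b c w where "x = fibre_of a e b c w" by (auto simp: fibre_ring_sel)
        then obtain z where "z \<in> kcocycles q" "to_fibre z = x" using sum_rep by blast
        then show "x \<in> h ` carrier H" using h pi_closed by (metis image_eqI)
      qed
    qed
  qed
  moreover have "h ` HC n = fibre_component n" for n
  proof (intro equalityI subsetI)
    fix x assume "x \<in> h ` HC n"
    then obtain z where z: "z \<in> kcocycles q" "\<And>i j. i + j \<noteq> n \<Longrightarrow> z i j = 0" "x = to_fibre z"
      by (auto simp: pi_component h)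
    have 0: "l < 5 \<Longrightarrow> l \<notin> indexA n \<Longrightarrow> coordA z l = 0" for l by (rule coordA_outside[OF z(2)])
    show "x \<in> fibre_component n"
      unfolding z(3) to_fibre_def fibre_component_iff
      using 0[of 0] 0[of 1] 0[of 2] 0[of 3] 0[of 4] by (auto simp: indexA_def)
  next
    fix x :: "'k poly set \<times> (letter, 'k) free_algebra set"
    assume x: "x \<in> fibre_component n"
    then have "x \<in> carrier fibre_ring" by (auto simp: fibre_component_def)
    then obtain a e b c w where xe: "x = fibre_of a e b c w" by (auto simp: fibre_ring_sel)
    obtain z where z: "z \<in> kcocycles q" "to_fibre z = x"
      "\<And>i j. z i j \<noteq> 0 \<Longrightarrow> (i + j = 0 \<and> (a, e) \<noteq> (0, 0)) \<or> (i + j = 1 \<and> (b, c) \<noteq> (0, 0)) \<or> (i + j = 2 \<and> w \<noteq> 0)"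
      using sum_rep[of a e b c w] xe by blast
    have "z i j = 0" if "i + j \<noteq> n" for i j
      using z(3)[of i j] x that unfolding xe fibre_component_iff by auto
    then have "\<pi> z \<in> HC n" using z(1) by (auto simp: pi_component)
    then show "x \<in> h ` HC n" using h[OF z(1)] z(2) by (metis image_eqI)
  qed
  ultimately show ?thesis by blast
qed

end


theorem mainTheorem1:
  fixes q :: "'k::field"
    and P :: "nat \<Rightarrow>
      (((letter, 'k) free_algebra set \<times> (letter, 'k) free_algebra set \<Rightarrow>\<^sub>0 'k) set, 'p) module"
    and d :: "nat \<Rightarrow> 'p \<Rightarrow> 'p"
    and \<epsilon> :: "'p \<Rightarrow> (letter, 'k) free_algebra set"
  assumes "projective_resolution (enveloping_algebra (Lambda q) (Lambda_unit q)) P d \<epsilon>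
             (regular_bimodule (Lambda q) (Lambda_unit q))"
  shows "let H = HH (Lambda q) (Lambda_unit q) P d \<epsilon>;
             HC = HH_component (Lambda q) (Lambda_unit q) P d;
             \<eta> = HH_unit (Lambda q) (Lambda_unit q) P d \<epsilon>;
             K = range \<eta>
         in (q \<noteq> 0 \<and> \<not> root_of_unity q \<longrightarrow>
               ring.dimension H 5 K (carrier H) \<and>
               has_hilbert_series H K HC (2 + 2 * fps_X + fps_X ^ 2) \<and>
               (\<exists>h\<in>ring_iso H (fibre_ring :: ('k poly set \<times> (letter, 'k) free_algebra set) ring).
                  \<forall>n. h ` HC n = fibre_component n)) \<and>
            (root_of_unity q \<longrightarrow>
               \<not> ring.finite_dimension H K (carrier H) \<and>
               (\<exists>S. polynomial_subring_in_two H \<eta> S \<and> fin_gen_module_over_subring H S)) \<and>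
            (q = 0 \<longrightarrow>
               \<not> fin_gen_algebra H K \<and>
               has_hilbert_series H K HC (1 + (1 + fps_X ^ 3) / (1 - fps_X) ^ 2))"
proof -
  interpret R: HH_resolution q P d \<epsilon>
    by (rule HH_resolution.intro) (rule assms)
  have a: "ring.dimension R.HHr 5 R.K (carrier R.HHr) \<and>
      has_hilbert_series R.HHr R.K (HH_component (Lambda q) (Lambda_unit q) P d) (2 + 2 * fps_X + fps_X ^ 2) \<and>
      (\<exists>h\<in>ring_iso R.HHr (fibre_ring :: ('k poly set \<times> (letter, 'k) free_algebra set) ring).
        \<forall>n. h ` HH_component (Lambda q) (Lambda_unit q) P d n = fibre_component n)"
    if "q \<noteq> 0 \<and> \<not> root_of_unity q"
  proof -
    interpret HH_generic q R.HHr "HH_component (Lambda q) (Lambda_unit q) P d"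
      "HH_unit (Lambda q) (Lambda_unit q) P d \<epsilon>" R.Pi'
      by unfold_locales (use that in auto)
    show ?thesis using dimension_generic hilbert_series_generic ring_iso_generic by blast
  qed
  have b: "\<not> ring.finite_dimension R.HHr R.K (carrier R.HHr) \<and>
      (\<exists>S. polynomial_subring_in_two R.HHr (HH_unit (Lambda q) (Lambda_unit q) P d \<epsilon>) S \<and>
        fin_gen_module_over_subring R.HHr S)"
    if "root_of_unity q"
  proof -
    obtain n where n: "n > 0" "q ^ n = 1" using \<open>root_of_unity q\<close> by (auto simp: root_of_unity_def)
    \<comment> \<open>Doubling the exponent n makes it even, whatever its parity.\<close>
    interpret HH_root q R.HHr "HH_component (Lambda q) (Lambda_unit q) P d"
      "HH_unit (Lambda q) (Lambda_unit q) P d \<epsilon>" R.Pi' "2 * n"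
      by unfold_locales (use n in \<open>auto simp: power_mult power2_eq_square power_mult_distrib mult.commute[of 2]\<close>)
    show ?thesis using infinite_dimensional polynomial_subring fin_gen_module by blast
  qed
  show ?thesis
    unfolding Let_def using a b R.not_fin_gen_0 R.hilbert_series_0 by blast
qed

end
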